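(* The local index formula of the spectral triple $(\mathcal A,\mathcal H,D)$, i.e. the cocycle $(\varphi_1,\varphi_3)$, is given by the cyclic cocycle $\tau_1$ up to the coboundary of the cochain $(\varphi_0,\varphi_2)$; precisely, $$\varphi_1=\tau_1+b\varphi_0+B\varphi_2,\qquad \varphi_3=b\varphi_2 .$$
   Context: Let $\mathcal{H}$ be the Hilbert space with orthonormal basis $e^{(n)}_{ij}$, $n\in\frac12\mathbb{N}$, $i,j\in\{-n,-n+1,\dots,n\}$. (This is the case $q=0$ of $SU_q(2)$.) Define bounded operators $\alpha,\beta$ on $\mathcal H$ by: $\alpha e^{(n)}_{ij}=e^{(n-1/2)}_{i-1/2,\,j-1/2}$ if $i>-n$ and $j>-n$, and $\alpha e^{(n)}_{ij}=0$ if $i=-n$ or $j=-n$; $\beta e^{(n)}_{ij}=0$ if $i\neq -n$ and $j\neq -n$; $\beta e^{(n)}_{-n,j}=e^{(n-1/2)}_{-(n-1/2),\,j-1/2}$ if $j\ne -n$; $\beta e^{(n)}_{i,-n}=-e^{(n+1/2)}_{i+1/2,\,-(n+1/2)}$. Put $e=\beta\beta^*=\beta^*\beta$ (a projection). For $f=\sum_n \hat f_n e^{in\theta}\in C^\infty(S^1)$ put $f(\beta)=\sum_{n>0}\hat f_n\beta^n+\sum_{n<0}\hat f_n\beta^{*(-n)}+\hat f_0\,e$. $\mathcal{A}$ is the algebra of all sums $$a=\sum_{k,\ell\ge0}\alpha^{*k}f_{k\ell}(\beta)\alpha^\ell+\sum_{\ell\ge0}\lambda_\ell\alpha^\ell+\sum_{k>0}\lambda'_k\alpha^{*k},\qquad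 ( * )$$ where $(\lambda_\ell),(\lambda'_k)$ are scalar sequences of rapid decay and $(f_{k\ell})$ is a double sequence of rapid decay with values in $C^\infty(S^1)$. The symbol map is the homomorphism $\sigma:\mathcal A\to C^\infty(S^1)$, $\sigma(a)=\sum_{\ell\ge0}\lambda_\ell u^\ell+\sum_{k>0}\lambda'_ku^{-k}$, $u=e^{i\theta}$. $D$ is the diagonal operator $D e^{(n)}_{ij}=(2\delta_0(n-i)-1)\,2n\,e^{(n)}_{ij}$, where $\delta_0(0)=1$ and $\delta_0(k)=0$ for $k\neq0$. Write $\nabla(T)=[D^2,T]$ and $\int\!\!\!\!\!-\,P=\mathrm{Res}_{z=0}\mathrm{Trace}(P|D|^{-z})$ (on $\ker D$ one replaces $|D|$ by any $\varepsilon>0$; this does not affect residues). The local index cocycle, up to the overall factor $(2i\pi)^{1/2}$, is $(\varphi_1,\varphi_3)$ with $$\varphi_1(a^0,a^1)=\int\!\!\!\!\!\!-\,a^0[D,a^1]|D|^{-1}-\tfrac14\int\!\!\!\!\!\!-\,a^0\nabla([D,a^1])|D|^{-3}+\tfrac18\int\!\!\!\!\!\!-\,a^0\nabla^2([D,a^1])|D|^{-5},$$ $$\varphi_3(a^0,a^1,a^2,a^3)=\tfrac1{12}\int\!\!\!\!\!\!-\,a^0[D,a^1][D,a^2][D,a^3]|D|^{-3}.$$ Coboundaries: $(b\psi)(a^0,\dots,a^{m+1})=\sum_{j=0}^m(-1)^j\psi(a^0,\dots,a^ja^{j+1},\dots,a^{m+1})+(-1)^{m+1}\psi(a^{m+1}a^0,a^1,\dots,a^m)$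 for an $(m+1)$-linear form $\psi$ on $\mathcal A$; $B=A_{\mathrm{cyc}}B_0$, where for an $(m+1)$-linear form $\varphi$, $(B_0\varphi)(a^0,\dots,a^{m-1})=\varphi(1,a^0,\dots,a^{m-1})-(-1)^m\varphi(a^0,\dots,a^{m-1},1)$ and $(A_{\mathrm{cyc}}\psi)(a^0,\dots,a^{m-1})=\sum_{j=0}^{m-1}(-1)^{(m-1)j}\psi(a^j,a^{j+1},\dots,a^{j-1})$. The cyclic 1-cocycle $\tau_1$ on $\mathcal A$: $\tau_1(x,y)=0$ if $x$ or $y$ is of the form $\alpha^{*k}$ or $\alpha^\ell$ ($k,\ell\geq 0$); $\tau_1(\alpha^{*k}f(\beta)\alpha^\ell,\alpha^{*k'}g(\beta)\alpha^{\ell'})=0$ unless $\ell'=k$ and $k'=\ell$; and $\tau_1(\alpha^{*k}f(\beta)\alpha^\ell,\alpha^{*\ell}g(\beta)\alpha^k)=\frac1{\pi i}\int_{S^1}f\,dg$ (extended by linearity and continuity). The 0-cochain $\varphi_0$: $\varphi_0(\alpha^{*k}f(\beta)\alpha^\ell)=0$ unless $k=\ell$, $\varphi_0(\alpha^{*k}f(\beta)\alpha^k)=\rho(k)\frac1{2\pi}\int_{S^1}f\,d\theta$ with $\rho(j)=\frac23-j-j^2$, and $\varphi_0$ vanishes on $1$ and on all $\alpha^\ell,\alpha^{*\ell}$; i.e. $\varphi_0(a)=\sum_k\rho(k)\frac1{2\pi}\int f_{kk}\,d\theta$ for $a$ as in $( * )$. The 2-cochain $\varphi_2$: $\varphi_2(a_0,a_1,a_2)=-\frac1{24}\,\frac1{2\pi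 i}\int_{S^1}f_0f_1'f_2''\,d\theta$ with $f_j=\sigma(a_j)$ and $'=d/d\theta$. *)

theory Defs
  imports "HOL-Complex_Analysis.Complex_Analysis"
begin

section \<open>The Hilbert space of square-summable families\<close>

typedef 'a ell2 = "{f :: 'a \<Rightarrow> complex. (\<lambda>x. (cmod (f x))\<^sup>2) summable_on UNIV}"
  morphisms coord Abs_ell2
  by (intro exI[of _ "\<lambda>_. 0"]) simp

setup_lifting type_definition_ell2

lemma square_summable_coord: "(\<lambda>x. (cmod (coord \<xi> x))\<^sup>2) summable_on UNIV"
  using coord[of \<xi>] by simp

lemma square_summable_add:
  fixes f g :: "'a \<Rightarrow> complex"
  assumes "(\<lambda>x. (cmod (f x))\<^sup>2) summable_on UNIV" "(\<lambda>x. (cmod (g x))\<^sup>2) summable_on UNIV"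
  shows "(\<lambda>x. (cmod (f x + g x))\<^sup>2) summable_on UNIV"
proof (rule summable_on_comparison_test)
  show "(\<lambda>x. 2 * (cmod (f x))\<^sup>2 + 2 * (cmod (g x))\<^sup>2) summable_on UNIV"
    using assms by (intro summable_on_add summable_on_cmult_right)
  show "(cmod (f x + g x))\<^sup>2 \<le> 2 * (cmod (f x))\<^sup>2 + 2 * (cmod (g x))\<^sup>2" for x
  proof -
    have "(cmod (f x + g x))\<^sup>2 \<le> (cmod (f x) + cmod (g x))\<^sup>2"
      by (intro power_mono norm_triangle_ineq) auto
    also have "\<dots> \<le> 2 * (cmod (f x))\<^sup>2 + 2 * (cmod (g x))\<^sup>2"
      using sum_squares_bound[of "cmod (f x)" "cmod (g x)"] by (simp add: power2_sum)
    finally show ?thesis .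
  qed
qed auto

lemma square_summable_mult:
  fixes f :: "'a \<Rightarrow> complex"
  assumes "(\<lambda>x. (cmod (f x))\<^sup>2) summable_on UNIV"
  shows "(\<lambda>x. (cmod (c * f x))\<^sup>2) summable_on UNIV"
  using summable_on_cmult_right[OF assms, of "(cmod c)\<^sup>2"]
  by (simp add: norm_mult power_mult_distrib)

lift_definition scaleC_ell2 :: "complex \<Rightarrow> 'a ell2 \<Rightarrow> 'a ell2" (infixr \<open>*\<^sub>C\<close> 75)
  is "\<lambda>c f x. c * f x" by (simp add: square_summable_mult)

definition cinner :: "'a ell2 \<Rightarrow> 'a ell2 \<Rightarrow> complex" where
  "cinner \<xi> \<eta> = (\<Sum>\<^sub>\<infinity>x. cnj (coord \<xi> x) * coord \<eta> x)"

lemma summable_cinner: "(\<lambda>x. cnj (coord \<xi> x) * coord \<eta> x) summable_on UNIV"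
proof (rule abs_summable_summable, rule summable_on_comparison_test)
  show "(\<lambda>x. (cmod (coord \<xi> x))\<^sup>2 + (cmod (coord \<eta> x))\<^sup>2) summable_on UNIV"
    by (intro summable_on_add square_summable_coord)
  show "norm (cnj (coord \<xi> x) * coord \<eta> x) \<le> (cmod (coord \<xi> x))\<^sup>2 + (cmod (coord \<eta> x))\<^sup>2" for x
  proof -
    have "0 \<le> cmod (coord \<xi> x) * cmod (coord \<eta> x)" by simp
    moreover have "2 * (cmod (coord \<xi> x) * cmod (coord \<eta> x))
        \<le> (cmod (coord \<xi> x))\<^sup>2 + (cmod (coord \<eta> x))\<^sup>2"
      using sum_squares_bound[of "cmod (coord \<xi> x)" "cmod (coord \<eta> x)"] by (simp add: mult.assoc)
    ultimately show ?thesis unfolding norm_mult complex_mod_cnj by linarith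
  qed
qed auto

lemma Re_cinner_self: "Re (cinner \<xi> \<xi>) = (\<Sum>\<^sub>\<infinity>x. (cmod (coord \<xi> x))\<^sup>2)"
proof -
  have "Re (cnj z * z) = (cmod z)\<^sup>2" for z
    unfolding cmod_power2 by (simp add: power2_eq_square)
  then show ?thesis
    unfolding cinner_def by (simp only: infsum_Re[OF summable_cinner, symmetric])
qed

instantiation ell2 :: (type) real_inner
begin

lift_definition zero_ell2 :: "'a ell2" is "\<lambda>_. 0" by simp

lift_definition plus_ell2 :: "'a ell2 \<Rightarrow> 'a ell2 \<Rightarrow> 'a ell2" is "\<lambda>f g x. f x + g x"
  by (simp add: square_summable_add)

lift_definition uminus_ell2 :: "'a ell2 \<Rightarrow> 'a ell2" is "\<lambda>f x. - f x" by simp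

definition minus_ell2 :: "'a ell2 \<Rightarrow> 'a ell2 \<Rightarrow> 'a ell2" where "minus_ell2 \<xi> \<eta> = \<xi> + - \<eta>"

definition scaleR_ell2 :: "real \<Rightarrow> 'a ell2 \<Rightarrow> 'a ell2" where "scaleR_ell2 r \<xi> = complex_of_real r *\<^sub>C \<xi>"

definition inner_ell2 :: "'a ell2 \<Rightarrow> 'a ell2 \<Rightarrow> real" where "inner_ell2 \<xi> \<eta> = Re (cinner \<xi> \<eta>)"

definition norm_ell2 :: "'a ell2 \<Rightarrow> real" where "norm_ell2 \<xi> = sqrt (inner \<xi> \<xi>)"

definition sgn_ell2 :: "'a ell2 \<Rightarrow> 'a ell2" where "sgn_ell2 \<xi> = inverse (norm \<xi>) *\<^sub>R \<xi>"

definition dist_ell2 :: "'a ell2 \<Rightarrow> 'a ell2 \<Rightarrow> real" where "dist_ell2 \<xi> \<eta> = norm (\<xi> - \<eta>)"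

definition uniformity_ell2 :: "('a ell2 \<times> 'a ell2) filter" where
  "uniformity_ell2 = (INF e\<in>{0<..}. principal {(\<xi>, \<eta>). dist \<xi> \<eta> < e})"

definition open_ell2 :: "'a ell2 set \<Rightarrow> bool" where
  "open_ell2 U = (\<forall>\<xi>\<in>U. eventually (\<lambda>(\<xi>', \<eta>). \<xi>' = \<xi> \<longrightarrow> \<eta> \<in> U) uniformity)"

instance
proof
  fix \<xi> \<eta> \<zeta> :: "'a ell2" and r s :: real and U :: "'a ell2 set"
  show "\<xi> + \<eta> + \<zeta> = \<xi> + (\<eta> + \<zeta>)" by transfer (simp add: add.assoc)
  show "\<xi> + \<eta> = \<eta> + \<xi>" by transfer (simp add: add.commute)
  show "0 + \<xi> = \<xi>" by transfer simp
  show "- \<xi> + \<xi> = 0" by transfer simp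
  show "\<xi> - \<eta> = \<xi> + - \<eta>" by (rule minus_ell2_def)
  show "r *\<^sub>R (\<xi> + \<eta>) = r *\<^sub>R \<xi> + r *\<^sub>R \<eta>"
    unfolding scaleR_ell2_def by transfer (simp add: algebra_simps)
  show "(r + s) *\<^sub>R \<xi> = r *\<^sub>R \<xi> + s *\<^sub>R \<xi>"
    unfolding scaleR_ell2_def by transfer (simp add: algebra_simps)
  show "r *\<^sub>R s *\<^sub>R \<xi> = (r * s) *\<^sub>R \<xi>"
    unfolding scaleR_ell2_def by transfer (simp add: algebra_simps)
  show "1 *\<^sub>R \<xi> = \<xi>" unfolding scaleR_ell2_def by transfer simp
  show "sgn \<xi> = inverse (norm \<xi>) *\<^sub>R \<xi>" by (rule sgn_ell2_def)
  show "dist \<xi> \<eta> = norm (\<xi> - \<eta>)" by (rule dist_ell2_def)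
  show "uniformity = (INF e\<in>{0<..}. principal {(\<xi> :: 'a ell2, \<eta>). dist \<xi> \<eta> < e})"
    by (rule uniformity_ell2_def)
  show "open U = (\<forall>\<xi>\<in>U. eventually (\<lambda>(\<xi>', \<eta>). \<xi>' = \<xi> \<longrightarrow> \<eta> \<in> U) uniformity)"
    by (rule open_ell2_def)
  show "norm \<xi> = sqrt (inner \<xi> \<xi>)" by (rule norm_ell2_def)
  have "cinner \<eta> \<xi> = cnj (cinner \<xi> \<eta>)"
    unfolding cinner_def infsum_cnj[symmetric] by (simp add: mult.commute)
  then show "inner \<xi> \<eta> = inner \<eta> \<xi>" by (simp add: inner_ell2_def)
  have "cinner (\<xi> + \<eta>) \<zeta> = cinner \<xi> \<zeta> + cinner \<eta> \<zeta>"
    using infsum_add[OF summable_cinner[of \<xi> \<zeta>] summable_cinner[of \<eta> \<zeta>]]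
    by (simp add: cinner_def plus_ell2.rep_eq ring_distribs)
  then show "inner (\<xi> + \<eta>) \<zeta> = inner \<xi> \<zeta> + inner \<eta> \<zeta>" by (simp add: inner_ell2_def)
  have "cinner (r *\<^sub>R \<xi>) \<eta> = of_real r * cinner \<xi> \<eta>"
    by (simp add: cinner_def scaleR_ell2_def scaleC_ell2.rep_eq mult.assoc infsum_cmult_right')
  then show "inner (r *\<^sub>R \<xi>) \<eta> = r * inner \<xi> \<eta>" by (simp add: inner_ell2_def)
  have eq: "inner \<xi> \<xi> = (\<Sum>\<^sub>\<infinity>x. (cmod (coord \<xi> x))\<^sup>2)"
    by (simp only: inner_ell2_def Re_cinner_self)
  show "0 \<le> inner \<xi> \<xi>" unfolding eq by (intro infsum_nonneg) simp
  show "inner \<xi> \<xi> = 0 \<longleftrightarrow> \<xi> = 0"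
  proof
    assume "inner \<xi> \<xi> = 0"
    then have "(cmod (coord \<xi> x))\<^sup>2 = 0" for x
      using nonneg_infsum_le_0D[OF _ square_summable_coord[of \<xi>], of x] unfolding eq by simp
    then show "\<xi> = 0" by (intro coord_inject[THEN iffD1] ext) (simp add: zero_ell2.rep_eq)
  next
    assume 0: "\<xi> = 0"
    have "coord \<xi> x = 0" for x using 0 by (simp add: zero_ell2.rep_eq)
    then show "inner \<xi> \<xi> = 0" unfolding eq by simp
  qed
qed

end

lemma norm_ell2_square: "(norm \<xi>)\<^sup>2 = (\<Sum>\<^sub>\<infinity>x. (cmod (coord \<xi> x))\<^sup>2)" for \<xi> :: "'a ell2"
proof -
  have "(norm \<xi>)\<^sup>2 = Re (cinner \<xi> \<xi>)" by (simp add: power2_norm_eq_inner inner_ell2_def)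
  then show ?thesis by (simp only: Re_cinner_self)
qed

lemma coord_minus: "coord (\<xi> - \<eta>) x = coord \<xi> x - coord \<eta> x"
  unfolding minus_ell2_def plus_ell2.rep_eq uminus_ell2.rep_eq by simp

lemma sum_coord_le_norm:
  assumes "finite F" shows "(\<Sum>x\<in>F. (cmod (coord \<xi> x))\<^sup>2) \<le> (norm \<xi>)\<^sup>2"
  unfolding norm_ell2_square
  by (rule finite_sum_le_infsum[OF square_summable_coord assms]) auto

lemma coord_le_norm: "cmod (coord \<xi> x) \<le> norm \<xi>"
  by (rule power2_le_imp_le) (use sum_coord_le_norm[of "{x}" \<xi>] in simp_all)

instance ell2 :: (type) complete_space
proof
  fix X :: "nat \<Rightarrow> 'a ell2" assume X: "Cauchy X"
  have "Cauchy (\<lambda>n. coord (X n) x)" for x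
  proof (rule metric_CauchyI)
    fix e :: real assume "e > 0"
    with X obtain M where M: "\<And>m n. m \<ge> M \<Longrightarrow> n \<ge> M \<Longrightarrow> dist (X m) (X n) < e"
      by (meson metric_CauchyD)
    have "dist (coord (X m) x) (coord (X n) x) < e" if "m \<ge> M" "n \<ge> M" for m n
      using coord_le_norm[of "X m - X n" x] M[OF that] by (simp add: dist_norm coord_minus)
    then show "\<exists>M. \<forall>m\<ge>M. \<forall>n\<ge>M. dist (coord (X m) x) (coord (X n) x) < e" by blast
  qed
  then have "\<exists>l. (\<lambda>n. coord (X n) x) \<longlonglongrightarrow> l" for x
    using convergent_eq_Cauchy by blast
  then obtain L where L: "\<And>x. (\<lambda>n. coord (X n) x) \<longlonglongrightarrow> L x" by metis
  have key: "\<exists>M. \<forall>m\<ge>M. \<forall>F. finite F \<longrightarrow> (\<Sum>x\<in>F. (cmod (coord (X m) x - L x))\<^sup>2) \<le> e\<^sup>2"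
    if "e > 0" for e
  proof -
    from X that obtain M where M: "\<And>m n. m \<ge> M \<Longrightarrow> n \<ge> M \<Longrightarrow> dist (X m) (X n) < e"
      by (meson metric_CauchyD)
    have "(\<Sum>x\<in>F. (cmod (coord (X m) x - L x))\<^sup>2) \<le> e\<^sup>2" if F: "finite F" and m: "m \<ge> M" for F m
    proof (rule tendsto_upperbound)
      show "(\<lambda>n. \<Sum>x\<in>F. (cmod (coord (X m) x - coord (X n) x))\<^sup>2)
              \<longlonglongrightarrow> (\<Sum>x\<in>F. (cmod (coord (X m) x - L x))\<^sup>2)"
        by (intro tendsto_intros L)
      have "(\<Sum>x\<in>F. (cmod (coord (X m) x - coord (X n) x))\<^sup>2) \<le> e\<^sup>2" if "n \<ge> M" for n
      proof -
        have "(\<Sum>x\<in>F. (cmod (coord (X m) x - coord (X n) x))\<^sup>2) \<le> (norm (X m - X n))\<^sup>2"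
          using sum_coord_le_norm[OF F, of "X m - X n"] by (simp add: coord_minus)
        also have "\<dots> \<le> e\<^sup>2"
          using M[OF m that] by (intro power_mono) (auto simp: dist_norm)
        finally show ?thesis .
      qed
      then show "\<forall>\<^sub>F n in sequentially. (\<Sum>x\<in>F. (cmod (coord (X m) x - coord (X n) x))\<^sup>2) \<le> e\<^sup>2"
        by (auto simp: eventually_sequentially)
    qed simp
    then show ?thesis by blast
  qed
  have summ: "(\<lambda>x. (cmod (coord (X m) x - L x))\<^sup>2) summable_on UNIV"
    if "\<forall>F. finite F \<longrightarrow> (\<Sum>x\<in>F. (cmod (coord (X m) x - L x))\<^sup>2) \<le> e\<^sup>2" for m and e :: real
    by (rule nonneg_bdd_above_summable_on) (use that in \<open>auto intro!: bdd_aboveI[of _ "e\<^sup>2"]\<close>)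
  obtain M where M: "\<forall>m\<ge>M. \<forall>F. finite F \<longrightarrow> (\<Sum>x\<in>F. (cmod (coord (X m) x - L x))\<^sup>2) \<le> 1\<^sup>2"
    using key[of 1] by auto
  have "(\<lambda>x. (cmod (coord (X M) x - L x))\<^sup>2) summable_on UNIV"
    by (rule summ[of M 1]) (use M in auto)
  then have "(\<lambda>x. (cmod (-1 * (coord (X M) x - L x)))\<^sup>2) summable_on UNIV"
    by (rule square_summable_mult)
  from square_summable_add[OF square_summable_coord[of "X M"] this]
  have "(\<lambda>x. (cmod (L x))\<^sup>2) summable_on UNIV" by simp
  then have cL: "coord (Abs_ell2 L) = L" by (simp add: Abs_ell2_inverse)
  have "X \<longlonglongrightarrow> Abs_ell2 L"
  proof (rule metric_LIMSEQ_I)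
    fix r :: real assume r: "r > 0"
    then obtain M where M: "\<forall>m\<ge>M. \<forall>F. finite F \<longrightarrow> (\<Sum>x\<in>F. (cmod (coord (X m) x - L x))\<^sup>2) \<le> (r/2)\<^sup>2"
      using key[of "r/2"] by auto
    have "dist (X m) (Abs_ell2 L) < r" if "m \<ge> M" for m
    proof -
      have "(norm (X m - Abs_ell2 L))\<^sup>2 \<le> (r/2)\<^sup>2"
        unfolding norm_ell2_square coord_minus cL
        by (intro infsum_le_finite_sums summ[of m "r/2"]) (use M that in auto)
      then have "norm (X m - Abs_ell2 L) \<le> r/2" by (rule power2_le_imp_le) (use r in simp)
      then show ?thesis using r by (simp add: dist_norm)
    qed
    then show "\<exists>M. \<forall>m\<ge>M. dist (X m) (Abs_ell2 L) < r" by blast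
  qed
  then show "convergent X" by (auto simp: convergent_def)
qed

lift_definition ket :: "'a \<Rightarrow> 'a ell2" is "\<lambda>x y. if y = x then 1 else 0"
proof -
  fix x :: 'a
  have "(\<lambda>y. (cmod (if y = x then 1 else 0))\<^sup>2) summable_on {x}" by simp
  then show "(\<lambda>y. (cmod (if y = x then 1 else 0))\<^sup>2) summable_on UNIV"
    by (rule summable_on_cong_neutral[THEN iffD1, rotated -1]) auto
qed

text \<open>The operator with prescribed values on the orthonormal basis; the sum is unconditional
  and in norm, so this is the bounded operator with these values whenever there is one.\<close>
definition operator_on_basis :: "('a \<Rightarrow> 'a ell2) \<Rightarrow> 'a ell2 \<Rightarrow> 'a ell2" where
  "operator_on_basis F \<xi> = (\<Sum>\<^sub>\<infinity>x. coord \<xi> x *\<^sub>C F x)"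

definition adj :: "('a ell2 \<Rightarrow> 'a ell2) \<Rightarrow> 'a ell2 \<Rightarrow> 'a ell2" where
  "adj T = (THE S. \<forall>\<xi> \<eta>. cinner (S \<xi>) \<eta> = cinner \<xi> (T \<eta>))"

text \<open>The possibly unbounded diagonal operator with eigenvalues \<open>d\<close>, on its maximal domain
  of those \<open>\<xi>\<close> for which \<open>d \<xi>\<close> is square-summable. Off the domain the value is the dummy \<open>0\<close>.\<close>
definition diagonal_operator :: "('a \<Rightarrow> complex) \<Rightarrow> 'a ell2 \<Rightarrow> 'a ell2" where
  "diagonal_operator d \<xi> =
    (if (\<lambda>x. (cmod (d x * coord \<xi> x))\<^sup>2) summable_on UNIV
     then Abs_ell2 (\<lambda>x. d x * coord \<xi> x) else 0)"

text \<open>Nuclearity, that is, being trace class, of a densely defined operator whose domain contains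
  the basis vectors.\<close>
definition trace_class :: "('a ell2 \<Rightarrow> 'a ell2) \<Rightarrow> bool" where
  "trace_class T \<longleftrightarrow> (\<exists>u v :: 'a \<Rightarrow> 'a ell2.
     (\<lambda>k. norm (u k) * norm (v k)) summable_on UNIV \<and>
     (\<forall>x. T (ket x) = (\<Sum>\<^sub>\<infinity>k. cinner (v k) (ket x) *\<^sub>C u k)))"

definition operator_trace :: "('a ell2 \<Rightarrow> 'a ell2) \<Rightarrow> complex" where
  "operator_trace T = (\<Sum>\<^sub>\<infinity>x. cinner (ket x) (T (ket x)))"


section \<open>The operators on the Hilbert space of \<open>SU\<^sub>q(2)\<close> at \<open>q = 0\<close>\<close>

typedef idx = "{(n :: real, i :: real, j :: real).
    2 * n \<in> \<nat> \<and> n + i \<in> \<nat> \<and> n - i \<in> \<nat> \<and> n + j \<in> \<nat> \<and> n - j \<in> \<nat>}"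
  by (intro exI[of _ "(0, 0, 0)"]) simp

type_synonym hilb = "idx ell2"
type_synonym opr = "hilb \<Rightarrow> hilb"

definition bas :: "real \<Rightarrow> real \<Rightarrow> real \<Rightarrow> hilb" where
  "bas n i j = ket (Abs_idx (n, i, j))"

definition \<alpha> :: opr where
  "\<alpha> = operator_on_basis (\<lambda>x. case Rep_idx x of (n, i, j) \<Rightarrow>
     if i > - n \<and> j > - n then bas (n - 1/2) (i - 1/2) (j - 1/2) else 0)"

definition \<beta> :: opr where
  "\<beta> = operator_on_basis (\<lambda>x. case Rep_idx x of (n, i, j) \<Rightarrow>
     if i \<noteq> - n \<and> j \<noteq> - n then 0
     else if j \<noteq> - n then bas (n - 1/2) (- (n - 1/2)) (j - 1/2)
     else - bas (n + 1/2) (i + 1/2) (- (n + 1/2)))"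

definition proj_e :: opr where "proj_e = \<beta> \<circ> adj \<beta>"

definition \<delta>\<^sub>0 :: "real \<Rightarrow> real" where "\<delta>\<^sub>0 k = (if k = 0 then 1 else 0)"

definition D_eigenvalue :: "idx \<Rightarrow> real" where
  "D_eigenvalue x = (case Rep_idx x of (n, i, j) \<Rightarrow> (2 * \<delta>\<^sub>0 (n - i) - 1) * (2 * n))"

definition D :: opr where
  "D = diagonal_operator (\<lambda>x. complex_of_real (D_eigenvalue x))"

text \<open>\<open>|D|\<^sup>w\<close>, where \<open>|D|\<close> is replaced by \<open>\<epsilon>\<close> on the kernel of \<open>D\<close>.\<close>
definition absD_powr :: "real \<Rightarrow> complex \<Rightarrow> opr" where
  "absD_powr \<epsilon> w = diagonal_operator (\<lambda>x.
     complex_of_real (if D_eigenvalue x = 0 then \<epsilon> else \<bar>D_eigenvalue x\<bar>) powr w)"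

definition commutator :: "opr \<Rightarrow> opr \<Rightarrow> opr" where
  "commutator S T = (\<lambda>\<xi>. S (T \<xi>) - T (S \<xi>))"

definition nabla :: "opr \<Rightarrow> opr" where
  "nabla T = commutator (D \<circ> D) T"

text \<open>The zeta function \<open>z \<mapsto> Trace (P |D|\<^sup>-\<^sup>z)\<close> is defined for large real part of \<open>z\<close>; the residue at
  \<open>0\<close> is that of its meromorphic continuation, here to some half plane containing \<open>0\<close>.
  By the identity theorem the residue does not depend on the half plane.\<close>
definition has_residue_trace :: "real \<Rightarrow> opr \<Rightarrow> complex \<Rightarrow> bool" where
  "has_residue_trace \<epsilon> P r \<longleftrightarrow> (\<exists>R c g. c < 0 \<and> g meromorphic_on {z. Re z > c} \<and>
     (\<forall>z. Re z > R \<longrightarrow> trace_class (P \<circ> absD_powr \<epsilon> (- z)) \<and>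
                        g z = operator_trace (P \<circ> absD_powr \<epsilon> (- z))) \<and>
     residue g 0 = r)"

definition nc_integral :: "real \<Rightarrow> opr \<Rightarrow> complex" where
  "nc_integral \<epsilon> P = (THE r. has_residue_trace \<epsilon> P r)"


section \<open>Smooth functions on the circle\<close>

text \<open>Functions on the circle are \<open>2\<pi>\<close>-periodic functions of the angle.\<close>

definition ddt :: "(real \<Rightarrow> complex) \<Rightarrow> real \<Rightarrow> complex" where
  "ddt f = (\<lambda>t. vector_derivative f (at t))"

definition smooth_circle :: "(real \<Rightarrow> complex) set" where
  "smooth_circle = {f. (\<forall>t. f (t + 2 * pi) = f t) \<and> (\<forall>p t. (ddt ^^ p) f differentiable (at t))}"

definition circle_integral :: "(real \<Rightarrow> complex) \<Rightarrow> complex" where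
  "circle_integral f = integral {0..2 * pi} f"

definition fourier :: "(real \<Rightarrow> complex) \<Rightarrow> int \<Rightarrow> complex" where
  "fourier f n = 1 / (2 * pi) * circle_integral (\<lambda>t. f t * cis (- (real_of_int n * t)))"

definition rapid_decay :: "(nat \<Rightarrow> complex) \<Rightarrow> bool" where
  "rapid_decay c \<longleftrightarrow> (\<forall>s. \<exists>C. \<forall>k. real (1 + k) ^ s * cmod (c k) \<le> C)"

definition rapid_decay_smooth :: "(nat \<Rightarrow> nat \<Rightarrow> real \<Rightarrow> complex) \<Rightarrow> bool" where
  "rapid_decay_smooth f \<longleftrightarrow> (\<forall>k l. f k l \<in> smooth_circle) \<and>
     (\<forall>s p. \<exists>C. \<forall>k l t. real (1 + k + l) ^ s * cmod ((ddt ^^ p) (f k l) t) \<le> C)"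


section \<open>The algebra and its symbol map\<close>

definition fun_\<beta> :: "(real \<Rightarrow> complex) \<Rightarrow> opr" where
  "fun_\<beta> f \<xi> = (\<Sum>\<^sub>\<infinity>n\<in>{1..}. fourier f (int n) *\<^sub>C (\<beta> ^^ n) \<xi>)
             + (\<Sum>\<^sub>\<infinity>n\<in>{1..}. fourier f (- int n) *\<^sub>C (adj \<beta> ^^ n) \<xi>)
             + fourier f 0 *\<^sub>C proj_e \<xi>"

definition element_of ::
    "(nat \<Rightarrow> nat \<Rightarrow> real \<Rightarrow> complex) \<Rightarrow> (nat \<Rightarrow> complex) \<Rightarrow> (nat \<Rightarrow> complex) \<Rightarrow> opr" where
  "element_of f lam lam' \<xi> =
      (\<Sum>\<^sub>\<infinity>(k, l). (adj \<alpha> ^^ k) (fun_\<beta> (f k l) ((\<alpha> ^^ l) \<xi>)))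
    + (\<Sum>\<^sub>\<infinity>l. lam l *\<^sub>C (\<alpha> ^^ l) \<xi>)
    + (\<Sum>\<^sub>\<infinity>k\<in>{1..}. lam' k *\<^sub>C (adj \<alpha> ^^ k) \<xi>)"

text \<open>The entry \<open>lam' 0\<close> does not occur in the sum; it is set to \<open>0\<close> to make the data of an
  element unique.\<close>
definition has_expansion ::
    "opr \<Rightarrow> (nat \<Rightarrow> nat \<Rightarrow> real \<Rightarrow> complex) \<Rightarrow> (nat \<Rightarrow> complex) \<Rightarrow> (nat \<Rightarrow> complex) \<Rightarrow> bool" where
  "has_expansion a f lam lam' \<longleftrightarrow>
     rapid_decay_smooth f \<and> rapid_decay lam \<and> rapid_decay lam' \<and> lam' 0 = 0 \<and>
     a = element_of f lam lam'"

definition \<A> :: "opr set" where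
  "\<A> = {a. \<exists>f lam lam'. has_expansion a f lam lam'}"

definition expansion ::
    "opr \<Rightarrow> (nat \<Rightarrow> nat \<Rightarrow> real \<Rightarrow> complex) \<times> (nat \<Rightarrow> complex) \<times> (nat \<Rightarrow> complex)" where
  "expansion a = (THE (f, lam, lam'). has_expansion a f lam lam')"

definition f_coeff :: "opr \<Rightarrow> nat \<Rightarrow> nat \<Rightarrow> real \<Rightarrow> complex" where
  "f_coeff a = fst (expansion a)"

definition lam_coeff :: "opr \<Rightarrow> nat \<Rightarrow> complex" where
  "lam_coeff a = fst (snd (expansion a))"

definition lam'_coeff :: "opr \<Rightarrow> nat \<Rightarrow> complex" where
  "lam'_coeff a = snd (snd (expansion a))"

definition \<sigma> :: "opr \<Rightarrow> real \<Rightarrow> complex" where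
  "\<sigma> a = (\<lambda>t. (\<Sum>\<^sub>\<infinity>l. lam_coeff a l * cis (real l * t))
            + (\<Sum>\<^sub>\<infinity>k\<in>{1..}. lam'_coeff a k * cis (- (real k * t))))"


section \<open>Cochains\<close>

text \<open>An \<open>(m+1)\<close>-linear form takes the list \<open>[a\<^sub>0, \<dots>, a\<^sub>m]\<close> of its arguments. The product of the
  algebra is composition and its unit is \<open>id\<close>.\<close>

type_synonym cochain = "opr list \<Rightarrow> complex"

definition hochschild_b :: "cochain \<Rightarrow> cochain" where
  "hochschild_b \<psi> as = (let m = length as - 2 in
     (\<Sum>j\<le>m. (-1) ^ j * \<psi> (take j as @ [as ! j \<circ> as ! (j + 1)] @ drop (j + 2) as))
     + (-1) ^ (m + 1) * \<psi> ((last as \<circ> hd as) # tl (butlast as)))"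

definition B\<^sub>0 :: "cochain \<Rightarrow> cochain" where
  "B\<^sub>0 \<phi> as = (let m = length as in \<phi> (id # as) - (-1) ^ m * \<phi> (as @ [id]))"

definition A_cyc :: "cochain \<Rightarrow> cochain" where
  "A_cyc \<psi> as = (let m = length as in \<Sum>j<m. (-1) ^ ((m - 1) * j) * \<psi> (rotate j as))"

definition connes_B :: "cochain \<Rightarrow> cochain" where
  "connes_B \<phi> = A_cyc (B\<^sub>0 \<phi>)"

fun \<phi>\<^sub>1 :: "real \<Rightarrow> cochain" where
  "\<phi>\<^sub>1 \<epsilon> [a0, a1] =
      nc_integral \<epsilon> (a0 \<circ> commutator D a1 \<circ> absD_powr \<epsilon> (-1))
    - 1/4 * nc_integral \<epsilon> (a0 \<circ> nabla (commutator D a1) \<circ> absD_powr \<epsilon> (-3))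
    + 1/8 * nc_integral \<epsilon> (a0 \<circ> nabla (nabla (commutator D a1)) \<circ> absD_powr \<epsilon> (-5))"
| "\<phi>\<^sub>1 \<epsilon> _ = undefined"

fun \<phi>\<^sub>3 :: "real \<Rightarrow> cochain" where
  "\<phi>\<^sub>3 \<epsilon> [a0, a1, a2, a3] =
     1/12 * nc_integral \<epsilon>
       (a0 \<circ> commutator D a1 \<circ> commutator D a2 \<circ> commutator D a3 \<circ> absD_powr \<epsilon> (-3))"
| "\<phi>\<^sub>3 \<epsilon> _ = undefined"

text \<open>Only the pairs \<open>(\<alpha>*\<^sup>k f(\<beta>) \<alpha>\<^sup>l, \<alpha>*\<^sup>l g(\<beta>) \<alpha>\<^sup>k)\<close> contribute, with value
  \<open>(\<pi> i)\<^sup>-\<^sup>1 \<integral> f dg\<close>; by linearity and continuity the contributions are added over \<open>k, l\<close>.\<close>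
fun \<tau>\<^sub>1 :: cochain where
  "\<tau>\<^sub>1 [x, y] = (\<Sum>\<^sub>\<infinity>(k, l).
     1 / (pi * \<i>) * circle_integral (\<lambda>t. f_coeff x k l t * ddt (f_coeff y l k) t))"
| "\<tau>\<^sub>1 _ = undefined"

definition \<rho> :: "nat \<Rightarrow> real" where
  "\<rho> j = 2/3 - real j - (real j)\<^sup>2"

fun \<phi>\<^sub>0 :: cochain where
  "\<phi>\<^sub>0 [a] = (\<Sum>\<^sub>\<infinity>k. \<rho> k * (1 / (2 * pi) * circle_integral (f_coeff a k k)))"
| "\<phi>\<^sub>0 _ = undefined"

fun \<phi>\<^sub>2 :: cochain where
  "\<phi>\<^sub>2 [a0, a1, a2] = - 1/24 * (1 / (2 * pi * \<i>)) *
     circle_integral (\<lambda>t. \<sigma> a0 t * ddt (\<sigma> a1) t * ddt (ddt (\<sigma> a2)) t)"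
| "\<phi>\<^sub>2 _ = undefined"

end

(* In suitable coordinates (s, k, m) on the basis, an element of the algebra leaves s unchanged and acts by a
   kernel c k l (m - m') + [m = m'] t (k - l): the f_kl(beta) give the rapidly decaying part c, and the scalar
   coefficients, that is, the symbol, give the Toeplitz part t. The operator D is diagonal with eigenvalues
   +-(k + s + |m|), the sign being positive exactly for s = 0 and m >= 0. Since the shells |D| = N are finite,
   the zeta function is a Dirichlet series over N, and its residue is the coefficient of 1/N in the large N
   expansion of the sum of the diagonal entries over the shell, because of the simple pole of zeta at 1.

   For phi_1 this coefficient is explicit: a triple (l, k, n) of the decaying part of the product of the two
   kernels has weight (k - l)(1 + k + l) + 2n, and the Toeplitz part contributes the sum of
   t0(-d) t1(d) (d - d^3/4). The term 2n is tau_1, b phi_0 yields rho(l) - rho(k) = (k - l)(1 + k + l) and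
   d - d^3/3, and B phi_2 yields d^3/12. For phi_3 only the Toeplitz part matters: the commutator with D turns
   t(d) into d t(d) times the sign of D, and the signs on the shell N sum to 1 - N^2, while the three
   derivatives appear on the other side because b phi_2 integrates 2 f0 f1' f2' f3'. *)
theory Submission
  imports Defs
begin

text \<open>In the original indices k = min (n + i) (n + j), s = min (n - i) (n - j) and m = i - j.
  Three obstacles shape the proof. \<open>D\<close> is unbounded and takes a dummy value off its
  domain, so identities for commutators are proved on vectors with rapidly decaying coordinates;
  these include the basis and are preserved by everything that occurs. \<open>expansion\<close> and
  \<open>nc_integral\<close> are definite descriptions, so the coefficients must be shown to be
  determined by the operator (the Toeplitz part is seen far from the edge k = 0, a smooth function
  by its Fourier coefficients) and the residue by the trace. Finally, the 1/N coefficients have to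
  be summed over infinitely many triples, although the expansion of one triple is accurate only once
  N exceeds its size. Hence each remainder is bounded by N^-2 times a polynomial in the triple,
  uniformly in N, and rapid decay absorbs the polynomial. The product of two Toeplitz parts does not
  decay along k - l = d; there the shell is summed first for fixed d, and the decay in d does the
  rest.\<close>

instance ell2 :: (type) banach ..

section \<open>Coordinates, the expansion in the basis, and operators determined by it\<close>

lemma coord_add: "coord (\<xi> + \<eta>) x = coord \<xi> x + coord \<eta> x"
  by (simp add: plus_ell2.rep_eq)

lemma coord_scaleC: "coord (c *\<^sub>C \<xi>) x = c * coord \<xi> x"
  by (simp add: scaleC_ell2.rep_eq)

lemma coord_zero: "coord 0 x = 0"
  by (simp add: zero_ell2.rep_eq)

lemma coord_ket: "coord (ket x) y = (if y = x then 1 else 0)"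
  by (simp add: ket.rep_eq)

lemma ell2_eqI: "(\<And>x. coord \<xi> x = coord \<eta> x) \<Longrightarrow> \<xi> = \<eta>"
  by (metis coord_inject ext)

lemma coord_uminus: "coord (- \<xi>) x = - coord \<xi> x"
  by (simp add: uminus_ell2.rep_eq)

lemma norm_scaleC: "norm (c *\<^sub>C \<xi>) = cmod c * norm \<xi>" for \<xi> :: "'a ell2"
proof (rule power2_eq_imp_eq)
  show "(norm (c *\<^sub>C \<xi>))\<^sup>2 = (cmod c * norm \<xi>)\<^sup>2"
    unfolding power_mult_distrib norm_ell2_square coord_scaleC norm_mult
    by (rule infsum_cmult_right')
qed auto

lemma scaleR_eq_scaleC: "r *\<^sub>R \<xi> = complex_of_real r *\<^sub>C \<xi>" for \<xi> :: "'a ell2"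
  by (simp add: scaleR_ell2_def)

lemma bounded_linear_coord: "bounded_linear (\<lambda>\<xi>. coord \<xi> x)"
  by (rule bounded_linear_intro[of _ 1])
     (simp_all add: coord_add scaleR_eq_scaleC coord_scaleC coord_le_norm scaleR_conv_of_real)

lemma coord_sum: "coord (\<Sum>i\<in>F. f i) x = (\<Sum>i\<in>F. coord (f i) x)"
  by (rule linear_sum) (simp add: bounded_linear.linear bounded_linear_coord)

lemma coord_infsum: "f summable_on A \<Longrightarrow> coord (infsum f A) x = (\<Sum>\<^sub>\<infinity>i\<in>A. coord (f i) x)"
  by (rule infsumI[symmetric], rule has_sum_bounded_linear[OF bounded_linear_coord]) simp

lemma cinner_ket_left: "cinner (ket x) \<eta> = coord \<eta> x"
proof -
  have "cinner (ket x) \<eta> = (\<Sum>\<^sub>\<infinity>y\<in>{x}. coord \<eta> y)"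
    unfolding cinner_def by (rule infsum_cong_neutral) (auto simp: coord_ket)
  then show ?thesis by simp
qed

lemma norm_ket: "norm (ket x) = 1"
proof -
  have "(norm (ket x))\<^sup>2 = (\<Sum>\<^sub>\<infinity>y\<in>{x}. 1)"
    unfolding norm_ell2_square by (rule infsum_cong_neutral) (auto simp: coord_ket)
  then show ?thesis by (simp add: power2_eq_1_iff) (smt (verit) norm_ge_zero)
qed

lemma cinner_commute: "cinner \<eta> \<xi> = cnj (cinner \<xi> \<eta>)"
  unfolding cinner_def infsum_cnj[symmetric] by (simp add: mult.commute)

text \<open>Pythagoras: the squared distance from \<xi> to the partial sum over \<open>F\<close> is
  the mass of the squared coordinates outside \<open>F\<close>, which tends to 0.\<close>

lemma has_sum_ket: "((\<lambda>x. coord \<xi> x *\<^sub>C ket x) has_sum \<xi>) UNIV"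
proof -
  let ?q = "\<lambda>x. (cmod (coord \<xi> x))\<^sup>2"
  have n: "(norm (sum (\<lambda>x. coord \<xi> x *\<^sub>C ket x) F - \<xi>))\<^sup>2 = (norm \<xi>)\<^sup>2 - sum ?q F"
    if F: "finite F" for F
  proof -
    have c: "coord (sum (\<lambda>x. coord \<xi> x *\<^sub>C ket x) F - \<xi>) y = (if y \<in> F then 0 else - coord \<xi> y)" for y
      using F by (simp add: coord_minus coord_sum coord_scaleC coord_ket if_distrib[of "(*) _"]
          cong: if_cong)
    have "(norm (sum (\<lambda>x. coord \<xi> x *\<^sub>C ket x) F - \<xi>))\<^sup>2 = infsum ?q (- F)"
      unfolding norm_ell2_square c by (rule infsum_cong_neutral) auto
    also have "\<dots> = infsum ?q UNIV - infsum ?q F"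
      unfolding Compl_eq_Diff_UNIV
      by (rule infsum_Diff) (use F in \<open>auto intro: square_summable_coord\<close>)
    finally show ?thesis using F by (simp add: norm_ell2_square)
  qed
  have "(sum ?q \<longlongrightarrow> (norm \<xi>)\<^sup>2) (finite_subsets_at_top UNIV)"
    unfolding norm_ell2_square by (rule infsum_tendsto[OF square_summable_coord])
  from tendsto_diff[OF tendsto_const this, of "(norm \<xi>)\<^sup>2"]
  have "((\<lambda>F. (norm \<xi>)\<^sup>2 - sum ?q F) \<longlongrightarrow> 0) (finite_subsets_at_top UNIV)" by simp
  then have "((\<lambda>F. (norm (sum (\<lambda>x. coord \<xi> x *\<^sub>C ket x) F - \<xi>))\<^sup>2) \<longlongrightarrow> 0) (finite_subsets_at_top UNIV)"
    by (rule Lim_transform_eventually)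
       (auto intro!: eventually_finite_subsets_at_top_weakI simp: n)
  then have "((\<lambda>F. norm (sum (\<lambda>x. coord \<xi> x *\<^sub>C ket x) F - \<xi>)) \<longlongrightarrow> 0) (finite_subsets_at_top UNIV)"
    using tendsto_real_sqrt[of "\<lambda>F. (norm (sum (\<lambda>x. coord \<xi> x *\<^sub>C ket x) F - \<xi>))\<^sup>2" 0] by simp
  then show ?thesis
    unfolding has_sum_def by (metis Lim_null tendsto_norm_zero_iff)
qed

text \<open>The class instances of \<open>ell2\<close> are over the reals, so
  \<open>bounded_linear\<close> says nothing about complex scalars; complex homogeneity is recorded
  here as well.\<close>

definition bounded_op :: "real \<Rightarrow> ('a ell2 \<Rightarrow> 'a ell2) \<Rightarrow> bool" where
  "bounded_op K V \<longleftrightarrow> (\<forall>\<xi> \<eta>. V (\<xi> + \<eta>) = V \<xi> + V \<eta>) \<and> (\<forall>c \<xi>. V (c *\<^sub>C \<xi>) = c *\<^sub>C V \<xi>)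
     \<and> (\<forall>\<xi>. norm (V \<xi>) \<le> K * norm \<xi>)"

lemma bounded_op_linear: "bounded_op K V \<Longrightarrow> bounded_linear V"
  unfolding bounded_op_def
  by (rule bounded_linear_intro[of _ K]) (auto simp: scaleR_eq_scaleC mult.commute)

lemma operator_on_basis_eq:
  assumes V: "bounded_op K V" and F: "\<And>x. V (ket x) = F x"
  shows "operator_on_basis F = V"
proof
  fix \<xi>
  have "((\<lambda>x. V (coord \<xi> x *\<^sub>C ket x)) has_sum V \<xi>) UNIV"
    by (rule has_sum_bounded_linear[OF bounded_op_linear[OF V] has_sum_ket])
  then show "operator_on_basis F \<xi> = V \<xi>"
    using V unfolding operator_on_basis_def bounded_op_def F[symmetric] by (intro infsumI) simp
qed

text \<open>Testing against basis vectors recovers all coordinates, so at most one operator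
  satisfies the condition in the definite description of \<open>adj\<close>.\<close>

lemma adj_eqI:
  assumes S: "\<And>\<xi> \<eta>. cinner (S \<xi>) \<eta> = cinner \<xi> (T \<eta>)"
  shows "adj T = S"
  unfolding adj_def
proof (rule the_equality)
  fix S' assume S': "\<forall>\<xi> \<eta>. cinner (S' \<xi>) \<eta> = cinner \<xi> (T \<eta>)"
  show "S' = S"
  proof (intro ext ell2_eqI)
    fix \<xi> x
    show "coord (S' \<xi>) x = coord (S \<xi>) x"
      unfolding cinner_ket_left[symmetric] cinner_commute[of "ket x"] by (simp add: S S')
  qed
qed (use S in simp)

section \<open>Coordinates\<close>

type_synonym site = "nat \<times> nat \<times> int"

definition level :: "site \<Rightarrow> real" where
  "level x = (case x of (s, k, m) \<Rightarrow> real k + real s + \<bar>real_of_int m\<bar>)"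

text \<open>These coordinates are chosen such that the generators do not change \<open>s\<close>, \<open>\<alpha>\<close> lowers \<open>k\<close>, and
  \<open>\<beta>\<close> shifts \<open>m\<close> on \<open>k = 0\<close>. Here \<open>level\<close> is \<open>2 n\<close>.\<close>
definition st :: "site \<Rightarrow> idx" where
  "st x = (case x of (s, k, m) \<Rightarrow> Abs_idx (level x / 2,
     real k + max (real_of_int m) 0 - level x / 2, real k + max (- real_of_int m) 0 - level x / 2))"

lemma nonneg_int_Nats: "real_of_int i \<ge> 0 \<Longrightarrow> real_of_int i \<in> \<nat>"
  by (metis of_int_0_le_iff of_int_of_nat_eq of_nat_in_Nats zero_le_imp_eq_int)

lemma Rep_st: "Rep_idx (st (s, k, m)) = (level (s, k, m) / 2,
     real k + max (real_of_int m) 0 - level (s, k, m) / 2,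
     real k + max (- real_of_int m) 0 - level (s, k, m) / 2)"
proof -
  have "real k + real s + \<bar>real_of_int m\<bar> \<in> \<nat>" "real k + max (real_of_int m) 0 \<in> \<nat>"
    "real k + max (- real_of_int m) 0 \<in> \<nat>" "real s + max (- real_of_int m) 0 \<in> \<nat>"
    "real s + max (real_of_int m) 0 \<in> \<nat>"
    using nonneg_int_Nats[of "int k + int s + \<bar>m\<bar>"] nonneg_int_Nats[of "int k + max m 0"]
      nonneg_int_Nats[of "int k + max (-m) 0"] nonneg_int_Nats[of "int s + max m 0"]
      nonneg_int_Nats[of "int s + max (-m) 0"] by (simp_all add: of_int_max)
  moreover have "level (s, k, m) - (real k + max (real_of_int m) 0) = real s + max (- real_of_int m) 0"
    "level (s, k, m) - (real k + max (- real_of_int m) 0) = real s + max (real_of_int m) 0"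
    by (auto simp: level_def max_def)
  moreover have half: "c / 2 + (a - c / 2) = a" "c / 2 - (a - c / 2) = c - a" for a c :: real by simp_all
  moreover have "level (s, k, m) \<in> \<nat>" using \<open>real k + real s + \<bar>real_of_int m\<bar> \<in> \<nat>\<close> by (simp add: level_def)
  ultimately show ?thesis
    unfolding st_def split
    by (intro Abs_idx_inverse) (simp only: mem_Collect_eq split half, simp)
qed

lemma bij_st: "bij st"
proof (rule bijI)
  show "inj st"
  proof (rule injI)
    fix x y :: site assume xy: "st x = st y"
    obtain s k m s' k' m' where x: "x = (s, k, m)" and y: "y = (s', k', m')"
      by (metis prod_cases3)
    from xy have *: "Rep_idx (st (s, k, m)) = Rep_idx (st (s', k', m'))" by (simp add: x y)
    have 1: "level (s, k, m) = level (s', k', m')"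
      "real k + max (real_of_int m) 0 = real k' + max (real_of_int m') 0"
      "real k + max (- real_of_int m) 0 = real k' + max (- real_of_int m') 0"
      using * unfolding Rep_st by auto
    then have "real_of_int m = real_of_int m'" by (auto simp: max_def split: if_splits)
    then show "x = y" using 1 by (auto simp: level_def x y)
  qed
  show "surj st"
  proof -
    have "\<exists>x. z = st x" for z
    proof -
      obtain n i j where z: "Rep_idx z = (n, i, j)" by (metis prod_cases3)
      have nn: "2 * n \<in> \<nat>" "n + i \<in> \<nat>" "n - i \<in> \<nat>" "n + j \<in> \<nat>" "n - j \<in> \<nat>"
        using Rep_idx[of z] unfolding z by auto
      obtain x where x: "n + i = real x" using nn(2) by (auto elim: Nats_cases)
      obtain y where y: "n + j = real y" using nn(4) by (auto elim: Nats_cases)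
      obtain x' where x': "n - i = real x'" using nn(3) by (auto elim: Nats_cases)
      obtain y' where y': "n - j = real y'" using nn(5) by (auto elim: Nats_cases)
      \<comment> \<open>Here x + x' = y + y' = 2 n, hence x - y = y' - x'; so the two minima and the
        difference x - y determine all four numbers.\<close>
      let ?x = "(min x' y', min x y, int x - int y)"
      have e: "x + x' = y + y'" using x y x' y' by linarith
      have nij: "n = (real x + real x') / 2" "i = (real x - real x') / 2" "j = (real y - real y') / 2"
        using x y x' y' by simp_all
      have "real x + real x' = real y + real y'" using e by linarith
      then have "Rep_idx (st ?x) = (n, i, j)"
        unfolding Rep_st level_def nij by (auto simp: min_def max_def field_simps)
      then show ?thesis by (metis Rep_idx_inject z)
    qed
    then show ?thesis by (metis surjI surj_def)
  qed
qed

definition parity :: "site \<Rightarrow> complex" where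
  "parity x = (case x of (s, k, m) \<Rightarrow> (-1) ^ nat m)"

lemma parity_mult_self [simp]: "parity x * parity x = 1" "parity x * (parity x * c) = c"
  by (auto simp: parity_def split: prod.split simp flip: power_add mult_2 mult.assoc)

lemma norm_parity [simp]: "cmod (parity x) = 1"
  by (simp add: parity_def norm_power split: prod.split)

lemma cnj_parity [simp]: "cnj (parity x) = parity x"
  by (simp add: parity_def split: prod.split)

text \<open>The signs absorb the minus sign in the definition of \<open>\<beta>\<close>.\<close>
definition cf :: "hilb \<Rightarrow> site \<Rightarrow> complex" where
  "cf \<xi> x = parity x * coord \<xi> (st x)"

definition vec :: "(site \<Rightarrow> complex) \<Rightarrow> hilb" where
  "vec \<phi> = Abs_ell2 (\<lambda>i. parity (inv st i) * \<phi> (inv st i))"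

lemma coord_eq_cf: "coord \<xi> i = parity (inv st i) * cf \<xi> (inv st i)"
  using bij_st by (simp add: cf_def surj_f_inv_f bij_is_surj)

lemma cf_eqI: "(\<And>x. cf \<xi> x = cf \<eta> x) \<Longrightarrow> \<xi> = \<eta>"
  by (rule ell2_eqI) (simp add: coord_eq_cf)

lemma cmod_cf: "cmod (cf \<xi> x) = cmod (coord \<xi> (st x))"
  by (simp add: cf_def norm_mult)

lemma summable_cf: "(\<lambda>x. (cmod (cf \<xi> x))\<^sup>2) summable_on UNIV"
  unfolding cmod_cf summable_on_reindex_bij_betw[OF bij_st, of "\<lambda>i. (cmod (coord \<xi> i))\<^sup>2"]
  by (rule square_summable_coord)

lemma norm_cf: "(norm \<xi>)\<^sup>2 = (\<Sum>\<^sub>\<infinity>x. (cmod (cf \<xi> x))\<^sup>2)"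
  unfolding cmod_cf infsum_reindex_bij_betw[OF bij_st, of "\<lambda>i. (cmod (coord \<xi> i))\<^sup>2"]
  by (rule norm_ell2_square)

lemma cinner_cf: "cinner \<xi> \<eta> = (\<Sum>\<^sub>\<infinity>x. cnj (cf \<xi> x) * cf \<eta> x)"
  unfolding cinner_def
  by (subst infsum_reindex_bij_betw[OF bij_st, symmetric], rule infsum_cong)
     (simp add: cf_def mult.left_commute)

lemma cf_add: "cf (\<xi> + \<eta>) x = cf \<xi> x + cf \<eta> x"
  and cf_scaleC: "cf (c *\<^sub>C \<xi>) x = c * cf \<xi> x"
  and cf_zero: "cf 0 x = 0"
  and cf_uminus: "cf (- \<xi>) x = - cf \<xi> x"
  and cf_minus: "cf (\<xi> - \<eta>) x = cf \<xi> x - cf \<eta> x"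
  by (simp_all add: cf_def coord_add coord_scaleC coord_zero coord_uminus coord_minus algebra_simps)

lemma cf_ket: "cf (ket (st x)) y = (if y = x then parity x else 0)"
  using inj_eq[OF bij_is_inj[OF bij_st]] by (simp add: cf_def coord_ket)

lemma cmod_cf_le_norm: "cmod (cf \<xi> x) \<le> norm \<xi>"
  by (simp add: cmod_cf coord_le_norm)

lemma cf_infsum: "f summable_on A \<Longrightarrow> cf (infsum f A) x = (\<Sum>\<^sub>\<infinity>i\<in>A. cf (f i) x)"
  by (simp add: cf_def coord_infsum infsum_cmult_right')

lemma cf_vec:
  assumes "(\<lambda>x. (cmod (\<phi> x))\<^sup>2) summable_on UNIV"
  shows "cf (vec \<phi>) = \<phi>"
proof
  fix x
  have "(\<lambda>i. (cmod (parity (inv st i) * \<phi> (inv st i)))\<^sup>2) summable_on UNIV"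
    unfolding norm_mult norm_parity mult_1
    using assms summable_on_reindex_bij_betw[OF bij_imp_bij_inv[OF bij_st], of "\<lambda>x. (cmod (\<phi> x))\<^sup>2"]
    by simp
  then show "cf (vec \<phi>) x = \<phi> x"
    using bij_st by (simp add: cf_def vec_def Abs_ell2_inverse inv_f_f bij_is_inj)
qed

section \<open>The generators in coordinates\<close>

text \<open>In the coordinates \<alpha>, \<beta> and their adjoints all have this shape with
  \<open>h\<close> injective on \<open>S\<close>. Boundedness, coordinates and adjoints are
  therefore settled once for partial isometries of this kind.\<close>

definition pull :: "site set \<Rightarrow> (site \<Rightarrow> site) \<Rightarrow> opr" where
  "pull S h \<xi> = vec (\<lambda>x. if x \<in> S then cf \<xi> (h x) else 0)"

lemma
  assumes "inj_on h S"
  shows cf_pull: "cf (pull S h \<xi>) x = (if x \<in> S then cf \<xi> (h x) else 0)"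
    and bounded_op_pull: "bounded_op 1 (pull S h)"
proof -
  have sq: "(\<lambda>x. (cmod (if x \<in> S then cf \<xi> (h x) else 0))\<^sup>2) summable_on UNIV"
    and le: "(\<Sum>\<^sub>\<infinity>x. (cmod (if x \<in> S then cf \<xi> (h x) else 0))\<^sup>2) \<le> (norm \<xi>)\<^sup>2" for \<xi>
  proof -
    let ?q = "\<lambda>x. (cmod (cf \<xi> x))\<^sup>2"
    have *: "?q summable_on h ` S" by (rule summable_on_subset[OF summable_cf]) auto
    then have **: "(\<lambda>x. ?q (h x)) summable_on S"
      using summable_on_reindex[OF assms, of ?q] by (simp add: o_def)
    then show "(\<lambda>x. (cmod (if x \<in> S then cf \<xi> (h x) else 0))\<^sup>2) summable_on UNIV"
      by (rule summable_on_cong_neutral[THEN iffD1, rotated -1]) auto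
    have "(\<Sum>\<^sub>\<infinity>x. (cmod (if x \<in> S then cf \<xi> (h x) else 0))\<^sup>2) = (\<Sum>\<^sub>\<infinity>x\<in>S. ?q (h x))"
      by (rule infsum_cong_neutral) auto
    also have "\<dots> = infsum ?q (h ` S)" using infsum_reindex[OF assms, of ?q] by (simp add: o_def)
    also have "\<dots> \<le> infsum ?q UNIV" by (rule infsum_mono2[OF * summable_cf]) auto
    finally show "(\<Sum>\<^sub>\<infinity>x. (cmod (if x \<in> S then cf \<xi> (h x) else 0))\<^sup>2) \<le> (norm \<xi>)\<^sup>2"
      by (simp add: norm_cf)
  qed
  show cf: "cf (pull S h \<xi>) x = (if x \<in> S then cf \<xi> (h x) else 0)" for x \<xi>
    unfolding pull_def cf_vec[OF sq] ..
  have "norm (pull S h \<xi>) \<le> norm \<xi>" for \<xi>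
    by (rule power2_le_imp_le) (simp_all only: norm_cf[of "pull S h \<xi>"] cf le norm_ge_zero)
  then show "bounded_op 1 (pull S h)"
    unfolding bounded_op_def by (auto intro!: cf_eqI simp: cf cf_add cf_scaleC)
qed

lemma adj_pull:
  assumes S: "\<And>x. x \<in> S \<Longrightarrow> h x \<in> T" "\<And>x. x \<in> S \<Longrightarrow> g (h x) = x"
    and T: "\<And>y. y \<in> T \<Longrightarrow> g y \<in> S" "\<And>y. y \<in> T \<Longrightarrow> h (g y) = y"
  shows "adj (pull S h) = pull T g"
proof (rule adj_eqI)
  fix \<xi> \<eta>
  have h: "inj_on h S" and g: "inj_on g T" by (rule inj_on_inverseI, rule S, assumption, rule inj_on_inverseI, rule T)
  have "cinner (pull T g \<xi>) \<eta> = (\<Sum>\<^sub>\<infinity>y\<in>T. cnj (cf \<xi> (g y)) * cf \<eta> y)"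
    unfolding cinner_cf cf_pull[OF g] by (rule infsum_cong_neutral) auto
  also have "\<dots> = (\<Sum>\<^sub>\<infinity>x\<in>S. cnj (cf \<xi> x) * cf \<eta> (h x))"
    by (rule infsum_reindex_bij_witness[of _ h g]) (use S T in auto)
  also have "\<dots> = cinner \<xi> (pull S h \<eta>)"
    unfolding cinner_cf cf_pull[OF h] by (rule infsum_cong_neutral) auto
  finally show "cinner (pull T g \<xi>) \<eta> = cinner \<xi> (pull S h \<eta>)" .
qed

lemma bas_eqI:
  assumes "n = level (s, k, m) / 2" "i = real k + max (real_of_int m) 0 - n"
    "j = real k + max (- real_of_int m) 0 - n"
  shows "bas n i j = ket (st (s, k, m))"
  by (simp add: bas_def st_def assms)

lemma alpha_pull: "\<alpha> = pull UNIV (\<lambda>(s, k, m). (s, Suc k, m))"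
  unfolding \<alpha>_def
proof (rule operator_on_basis_eq)
  have h: "inj_on (\<lambda>(s, k, m). (s, Suc k, m)) (UNIV :: site set)" by (auto simp: inj_on_def)
  then show "bounded_op 1 (pull UNIV (\<lambda>(s, k, m). (s, Suc k, m)))" by (rule bounded_op_pull)
  fix i
  obtain s k m where i: "i = st (s, k, m)" using bij_st by (metis bij_pointE prod_cases3)
  show "pull UNIV (\<lambda>(s, k, m). (s, Suc k, m)) (ket i) = (case Rep_idx i of (n, i, j) \<Rightarrow>
     if i > - n \<and> j > - n then bas (n - 1/2) (i - 1/2) (j - 1/2) else 0)"
  \<comment> \<open>n + i = k + max m 0 and n + j = k + max (- m) 0 are both positive exactly if k >
    0, because at least one of the two maxima vanishes.\<close>
  proof (cases k)
    case 0
    then show ?thesis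
      unfolding i Rep_st
      by (intro cf_eqI) (auto simp: cf_pull[OF h] cf_ket cf_zero max_def)
  next
    case (Suc k')
    have "(case Rep_idx i of (n, i, j) \<Rightarrow>
     if i > - n \<and> j > - n then bas (n - 1/2) (i - 1/2) (j - 1/2) else 0) = ket (st (s, k', m))"
      unfolding i Rep_st
      by (auto intro!: bas_eqI simp: Suc level_def max_def field_simps)
    then show ?thesis
      by (intro cf_eqI) (auto simp: cf_pull[OF h] cf_ket i Suc parity_def)
  qed
qed

lemma beta_pull: "\<beta> = pull {(s, k, m). k = 0} (\<lambda>(s, k, m). (s, k, m - 1))"
  unfolding \<beta>_def
proof (rule operator_on_basis_eq)
  have h: "inj_on (\<lambda>(s, k, m). (s, k, m - 1)) {(s::nat, k::nat, m::int). k = 0}" by (auto simp: inj_on_def)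
  then show "bounded_op 1 (pull {(s, k, m). k = 0} (\<lambda>(s, k, m). (s, k, m - 1)))" by (rule bounded_op_pull)
  fix i
  obtain s k m where i: "i = st (s, k, m)" using bij_st by (metis bij_pointE prod_cases3)
  let ?F = "case Rep_idx i of (n, i, j) \<Rightarrow>
     if i \<noteq> - n \<and> j \<noteq> - n then 0
     else if j \<noteq> - n then bas (n - 1/2) (- (n - 1/2)) (j - 1/2)
     else - bas (n + 1/2) (i + 1/2) (- (n + 1/2))"
  show "pull {(s, k, m). k = 0} (\<lambda>(s, k, m). (s, k, m - 1)) (ket i) = ?F"
  proof (cases "k = 0")
    case False
    then have "?F = 0" unfolding i Rep_st by (auto simp: max_def)
    then show ?thesis using False
      by (intro cf_eqI) (auto simp: cf_pull[OF h] cf_ket cf_zero i)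
  next
    case k: True
    show ?thesis
    \<comment> \<open>On k = 0 the case m < 0 has i = - n and j above - n, so \<beta> lowers n. For
      m \<ge> 0 one has j = - n, and \<beta> raises n with a minus sign, which the change of
      \<open>parity\<close> from m to m + 1 cancels.\<close>
    proof (cases "m < 0")
      case True
      have "?F = ket (st (s, 0, m + 1))"
        unfolding i Rep_st using True
        by (auto intro!: bas_eqI simp: k level_def field_simps max_def)
      then show ?thesis using k True
        by (intro cf_eqI) (auto simp: cf_pull[OF h] cf_ket i parity_def)
    next
      case False
      have "?F = - ket (st (s, 0, m + 1))"
        unfolding i Rep_st using False
        by (auto intro!: bas_eqI simp: k level_def field_simps max_def)
      then show ?thesis using k False
        by (intro cf_eqI) (auto simp: cf_pull[OF h] cf_ket cf_uminus i parity_def nat_add_distrib)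
    qed
  qed
qed

lemma adj_alpha_pull: "adj \<alpha> = pull {(s, k, m). k > 0} (\<lambda>(s, k, m). (s, k - 1, m))"
  unfolding alpha_pull by (rule adj_pull) auto

lemma adj_beta_pull: "adj \<beta> = pull {(s, k, m). k = 0} (\<lambda>(s, k, m). (s, k, m + 1))"
  unfolding beta_pull by (rule adj_pull) auto

lemma cf_alpha: "cf (\<alpha> \<xi>) (s, k, m) = cf \<xi> (s, k + 1, m)"
  unfolding alpha_pull by (subst cf_pull) (auto simp: inj_on_def)

lemma cf_adj_alpha: "cf (adj \<alpha> \<xi>) (s, k, m) = (if k > 0 then cf \<xi> (s, k - 1, m) else 0)"
  unfolding adj_alpha_pull by (subst cf_pull) (auto simp: inj_on_def)

lemma cf_beta: "cf (\<beta> \<xi>) (s, k, m) = (if k = 0 then cf \<xi> (s, 0, m - 1) else 0)"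
  unfolding beta_pull by (subst cf_pull) (auto simp: inj_on_def)

lemma cf_adj_beta: "cf (adj \<beta> \<xi>) (s, k, m) = (if k = 0 then cf \<xi> (s, 0, m + 1) else 0)"
  unfolding adj_beta_pull by (subst cf_pull) (auto simp: inj_on_def)

lemma norm_generators:
  "norm (\<alpha> \<xi>) \<le> norm \<xi>" "norm (adj \<alpha> \<xi>) \<le> norm \<xi>" "norm (\<beta> \<xi>) \<le> norm \<xi>" "norm (adj \<beta> \<xi>) \<le> norm \<xi>"
proof -
  have *: "norm (pull S h \<xi>) \<le> norm \<xi>" if "inj_on h S" for S h
    using bounded_op_pull[OF that] by (simp add: bounded_op_def)
  show "norm (adj \<alpha> \<xi>) \<le> norm \<xi>" "norm (adj \<beta> \<xi>) \<le> norm \<xi>"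
    unfolding adj_alpha_pull adj_beta_pull by (rule *; auto simp: inj_on_def)+
  show "norm (\<alpha> \<xi>) \<le> norm \<xi>" "norm (\<beta> \<xi>) \<le> norm \<xi>"
    unfolding alpha_pull beta_pull by (rule *; auto simp: inj_on_def)+
qed

lemma norm_funpow_le: fixes T :: opr shows "(\<And>\<xi>. norm (T \<xi>) \<le> norm \<xi>) \<Longrightarrow> norm ((T ^^ n) \<xi>) \<le> norm (\<xi> :: hilb)"
proof (induction n)
  case (Suc n)
  show ?case using Suc.IH[OF Suc.prems] Suc.prems[of "(T ^^ n) \<xi>"] by simp
qed simp

lemma cf_alpha_pow: "cf ((\<alpha> ^^ n) \<xi>) (s, k, m) = cf \<xi> (s, k + n, m)"
  by (induction n arbitrary: k) (auto simp: cf_alpha)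

lemma cf_adj_alpha_pow: "cf ((adj \<alpha> ^^ n) \<xi>) (s, k, m) = (if k \<ge> n then cf \<xi> (s, k - n, m) else 0)"
  by (induction n arbitrary: k) (auto simp: cf_adj_alpha)

lemma cf_beta_pow: "n > 0 \<Longrightarrow> cf ((\<beta> ^^ n) \<xi>) (s, k, m) = (if k = 0 then cf \<xi> (s, 0, m - int n) else 0)"
proof (induction n arbitrary: k m)
  case (Suc n) then show ?case by (cases "n = 0") (auto simp: cf_beta algebra_simps)
qed simp

lemma cf_adj_beta_pow: "n > 0 \<Longrightarrow> cf ((adj \<beta> ^^ n) \<xi>) (s, k, m) = (if k = 0 then cf \<xi> (s, 0, m + int n) else 0)"
proof (induction n arbitrary: k m)
  case (Suc n) then show ?case by (cases "n = 0") (auto simp: cf_adj_beta algebra_simps)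
qed simp

lemma cf_proj_e: "cf (proj_e \<xi>) (s, k, m) = (if k = 0 then cf \<xi> (s, 0, m) else 0)"
  by (simp add: proj_e_def cf_beta cf_adj_beta)

lemma norm_proj_e: "norm (proj_e \<xi>) \<le> norm \<xi>"
  unfolding proj_e_def by (auto intro: order_trans norm_generators)

section \<open>Rapidly decaying families\<close>

text \<open>Rapid decay needs a size on the index set, and a negative power of it that is summable
  turns decay into summability. As the class is closed under products, sites, triples and pairs of
  indices are all covered by the same lemmas.\<close>

class sized =
  fixes sz :: "'a \<Rightarrow> real"
  assumes sz_nonneg [simp]: "0 \<le> sz x"
    and summable_sz: "\<exists>p::nat. (\<lambda>x. 1 / (1 + sz x) ^ p) summable_on UNIV"

instantiation nat :: sized
begin

definition sz_nat :: "nat \<Rightarrow> real" where "sz_nat n = real n"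

instance
proof
  have "summable (\<lambda>n. 1 / (1 + real n) ^ 2)"
    using inverse_power_summable[of 2, where ?'a = real, OF order_refl]
    by (subst (asm) summable_Suc_iff[symmetric]) (simp add: field_simps)
  then have "(\<lambda>x::nat. 1 / (1 + sz x) ^ 2) summable_on UNIV"
    unfolding sz_nat_def by (intro summable_nonneg_imp_summable_on) auto
  then show "\<exists>p::nat. (\<lambda>x::nat. 1 / (1 + sz x) ^ p) summable_on UNIV" ..
qed (simp add: sz_nat_def)

end

instantiation int :: sized
begin

definition sz_int :: "int \<Rightarrow> real" where "sz_int n = \<bar>real_of_int n\<bar>"

instance
proof
  obtain p :: nat where p: "(\<lambda>x::nat. 1 / (1 + sz x) ^ p) summable_on UNIV" using summable_sz by blast
  have inj: "inj (\<lambda>n. - int n)" by (simp add: inj_on_def)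
  have "(\<lambda>x::int. 1 / (1 + sz x) ^ p) summable_on range int"
    using p by (subst summable_on_reindex) (auto simp: o_def sz_int_def sz_nat_def)
  moreover have "(\<lambda>x::int. 1 / (1 + sz x) ^ p) summable_on range (\<lambda>n. - int n)"
    using p by (subst summable_on_reindex[OF inj]) (auto simp: o_def sz_int_def sz_nat_def)
  ultimately have "(\<lambda>x::int. 1 / (1 + sz x) ^ p) summable_on (range int \<union> range (\<lambda>n. - int n))"
    by (rule summable_on_union)
  moreover have "range int \<union> range (\<lambda>n. - int n) = UNIV"
    by (auto simp: image_iff) (metis int_cases2)
  ultimately show "\<exists>p::nat. (\<lambda>x::int. 1 / (1 + sz x) ^ p) summable_on UNIV" by auto
qed (simp add: sz_int_def)

end

instantiation prod :: (sized, sized) sized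
begin

definition sz_prod :: "'a \<times> 'b \<Rightarrow> real" where "sz_prod x = sz (fst x) + sz (snd x)"

instance
proof
  obtain p :: nat where p: "(\<lambda>x::'a. 1 / (1 + sz x) ^ p) summable_on UNIV" using summable_sz by blast
  obtain q :: nat where q: "(\<lambda>x::'b. 1 / (1 + sz x) ^ q) summable_on UNIV" using summable_sz by blast
  have "(\<lambda>(x, y). 1 / (1 + sz x) ^ p * (1 / (1 + sz y) ^ q)) summable_on Sigma (UNIV::'a set) (\<lambda>_. UNIV::'b set)"
  proof (rule summable_on_SigmaI)
    show "((\<lambda>y::'b. case (x, y) of (x, y) \<Rightarrow> 1 / (1 + sz x) ^ p * (1 / (1 + sz y) ^ q)) has_sum
        1 / (1 + sz x) ^ p * (\<Sum>\<^sub>\<infinity>y. 1 / (1 + sz (y::'b)) ^ q)) UNIV" for x :: 'a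
      using has_sum_cmult_right[OF has_sum_infsum[OF q], of "1 / (1 + sz x) ^ p"] by simp
    show "(\<lambda>x::'a. 1 / (1 + sz x) ^ p * (\<Sum>\<^sub>\<infinity>y. 1 / (1 + sz (y::'b)) ^ q)) summable_on UNIV"
      using p by (rule summable_on_cmult_left)
  qed simp
  then have *: "(\<lambda>z::'a \<times> 'b. 1 / (1 + sz (fst z)) ^ p * (1 / (1 + sz (snd z)) ^ q)) summable_on UNIV"
    by (simp add: case_prod_unfold)
  have "(\<lambda>z::'a \<times> 'b. 1 / (1 + sz z) ^ (p + q)) summable_on UNIV"
  proof (rule summable_on_comparison_test[OF *])
    fix z :: "'a \<times> 'b"
    have "(1 + sz (fst z)) ^ p * (1 + sz (snd z)) ^ q \<le> (1 + sz z) ^ p * (1 + sz z) ^ q"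
      by (intro mult_mono power_mono) (auto simp: sz_prod_def)
    moreover have "0 < (1 + sz (fst z)) ^ p * (1 + sz (snd z)) ^ q"
      by (intro mult_pos_pos zero_less_power) (auto simp: add_pos_nonneg)
    ultimately show "1 / (1 + sz z) ^ (p + q) \<le> 1 / (1 + sz (fst z)) ^ p * (1 / (1 + sz (snd z)) ^ q)"
      by (simp add: power_add frac_le)
  qed (auto simp: sz_prod_def)
  then show "\<exists>p::nat. (\<lambda>x::'a \<times> 'b. 1 / (1 + sz x) ^ p) summable_on UNIV" ..
qed (simp add: sz_prod_def)

end

lemma power_sz_pos [simp]: "0 < (1 + sz x) ^ r"
  by (rule zero_less_power) (simp add: add_pos_nonneg)

lemma one_plus_sz_neq_0 [simp]: "1 + sz x \<noteq> 0"
  using sz_nonneg[of x] by linarith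

definition rd :: "('a::sized \<Rightarrow> complex) \<Rightarrow> bool" where
  "rd f \<longleftrightarrow> (\<forall>r. \<exists>C. \<forall>x. cmod (f x) \<le> C / (1 + sz x) ^ r)"

lemma rdI: "(\<And>r. \<exists>C. \<forall>x. cmod (f x) \<le> C / (1 + sz x) ^ r) \<Longrightarrow> rd f"
  by (simp add: rd_def)

lemma rdE:
  assumes "rd f"
  obtains C where "C > 0" "\<And>x. cmod (f x) \<le> C / (1 + sz x) ^ r"
proof -
  obtain C where C: "\<And>x. cmod (f x) \<le> C / (1 + sz x) ^ r" using assms unfolding rd_def by blast
  show ?thesis
  proof (rule that[of "max C 1"])
    show "cmod (f x) \<le> max C 1 / (1 + sz x) ^ r" for x
      using C[of x] by (rule order_trans) (auto intro: divide_right_mono)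
  qed simp
qed

text \<open>A reindexing \<open>h\<close> that does not decrease the size preserves decay, and a
  polynomial factor of degree \<open>q\<close> only uses up \<open>q\<close> of the available
  exponents.\<close>

lemma rd_le:
  assumes g: "rd g" and le: "\<And>x. cmod (f x) \<le> K * (1 + sz x) ^ q * cmod (g (h x))"
    and h: "\<And>x. sz x \<le> sz (h x)" and K: "K \<ge> 0"
  shows "rd f"
proof (rule rdI)
  fix r
  obtain C where C: "C > 0" "\<And>x. cmod (g x) \<le> C / (1 + sz x) ^ (q + r)" using g by (rule rdE) auto
  have "cmod (f x) \<le> K * C / (1 + sz x) ^ r" for x
  proof -
    have "cmod (g (h x)) \<le> C / (1 + sz x) ^ (q + r)"
      using C(2)[of "h x"]
      by (rule order_trans) (use C(1) h[of x] in \<open>auto intro!: divide_left_mono power_mono mult_pos_pos\<close>)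
    then have "K * (1 + sz x) ^ q * cmod (g (h x)) \<le> K * (1 + sz x) ^ q * (C / (1 + sz x) ^ (q + r))"
      using K by (intro mult_left_mono) auto
    also have "\<dots> = K * C / (1 + sz x) ^ r"
      by (simp add: power_add)
    finally show ?thesis using le[of x] by linarith
  qed
  then show "\<exists>C. \<forall>x. cmod (f x) \<le> C / (1 + sz x) ^ r" by blast
qed

lemma rd_poly_mult:
  assumes "rd g" "\<And>x. cmod (p x) \<le> K * (1 + sz x) ^ q" "K \<ge> 0"
  shows "rd (\<lambda>x. p x * g x)"
  by (rule rd_le[OF assms(1), of _ K q id]) (use assms in \<open>auto simp: norm_mult intro!: mult_right_mono\<close>)

lemma rd_mono: "rd g \<Longrightarrow> (\<And>x. cmod (f x) \<le> cmod (g x)) \<Longrightarrow> rd f"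
  by (rule rd_le[of g f 1 0 id]) auto

lemma rd_cmult: "rd g \<Longrightarrow> rd (\<lambda>x. c * g x)"
  by (rule rd_poly_mult[of g _ "cmod c" 0]) auto

lemma rd_add:
  assumes "rd f" "rd g" shows "rd (\<lambda>x. f x + g x)"
proof (rule rdI)
  fix r
  obtain C where C: "\<And>x. cmod (f x) \<le> C / (1 + sz x) ^ r" using assms(1) by (rule rdE) auto
  obtain C' where C': "\<And>x. cmod (g x) \<le> C' / (1 + sz x) ^ r" using assms(2) by (rule rdE) auto
  have "cmod (f x + g x) \<le> (C + C') / (1 + sz x) ^ r" for x
    using norm_triangle_ineq[of "f x" "g x"] C[of x] C'[of x] by (simp add: add_divide_distrib)
  then show "\<exists>C. \<forall>x. cmod (f x + g x) \<le> C / (1 + sz x) ^ r" by blast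
qed

lemma rd_zero [simp]: "rd (\<lambda>x. 0)"
  by (auto simp: rd_def intro!: exI[of _ 0])

lemma rd_abs_summable:
  assumes "rd f" shows "(\<lambda>x. cmod (f x)) summable_on A"
proof -
  obtain p :: nat where p: "(\<lambda>x::'a. 1 / (1 + sz x) ^ p) summable_on UNIV" using summable_sz by blast
  obtain C where C: "\<And>x. cmod (f x) \<le> C / (1 + sz x) ^ p" using assms by (rule rdE) auto
  have "(\<lambda>x. cmod (f x)) summable_on UNIV"
    by (rule Infinite_Sum.abs_summable_on_comparison_test'[OF summable_on_cmult_right[OF p, of C]]) (use C in simp)
  then show ?thesis by (rule summable_on_subset) simp
qed

lemma rd_summable: "rd f \<Longrightarrow> f summable_on A"
  by (rule abs_summable_summable) (rule rd_abs_summable)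

lemma rd_bounded:
  assumes "rd f" obtains C where "C > 0" "\<And>x. cmod (f x) \<le> C"
  using rdE[OF assms, of 0 thesis] by simp

lemma rd_finite_support:
  assumes "finite {x. f x \<noteq> 0}" shows "rd f"
proof (rule rdI)
  fix r
  let ?S = "{x. f x \<noteq> 0}" and ?h = "\<lambda>x. cmod (f x) * (1 + sz x) ^ r"
  have "cmod (f x) \<le> sum ?h ?S / (1 + sz x) ^ r" for x
  proof (cases "f x = 0")
    case False
    then have "?h x \<le> sum ?h ?S" by (intro member_le_sum assms) auto
    then show ?thesis by (simp add: pos_le_divide_eq)
  qed (simp add: sum_nonneg)
  then show "\<exists>C. \<forall>x. cmod (f x) \<le> C / (1 + sz x) ^ r" by blast
qed

section \<open>Convolutions and partial sums of rapidly decaying families\<close>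

definition conv :: "(int \<Rightarrow> complex) \<Rightarrow> (int \<Rightarrow> complex) \<Rightarrow> int \<Rightarrow> complex" where
  "conv c d n = (\<Sum>\<^sub>\<infinity>k. c (n - k) * d k)"

lemma rd_conv_pair:
  assumes "rd c" "rd d" shows "rd (\<lambda>(n::int, k). c (n - k) * d k)"
proof (rule rdI)
  fix r
  obtain C where C: "C > 0" "\<And>x. cmod (c x) \<le> C / (1 + sz x) ^ r" using assms(1) by (rule rdE) auto
  obtain C' where C': "C' > 0" "\<And>x. cmod (d x) \<le> C' / (1 + sz x) ^ (r + r)" using assms(2) by (rule rdE) auto
  have "cmod (c (n - k) * d k) \<le> C * C' / (1 + sz (n, k)) ^ r" for n k
  proof -
    \<comment> \<open>The size is at most |n - k| + 2 |k|, and each occurrence of |k| is paid for by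
      its own factor. This is why \<open>d\<close> is used with the exponent r + r.\<close>
    have "1 + sz (n, k) \<le> (1 + sz (n - k)) * ((1 + sz k) * (1 + sz k))"
    proof -
      have "1 + sz (n, k) \<le> 1 + sz (n - k) + 2 * sz k"
        by (simp add: sz_prod_def sz_int_def)
      also have "\<dots> \<le> (1 + sz (n - k)) * ((1 + sz k) * (1 + sz k))"
        using mult_nonneg_nonneg[OF sz_nonneg sz_nonneg, of "n - k" k]
          mult_nonneg_nonneg[OF sz_nonneg sz_nonneg, of k k]
          mult_nonneg_nonneg[OF mult_nonneg_nonneg[OF sz_nonneg sz_nonneg] sz_nonneg, of "n - k" k k]
        by (simp add: algebra_simps)
      finally show ?thesis .
    qed
    then have "(1 + sz (n, k)) ^ r \<le> (1 + sz (n - k)) ^ r * (1 + sz k) ^ (r + r)"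
      using power_mono[of "1 + sz (n, k)" "(1 + sz (n - k)) * ((1 + sz k) * (1 + sz k))" r]
      by (simp add: power_mult_distrib power_add)
    then have "C * C' / ((1 + sz (n - k)) ^ r * (1 + sz k) ^ (r + r)) \<le> C * C' / (1 + sz (n, k)) ^ r"
      using C(1) C'(1) by (intro divide_left_mono mult_pos_pos) auto
    moreover have "cmod (c (n - k) * d k) \<le> C / (1 + sz (n - k)) ^ r * (C' / (1 + sz k) ^ (r + r))"
      unfolding norm_mult using C C' by (intro mult_mono) (auto intro: order_trans[OF norm_ge_zero])
    ultimately show ?thesis by simp
  qed
  then show "\<exists>C. \<forall>x. cmod (case x of (n, k) \<Rightarrow> c (n - k) * d k) \<le> C / (1 + sz x) ^ r" by auto
qed

lemma infsum_minus:
  fixes f g :: "_ \<Rightarrow> 'b::banach"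
  assumes "f summable_on A" "g summable_on A"
  shows "infsum (\<lambda>x. f x - g x) A = infsum f A - infsum g A"
    and "(\<lambda>x. f x - g x) summable_on A"
  using infsum_add[OF assms(1) summable_on_uminus[THEN iffD2, OF assms(2)]] summable_on_add[OF assms(1) summable_on_uminus[THEN iffD2, OF assms(2)]]
  by (simp_all add: infsum_uminus)

lemma rd_section:
  assumes "rd (\<lambda>(x, y). f x y)" shows "rd (f x)"
  using rd_le[OF assms, of "f x" 1 0 "\<lambda>y. (x, y)"] by (simp add: sz_prod_def)

text \<open>Of the exponent r + p, the part p makes the sum over \<open>y\<close> converge and r
  remains for \<open>x\<close>, since both 1 + sz x and 1 + sz y are at most 1 + sz (x, y).\<close>

lemma rd_infsum:
  fixes f :: "'a::sized \<Rightarrow> 'b::sized \<Rightarrow> complex"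
  assumes "rd (\<lambda>(x, y). f x y)" shows "rd (\<lambda>x. \<Sum>\<^sub>\<infinity>y\<in>A. f x y)"
proof (rule rdI)
  fix r
  obtain p :: nat where p: "(\<lambda>x::'b. 1 / (1 + sz x) ^ p) summable_on UNIV" using summable_sz by blast
  obtain C where C: "C > 0" "\<And>z. cmod (case z of (x, y) \<Rightarrow> f x y) \<le> C / (1 + sz z) ^ (r + p)"
    using assms by (rule rdE) auto
  let ?S = "\<Sum>\<^sub>\<infinity>y\<in>A. 1 / (1 + sz (y::'b)) ^ p"
  have "cmod (\<Sum>\<^sub>\<infinity>y\<in>A. f x y) \<le> C * ?S / (1 + sz x) ^ r" for x
  proof (rule norm_infsum_le[OF has_sum_infsum])
    show "f x summable_on A" using rd_section[OF assms] by (rule rd_summable)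
    have p': "(\<lambda>x::'b. 1 / (1 + sz x) ^ p) summable_on A" using p by (rule summable_on_subset) simp
    have "((\<lambda>y::'b. C / (1 + sz x) ^ r * (1 / (1 + sz y) ^ p)) has_sum C / (1 + sz x) ^ r * ?S) A"
      by (intro has_sum_cmult_right has_sum_infsum p')
    then show "((\<lambda>y::'b. C / (1 + sz x) ^ r * (1 / (1 + sz y) ^ p)) has_sum C * ?S / (1 + sz x) ^ r) A"
      by simp
    fix y :: 'b
    have "(1 + sz x) ^ r * (1 + sz y) ^ p \<le> (1 + sz (x, y)) ^ r * (1 + sz (x, y)) ^ p"
      by (intro mult_mono power_mono) (auto simp: sz_prod_def)
    then have "C / (1 + sz (x, y)) ^ (r + p) \<le> C / ((1 + sz x) ^ r * (1 + sz y) ^ p)"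
      using C(1) by (intro divide_left_mono mult_pos_pos) (auto simp: power_add)
    then show "norm (f x y) \<le> C / (1 + sz x) ^ r * (1 / (1 + sz y) ^ p)"
      using C(2)[of "(x, y)"] by simp
  qed
  then show "\<exists>C. \<forall>x. cmod (\<Sum>\<^sub>\<infinity>y\<in>A. f x y) \<le> C / (1 + sz x) ^ r" by blast
qed

lemma rd_conv: "rd c \<Longrightarrow> rd d \<Longrightarrow> rd (conv c d)"
  unfolding conv_def[abs_def] by (rule rd_infsum, rule rd_conv_pair)

section \<open>Trigonometric series\<close>

definition trig :: "(int \<Rightarrow> complex) \<Rightarrow> real \<Rightarrow> complex" where
  "trig c t = (\<Sum>\<^sub>\<infinity>n. c n * cis (of_int n * t))"

lemma trig_abs_summable: "rd c \<Longrightarrow> (\<lambda>n. cmod (c n * cis (of_int n * t))) summable_on A"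
  using rd_abs_summable[of c A] by (simp add: norm_mult)

lemma trig_summable: "rd c \<Longrightarrow> (\<lambda>n. c n * cis (of_int n * t)) summable_on A"
  by (rule abs_summable_summable) (rule trig_abs_summable)

lemma trig_add: "rd c \<Longrightarrow> rd d \<Longrightarrow> trig (\<lambda>n. c n + d n) t = trig c t + trig d t"
  unfolding trig_def by (simp add: ring_distribs infsum_add trig_summable)

lemma trig_cmult: "trig (\<lambda>n. a * c n) t = a * trig c t"
  unfolding trig_def by (simp add: mult.assoc infsum_cmult_right')

lemma trig_finite: "(\<And>n. n \<notin> F \<Longrightarrow> c n = 0) \<Longrightarrow> finite F \<Longrightarrow> trig c t = (\<Sum>n\<in>F. c n * cis (of_int n * t))"
  unfolding trig_def infsum_finite[symmetric] by (rule infsum_cong_neutral) auto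

lemma trig_mult:
  assumes "rd c" "rd d" shows "trig c t * trig d t = trig (conv c d) t"
proof -
  let ?e = "\<lambda>n::int. cis (of_int n * t)"
  have s: "(\<lambda>(n, k). c (n - k) * d k * ?e n) summable_on UNIV \<times> UNIV"
    using rd_conv_pair[OF assms]
    by (intro abs_summable_summable[OF rd_abs_summable], elim rd_mono) (auto simp: norm_mult)
  have "trig (conv c d) t = (\<Sum>\<^sub>\<infinity>n. \<Sum>\<^sub>\<infinity>k. c (n - k) * d k * ?e n)"
    unfolding trig_def conv_def by (simp add: infsum_cmult_left')
  also have "\<dots> = (\<Sum>\<^sub>\<infinity>k. \<Sum>\<^sub>\<infinity>n. c (n - k) * d k * ?e n)"
    by (rule infsum_swap_banach[OF s])
  also have "\<dots> = (\<Sum>\<^sub>\<infinity>k. \<Sum>\<^sub>\<infinity>n. c n * ?e n * (d k * ?e k))"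
  proof (rule infsum_cong)
    fix k
    have e: "?e n = ?e (n - k) * ?e k" for n by (simp add: cis_mult algebra_simps)
    have "(\<Sum>\<^sub>\<infinity>n. c (n - k) * d k * ?e n) = (\<Sum>\<^sub>\<infinity>n. c (n - k) * ?e (n - k) * (d k * ?e k))"
    proof (rule infsum_cong)
      fix n show "c (n - k) * d k * ?e n = c (n - k) * ?e (n - k) * (d k * ?e k)"
        using e[of n] by simp
    qed
    also have "\<dots> = (\<Sum>\<^sub>\<infinity>n. c n * ?e n * (d k * ?e k))"
      by (rule infsum_reindex_bij_witness[of _ "\<lambda>n. n + k" "\<lambda>n. n - k"]) auto
    finally show "(\<Sum>\<^sub>\<infinity>n. c (n - k) * d k * ?e n) = (\<Sum>\<^sub>\<infinity>n. c n * ?e n * (d k * ?e k))" .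
  qed
  also have "\<dots> = trig c t * trig d t"
    unfolding trig_def by (simp only: infsum_cmult_left' infsum_cmult_right')
  finally show ?thesis ..
qed

lemma norm_trig_le:
  assumes "rd c" shows "cmod (trig c t) \<le> (\<Sum>\<^sub>\<infinity>n. cmod (c n))"
  unfolding trig_def
  using norm_infsum_bound[OF trig_abs_summable[OF assms, of t UNIV]] by (simp add: norm_mult)

lemma rd_deriv: "rd c \<Longrightarrow> rd (\<lambda>n. (\<i> * of_int n) ^ p * c n)"
  by (rule rd_poly_mult[of c _ 1 p]) (auto simp: norm_mult norm_power sz_int_def intro: power_mono)

lemma rd_deriv1: "rd c \<Longrightarrow> rd (\<lambda>n. \<i> * of_int n * c n)"
  using rd_deriv[of c 1] by simp

text \<open>The second order Taylor remainder of the n-th term is at most |c n| n^2 h^2, and these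
  majorants are summable. The difference quotient is thus estimated directly.\<close>

lemma trig_has_vector_derivative:
  assumes c: "rd c"
  shows "(trig c has_vector_derivative trig (\<lambda>n. \<i> * of_int n * c n) t) (at t)"
proof -
  let ?c' = "\<lambda>n. \<i> * of_int n * c n"
  let ?C = "\<Sum>\<^sub>\<infinity>n. cmod (c n) * sz n ^ 2"
  have rd2: "(\<lambda>n. cmod (c n) * sz n ^ 2) summable_on UNIV"
    using rd_abs_summable[OF rd_deriv[OF c, of 2], of UNIV]
    by (simp add: norm_mult norm_power sz_int_def mult.commute)
  have bound: "cmod (trig c (t + h) - trig c t - h *\<^sub>R trig ?c' t) \<le> ?C * h ^ 2" for h
  proof -
    have "trig c (t + h) - trig c t - h *\<^sub>R trig ?c' t =
      (\<Sum>\<^sub>\<infinity>n. c n * cis (of_int n * (t + h)) - c n * cis (of_int n * t) - of_real h * (?c' n * cis (of_int n * t)))"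
      unfolding trig_def scaleR_conv_of_real infsum_cmult_right'[symmetric]
      by (simp only: infsum_minus trig_summable[OF c] trig_summable[OF rd_deriv1[OF c]] summable_on_cmult_right)
    also have "cmod \<dots> \<le> ?C * h ^ 2"
    proof (rule norm_infsum_le[OF has_sum_infsum])
      show "(\<lambda>n. c n * cis (of_int n * (t + h)) - c n * cis (of_int n * t) - of_real h * (?c' n * cis (of_int n * t))) summable_on UNIV"
        by (intro infsum_minus(2) summable_on_cmult_right trig_summable rd_deriv1 c)
      show "((\<lambda>n. cmod (c n) * sz n ^ 2 * h ^ 2) has_sum ?C * h ^ 2) UNIV"
        by (intro has_sum_cmult_left has_sum_infsum rd2)
      fix n
      have "c n * cis (of_int n * (t + h)) - c n * cis (of_int n * t) - of_real h * (?c' n * cis (of_int n * t))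
        = c n * cis (of_int n * t) * (exp (\<i> * of_real (of_int n * h)) - (\<Sum>i\<le>1. (\<i> * of_real (of_int n * h)) ^ i / fact i))"
      proof -
        have "exp (\<i> * of_real (of_int n * h)) = cis (of_int n * h)" by (simp only: cis_conv_exp)
        moreover have "cis (of_int n * (t + h)) = cis (of_int n * t) * cis (of_int n * h)"
          by (simp add: cis_mult algebra_simps)
        ultimately show ?thesis by (simp add: algebra_simps)
      qed
      also have "cmod \<dots> = cmod (c n) * cmod (exp (\<i> * of_real (of_int n * h)) - (\<Sum>i\<le>1. (\<i> * of_real (of_int n * h)) ^ i / fact i))"
        by (simp add: norm_mult)
      also have "\<dots> \<le> cmod (c n) * (exp \<bar>Re (\<i> * of_real (of_int n * h))\<bar> * cmod (\<i> * of_real (of_int n * h)) ^ Suc 1 / fact 1)"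
        by (intro mult_left_mono Taylor_exp) auto
      also have "\<dots> = cmod (c n) * sz n ^ 2 * h ^ 2"
        by (simp add: norm_mult sz_int_def abs_mult power_mult_distrib power2_eq_square[symmetric])
      finally show "cmod (c n * cis (of_int n * (t + h)) - c n * cis (of_int n * t) - of_real h * (?c' n * cis (of_int n * t)))
        \<le> cmod (c n) * sz n ^ 2 * h ^ 2" .
    qed
    finally show ?thesis .
  qed
  show ?thesis
    unfolding has_vector_derivative_def has_derivative_at
  proof (intro conjI)
    show "bounded_linear (\<lambda>x. x *\<^sub>R trig ?c' t)" by (rule bounded_linear_scaleR_left)
    show "(\<lambda>h. cmod (trig c (t + h) - trig c t - h *\<^sub>R trig ?c' t) / norm h) \<midarrow>0\<rightarrow> 0"
    proof (rule Lim_null_comparison)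
      show "\<forall>\<^sub>F h in at 0. norm (cmod (trig c (t + h) - trig c t - h *\<^sub>R trig ?c' t) / norm h) \<le> ?C * \<bar>h\<bar>"
      proof (rule eventuallyI)
        fix h :: real
        show "norm (cmod (trig c (t + h) - trig c t - h *\<^sub>R trig ?c' t) / norm h) \<le> ?C * \<bar>h\<bar>"
          using bound[of h] by (cases "h = 0") (auto simp: divide_le_eq power2_eq_square mult.assoc)
      qed
      have "((\<lambda>h. ?C * \<bar>h\<bar>) \<longlongrightarrow> ?C * \<bar>0\<bar>) (at (0::real))" by (intro tendsto_intros)
      then show "((\<lambda>h. ?C * \<bar>h\<bar>) \<longlongrightarrow> 0) (at (0::real))" by simp
    qed
  qed
qed

lemma ddt_trig: "rd c \<Longrightarrow> ddt (trig c) = trig (\<lambda>n. \<i> * of_int n * c n)"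
  unfolding ddt_def by (intro ext vector_derivative_at trig_has_vector_derivative)

lemma ddt_pow_trig: "rd c \<Longrightarrow> (ddt ^^ p) (trig c) = trig (\<lambda>n. (\<i> * of_int n) ^ p * c n)"
  by (induction p) (auto simp: ddt_trig rd_deriv mult.assoc[symmetric])

lemma continuous_trig: "rd c \<Longrightarrow> continuous_on A (trig c)"
  by (intro continuous_at_imp_continuous_on ballI
      has_vector_derivative_continuous[OF trig_has_vector_derivative])

lemma trig_periodic: "trig c (t + 2 * pi) = trig c t"
proof -
  have "cis (of_int n * (t + 2 * pi)) = cis (of_int n * t)" for n
    by (simp add: ring_distribs cis_mult[symmetric] cis_multiple_2pi mult.commute[of _ "2 * pi"] mult.left_commute)
  then show ?thesis by (simp add: trig_def)
qed

lemma trig_smooth: "rd c \<Longrightarrow> trig c \<in> smooth_circle"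
  unfolding smooth_circle_def
  by (auto simp: trig_periodic ddt_pow_trig intro: differentiableI_vector[OF trig_has_vector_derivative[OF rd_deriv]])

lemma circle_integral_deriv:
  assumes "\<And>t. (f has_vector_derivative f' t) (at t)" "f (2 * pi) = f 0"
  shows "circle_integral f' = 0"
proof -
  have "(f' has_integral (f (2 * pi) - f 0)) {0..2 * pi}"
    by (rule fundamental_theorem_of_calculus) (auto intro: has_vector_derivative_at_within assms)
  then show ?thesis using assms(2) by (simp add: circle_integral_def integral_unique)
qed

text \<open>Dividing the coefficients with n \<noteq> 0 by i n gives a periodic primitive of all but
  the constant term, so the fundamental theorem of calculus takes the place of an exchange of sum
  and integral.\<close>

lemma circle_integral_trig:
  assumes c: "rd c" shows "circle_integral (trig c) = of_real (2 * pi) * c 0"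
proof -
  let ?d = "\<lambda>n. (if n = 0 then 0 else 1 / (\<i> * of_int n)) * c n"
  have d: "rd ?d"
    by (rule rd_mono[OF c]) (auto simp: norm_mult norm_divide divide_le_eq mult_le_cancel_left1
      simp flip: of_int_abs)
  let ?z = "\<lambda>n::int. if n = 0 then c 0 else 0"
  have z: "rd ?z" by (rule rd_finite_support) auto
  have "trig c t = trig (\<lambda>n. \<i> * of_int n * ?d n) t + c 0" for t
  proof -
    have "trig c t = trig (\<lambda>n. \<i> * of_int n * ?d n + ?z n) t"
      by (rule arg_cong2[of _ _ _ _ trig]) auto
    also have "\<dots> = trig (\<lambda>n. \<i> * of_int n * ?d n) t + trig ?z t"
      by (rule trig_add[OF rd_deriv1[OF d] z])
    also have "trig ?z t = c 0" by (subst trig_finite[of "{0}"]) auto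
    finally show ?thesis .
  qed
  then have "trig c = (\<lambda>t. trig (\<lambda>n. \<i> * of_int n * ?d n) t + c 0)" by blast
  then have "circle_integral (trig c) = circle_integral (trig (\<lambda>n. \<i> * of_int n * ?d n)) + circle_integral (\<lambda>_. c 0)"
    unfolding circle_integral_def
    by (simp only:) (intro integral_add integrable_continuous_real continuous_trig rd_deriv1 d continuous_on_const)
  also have "circle_integral (trig (\<lambda>n. \<i> * of_int n * ?d n)) = 0"
    by (rule circle_integral_deriv[OF trig_has_vector_derivative[OF d]]) (use trig_periodic[of ?d 0] in simp)
  finally show ?thesis by (simp add: circle_integral_def scaleR_conv_of_real)
qed

text \<open>The exponential cis (- n t) is itself a trigonometric series with one coefficient, so
  the integral is the zeroth coefficient of a convolution.\<close>

lemma fourier_trig: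
  assumes c: "rd c" shows "fourier (trig c) = c"
proof
  fix n
  let ?u = "\<lambda>k::int. if k = - n then 1 else 0 :: complex"
  have u: "rd ?u" by (rule rd_finite_support) auto
  have "trig ?u t = cis (- (of_int n * t))" for t
    by (subst trig_finite[of "{- n}"]) auto
  then have "trig c t * cis (- (of_int n * t)) = trig (conv c ?u) t" for t
    using trig_mult[OF c u, of t] by simp
  moreover have "conv c ?u 0 = (\<Sum>\<^sub>\<infinity>k\<in>{- n}. c (0 - k))"
    unfolding conv_def by (rule infsum_cong_neutral) auto
  ultimately show "fourier (trig c) n = c n"
    using circle_integral_trig[OF rd_conv[OF c u]] by (simp add: fourier_def cong: if_cong)
qed

section \<open>Trigonometric polynomials and Fourier coefficients of smooth functions\<close>

inductive trig_poly :: "(real \<Rightarrow> complex) \<Rightarrow> bool" where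
  monom: "trig_poly (\<lambda>t. c * cis (of_int n * t))"
| add: "trig_poly f \<Longrightarrow> trig_poly g \<Longrightarrow> trig_poly (\<lambda>t. f t + g t)"

lemma trig_poly_mult: "trig_poly f \<Longrightarrow> trig_poly g \<Longrightarrow> trig_poly (\<lambda>t. f t * g t)"
proof (induction f rule: trig_poly.induct)
  case (monom c n)
  from monom show ?case
  proof (induction g rule: trig_poly.induct)
    case (monom c' n')
    have "(\<lambda>t. c * cis (of_int n * t) * (c' * cis (of_int n' * t))) = (\<lambda>t. (c * c') * cis (of_int (n + n') * t))"
      by (auto simp: cis_mult[symmetric] ring_distribs)
    then show ?case by (simp only: trig_poly.monom)
  next
    case (add f g)
    then show ?case using trig_poly.add by (simp add: ring_distribs)
  qed
next
  case (add f g)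
  then show ?case using trig_poly.add by (simp add: ring_distribs)
qed

lemma trig_poly_const: "trig_poly (\<lambda>t. c)"
  using trig_poly.monom[of c 0] by simp

text \<open>Cosine and sine are combinations of cis t and cis (- t), so a real linear functional of
  cis t is a trigonometric polynomial. This makes the Stone-Weierstrass theorem on the unit circle
  in the plane a statement about trigonometric approximation.\<close>

lemma trig_poly_real_polynomial:
  assumes "real_polynomial_function p" shows "trig_poly (\<lambda>t. of_real (p (cis t)))"
  using assms
proof induction
  case (linear f)
  interpret bounded_linear f by fact
  have fc: "f (cis t) = cos t * f 1 + sin t * f \<i>" for t
  proof -
    have "cis t = cos t *\<^sub>R 1 + sin t *\<^sub>R \<i>" by (simp add: complex_eq_iff)
    then show ?thesis by (simp only: add scale) simp
  qed
  have cs: "complex_of_real (cos t) = (cis t + cis (- t)) / 2"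
    "complex_of_real (sin t) = - \<i> / 2 * (cis t - cis (- t))" for t
    by (simp_all add: complex_eq_iff)
  have "(\<lambda>t. complex_of_real (f (cis t))) = (\<lambda>t. (f 1 / 2 - \<i> * f \<i> / 2) * cis (of_int 1 * t)
      + (f 1 / 2 + \<i> * f \<i> / 2) * cis (of_int (- 1) * t))"
    by (intro ext, simp only: fc of_real_add of_real_mult cs) (simp add: field_simps)
  then show ?case by (simp only: trig_poly.intros)
next
  case (const c) then show ?case by (rule trig_poly_const)
next
  case (add f g) then show ?case using trig_poly.add by simp
next
  case (mult f g) then show ?case using trig_poly_mult by simp
qed

lemma trig_poly_polynomial:
  fixes p :: "complex \<Rightarrow> complex"
  assumes "polynomial_function p" shows "trig_poly (\<lambda>t. p (cis t))"
proof -
  have "real_polynomial_function (Re \<circ> p)" "real_polynomial_function (Im \<circ> p)"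
    using assms unfolding polynomial_function_def by (auto intro: bounded_linear_Re bounded_linear_Im)
  then have "trig_poly (\<lambda>t. of_real ((Re \<circ> p) (cis t)) + \<i> * of_real ((Im \<circ> p) (cis t)))"
    by (intro trig_poly.add trig_poly_mult trig_poly_const trig_poly_real_polynomial)
  then show ?thesis by (simp add: complex_eq[symmetric])
qed

lemma periodic_int:
  assumes "\<And>t. f (t + 2 * pi) = f t"
  shows "f (t + 2 * pi * of_int n) = f t"
proof -
  have *: "f (t + 2 * pi * of_nat k) = f t" for k t
  proof (induction k)
    case (Suc k)
    then show ?case using assms[of "t + 2 * pi * of_nat k"] by (simp add: algebra_simps)
  qed simp
  show ?thesis
  proof (cases "n \<ge> 0")
    case True
    then show ?thesis using *[of t "nat n"] by simp
  next
    case False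
    then show ?thesis using *[of "t + 2 * pi * of_int n" "nat (- n)"] by simp
  qed
qed

lemma periodic_cis:
  assumes "\<And>t. f (t + 2 * pi) = f t" "cis s = cis t"
  shows "f s = f t"
proof -
  have "cos s = cos t" "sin s = sin t" using assms(2) by (auto simp: complex_eq_iff)
  then obtain n where "s = t + 2 * pi * of_int n" using sin_cos_eq_iff by (metis mult.assoc mult.commute)
  then show ?thesis using periodic_int[of f, OF assms(1)] by simp
qed

text \<open>Only the cut of \<open>Arg\<close> along the negative axis is at issue. Near it
  \<open>Arg (- z) + pi\<close> is a continuous choice of the angle, and by periodicity
  \<open>f\<close> does not see the difference.\<close>

lemma continuous_on_circle:
  assumes per: "\<And>t. f (t + 2 * pi) = f t" and cont: "continuous_on UNIV f"
  shows "continuous_on (sphere 0 1) (\<lambda>z. f (Arg z))"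
proof (rule continuous_at_imp_continuous_on, rule ballI)
  fix z :: complex assume z: "z \<in> sphere 0 1"
  then have z0: "z \<noteq> 0" by auto
  have cA: "isCont f t" for t using cont by (simp add: continuous_on_eq_continuous_at)
  have cis_Arg': "cis (Arg w) = sgn w" if "w \<noteq> 0" for w using cis_Arg[OF that] .
  show "isCont (\<lambda>z. f (Arg z)) z"
  proof (cases "z \<in> \<real>\<^sub>\<le>\<^sub>0")
    case False
    then show ?thesis by (intro isCont_o2[OF continuous_at_Arg cA])
  next
    case True
    then have nz: "- z \<notin> \<real>\<^sub>\<le>\<^sub>0" using z0 by (auto simp: complex_nonpos_Reals_iff complex_eq_iff)
    have "isCont (\<lambda>z. Arg (- z)) z"
      using continuous_at_Arg[OF nz] by (intro isCont_o2[of z uminus Arg]) auto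
    then have "isCont (\<lambda>z. Arg (- z) + pi) z" by (intro continuous_intros)
    then have c: "isCont (\<lambda>z. f (Arg (- z) + pi)) z" using cA by (rule isCont_o2)
    have "f (Arg (- w) + pi) = f (Arg w)" if "w \<noteq> 0" for w
    proof (rule periodic_cis[of f, OF per])
      have "cis (Arg (- w) + pi) = - cis (Arg (- w))" by (simp add: cis_mult[symmetric])
      then show "cis (Arg (- w) + pi) = cis (Arg w)" using that by (simp add: cis_Arg' sgn_minus)
    qed
    then have "\<forall>\<^sub>F w in nhds z. f (Arg (- w) + pi) = f (Arg w)"
      using z0 by (auto intro!: eventually_mono[OF t1_space_nhds[OF z0]])
    from isCont_cong[OF this] show ?thesis using c by simp
  qed
qed

lemma smooth_circleD:
  assumes "f \<in> smooth_circle"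
  shows "(f has_vector_derivative ddt f t) (at t)" "ddt f \<in> smooth_circle" "f (t + 2 * pi) = f t"
    "continuous_on A f"
proof -
  have p: "f (t + 2 * pi) = f t" and d: "(ddt ^^ p) f differentiable (at t)" for t p
    using assms by (auto simp: smooth_circle_def)
  show v: "(f has_vector_derivative ddt f t) (at t)" for t
    using d[of 0 t] by (simp add: ddt_def vector_derivative_works)
  show "f (t + 2 * pi) = f t" by (rule p)
  show "continuous_on A f"
    using v by (intro continuous_at_imp_continuous_on ballI has_vector_derivative_continuous)
  have "ddt f (t + 2 * pi) = ddt f t" for t
  proof -
    have "((f \<circ> (\<lambda>t. t + 2 * pi)) has_vector_derivative (1 *\<^sub>R ddt f (t + 2 * pi))) (at t)"
      by (rule vector_diff_chain_at) (auto intro!: derivative_eq_intros v)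
    then have "(f has_vector_derivative ddt f (t + 2 * pi)) (at t)" by (simp add: o_def p)
    then show ?thesis using v vector_derivative_unique_at by blast
  qed
  moreover have "(ddt ^^ p) (ddt f) differentiable (at t)" for t p
    using d[of "Suc p" t] by (simp add: funpow_swap1)
  ultimately show "ddt f \<in> smooth_circle" by (simp add: smooth_circle_def)
qed

lemma circle_integrable:
  "continuous_on UNIV f \<Longrightarrow> f integrable_on {0..2 * pi}" for f :: "real \<Rightarrow> complex"
  by (rule integrable_continuous_real) (rule continuous_on_subset, auto)

lemma circle_integral_add:
  "continuous_on UNIV f \<Longrightarrow> continuous_on UNIV g \<Longrightarrow>
    circle_integral (\<lambda>t. f t + g t) = circle_integral f + circle_integral g"
  unfolding circle_integral_def by (intro integral_add circle_integrable)

lemma circle_integral_diff: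
  "continuous_on UNIV f \<Longrightarrow> continuous_on UNIV g \<Longrightarrow>
    circle_integral (\<lambda>t. f t - g t) = circle_integral f - circle_integral g"
  unfolding circle_integral_def by (intro integral_diff circle_integrable)

lemma circle_integral_cmult: "circle_integral (\<lambda>t. c * f t) = c * circle_integral f"
  unfolding circle_integral_def by (rule integral_mult_right)

lemma norm_circle_integral_le:
  assumes "continuous_on UNIV f" "\<And>t. cmod (f t) \<le> B"
  shows "cmod (circle_integral f) \<le> 2 * pi * B"
proof -
  have "cmod (integral (cbox 0 (2 * pi)) f) \<le> B * measure lborel (cbox 0 (2 * pi))"
    by (rule integrable_bound) (use assms circle_integrable[OF assms(1)] in \<open>auto intro: order_trans[OF norm_ge_zero]\<close>)
  then show ?thesis by (simp add: circle_integral_def mult.commute)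
qed

lemma fourier_ddt:
  assumes f: "f \<in> smooth_circle"
  shows "fourier (ddt f) n = \<i> * of_int n * fourier f n"
proof -
  let ?e = "\<lambda>t. cis (- (of_int n * t))"
  have e: "(?e has_vector_derivative (- (\<i> * of_int n) * ?e t)) (at t)" for t
  proof -
    have "((\<lambda>t. exp (\<i> * (of_real t * - of_int n))) has_vector_derivative (- (\<i> * of_int n) * exp (\<i> * (of_real t * - of_int n)))) (at t)"
      by (auto intro!: derivative_eq_intros has_vector_derivative_real_field)
    then show ?thesis by (simp add: cis_conv_exp mult.commute)
  qed
  have ce: "continuous_on UNIV ?e" by (intro continuous_intros)
  have "circle_integral (\<lambda>t. f t * (- (\<i> * of_int n) * ?e t) + ddt f t * ?e t) = 0"
  proof (rule circle_integral_deriv[where f = "\<lambda>t. f t * ?e t"])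
    show "((\<lambda>t. f t * ?e t) has_vector_derivative f t * (- (\<i> * of_int n) * ?e t) + ddt f t * ?e t) (at t)" for t
      by (rule has_vector_derivative_mult[OF smooth_circleD(1)[OF f] e])
    have "?e (2 * pi) = ?e 0"
      using cis_multiple_2pi[of "- of_int n"] by (simp add: mult.commute mult.left_commute)
    then show "f (2 * pi) * ?e (2 * pi) = f 0 * ?e 0" using smooth_circleD(3)[OF f, of 0] by simp
  qed
  moreover have "(\<lambda>t. f t * (- (\<i> * of_int n) * ?e t) + ddt f t * ?e t)
      = (\<lambda>t. ddt f t * ?e t - (\<i> * of_int n) * (f t * ?e t))"
    by (simp add: algebra_simps)
  moreover have "circle_integral (\<lambda>t. ddt f t * ?e t - (\<i> * of_int n) * (f t * ?e t))
      = circle_integral (\<lambda>t. ddt f t * ?e t) - circle_integral (\<lambda>t. (\<i> * of_int n) * (f t * ?e t))"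
    by (intro circle_integral_diff continuous_on_mult continuous_on_const ce smooth_circleD f)
  ultimately have "circle_integral (\<lambda>t. (\<i> * of_int n) * (f t * ?e t)) = circle_integral (\<lambda>t. ddt f t * ?e t)"
    by (simp only: right_minus_eq)
  then show ?thesis by (simp add: fourier_def circle_integral_cmult)
qed

lemma fourier_ddt_pow:
  assumes "f \<in> smooth_circle"
  shows "(ddt ^^ p) f \<in> smooth_circle" "fourier ((ddt ^^ p) f) n = (\<i> * of_int n) ^ p * fourier f n"
  using assms by (induction p) (auto simp: smooth_circleD fourier_ddt)

lemma norm_fourier_le:
  assumes f: "f \<in> smooth_circle" and B: "\<And>t. cmod (f t) \<le> B"
  shows "cmod (fourier f n) \<le> B"
proof -
  have "cmod (circle_integral (\<lambda>t. f t * cis (- (real_of_int n * t)))) \<le> 2 * pi * B"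
    by (rule norm_circle_integral_le)
       (auto intro!: continuous_intros smooth_circleD(4)[OF f] simp: norm_mult intro: B)
  then show ?thesis by (simp add: fourier_def norm_mult norm_divide field_simps)
qed

text \<open>The p-th derivative multiplies the coefficient by (i n)^p, and 1 + |n| \<le> 2 |n| for n
  \<noteq> 0, whence the factor 2^p. For n = 0 derivatives give nothing, and the bound on
  \<open>f\<close> itself is used.\<close>

lemma fourier_decay:
  assumes f: "f \<in> smooth_circle" and B: "\<And>t. cmod ((ddt ^^ p) f t) \<le> B" "\<And>t. cmod (f t) \<le> B"
  shows "cmod (fourier f n) * (1 + sz n) ^ p \<le> 2 ^ p * B"
proof (cases "n = 0")
  case True
  then show ?thesis
    using norm_fourier_le[OF f B(2), of 0] mult_mono[of 1 "2 ^ p" "cmod (fourier f 0)" B]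
    by (simp add: sz_int_def)
next
  case False
  then have "1 + sz n \<le> 2 * sz n"
    unfolding sz_int_def of_int_abs[symmetric] by linarith
  then have "cmod (fourier f n) * (1 + sz n) ^ p \<le> cmod (fourier f n) * (2 * sz n) ^ p"
    by (intro mult_left_mono power_mono) auto
  also have "\<dots> = 2 ^ p * cmod (fourier ((ddt ^^ p) f) n)"
    by (simp add: fourier_ddt_pow[OF f] norm_mult norm_power sz_int_def power_mult_distrib)
  also have "\<dots> \<le> 2 ^ p * B"
    by (intro mult_left_mono norm_fourier_le fourier_ddt_pow f B) auto
  finally show ?thesis .
qed

lemma smooth_bounded:
  assumes f: "f \<in> smooth_circle" shows "\<exists>B. \<forall>t. cmod (f t) \<le> B"
proof -
  have "compact (f ` {- pi..pi})" by (intro compact_continuous_image smooth_circleD(4)[OF f] compact_Icc)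
  from compact_imp_bounded[OF this] obtain B where B: "\<forall>y\<in>f ` {- pi..pi}. cmod y \<le> B"
    unfolding bounded_iff ..
  have "cmod (f t) \<le> B" for t
  proof -
    have "cis (Arg (cis t)) = cis t" using cis_Arg[of "cis t"] by simp
    then have "f t = f (Arg (cis t))" by (intro periodic_cis[of f, OF smooth_circleD(3)[OF f]]) simp
    then show ?thesis using bspec[OF B imageI, of "Arg (cis t)"] Arg_bounded[of "cis t"] by simp
  qed
  then show ?thesis by (intro exI allI)
qed

lemma rd_fourier:
  assumes f: "f \<in> smooth_circle" shows "rd (fourier f)"
proof (rule rdI)
  fix r
  obtain B where B: "\<And>t. cmod (f t) \<le> B" using smooth_bounded[OF f] by blast
  obtain B' where B': "\<And>t. cmod ((ddt ^^ r) f t) \<le> B'"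
    using smooth_bounded[OF fourier_ddt_pow(1)[OF f, of r]] by blast
  have "cmod (fourier f n) * (1 + sz n) ^ r \<le> 2 ^ r * max B B'" for n
    by (rule fourier_decay[OF f]) (use B B' in \<open>auto simp: le_max_iff_disj\<close>)
  then show "\<exists>C. \<forall>x. cmod (fourier f x) \<le> C / (1 + sz x) ^ r"
    by (auto simp: pos_le_divide_eq)
qed

text \<open>A trigonometric polynomial integrates to 0 against \<open>f\<close>. Approximating the
  conjugate of \<open>f\<close> uniformly by such polynomials gives that the integral of |f|^2 is 0,
  and continuity finishes.\<close>

lemma fourier_zero_imp_zero:
  assumes f: "f \<in> smooth_circle" and z: "\<And>n. fourier f n = 0"
  shows "f t = 0"
proof -
  have cf: "continuous_on UNIV f" by (rule smooth_circleD(4)[OF f])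
  obtain B where B: "\<And>t. cmod (f t) \<le> B" using smooth_bounded[OF f] by blast
  have B0: "B \<ge> 0" using order_trans[OF norm_ge_zero B] .
  have tp: "circle_integral (\<lambda>t. q t * f t) = 0 \<and> continuous_on UNIV q" if "trig_poly q" for q
    using that
  proof induction
    case (monom c n)
    have "circle_integral (\<lambda>t. f t * cis (- (of_int (- n) * t))) = 0" using z[of "- n"] by (simp add: fourier_def)
    then show ?case
      using circle_integral_cmult[of c "\<lambda>t. f t * cis (- (of_int (- n) * t))"]
      by (auto simp: mult_ac intro!: continuous_intros)
  next
    case (add p q)
    then show ?case
      using circle_integral_add[of "\<lambda>t. p t * f t" "\<lambda>t. q t * f t"]
      by (simp add: ring_distribs continuous_on_mult continuous_on_add cf)
  qed
  let ?I = "circle_integral (\<lambda>t. cnj (f t) * f t)"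
  have small: "cmod ?I \<le> 2 * pi * (e * B)" if e: "e > 0" for e
  proof -
    have "continuous_on (sphere 0 1) (\<lambda>z. cnj (f (Arg z)))"
      by (intro continuous_intros continuous_on_circle[of f] smooth_circleD(3)[OF f] cf)
    then obtain g where g: "polynomial_function g" "\<And>z. z \<in> sphere 0 1 \<Longrightarrow> cmod (cnj (f (Arg z)) - g z) < e"
      using Stone_Weierstrass_polynomial_function[OF compact_sphere _ e, of 0 1 "\<lambda>z. cnj (f (Arg z))"] by auto
    have le: "cmod (cnj (f t) - g (cis t)) \<le> e" for t
    proof -
      have "cis (Arg (cis t)) = cis t" using cis_Arg[of "cis t"] by simp
      then have "f t = f (Arg (cis t))" by (intro periodic_cis[of f, OF smooth_circleD(3)[OF f]]) simp
      then show ?thesis using g(2)[of "cis t"] by simp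
    qed
    note tg = tp[OF trig_poly_polynomial[OF g(1)]]
    have "?I = circle_integral (\<lambda>t. (cnj (f t) - g (cis t)) * f t + g (cis t) * f t)"
      by (simp add: algebra_simps)
    also have "\<dots> = circle_integral (\<lambda>t. (cnj (f t) - g (cis t)) * f t)"
      using tg by (subst circle_integral_add) (auto intro!: continuous_on_mult continuous_on_diff continuous_on_cnj cf)
    also have "cmod \<dots> \<le> 2 * pi * (e * B)"
    proof (rule norm_circle_integral_le)
      show "continuous_on UNIV (\<lambda>t. (cnj (f t) - g (cis t)) * f t)"
        using tg by (intro continuous_on_mult continuous_on_diff continuous_on_cnj cf) blast
      show "cmod ((cnj (f t) - g (cis t)) * f t) \<le> e * B" for t
        unfolding norm_mult using e by (intro mult_mono le B) auto
    qed
    finally show ?thesis .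
  qed
  have I0: "?I = 0"
  proof (rule ccontr)
    assume "?I \<noteq> 0"
    then have p: "cmod ?I > 0" by simp
    have aux: "2 * pi * (X / (4 * pi * c) * B) = X * (B / c) / 2" if "c \<noteq> 0" for X c
      using that by (simp add: field_simps)
    \<comment> \<open>This choice of e yields at most half of |I|, a contradiction; B + 1 instead of
      B keeps the denominator positive.\<close>
    have "cmod ?I \<le> 2 * pi * (cmod ?I / (4 * pi * (B + 1)) * B)" using p B0 by (intro small) auto
    also have "\<dots> = cmod ?I * (B / (B + 1)) / 2" by (rule aux) (use B0 in simp)
    also have "\<dots> \<le> cmod ?I * 1 / 2" using B0 p by (intro divide_right_mono mult_left_mono) auto
    finally show False using p by simp
  qed
  have "f t = 0" if t: "t \<in> {0..2 * pi}" for t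
  proof -
    let ?u = "\<lambda>t. (cmod (f t))\<^sup>2"
    have cu: "continuous_on UNIV ?u" by (intro continuous_intros cf)
    have "(\<lambda>t. cnj (f t) * f t) integrable_on {0..2 * pi}"
      by (intro circle_integrable continuous_on_mult continuous_on_cnj cf)
    then have i0: "((\<lambda>t. cnj (f t) * f t) has_integral 0) {0..2 * pi}"
      using I0 unfolding circle_integral_def has_integral_iff by blast
    have "complex_of_real (?u t) = cnj (f t) * f t" for t
      by (subst mult.commute) (rule complex_norm_square)
    then have "((\<lambda>t. complex_of_real (?u t)) has_integral 0) {0..2 * pi}"
      using i0 by (simp only:)
    from has_integral_Re[OF this] have "(?u has_integral 0) {0..2 * pi}"
      by (simp only: Re_complex_of_real zero_complex.simps)
    then have "?u t = 0"
      using has_integral_0_cbox_imp_0[of 0 "2 * pi" ?u t] continuous_on_subset[OF cu subset_UNIV] t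
      by (simp add: not_le)
    then show ?thesis by simp
  qed
  \<comment> \<open>The vanishing is known on [0, 2 pi], so the representative of a general angle is
    taken from \<open>Arg2pi\<close>.\<close>
  moreover have "cis t = of_real (cmod (cis t)) * exp (\<i> * of_real (Arg2pi (cis t)))"
    using Arg2pi[of "cis t"] unfolding is_Arg_def by blast
  then have "cis (Arg2pi (cis t)) = cis t"
    unfolding norm_cis of_real_1 mult_1_left cis_conv_exp[symmetric] by (rule sym)
  then have "f t = f (Arg2pi (cis t))" by (intro periodic_cis[of f, OF smooth_circleD(3)[OF f]]) simp
  ultimately show ?thesis using Arg2pi[of "cis t"] by (auto simp: less_imp_le)
qed

lemma trig_fourier:
  assumes f: "f \<in> smooth_circle" shows "trig (fourier f) = f"
proof
  fix t
  let ?g = "trig (fourier f)"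
  note rf = rd_fourier[OF f]
  have gs: "?g \<in> smooth_circle" by (rule trig_smooth[OF rf])
  have d: "(ddt ^^ p) (\<lambda>t. ?g t - f t) = (\<lambda>t. (ddt ^^ p) ?g t - (ddt ^^ p) f t)" for p
  proof (induction p)
    case (Suc p)
    have "((\<lambda>t. (ddt ^^ p) ?g t - (ddt ^^ p) f t) has_vector_derivative
        (ddt ((ddt ^^ p) ?g) t - ddt ((ddt ^^ p) f) t)) (at t)" for t
      by (intro has_vector_derivative_diff smooth_circleD fourier_ddt_pow f gs)
    then show ?case unfolding funpow.simps o_def Suc by (intro ext) (simp add: ddt_def[of "\<lambda>t. _ t - _ t"] vector_derivative_at)
  qed simp
  have s: "(\<lambda>t. ?g t - f t) \<in> smooth_circle"
    unfolding smooth_circle_def mem_Collect_eq d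
  proof (intro conjI allI differentiable_diff)
    show "(ddt ^^ p) ?g differentiable at t" "(ddt ^^ p) f differentiable at t" for p t
      using gs f by (simp_all add: smooth_circle_def)
  qed (simp only: smooth_circleD(3)[OF f] smooth_circleD(3)[OF gs])
  have "fourier (\<lambda>t. ?g t - f t) n = 0" for n
  proof -
    have "circle_integral (\<lambda>t. ?g t * cis (- (real_of_int n * t)) - f t * cis (- (real_of_int n * t)))
      = circle_integral (\<lambda>t. ?g t * cis (- (real_of_int n * t))) - circle_integral (\<lambda>t. f t * cis (- (real_of_int n * t)))"
      by (intro circle_integral_diff continuous_intros smooth_circleD(4) f gs)
    then have "fourier (\<lambda>t. ?g t - f t) n = fourier ?g n - fourier f n"
      by (simp add: fourier_def ring_distribs)
    then show ?thesis by (simp add: fourier_trig[OF rf])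
  qed
  from fourier_zero_imp_zero[OF s this, of t] show "?g t = f t" by simp
qed

section \<open>Sums over the transversal lattice\<close>

definition ydist :: "nat \<times> int \<Rightarrow> nat \<times> int \<Rightarrow> real" where
  "ydist y z = \<bar>real (fst y) - real (fst z)\<bar> + \<bar>real_of_int (snd y) - real_of_int (snd z)\<bar>"

lemma ydist_nonneg [simp]: "0 \<le> ydist y z"
  by (simp add: ydist_def)

lemma ydist_commute: "ydist y z = ydist z y"
  by (simp add: ydist_def)

lemma power_ydist_pos [simp]: "0 < (1 + ydist y z) ^ r"
  by (rule zero_less_power) (simp add: add_pos_nonneg)

text \<open>Taking differences with \<open>y\<close> embeds the half-lattice into pairs of integers,
  and every such sum is part of one fixed convergent sum there.\<close>

lemma ydist_sum_ex:
  "\<exists>(p::nat) S. \<forall>y. (\<lambda>z. 1 / (1 + ydist y z) ^ p) summable_on UNIV \<and> (\<Sum>\<^sub>\<infinity>z. 1 / (1 + ydist y z) ^ p) \<le> S"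
proof -
  obtain p :: nat where p: "(\<lambda>x::int \<times> int. 1 / (1 + sz x) ^ p) summable_on UNIV" using summable_sz by blast
  have "(\<lambda>z. 1 / (1 + ydist y z) ^ p) summable_on UNIV \<and>
    (\<Sum>\<^sub>\<infinity>z. 1 / (1 + ydist y z) ^ p) \<le> (\<Sum>\<^sub>\<infinity>x::int \<times> int. 1 / (1 + sz x) ^ p)" for y
  proof -
    let ?h = "\<lambda>z::nat \<times> int. (int (fst y) - int (fst z), snd y - snd z)"
    have inj: "inj ?h" by (auto simp: inj_on_def prod_eq_iff)
    have e: "(\<lambda>z. 1 / (1 + ydist y z) ^ p) = (\<lambda>x. 1 / (1 + sz x) ^ p) \<circ> ?h"
      by (rule ext) (simp add: ydist_def sz_prod_def sz_int_def)
    have s: "(\<lambda>x::int \<times> int. 1 / (1 + sz x) ^ p) summable_on range ?h" using p by (rule summable_on_subset) simp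
    show ?thesis
      unfolding e summable_on_reindex[OF inj, symmetric] infsum_reindex[OF inj, symmetric]
      using s infsum_mono2[OF s p] by simp
  qed
  then show ?thesis by blast
qed

text \<open>By translation invariance the sums over \<open>z\<close> are bounded uniformly in \<open>y\<close>, see \<open>ydist_sum\<close>.\<close>
definition p0 :: nat where
  "p0 = (SOME p. \<exists>S. \<forall>y. (\<lambda>z. 1 / (1 + ydist y z) ^ p) summable_on UNIV \<and> (\<Sum>\<^sub>\<infinity>z. 1 / (1 + ydist y z) ^ p) \<le> S)"

definition S0 :: real where
  "S0 = (SOME S. \<forall>y. (\<lambda>z. 1 / (1 + ydist y z) ^ p0) summable_on UNIV \<and> (\<Sum>\<^sub>\<infinity>z. 1 / (1 + ydist y z) ^ p0) \<le> S)"

lemma ydist_sum: "(\<lambda>z. 1 / (1 + ydist y z) ^ p0) summable_on UNIV" "(\<Sum>\<^sub>\<infinity>z. 1 / (1 + ydist y z) ^ p0) \<le> S0"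
proof -
  have "\<exists>S. \<forall>y. (\<lambda>z. 1 / (1 + ydist y z) ^ p0) summable_on UNIV \<and> (\<Sum>\<^sub>\<infinity>z. 1 / (1 + ydist y z) ^ p0) \<le> S"
    unfolding p0_def by (rule someI_ex) (rule ydist_sum_ex)
  then have "\<forall>y. (\<lambda>z. 1 / (1 + ydist y z) ^ p0) summable_on UNIV \<and> (\<Sum>\<^sub>\<infinity>z. 1 / (1 + ydist y z) ^ p0) \<le> S0"
    unfolding S0_def by (rule someI_ex)
  then show "(\<lambda>z. 1 / (1 + ydist y z) ^ p0) summable_on UNIV" "(\<Sum>\<^sub>\<infinity>z. 1 / (1 + ydist y z) ^ p0) \<le> S0" by blast+
qed

lemma S0_nonneg: "0 \<le> S0"
  by (rule order_trans[OF infsum_nonneg ydist_sum(2)[of "(0, 0)"]]) simp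

lemma ydist_estimate:
  fixes g :: "nat \<times> int \<Rightarrow> complex"
  assumes g: "\<And>z. cmod (g z) \<le> B / (1 + ydist y z) ^ p0" and B: "B \<ge> 0"
  shows "(\<lambda>z. cmod (g z)) summable_on UNIV" "g summable_on UNIV" "cmod (infsum g UNIV) \<le> B * S0"
    "(\<Sum>\<^sub>\<infinity>z. cmod (g z)) \<le> B * S0"
proof -
  have sB: "(\<lambda>z. B * (1 / (1 + ydist y z) ^ p0)) summable_on UNIV"
    by (rule summable_on_cmult_right[OF ydist_sum(1)])
  show s: "(\<lambda>z. cmod (g z)) summable_on UNIV"
    by (rule Infinite_Sum.abs_summable_on_comparison_test'[OF sB]) (use g in simp)
  show "g summable_on UNIV" by (rule abs_summable_summable[OF s])
  have "(\<Sum>\<^sub>\<infinity>z. cmod (g z)) \<le> (\<Sum>\<^sub>\<infinity>z. B * (1 / (1 + ydist y z) ^ p0))"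
    by (rule infsum_mono[OF s sB]) (use g in simp)
  also have "\<dots> = B * (\<Sum>\<^sub>\<infinity>z. 1 / (1 + ydist y z) ^ p0)" by (rule infsum_cmult_right')
  also have "\<dots> \<le> B * S0" by (intro mult_left_mono ydist_sum B)
  finally show "(\<Sum>\<^sub>\<infinity>z. cmod (g z)) \<le> B * S0" .
  with norm_infsum_bound[OF s] show "cmod (infsum g UNIV) \<le> B * S0" by linarith
qed

lemma power_frac_le: "0 \<le> C \<Longrightarrow> 0 < a \<Longrightarrow> a \<le> b \<Longrightarrow> C / b ^ r \<le> C / (a::real) ^ r"
  by (intro divide_left_mono power_mono mult_pos_pos zero_less_power) auto

section \<open>Toeplitz matrices with a sign, modulo rapidly decaying matrices\<close>

definition sg :: "nat \<Rightarrow> int \<Rightarrow> complex" where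
  "sg s m = (if s = 0 \<and> m \<ge> 0 then 1 else - 1)"

lemma norm_sg [simp]: "cmod (sg s m) = 1"
  by (simp add: sg_def)

type_synonym mat = "nat \<Rightarrow> nat \<times> int \<Rightarrow> nat \<times> int \<Rightarrow> complex"

text \<open>The power \<open>j\<close> counts the commutators with \<open>D\<close>, each of which contributes a sign of \<open>D\<close>.\<close>
definition toep :: "nat \<Rightarrow> (int \<Rightarrow> complex) \<Rightarrow> mat" where
  "toep j u s y z = (if snd y = snd z then sg s (snd y) ^ j * u (int (fst y) - int (fst z)) else 0)"

text \<open>In contrast to \<open>ydist\<close> the first coordinates are added, not subtracted:
  decay in \<open>esz\<close> means being concentrated near the edge k = 0, while in the second
  coordinate it only means being near the diagonal.\<close>

definition esz :: "nat \<times> int \<Rightarrow> nat \<times> int \<Rightarrow> real" where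
  "esz y z = real (fst y) + real (fst z) + \<bar>real_of_int (snd y) - real_of_int (snd z)\<bar>"

text \<open>This plays the role of the Toeplitz algebra modulo smoothing operators, with the
  constants uniform in \<open>s\<close>. The error is not small along m, only along k.\<close>

definition toeplitz_mod :: "nat \<Rightarrow> (int \<Rightarrow> complex) \<Rightarrow> mat \<Rightarrow> bool" where
  "toeplitz_mod j u M \<longleftrightarrow> rd u \<and> (\<forall>r. \<exists>C. \<forall>s y z. cmod (M s y z - toep j u s y z) \<le> C / (1 + esz y z) ^ r)"

lemma ydist_le_esz: "ydist y z \<le> esz y z"
  by (auto simp: ydist_def esz_def)

lemma esz_nonneg [simp]: "0 \<le> esz y z"
  by (simp add: esz_def)

lemma power_esz_pos [simp]: "0 < (1 + esz y z) ^ r"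
  by (rule zero_less_power) (simp add: add_pos_nonneg)

lemma toeplitz_modE:
  assumes "toeplitz_mod j u M"
  obtains C where "C > 0" "\<And>s y z. cmod (M s y z - toep j u s y z) \<le> C / (1 + esz y z) ^ r"
proof -
  obtain C where C: "\<And>s y z. cmod (M s y z - toep j u s y z) \<le> C / (1 + esz y z) ^ r"
    using assms unfolding toeplitz_mod_def by blast
  show ?thesis
  proof (rule that[of "max C 1"])
    show "cmod (M s y z - toep j u s y z) \<le> max C 1 / (1 + esz y z) ^ r" for s y z
      using C[of s y z] by (rule order_trans) (auto intro: divide_right_mono less_imp_le)
  qed simp
qed

lemma toep_bound:
  assumes "rd u"
  obtains C where "C > 0" "\<And>s y z. cmod (toep j u s y z) \<le> C / (1 + ydist y z) ^ r"
proof -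
  obtain C where C: "C > 0" "\<And>x. cmod (u x) \<le> C / (1 + sz x) ^ r" using assms by (rule rdE) auto
  have "cmod (toep j u s y z) \<le> C / (1 + ydist y z) ^ r" for s y z
    using C(1) C(2)[of "int (fst y) - int (fst z)"]
    by (auto simp: toep_def norm_mult norm_power ydist_def sz_int_def intro: less_imp_le)
  with C(1) that show ?thesis by blast
qed

lemma toeplitz_mod_bound:
  assumes M: "toeplitz_mod j u M"
  obtains C where "C > 0" "\<And>s y z. cmod (M s y z) \<le> C / (1 + ydist y z) ^ r"
proof -
  obtain C where C: "C > 0" "\<And>s y z. cmod (M s y z - toep j u s y z) \<le> C / (1 + esz y z) ^ r"
    using M by (rule toeplitz_modE) auto
  obtain C' where C': "C' > 0" "\<And>s y z. cmod (toep j u s y z) \<le> C' / (1 + ydist y z) ^ r"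
    using M unfolding toeplitz_mod_def by (metis toep_bound)
  have "cmod (M s y z) \<le> (C + C') / (1 + ydist y z) ^ r" for s y z
  proof -
    have "cmod (M s y z) \<le> cmod (M s y z - toep j u s y z) + cmod (toep j u s y z)"
      using norm_triangle_ineq[of "M s y z - toep j u s y z" "toep j u s y z"] by simp
    moreover have "C / (1 + esz y z) ^ r \<le> C / (1 + ydist y z) ^ r"
      using C(1) ydist_le_esz[of y z] by (intro power_frac_le) (auto simp: add_pos_nonneg)
    ultimately show ?thesis using C(2)[of s y z] C'(2)[of s y z] by (simp add: add_divide_distrib)
  qed
  with C(1) C'(1) that[of "C + C'"] show ?thesis by simp
qed

definition mat_mult :: "mat \<Rightarrow> mat \<Rightarrow> mat" where
  "mat_mult M M' s y z = (\<Sum>\<^sub>\<infinity>w. M s y w * M' s w z)"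

text \<open>The sum over the half-line is the full convolution minus the terms with intermediate
  index n < 0. There |k - n| = k + |n| and |n - l| = l + |n|, so this Hankel part decays in k and l.
  The signs multiply because both factors preserve m.\<close>

lemma toep_mult:
  assumes u: "rd u" and u': "rd u'"
  shows "\<exists>C. \<forall>s y z. cmod ((\<Sum>\<^sub>\<infinity>w. toep j u s y w * toep j' u' s w z) - toep (j + j') (conv u u') s y z)
    \<le> C / (1 + esz y z) ^ r"
proof -
  obtain p :: nat where p: "(\<lambda>x::int. 1 / (1 + sz x) ^ p) summable_on UNIV" using summable_sz by blast
  obtain C where C: "C > 0" "\<And>x. cmod (u x) \<le> C / (1 + sz x) ^ (r + p)" using u by (rule rdE) auto
  obtain C' where C': "C' > 0" "\<And>x. cmod (u' x) \<le> C' / (1 + sz x) ^ r" using u' by (rule rdE) auto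
  let ?S = "\<Sum>\<^sub>\<infinity>n\<in>{..<0::int}. 1 / (1 + sz n) ^ p"
  have "cmod ((\<Sum>\<^sub>\<infinity>w. toep j u s y w * toep j' u' s w z) - toep (j + j') (conv u u') s y z)
      \<le> C * C' * ?S / (1 + esz y z) ^ r" for s y z
  proof (cases "snd y = snd z")
    case False
    then have "(\<lambda>w. toep j u s y w * toep j' u' s w z) = (\<lambda>w. 0)" by (auto simp: toep_def)
    moreover have "?S \<ge> 0" by (intro infsum_nonneg) (simp add: less_imp_le)
    ultimately show ?thesis using False C(1) C'(1) by (simp add: toep_def)
  next
    case True
    obtain k l m where y: "y = (k, m)" and z: "z = (l, m)" using True by (metis prod.collapse)
    let ?a = "\<lambda>n::int. u (int k - n) * u' (n - int l)"
    let ?b = "\<lambda>i::int. u (int k - int l - i) * u' i"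
    have rdb: "?b summable_on UNIV"
      using rd_section[OF rd_conv_pair[OF u u'], of "int k - int l"] by (rule rd_summable)
    have "(?a summable_on UNIV) = (?b summable_on UNIV)"
      by (rule summable_on_reindex_bij_witness[of _ "\<lambda>i. i + int l" "\<lambda>n. n - int l"]) (auto simp: algebra_simps)
    then have a: "?a summable_on A" for A using rdb summable_on_subset by blast
    have "conv u u' (int k - int l) = infsum ?a UNIV"
      unfolding conv_def
      by (rule infsum_reindex_bij_witness[of _ "\<lambda>n. n - int l" "\<lambda>i. i + int l"]) (auto simp: algebra_simps)
    also have "\<dots> = infsum ?a {0..} + infsum ?a {..<0}"
      by (subst infsum_Un_disjoint[symmetric]) (auto intro: a arg_cong[where f = "infsum ?a"])
    also have "infsum ?a {0..} = (\<Sum>\<^sub>\<infinity>i. u (int k - int i) * u' (int i - int l))"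
      by (rule infsum_reindex_bij_witness[of _ int nat]) auto
    finally have conv: "conv u u' (int k - int l) = (\<Sum>\<^sub>\<infinity>i. u (int k - int i) * u' (int i - int l)) + infsum ?a {..<0}" .
    have "(\<Sum>\<^sub>\<infinity>w. toep j u s y w * toep j' u' s w z) =
      (\<Sum>\<^sub>\<infinity>w\<in>range (\<lambda>i. (i, m)). toep j u s y w * toep j' u' s w z)"
      by (rule infsum_cong_neutral) (auto simp: toep_def y z)
    also have "\<dots> = (\<Sum>\<^sub>\<infinity>i. sg s m ^ (j + j') * (u (int k - int i) * u' (int i - int l)))"
      by (subst infsum_reindex) (auto simp: inj_on_def o_def toep_def y z power_add mult_ac)
    also have "\<dots> = sg s m ^ (j + j') * (\<Sum>\<^sub>\<infinity>i. u (int k - int i) * u' (int i - int l))"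
      by (rule infsum_cmult_right')
    finally have "(\<Sum>\<^sub>\<infinity>w. toep j u s y w * toep j' u' s w z) - toep (j + j') (conv u u') s y z
      = - (sg s m ^ (j + j') * infsum ?a {..<0})"
      using conv by (simp add: toep_def y z ring_distribs)
    also have "cmod \<dots> = cmod (infsum ?a {..<0})" by (simp add: norm_mult norm_power)
    also have "\<dots> \<le> C * C' / (1 + esz y z) ^ r * ?S"
    proof (rule norm_infsum_le[OF has_sum_infsum[OF a]])
      have "(\<lambda>n::int. 1 / (1 + sz n) ^ p) summable_on {..<0}" using p by (rule summable_on_subset) simp
      from has_sum_cmult_right[OF has_sum_infsum[OF this]]
      show "((\<lambda>n::int. C * C' / (1 + esz y z) ^ r * (1 / (1 + sz n) ^ p)) has_sum C * C' / (1 + esz y z) ^ r * ?S) {..<0}" .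
      fix n :: int assume n: "n \<in> {..<0}"
      have s1: "sz (int k - n) = real k + sz n" "sz (n - int l) = real l + sz n" using n by (auto simp: sz_int_def)
      have "(1 + esz y z) ^ r * (1 + sz n) ^ p \<le> ((1 + sz (int k - n)) * (1 + sz (n - int l))) ^ r * (1 + sz (int k - n)) ^ p"
      proof (intro mult_mono power_mono)
        show "1 + esz y z \<le> (1 + sz (int k - n)) * (1 + sz (n - int l))"
          unfolding s1 using sz_nonneg[of n] by (simp add: esz_def y z algebra_simps)
      qed (auto simp: s1)
      also have "\<dots> = (1 + sz (int k - n)) ^ (r + p) * (1 + sz (n - int l)) ^ r"
        by (simp add: power_mult_distrib power_add)
      finally have "C * C' / ((1 + sz (int k - n)) ^ (r + p) * (1 + sz (n - int l)) ^ r)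
          \<le> C * C' / ((1 + esz y z) ^ r * (1 + sz n) ^ p)"
        using C(1) C'(1) by (intro divide_left_mono mult_pos_pos) auto
      moreover have "cmod (?a n) \<le> C / (1 + sz (int k - n)) ^ (r + p) * (C' / (1 + sz (n - int l)) ^ r)"
        unfolding norm_mult using C(1) by (intro mult_mono C C') (auto intro: less_imp_le)
      ultimately show "cmod (?a n) \<le> C * C' / (1 + esz y z) ^ r * (1 / (1 + sz n) ^ p)" by simp
    qed
    finally show ?thesis by (simp add: mult.commute mult.left_commute)
  qed
  then show ?thesis by blast
qed

lemma one_plus_mult_le:
  fixes a b c :: real
  assumes "0 \<le> a" "0 \<le> b" "c \<le> a + b" shows "1 + c \<le> (1 + a) * (1 + b)"
  using mult_nonneg_nonneg[OF assms(1,2)] assms(3) by (simp add: distrib_left distrib_right)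

lemma ydist_triangle: "ydist y z \<le> ydist y w + ydist w z"
  by (simp add: ydist_def)

lemma esz_triangle: "esz y z \<le> esz y w + ydist w z" "esz y z \<le> ydist y w + esz w z"
  by (auto simp: ydist_def esz_def)

lemma mult_bound:
  fixes x y :: complex
  assumes "cmod x \<le> C / a" "cmod y \<le> C' / b" "c \<le> a * b" "C > 0" "C' > 0" "a > 0" "b > 0" "c > 0"
  shows "cmod (x * y) \<le> C * C' / c"
proof -
  have "cmod (x * y) \<le> C / a * (C' / b)"
    unfolding norm_mult using assms by (intro mult_mono) (auto intro: less_imp_le)
  also have "\<dots> \<le> C * C' / c" using assms by (simp add: frac_le)
  finally show ?thesis .
qed

text \<open>Write M M' = E M' + T E' + T T' with Toeplitz parts T, T' and errors E, E'. By the
  triangle inequalities between \<open>esz\<close> and \<open>ydist\<close>, a factor decaying off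
  the diagonal carries the \<open>esz\<close> decay of the error to the end points; an extra p0
  powers make the sum over the intermediate point converge.\<close>

lemma toeplitz_mod_mult:
  assumes M: "toeplitz_mod j u M" and M': "toeplitz_mod j' u' M'"
  shows "toeplitz_mod (j + j') (conv u u') (mat_mult M M')"
    and "(\<lambda>w. M s y w * M' s w z) summable_on UNIV"
proof -
  have u: "rd u" "rd u'" using M M' by (auto simp: toeplitz_mod_def)
  define E where "E = (\<lambda>s y z. M s y z - toep j u s y z)"
  define E' where "E' = (\<lambda>s y z. M' s y z - toep j' u' s y z)"
  have EM: "\<exists>C>0. \<forall>s y z w. cmod (E s y w * M' s w z) \<le> C / (1 + esz y z) ^ r / (1 + ydist y w) ^ p0" for r
  proof -
    obtain C where C: "C > 0" "\<And>s y z. cmod (E s y z) \<le> C / (1 + esz y z) ^ (r + p0)"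
      using M unfolding E_def by (rule toeplitz_modE) auto
    obtain C' where C': "C' > 0" "\<And>s y z. cmod (M' s y z) \<le> C' / (1 + ydist y z) ^ r"
      using M' by (rule toeplitz_mod_bound) auto
    have "cmod (E s y w * M' s w z) \<le> C * C' / ((1 + esz y z) ^ r * (1 + ydist y w) ^ p0)" for s y z w
    proof (rule mult_bound[OF C(2) C'(2)])
      have "(1 + esz y z) ^ r * (1 + ydist y w) ^ p0 \<le> ((1 + esz y w) * (1 + ydist w z)) ^ r * (1 + esz y w) ^ p0"
        using esz_triangle(1)[of y z w] ydist_le_esz[of y w]
        by (intro mult_mono power_mono one_plus_mult_le) (auto simp: add_nonneg_nonneg)
      then show "(1 + esz y z) ^ r * (1 + ydist y w) ^ p0 \<le> (1 + esz y w) ^ (r + p0) * (1 + ydist w z) ^ r"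
        by (simp add: power_mult_distrib power_add mult_ac)
    qed (use C(1) C'(1) in auto)
    then show ?thesis using C(1) C'(1) by (intro exI[of _ "C * C'"]) (simp add: mult.assoc)
  qed
  have TE: "\<exists>C>0. \<forall>s y z w. cmod (toep j u s y w * E' s w z) \<le> C / (1 + esz y z) ^ r / (1 + ydist z w) ^ p0" for r
  proof -
    obtain C where C: "C > 0" "\<And>s y z. cmod (toep j u s y z) \<le> C / (1 + ydist y z) ^ r"
      using u(1) by (rule toep_bound) auto
    obtain C' where C': "C' > 0" "\<And>s y z. cmod (E' s y z) \<le> C' / (1 + esz y z) ^ (r + p0)"
      using M' unfolding E'_def by (rule toeplitz_modE) auto
    have "cmod (toep j u s y w * E' s w z) \<le> C * C' / ((1 + esz y z) ^ r * (1 + ydist z w) ^ p0)" for s y z w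
      unfolding ydist_commute[of z w]
    proof (rule mult_bound[OF C(2) C'(2)])
      have "(1 + esz y z) ^ r * (1 + ydist w z) ^ p0 \<le> ((1 + ydist y w) * (1 + esz w z)) ^ r * (1 + esz w z) ^ p0"
        using esz_triangle(2)[of y z w] ydist_le_esz[of w z]
        by (intro mult_mono power_mono one_plus_mult_le) (auto simp: add_nonneg_nonneg)
      then show "(1 + esz y z) ^ r * (1 + ydist w z) ^ p0 \<le> (1 + ydist y w) ^ r * (1 + esz w z) ^ (r + p0)"
        by (simp add: power_mult_distrib power_add mult_ac)
    qed (use C(1) C'(1) in auto)
    then show ?thesis using C(1) C'(1)
      by (intro exI[of _ "C * C'"]) (simp add: mult.assoc)
  qed
  have TT: "(\<lambda>w. toep j u s y w * toep j' u' s w z) summable_on UNIV" for s y z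
  proof -
    obtain C where C: "C > 0" "\<And>s y z. cmod (toep j u s y z) \<le> C / (1 + ydist y z) ^ p0"
      using u(1) by (rule toep_bound) auto
    obtain C' where C': "C' > 0" "\<And>s y z. cmod (toep j' u' s y z) \<le> C' / (1 + ydist y z) ^ 0"
      by (rule toep_bound[OF u(2), where r = 0 and j = j']) blast
    show ?thesis
      by (rule ydist_estimate(2)[of _ "C * C'" y])
         (use C(1) C'(1) in \<open>auto intro: mult_bound[OF C(2) C'(2)]\<close>)
  qed
  have split: "M s y w * M' s w z = E s y w * M' s w z + toep j u s y w * E' s w z
      + toep j u s y w * toep j' u' s w z" for s y z w
    by (simp add: E_def E'_def algebra_simps)
  have sEM: "(\<lambda>w. E s y w * M' s w z) summable_on UNIV" for s y z
  proof -
    obtain C where C: "C > 0" "\<And>s y z w. cmod (E s y w * M' s w z) \<le> C / (1 + esz y z) ^ 0 / (1 + ydist y w) ^ p0"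
      using EM[of 0] by blast
    show ?thesis by (rule ydist_estimate(2)[of _ C y]) (use C in auto)
  qed
  have sTE: "(\<lambda>w. toep j u s y w * E' s w z) summable_on UNIV" for s y z
  proof -
    obtain C where C: "C > 0" "\<And>s y z w. cmod (toep j u s y w * E' s w z) \<le> C / (1 + esz y z) ^ 0 / (1 + ydist z w) ^ p0"
      using TE[of 0] by blast
    show ?thesis by (rule ydist_estimate(2)[of _ C z]) (use C in auto)
  qed
  show "(\<lambda>w. M s y w * M' s w z) summable_on UNIV"
    unfolding split by (intro summable_on_add sEM sTE TT)
  have mm: "mat_mult M M' s y z = (\<Sum>\<^sub>\<infinity>w. E s y w * M' s w z) + (\<Sum>\<^sub>\<infinity>w. toep j u s y w * E' s w z)
      + (\<Sum>\<^sub>\<infinity>w. toep j u s y w * toep j' u' s w z)" for s y z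
    unfolding mat_mult_def split
    by (simp add: infsum_add summable_on_add sEM sTE TT)
  show "toeplitz_mod (j + j') (conv u u') (mat_mult M M')"
    unfolding toeplitz_mod_def
  proof (intro conjI allI)
    show "rd (conv u u')" by (rule rd_conv[OF u])
    fix r
    obtain C1 where C1: "C1 > 0" "\<And>s y z w. cmod (E s y w * M' s w z) \<le> C1 / (1 + esz y z) ^ r / (1 + ydist y w) ^ p0"
      using EM[of r] by blast
    obtain C2 where C2: "C2 > 0" "\<And>s y z w. cmod (toep j u s y w * E' s w z) \<le> C2 / (1 + esz y z) ^ r / (1 + ydist z w) ^ p0"
      using TE[of r] by blast
    obtain C3 where C3: "\<And>s y z. cmod ((\<Sum>\<^sub>\<infinity>w. toep j u s y w * toep j' u' s w z) - toep (j + j') (conv u u') s y z)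
        \<le> C3 / (1 + esz y z) ^ r"
      using toep_mult[OF u, of j j' r] by blast
    have "cmod (mat_mult M M' s y z - toep (j + j') (conv u u') s y z) \<le> (C1 * S0 + C2 * S0 + C3) / (1 + esz y z) ^ r" for s y z
    proof -
      have 1: "cmod (\<Sum>\<^sub>\<infinity>w. E s y w * M' s w z) \<le> C1 / (1 + esz y z) ^ r * S0"
        by (rule ydist_estimate(3)[OF C1(2)]) (use C1(1) in \<open>simp add: less_imp_le\<close>)
      have 2: "cmod (\<Sum>\<^sub>\<infinity>w. toep j u s y w * E' s w z) \<le> C2 / (1 + esz y z) ^ r * S0"
        by (rule ydist_estimate(3)[OF C2(2)]) (use C2(1) in \<open>simp add: less_imp_le\<close>)
      have "mat_mult M M' s y z - toep (j + j') (conv u u') s y z = (\<Sum>\<^sub>\<infinity>w. E s y w * M' s w z)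
        + (\<Sum>\<^sub>\<infinity>w. toep j u s y w * E' s w z)
        + ((\<Sum>\<^sub>\<infinity>w. toep j u s y w * toep j' u' s w z) - toep (j + j') (conv u u') s y z)"
        unfolding mm by simp
      also have "cmod \<dots> \<le> C1 / (1 + esz y z) ^ r * S0 + C2 / (1 + esz y z) ^ r * S0 + C3 / (1 + esz y z) ^ r"
        by (intro norm_triangle_mono 1 2 C3)
      finally show ?thesis by (simp add: add_divide_distrib)
    qed
    then show "\<exists>C. \<forall>s y z. cmod (mat_mult M M' s y z - toep (j + j') (conv u u') s y z) \<le> C / (1 + esz y z) ^ r"
      by blast
  qed
qed

section \<open>Elements of the algebra as kernels\<close>

text \<open>\<open>toep 0\<close> carries no sign, so the kernel does not depend on \<open>s\<close>
  and is invariant under common translations of the second coordinates.\<close>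

definition ker :: "(nat \<Rightarrow> nat \<Rightarrow> int \<Rightarrow> complex) \<Rightarrow> (int \<Rightarrow> complex) \<Rightarrow> mat" where
  "ker c t s y z = c (fst y) (fst z) (snd y - snd z) + toep 0 t s y z"

definition rd3 :: "(nat \<Rightarrow> nat \<Rightarrow> int \<Rightarrow> complex) \<Rightarrow> bool" where
  "rd3 c \<longleftrightarrow> rd (\<lambda>(k, l, n). c k l n)"

lemma sz_triple: "sz (k :: nat, l :: nat, n :: int) = real k + real l + \<bar>real_of_int n\<bar>"
  by (simp add: sz_prod_def sz_nat_def sz_int_def)

lemma toeplitz_mod_ker: "rd3 c \<Longrightarrow> rd t \<Longrightarrow> toeplitz_mod 0 t (ker c t)"
proof -
  assume c: "rd3 c" and t: "rd t"
  have "\<exists>C. \<forall>s y z. cmod (ker c t s y z - toep 0 t s y z) \<le> C / (1 + esz y z) ^ r" for r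
  proof -
    obtain C where C: "\<And>x. cmod (case x of (k, l, n) \<Rightarrow> c k l n) \<le> C / (1 + sz x) ^ r"
      using c unfolding rd3_def by (rule rdE) auto
    have "cmod (ker c t s y z - toep 0 t s y z) \<le> C / (1 + esz y z) ^ r" for s y z
      using C[of "(fst y, fst z, snd y - snd z)"] by (simp add: ker_def sz_triple esz_def)
    then show ?thesis by blast
  qed
  then show ?thesis using t by (simp add: toeplitz_mod_def)
qed

definition has_kernel :: "opr \<Rightarrow> (nat \<Rightarrow> nat \<Rightarrow> int \<Rightarrow> complex) \<Rightarrow> (int \<Rightarrow> complex) \<Rightarrow> bool" where
  "has_kernel a c t \<longleftrightarrow> rd3 c \<and> rd t \<and>
     (\<forall>\<xi> s y. cf (a \<xi>) (s, y) = (\<Sum>\<^sub>\<infinity>z. ker c t s y z * cf \<xi> (s, z)))"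

lemma has_kernelD:
  "has_kernel a c t \<Longrightarrow> cf (a \<xi>) (s, y) = (\<Sum>\<^sub>\<infinity>z. ker c t s y z * cf \<xi> (s, z))"
  by (simp add: has_kernel_def del: split_paired_All)

lemma has_kernel_rd: "has_kernel a c t \<Longrightarrow> rd3 c" "has_kernel a c t \<Longrightarrow> rd t"
  by (simp_all add: has_kernel_def del: split_paired_All)

lemma has_kernelI:
  "rd3 c \<Longrightarrow> rd t \<Longrightarrow> (\<And>\<xi> s y. cf (a \<xi>) (s, y) = (\<Sum>\<^sub>\<infinity>z. ker c t s y z * cf \<xi> (s, z))) \<Longrightarrow> has_kernel a c t"
  by (simp add: has_kernel_def del: split_paired_All)

lemma abs_summable_pairI:
  fixes f :: "'a \<Rightarrow> 'b \<Rightarrow> complex"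
  assumes "\<And>x. (\<lambda>y. cmod (f x y)) summable_on UNIV" "(\<lambda>x. \<Sum>\<^sub>\<infinity>y. cmod (f x y)) summable_on UNIV"
  shows "(\<lambda>(x, y). f x y) summable_on UNIV \<times> UNIV"
proof (rule abs_summable_summable)
  have "(\<lambda>(x, y). cmod (f x y)) summable_on UNIV \<times> UNIV"
    by (rule summable_on_SigmaI[OF _ assms(2)]) (use assms(1) in auto)
  then show "(\<lambda>z. cmod (case z of (x, y) \<Rightarrow> f x y)) summable_on UNIV \<times> UNIV"
    by (simp add: case_prod_unfold)
qed

lemma kernel_summable:
  assumes M: "toeplitz_mod j u M" and \<phi>: "\<And>z. cmod (\<phi> z) \<le> B"
  shows "(\<lambda>z. M s y z * \<phi> z) summable_on UNIV" "(\<lambda>z. cmod (M s y z * \<phi> z)) summable_on UNIV"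
proof -
  have B: "B \<ge> 0" by (rule order_trans[OF norm_ge_zero \<phi>])
  obtain C where C: "C > 0" "\<And>s y z. cmod (M s y z) \<le> C / (1 + ydist y z) ^ p0"
    using M by (rule toeplitz_mod_bound) auto
  have "cmod (M s y z * \<phi> z) \<le> C * B / (1 + ydist y z) ^ p0" for z
    using mult_mono[OF C(2)[of s y z] \<phi>[of z]] C(1) by (simp add: norm_mult less_imp_le)
  then show "(\<lambda>z. M s y z * \<phi> z) summable_on UNIV" "(\<lambda>z. cmod (M s y z * \<phi> z)) summable_on UNIV"
    using ydist_estimate(1,2)[of "\<lambda>z. M s y z * \<phi> z" "C * B" y] C(1) B by auto
qed

text \<open>Basis vectors show that the whole matrices agree. Along k - l = d with k, l going to
  infinity the entries of \<open>c\<close> and \<open>c'\<close> tend to 0, so the limit is t d as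
  well as t' d; subtracting the Toeplitz parts leaves c = c'.\<close>

lemma has_kernel_unique:
  assumes "has_kernel a c t" "has_kernel a c' t'"
  shows "c = c' \<and> t = t'"
proof -
  have ket: "cf (a (ket (st (s, z)))) (s, y) = ker c t s y z * parity (s, z)" if "has_kernel a c t" for c t s y z
  proof -
    have "cf (a (ket (st (s, z)))) (s, y) = (\<Sum>\<^sub>\<infinity>w\<in>{z}. ker c t s y w * parity (s, w))"
      unfolding has_kernelD[OF that] by (rule infsum_cong_neutral) (auto simp: cf_ket)
    then show ?thesis by simp
  qed
  have eq: "ker c t s y z = ker c' t' s y z" for s y z
  proof -
    have "ker c t s y z * parity (s, z) = ker c' t' s y z * parity (s, z)" using ket[OF assms(1)] ket[OF assms(2)] by metis
    moreover have "parity (s, z) \<noteq> 0" using norm_parity[of "(s, z)"] by fastforce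
    ultimately show ?thesis by simp
  qed
  have e1: "c k l n + (if n = 0 then t (int k - int l) else 0) = c' k l n + (if n = 0 then t' (int k - int l) else 0)" for k l n
    using eq[of 0 "(k, n)" "(l, 0)"] by (cases "n = 0") (simp_all add: ker_def toep_def)
  have "t d = t' d" for d
  proof -
    have r3: "rd3 c" "rd3 c'" using assms by (auto intro: has_kernel_rd)
    obtain C where C: "C > 0" "\<And>x. cmod (case x of (k, l, n) \<Rightarrow> c k l n) \<le> C / (1 + sz x) ^ 1"
      using rdE[OF r3(1)[unfolded rd3_def], of 1] by blast
    obtain C' where C': "C' > 0" "\<And>x. cmod (case x of (k, l, n) \<Rightarrow> c' k l n) \<le> C' / (1 + sz x) ^ 1"
      using rdE[OF r3(2)[unfolded rd3_def], of 1] by blast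
    have bound: "cmod (t d - t' d) \<le> (C + C') / (1 + real j)" for j
    proof -
      let ?k = "nat (max d 0) + j" and ?l = "nat (max (- d) 0) + j"
      have d: "int ?k - int ?l = d" by auto
      have "t d - t' d = c' ?k ?l 0 - c ?k ?l 0" using e1[of ?k ?l 0] unfolding d by (simp add: algebra_simps)
      then have "cmod (t d - t' d) \<le> cmod (c' ?k ?l 0) + cmod (c ?k ?l 0)" by (simp add: norm_triangle_ineq4)
      also have "\<dots> \<le> C' / (1 + sz (?k, ?l, 0::int)) + C / (1 + sz (?k, ?l, 0::int))"
        using C(2)[of "(?k, ?l, 0)"] C'(2)[of "(?k, ?l, 0)"] by simp
      also have "\<dots> \<le> C' / (1 + real j) + C / (1 + real j)"
        using C(1) C'(1) by (intro add_mono divide_left_mono) (auto simp: sz_triple)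
      finally show ?thesis by (simp add: add_divide_distrib)
    qed
    have "(\<lambda>j. (C + C') / (1 + real j)) \<longlonglongrightarrow> 0" by real_asymp
    then have "cmod (t d - t' d) \<le> 0" using bound by (intro LIMSEQ_le_const[of _ 0]) auto
    then show ?thesis by simp
  qed
  then have "t = t'" by blast
  moreover have "c k l n = c' k l n" for k l n using e1[of k l n]
    unfolding \<open>t = t'\<close> by (rule add_right_imp_eq)
  then have "c = c'" by blast
  ultimately show ?thesis by blast
qed

text \<open>Translation invariance survives multiplication, so the decaying part of the product can
  be read off from the columns with s = 0 and second coordinate 0. The identity for
  \<open>mat_mult\<close> is kept as a conclusion because \<open>\<phi>\<^sub>0\<close> of a product
  needs the actual diagonal of the new decaying part.\<close>

lemma has_kernel_comp:
  assumes a: "has_kernel a c t" and a': "has_kernel a' c' t'"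
  obtains c'' where "has_kernel (a \<circ> a') c'' (conv t t')"
    "\<And>s y z. mat_mult (ker c t) (ker c' t') s y z = ker c'' (conv t t') s y z"
proof -
  have M: "toeplitz_mod 0 t (ker c t)" and M': "toeplitz_mod 0 t' (ker c' t')"
    using a a' by (auto intro: toeplitz_mod_ker has_kernel_rd)
  let ?P = "mat_mult (ker c t) (ker c' t')"
  have P: "toeplitz_mod 0 (conv t t') ?P" using toeplitz_mod_mult(1)[OF M M'] by simp
  have inv: "?P s (k, m) (l, m') = ?P 0 (k, m - m') (l, 0)" for s k m l m'
  proof -
    have "?P s (k, m) (l, m') = (\<Sum>\<^sub>\<infinity>w. ker c t s (k, m) w * ker c' t' s w (l, m'))" by (simp add: mat_mult_def)
    also have "\<dots> = (\<Sum>\<^sub>\<infinity>w. ker c t 0 (k, m - m') w * ker c' t' 0 w (l, 0))"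
      by (rule infsum_reindex_bij_witness[of _ "\<lambda>(j, i). (j, i + m')" "\<lambda>(j, i). (j, i - m')"])
         (auto simp: ker_def toep_def)
    finally show ?thesis by (simp add: mat_mult_def)
  qed
  define c'' where "c'' = (\<lambda>k l n. ?P 0 (k, n) (l, 0) - toep 0 (conv t t') 0 (k, n) (l, 0))"
  have r: "rd3 c''"
    unfolding rd3_def
  proof (rule rdI)
    fix r
    obtain C where C: "\<And>s y z. cmod (?P s y z - toep 0 (conv t t') s y z) \<le> C / (1 + esz y z) ^ r"
      using P by (rule toeplitz_modE) auto
    have "cmod (c'' k l n) \<le> C / (1 + sz (k, l, n)) ^ r" for k l n
      using C[of 0 "(k, n)" "(l, 0)"] by (simp add: c''_def sz_triple esz_def)
    then show "\<exists>C. \<forall>x. cmod (case x of (k, l, n) \<Rightarrow> c'' k l n) \<le> C / (1 + sz x) ^ r" by auto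
  qed
  have e: "?P s y z = ker c'' (conv t t') s y z" for s y z
    using inv[of s "fst y" "snd y" "fst z" "snd z"] by (simp add: ker_def c''_def toep_def)
  have "cf ((a \<circ> a') \<xi>) (s, y) = (\<Sum>\<^sub>\<infinity>z. ker c'' (conv t t') s y z * cf \<xi> (s, z))" for \<xi> s y
  proof -
    let ?\<phi> = "\<lambda>z. cf \<xi> (s, z)"
    have \<phi>: "cmod (?\<phi> z) \<le> norm \<xi>" for z by (rule cmod_cf_le_norm)
    obtain C where C: "C > 0" "\<And>s y z. cmod (ker c t s y z) \<le> C / (1 + ydist y z) ^ p0"
      using M by (rule toeplitz_mod_bound) auto
    obtain C' where C': "C' > 0" "\<And>s y z. cmod (ker c' t' s y z) \<le> C' / (1 + ydist y z) ^ p0"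
      using M' by (rule toeplitz_mod_bound) auto
    have b: "cmod (ker c' t' s w z * ?\<phi> z) \<le> C' * norm \<xi> / (1 + ydist w z) ^ p0" for w z
      using mult_mono[OF C'(2)[of s w z] \<phi>[of z]] C'(1) by (simp add: norm_mult less_imp_le)
    have B: "0 \<le> C' * norm \<xi>" using C'(1) by simp
    have s: "(\<lambda>(w, z). ker c t s y w * (ker c' t' s w z * ?\<phi> z)) summable_on UNIV \<times> UNIV"
    proof (rule abs_summable_pairI)
      show "(\<lambda>z. cmod (ker c t s y w * (ker c' t' s w z * ?\<phi> z))) summable_on UNIV" for w
        using summable_on_cmult_right[OF kernel_summable(2)[of _ _ _ ?\<phi>, OF M' \<phi>], of "cmod (ker c t s y w)" s w]
        by (simp add: norm_mult)
      have "cmod (ker c t s y w * of_real (\<Sum>\<^sub>\<infinity>z. cmod (ker c' t' s w z * ?\<phi> z))) \<le> C * (C' * norm \<xi> * S0) / (1 + ydist y w) ^ p0" for w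
      proof -
        have "0 \<le> (\<Sum>\<^sub>\<infinity>z. cmod (ker c' t' s w z * ?\<phi> z))" by (rule infsum_nonneg) simp
        moreover have "(\<Sum>\<^sub>\<infinity>z. cmod (ker c' t' s w z * ?\<phi> z)) \<le> C' * norm \<xi> * S0"
          by (rule ydist_estimate(4)[OF b B])
        ultimately show ?thesis
          using mult_mono[OF C(2)[of s y w], of "\<Sum>\<^sub>\<infinity>z. cmod (ker c' t' s w z * ?\<phi> z)" "C' * norm \<xi> * S0"] C(1)
          by (simp add: norm_mult less_imp_le)
      qed
      then have "(\<lambda>w. cmod (ker c t s y w * of_real (\<Sum>\<^sub>\<infinity>z. cmod (ker c' t' s w z * ?\<phi> z)))) summable_on UNIV"
        by (rule ydist_estimate(1)) (use C(1) B S0_nonneg in simp)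
      moreover have "cmod (ker c t s y w * of_real (\<Sum>\<^sub>\<infinity>z. cmod (ker c' t' s w z * ?\<phi> z)))
          = (\<Sum>\<^sub>\<infinity>z. cmod (ker c t s y w * (ker c' t' s w z * ?\<phi> z)))" for w
      proof -
        have "0 \<le> (\<Sum>\<^sub>\<infinity>z. cmod (ker c' t' s w z * ?\<phi> z))" by (rule infsum_nonneg) simp
        then show ?thesis by (simp only: norm_mult norm_of_real abs_of_nonneg infsum_cmult_right')
      qed
      ultimately show "(\<lambda>w. \<Sum>\<^sub>\<infinity>z. cmod (ker c t s y w * (ker c' t' s w z * ?\<phi> z))) summable_on UNIV" by (simp only:)
    qed
    have "cf ((a \<circ> a') \<xi>) (s, y) = (\<Sum>\<^sub>\<infinity>w. ker c t s y w * (\<Sum>\<^sub>\<infinity>z. ker c' t' s w z * ?\<phi> z))"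
      by (simp add: has_kernelD[OF a] has_kernelD[OF a'])
    also have "\<dots> = (\<Sum>\<^sub>\<infinity>w. \<Sum>\<^sub>\<infinity>z. ker c t s y w * (ker c' t' s w z * ?\<phi> z))"
      by (simp add: infsum_cmult_right')
    also have "\<dots> = (\<Sum>\<^sub>\<infinity>z. \<Sum>\<^sub>\<infinity>w. ker c t s y w * (ker c' t' s w z * ?\<phi> z))"
      by (rule infsum_swap_banach[OF s])
    also have "\<dots> = (\<Sum>\<^sub>\<infinity>z. ?P s y z * ?\<phi> z)"
      by (simp add: mat_mult_def infsum_cmult_left' flip: mult.assoc)
    finally show ?thesis by (simp add: e)
  qed
  then have "has_kernel (a \<circ> a') c'' (conv t t')"
    by (intro has_kernelI r rd_conv has_kernel_rd[OF a] has_kernel_rd[OF a'])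
  with e that show ?thesis by blast
qed

lemma has_kernel_id: "has_kernel id (\<lambda>k l n. 0) (\<lambda>d. if d = 0 then 1 else 0)"
proof -
  have "cf (id \<xi>) (s, y) = (\<Sum>\<^sub>\<infinity>z. ker (\<lambda>k l n. 0) (\<lambda>d. if d = 0 then 1 else 0) s y z * cf \<xi> (s, z))" for \<xi> s y
  proof -
    have "(\<Sum>\<^sub>\<infinity>z. ker (\<lambda>k l n. 0) (\<lambda>d. if d = 0 then 1 else 0) s y z * cf \<xi> (s, z)) = (\<Sum>\<^sub>\<infinity>z\<in>{y}. cf \<xi> (s, z))"
      by (rule infsum_cong_neutral) (auto simp: ker_def toep_def prod_eq_iff)
    then show ?thesis by simp
  qed
  moreover have "rd3 (\<lambda>k l n. 0)" by (simp add: rd3_def case_prod_unfold)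
  moreover have "rd (\<lambda>d::int. if d = 0 then 1 else 0)" by (rule rd_finite_support) auto
  ultimately show ?thesis by (intro has_kernelI)
qed

section \<open>Expansions and kernels\<close>

lemma infsum_int_split:
  fixes g :: "int \<Rightarrow> 'b::banach"
  assumes "g summable_on UNIV"
  shows "infsum g UNIV = (\<Sum>\<^sub>\<infinity>n\<in>{1..}. g (int n)) + (\<Sum>\<^sub>\<infinity>n\<in>{1..}. g (- int n)) + g 0"
    and "(\<lambda>n. g (int n)) summable_on {1..}" "(\<lambda>n. g (- int n)) summable_on {1..}"
proof -
  have s: "g summable_on A" for A using assms by (rule summable_on_subset_banach) simp
  have 1: "infsum g {1..} = (\<Sum>\<^sub>\<infinity>n\<in>{1..}. g (int n))"
    by (rule infsum_reindex_bij_witness[of _ int nat]) auto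
  have 2: "infsum g {..- 1} = (\<Sum>\<^sub>\<infinity>n\<in>{1..}. g (- int n))"
    by (rule infsum_reindex_bij_witness[of _ "\<lambda>n. - int n" "\<lambda>n. nat (- n)"]) auto
  have U: "UNIV = {1..} \<union> {..- 1} \<union> {0::int}" by auto
  have "infsum g UNIV = infsum g {1..} + infsum g {..- 1} + infsum g {0}"
  proof -
    have "infsum g ({1..} \<union> {..- 1} \<union> {0}) = infsum g ({1..} \<union> {..- 1}) + infsum g {0}"
      by (rule infsum_Un_disjoint) (auto intro: s)
    also have "infsum g ({1..} \<union> {..- 1}) = infsum g {1..} + infsum g {..- 1}"
      by (rule infsum_Un_disjoint) (auto intro: s)
    finally show ?thesis using U by simp
  qed
  then show "infsum g UNIV = (\<Sum>\<^sub>\<infinity>n\<in>{1..}. g (int n)) + (\<Sum>\<^sub>\<infinity>n\<in>{1..}. g (- int n)) + g 0"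
    using 1 2 by simp
  have "(g summable_on {1..}) = ((\<lambda>n. g (int n)) summable_on {1..})"
    by (rule summable_on_reindex_bij_witness[of _ int nat]) auto
  then show "(\<lambda>n. g (int n)) summable_on {1..}" using s by simp
  have "(g summable_on {..- 1}) = ((\<lambda>n. g (- int n)) summable_on {1..})"
    by (rule summable_on_reindex_bij_witness[of _ "\<lambda>n. - int n" "\<lambda>n. nat (- n)"]) auto
  then show "(\<lambda>n. g (- int n)) summable_on {1..}" using s by simp
qed

lemma operator_series:
  fixes T :: "'a \<Rightarrow> opr"
  assumes a: "(\<lambda>n. cmod (a n)) summable_on A" and T: "\<And>n. n \<in> A \<Longrightarrow> norm (T n \<xi>) \<le> norm \<xi>"
  shows "(\<lambda>n. a n *\<^sub>C T n \<xi>) summable_on A"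
    and "norm (\<Sum>\<^sub>\<infinity>n\<in>A. a n *\<^sub>C T n \<xi>) \<le> (\<Sum>\<^sub>\<infinity>n\<in>A. cmod (a n)) * norm \<xi>"
    and "cf (\<Sum>\<^sub>\<infinity>n\<in>A. a n *\<^sub>C T n \<xi>) x = (\<Sum>\<^sub>\<infinity>n\<in>A. a n * cf (T n \<xi>) x)"
proof -
  have le: "norm (a n *\<^sub>C T n \<xi>) \<le> cmod (a n) * norm \<xi>" if "n \<in> A" for n
    unfolding norm_scaleC by (intro mult_left_mono T that) simp
  have "(\<lambda>n. norm (a n *\<^sub>C T n \<xi>)) summable_on A"
    by (rule Infinite_Sum.abs_summable_on_comparison_test'[OF summable_on_cmult_left[OF a]]) (rule le)
  then show s: "(\<lambda>n. a n *\<^sub>C T n \<xi>) summable_on A" by (rule abs_summable_summable)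
  show "norm (\<Sum>\<^sub>\<infinity>n\<in>A. a n *\<^sub>C T n \<xi>) \<le> (\<Sum>\<^sub>\<infinity>n\<in>A. cmod (a n)) * norm \<xi>"
    by (rule norm_infsum_le[OF has_sum_infsum[OF s] has_sum_cmult_left[OF has_sum_infsum[OF a]]]) (rule le)
  show "cf (\<Sum>\<^sub>\<infinity>n\<in>A. a n *\<^sub>C T n \<xi>) x = (\<Sum>\<^sub>\<infinity>n\<in>A. a n * cf (T n \<xi>) x)"
    by (simp add: cf_infsum[OF s] cf_scaleC)
qed

lemma
  assumes f: "rd (fourier f)"
  shows cf_fun_beta: "cf (fun_\<beta> f \<xi>) (s, k, m) =
      (if k = 0 then \<Sum>\<^sub>\<infinity>n. fourier f n * cf \<xi> (s, 0, m - n) else 0)"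
    and norm_fun_beta: "norm (fun_\<beta> f \<xi>) \<le> (\<Sum>\<^sub>\<infinity>n. cmod (fourier f n)) * norm \<xi>"
proof -
  note abs = rd_abs_summable[OF f, of UNIV]
  note s = infsum_int_split(2,3)[OF abs]
  note pos = operator_series[OF s(1), of "\<lambda>n. \<beta> ^^ n", OF norm_funpow_le[OF norm_generators(3)]]
  note neg = operator_series[OF s(2), of "\<lambda>n. adj \<beta> ^^ n", OF norm_funpow_le[OF norm_generators(4)]]
  have "norm (fun_\<beta> f \<xi>) \<le> (\<Sum>\<^sub>\<infinity>n\<in>{1..}. cmod (fourier f (int n))) * norm \<xi>
      + (\<Sum>\<^sub>\<infinity>n\<in>{1..}. cmod (fourier f (- int n))) * norm \<xi> + cmod (fourier f 0) * norm \<xi>"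
    unfolding fun_\<beta>_def
    by (intro norm_triangle_mono pos(2) neg(2)) (simp add: norm_scaleC norm_proj_e mult_left_mono)
  then show "norm (fun_\<beta> f \<xi>) \<le> (\<Sum>\<^sub>\<infinity>n. cmod (fourier f n)) * norm \<xi>"
    unfolding infsum_int_split(1)[OF abs] by (simp add: distrib_right)
  have "(\<lambda>n. fourier f n * cf \<xi> (s, 0, m - n)) summable_on UNIV"
    by (rule abs_summable_summable, rule Infinite_Sum.abs_summable_on_comparison_test'[OF summable_on_cmult_left[OF abs, of "norm \<xi>"]])
       (simp add: norm_mult cmod_cf_le_norm mult_left_mono)
  note split = infsum_int_split(1)[OF this]
  have "cf (fun_\<beta> f \<xi>) (s, k, m) = (\<Sum>\<^sub>\<infinity>n\<in>{1..}. fourier f (int n) * cf ((\<beta> ^^ n) \<xi>) (s, k, m))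
      + (\<Sum>\<^sub>\<infinity>n\<in>{1..}. fourier f (- int n) * cf ((adj \<beta> ^^ n) \<xi>) (s, k, m)) + fourier f 0 * cf (proj_e \<xi>) (s, k, m)"
    by (simp only: fun_\<beta>_def cf_add cf_scaleC pos(3) neg(3))
  also have "(\<Sum>\<^sub>\<infinity>n\<in>{1..}. fourier f (int n) * cf ((\<beta> ^^ n) \<xi>) (s, k, m))
      = (\<Sum>\<^sub>\<infinity>n\<in>{1..}. if k = 0 then fourier f (int n) * cf \<xi> (s, 0, m - int n) else 0)"
    by (rule infsum_cong) (simp add: cf_beta_pow)
  also have "(\<Sum>\<^sub>\<infinity>n\<in>{1..}. fourier f (- int n) * cf ((adj \<beta> ^^ n) \<xi>) (s, k, m))
      = (\<Sum>\<^sub>\<infinity>n\<in>{1..}. if k = 0 then fourier f (- int n) * cf \<xi> (s, 0, m - (- int n)) else 0)"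
    by (rule infsum_cong) (simp add: cf_adj_beta_pow)
  finally show "cf (fun_\<beta> f \<xi>) (s, k, m) = (if k = 0 then \<Sum>\<^sub>\<infinity>n. fourier f n * cf \<xi> (s, 0, m - n) else 0)"
    unfolding split by (simp add: cf_proj_e)
qed

lemma rd3_fourier:
  assumes f: "rapid_decay_smooth f" shows "rd3 (\<lambda>k l. fourier (f k l))"
  unfolding rd3_def
proof (rule rdI)
  fix r
  have fs: "f k l \<in> smooth_circle" for k l using f by (simp add: rapid_decay_smooth_def)
  obtain C0 where C0: "\<And>k l t. real (1 + k + l) ^ r * cmod ((ddt ^^ 0) (f k l) t) \<le> C0"
    using f unfolding rapid_decay_smooth_def by meson
  obtain C1 where C1: "\<And>k l t. real (1 + k + l) ^ r * cmod ((ddt ^^ r) (f k l) t) \<le> C1"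
    using f unfolding rapid_decay_smooth_def by meson
  let ?C = "max C0 C1"
  have "cmod (fourier (f k l) n) \<le> 2 ^ r * ?C / (1 + sz (k, l, n)) ^ r" for k l n
  proof -
    have pos: "0 < real (1 + k + l) ^ r" by simp
    have "cmod (fourier (f k l) n) * (1 + sz n) ^ r \<le> 2 ^ r * (?C / real (1 + k + l) ^ r)"
    proof (rule fourier_decay[OF fs])
      show "cmod ((ddt ^^ r) (f k l) t) \<le> ?C / real (1 + k + l) ^ r" "cmod (f k l t) \<le> ?C / real (1 + k + l) ^ r" for t
        using C0[of k l t] C1[of k l t] unfolding pos_le_divide_eq[OF pos] by (auto simp: mult.commute)
    qed
    then have "cmod (fourier (f k l) n) * ((1 + sz n) ^ r * real (1 + k + l) ^ r) \<le> 2 ^ r * ?C"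
      using pos by (simp add: pos_le_divide_eq mult.assoc)
    moreover have "(1 + sz (k, l, n)) ^ r \<le> (1 + sz n) ^ r * real (1 + k + l) ^ r"
      unfolding power_mult_distrib[symmetric]
      by (rule power_mono) (use sz_nonneg[of n] in \<open>auto simp: sz_triple sz_int_def algebra_simps\<close>)
    then have "cmod (fourier (f k l) n) * (1 + sz (k, l, n)) ^ r \<le> cmod (fourier (f k l) n) * ((1 + sz n) ^ r * real (1 + k + l) ^ r)"
      by (intro mult_left_mono) auto
    ultimately show ?thesis by (simp add: pos_le_divide_eq)
  qed
  then show "\<exists>C. \<forall>x. cmod (case x of (k, l, n) \<Rightarrow> fourier (f k l) n) \<le> C / (1 + sz x) ^ r" by auto
qed

lemma rd3_section: "rd3 c \<Longrightarrow> rd (c k l)"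
  unfolding rd3_def using rd_section[of "\<lambda>k (l, n). c k l n" k] rd_section[of "c k" l]
  by (simp add: case_prod_unfold)

text \<open>Of the exponent s + p + q, s serves the weight in k and l, p the derivatives, and q the
  summation over n.\<close>

lemma rapid_decay_smooth_trig:
  assumes c: "rd3 c" shows "rapid_decay_smooth (\<lambda>k l. trig (c k l))"
  unfolding rapid_decay_smooth_def
proof (intro conjI allI)
  fix k l show "trig (c k l) \<in> smooth_circle" by (rule trig_smooth[OF rd3_section[OF c]])
next
  fix s p :: nat
  obtain q :: nat where q: "(\<lambda>x::int. 1 / (1 + sz x) ^ q) summable_on UNIV" using summable_sz by blast
  obtain C where C: "C > 0" "\<And>x. cmod (case x of (k, l, n) \<Rightarrow> c k l n) \<le> C / (1 + sz x) ^ (s + p + q)"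
    using c unfolding rd3_def by (rule rdE) auto
  let ?S = "\<Sum>\<^sub>\<infinity>x::int. 1 / (1 + sz x) ^ q"
  have "real (1 + k + l) ^ s * cmod ((ddt ^^ p) (trig (c k l)) t) \<le> C * ?S" for k l t
  proof -
    let ?d = "\<lambda>n. (\<i> * of_int n) ^ p * c k l n"
    have d: "rd ?d" by (rule rd_deriv[OF rd3_section[OF c]])
    have "cmod ((ddt ^^ p) (trig (c k l)) t) \<le> (\<Sum>\<^sub>\<infinity>n. cmod (?d n))"
      unfolding ddt_pow_trig[OF rd3_section[OF c]] by (rule norm_trig_le[OF d])
    then have "real (1 + k + l) ^ s * cmod ((ddt ^^ p) (trig (c k l)) t) \<le> (\<Sum>\<^sub>\<infinity>n. real (1 + k + l) ^ s * cmod (?d n))"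
      unfolding infsum_cmult_right' by (intro mult_left_mono) auto
    also have "\<dots> \<le> (\<Sum>\<^sub>\<infinity>n. C * (1 / (1 + sz (n::int)) ^ q))"
    proof (rule infsum_mono)
      show "(\<lambda>n. real (1 + k + l) ^ s * cmod (?d n)) summable_on UNIV"
        by (rule summable_on_cmult_right[OF rd_abs_summable[OF d]])
      show "(\<lambda>n::int. C * (1 / (1 + sz n) ^ q)) summable_on UNIV" by (rule summable_on_cmult_right[OF q])
      fix n :: int
      have "real (1 + k + l) ^ s * sz n ^ p * (1 + sz n) ^ q \<le> (1 + sz (k, l, n)) ^ s * (1 + sz (k, l, n)) ^ p * (1 + sz (k, l, n)) ^ q"
        by (intro mult_mono power_mono) (auto simp: sz_triple sz_int_def)
      then have "real (1 + k + l) ^ s * sz n ^ p * (1 + sz n) ^ q \<le> (1 + sz (k, l, n)) ^ (s + p + q)" by (simp add: power_add)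
      then have "real (1 + k + l) ^ s * sz n ^ p * (1 + sz n) ^ q * (C / (1 + sz (k, l, n)) ^ (s + p + q)) \<le> C"
        using C(1) by (simp add: pos_divide_le_eq)
      moreover have "real (1 + k + l) ^ s * sz n ^ p * (1 + sz n) ^ q * cmod (c k l n)
          \<le> real (1 + k + l) ^ s * sz n ^ p * (1 + sz n) ^ q * (C / (1 + sz (k, l, n)) ^ (s + p + q))"
        using C(2)[of "(k, l, n)"] by (intro mult_left_mono) auto
      ultimately have "real (1 + k + l) ^ s * sz n ^ p * (1 + sz n) ^ q * cmod (c k l n) \<le> C" by linarith
      moreover have "cmod (?d n) = sz n ^ p * cmod (c k l n)" by (simp add: norm_mult norm_power sz_int_def)
      ultimately have "real (1 + k + l) ^ s * cmod (?d n) * (1 + sz n) ^ q \<le> C" by (simp only: mult_ac)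
      then show "real (1 + k + l) ^ s * cmod (?d n) \<le> C * (1 / (1 + sz n) ^ q)"
        using pos_le_divide_eq[OF power_sz_pos[of n q]] by simp
    qed
    also have "\<dots> = C * ?S" by (rule infsum_cmult_right')
    finally show ?thesis .
  qed
  then show "\<exists>C. \<forall>k l t. real (1 + k + l) ^ s * cmod ((ddt ^^ p) (trig (c k l)) t) \<le> C" by blast
qed

lemma rapid_decay_rd: "rapid_decay g \<longleftrightarrow> rd g"
proof
  assume g: "rapid_decay g"
  show "rd g"
  proof (rule rdI)
    fix r
    obtain C where "\<And>k. real (1 + k) ^ r * cmod (g k) \<le> C" using g unfolding rapid_decay_def by blast
    then have "cmod (g k) \<le> C / (1 + sz k) ^ r" for k
      by (simp add: pos_le_divide_eq sz_nat_def mult.commute)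
    then show "\<exists>C. \<forall>x. cmod (g x) \<le> C / (1 + sz x) ^ r" by blast
  qed
next
  assume g: "rd g"
  show "rapid_decay g"
    unfolding rapid_decay_def
  proof
    fix s
    obtain C where "\<And>x. cmod (g x) \<le> C / (1 + sz x) ^ s" using g by (rule rdE) auto
    then have "real (1 + k) ^ s * cmod (g k) \<le> C" for k
      by (simp add: pos_le_divide_eq sz_nat_def mult.commute)
    then show "\<exists>C. \<forall>k. real (1 + k) ^ s * cmod (g k) \<le> C" by blast
  qed
qed

text \<open>The l-th power of \<alpha> evaluates a vector at k + l, so its matrix lies on the
  difference - l. The sign is why the n-th Fourier coefficient of the symbol map is t (- n).\<close>

definition toep_symbol :: "(nat \<Rightarrow> complex) \<Rightarrow> (nat \<Rightarrow> complex) \<Rightarrow> int \<Rightarrow> complex" where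
  "toep_symbol lam lam' d = (if d \<le> 0 then lam (nat (- d)) else lam' (nat d))"

lemma rd_toep_symbol:
  assumes "rd lam" "rd lam'" shows "rd (toep_symbol lam lam')"
proof -
  have "rd (\<lambda>d::int. if d \<le> 0 then lam (nat (- d)) else 0)"
    by (rule rd_le[OF assms(1), of _ 1 0 "\<lambda>d. nat \<bar>d\<bar>"]) (auto simp: sz_int_def sz_nat_def)
  moreover have "rd (\<lambda>d::int. if d \<le> 0 then 0 else lam' (nat d))"
    by (rule rd_le[OF assms(2), of _ 1 0 "\<lambda>d. nat \<bar>d\<bar>"]) (auto simp: sz_int_def sz_nat_def)
  ultimately have "rd (\<lambda>d. (if d \<le> 0 then lam (nat (- d)) else 0) + (if d \<le> 0 then 0 else lam' (nat d)))"
    by (rule rd_add)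
  then show ?thesis by (rule rd_mono) (auto simp: toep_symbol_def)
qed

text \<open>f(\<beta>) lives on k = 0, where it acts as a convolution in m. Between the i-th power
  of \<open>adj \<alpha>\<close> and the j-th power of \<alpha> it becomes the block from first
  coordinate j to first coordinate i, so the double series fills in each block exactly once.\<close>

lemma has_kernel_element_of:
  assumes c: "rd3 (\<lambda>k l. fourier (f k l))" and l: "rd lam" "rd lam'"
  shows "has_kernel (element_of f lam lam') (\<lambda>k l. fourier (f k l)) (toep_symbol lam lam')"
proof (rule has_kernelI[OF c rd_toep_symbol[OF l]])
  fix \<xi> s and y :: "nat \<times> int"
  obtain k m where y: "y = (k, m)" by (cases y)
  let ?c = "\<lambda>k l. fourier (f k l)" and ?t = "toep_symbol lam lam'"
  have rf: "rd (fourier (f k l))" for k l using rd3_section[OF c] .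
  let ?T = "\<lambda>(i, j). (adj \<alpha> ^^ i) (fun_\<beta> (f i j) ((\<alpha> ^^ j) \<xi>))"
  note ap = norm_funpow_le[OF norm_generators(1)] and aa = norm_funpow_le[OF norm_generators(2)]
  have sT: "?T summable_on UNIV"
  proof (rule abs_summable_summable, rule Infinite_Sum.abs_summable_on_comparison_test')
    have "(\<lambda>((i, j), n). cmod (?c i j n)) summable_on UNIV \<times> UNIV"
    proof -
      have "(\<lambda>(i, j, n). cmod (?c i j n)) summable_on UNIV"
        using rd_abs_summable[OF c[unfolded rd3_def], of UNIV] by (simp add: case_prod_unfold)
      moreover have "((\<lambda>(i, j, n). cmod (?c i j n)) summable_on UNIV) = ((\<lambda>((i, j), n). cmod (?c i j n)) summable_on UNIV \<times> UNIV)"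
        by (rule summable_on_reindex_bij_witness[of _ "\<lambda>((i, j), n). (i, j, n)" "\<lambda>(i, j, n). ((i, j), n)"]) auto
      ultimately show ?thesis by simp
    qed
    then have "(\<lambda>(ij, n). cmod (?c (fst ij) (snd ij) n)) summable_on (UNIV \<times> UNIV)" by (simp add: case_prod_unfold)
    from summable_on_Sigma_banach[OF this]
    show "(\<lambda>ij. (\<Sum>\<^sub>\<infinity>n. cmod (?c (fst ij) (snd ij) n)) * norm \<xi>) summable_on UNIV"
      by (intro summable_on_cmult_left)
    fix ij :: "nat \<times> nat"
    obtain i j where ij: "ij = (i, j)" by (cases ij)
    have "norm (?T ij) \<le> norm (fun_\<beta> (f i j) ((\<alpha> ^^ j) \<xi>))" unfolding ij split by (rule aa)
    also have "\<dots> \<le> (\<Sum>\<^sub>\<infinity>n. cmod (?c i j n)) * norm ((\<alpha> ^^ j) \<xi>)" by (rule norm_fun_beta[OF rf])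
    also have "\<dots> \<le> (\<Sum>\<^sub>\<infinity>n. cmod (?c i j n)) * norm \<xi>" by (intro mult_left_mono ap infsum_nonneg) simp
    finally show "norm (?T ij) \<le> (\<Sum>\<^sub>\<infinity>n. cmod (?c (fst ij) (snd ij) n)) * norm \<xi>" by (simp add: ij)
  qed
  note s1 = operator_series[OF rd_abs_summable[OF l(1), of UNIV], of "\<lambda>n. \<alpha> ^^ n", OF ap]
  note s2 = operator_series[OF rd_abs_summable[OF l(2), of "{1..}"], of "\<lambda>n. adj \<alpha> ^^ n", OF aa]
  let ?\<phi> = "\<lambda>z. cf \<xi> (s, z)"
  have \<phi>: "cmod (?\<phi> z) \<le> norm \<xi>" for z by (rule cmod_cf_le_norm)
  have z: "rd (\<lambda>_::int. 0 :: complex)" "rd3 (\<lambda>_ _ _. 0)" by (simp_all add: rd3_def case_prod_unfold)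
  have ker_split: "ker ?c ?t s y w = ker ?c (\<lambda>_. 0) s y w + toep 0 ?t s y w" for w
    by (simp add: ker_def toep_def)
  have kz: "ker ?c (\<lambda>_. 0) s y w = ?c (fst y) (fst w) (snd y - snd w)" for y w
    by (simp add: ker_def toep_def)
  have sc: "(\<lambda>w. ker ?c (\<lambda>_. 0) s y w * ?\<phi> w) summable_on UNIV"
    by (rule kernel_summable(1)[OF toeplitz_mod_ker[OF c z(1)] \<phi>])
  have st: "(\<lambda>w. toep 0 ?t s y w * ?\<phi> w) summable_on UNIV"
    using kernel_summable(1)[OF toeplitz_mod_ker[OF z(2) rd_toep_symbol[OF l]] \<phi>, of s y] by (simp add: ker_def)
  have "(\<Sum>\<^sub>\<infinity>ij. cf (?T ij) (s, k, m)) = (\<Sum>\<^sub>\<infinity>w. ker ?c (\<lambda>_. 0) s y w * ?\<phi> w)"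
  proof -
    have "(\<Sum>\<^sub>\<infinity>ij. cf (?T ij) (s, k, m)) = (\<Sum>\<^sub>\<infinity>ij\<in>range (\<lambda>j. (k, j)). \<Sum>\<^sub>\<infinity>n. ?c k (snd ij) n * ?\<phi> (snd ij, m - n))"
    proof (rule infsum_cong_neutral)
      show "cf (?T ij) (s, k, m) = 0" if "ij \<in> UNIV - range (\<lambda>j. (k, j))" for ij
        using that by (cases ij) (auto simp: cf_adj_alpha_pow cf_fun_beta[OF rf])
      show "cf (?T ij) (s, k, m) = (\<Sum>\<^sub>\<infinity>n. ?c k (snd ij) n * ?\<phi> (snd ij, m - n))" if "ij \<in> UNIV \<inter> range (\<lambda>j. (k, j))" for ij
        using that by (auto simp: cf_adj_alpha_pow cf_fun_beta[OF rf] cf_alpha_pow)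
    qed auto
    also have "\<dots> = (\<Sum>\<^sub>\<infinity>j. \<Sum>\<^sub>\<infinity>n. ?c k j n * ?\<phi> (j, m - n))"
      by (subst infsum_reindex) (auto simp: inj_on_def o_def)
    also have "\<dots> = (\<Sum>\<^sub>\<infinity>j. \<Sum>\<^sub>\<infinity>m'. ?c k j (m - m') * ?\<phi> (j, m'))"
      by (rule infsum_cong, rule infsum_reindex_bij_witness[of _ "\<lambda>m'. m - m'" "\<lambda>n. m - n"]) auto
    also have "\<dots> = (\<Sum>\<^sub>\<infinity>(j, m')\<in>UNIV \<times> UNIV. ?c k j (m - m') * ?\<phi> (j, m'))"
      using sc by (intro infsum_Sigma'_banach) (simp add: kz y case_prod_unfold)
    finally show ?thesis by (simp add: kz y case_prod_unfold)
  qed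
  moreover have "(\<Sum>\<^sub>\<infinity>j. lam j * ?\<phi> (k + j, m)) + (\<Sum>\<^sub>\<infinity>j\<in>{1..}. lam' j * (if k \<ge> j then ?\<phi> (k - j, m) else 0))
      = (\<Sum>\<^sub>\<infinity>w. toep 0 ?t s y w * ?\<phi> w)"
  proof -
    let ?g = "\<lambda>w. toep 0 ?t s y w * ?\<phi> w"
    \<comment> \<open>The powers of \<alpha> read the vector at first coordinates at least k, those
      of \<open>adj \<alpha>\<close> below k.\<close>
    let ?A = "range (\<lambda>j. (k + j, m))" and ?B = "(\<lambda>j. (k - j, m)) ` {1..k}"
    have "(\<Sum>\<^sub>\<infinity>j. lam j * ?\<phi> (k + j, m)) = infsum ?g ?A"
      by (subst infsum_reindex) (auto simp: inj_on_def o_def toep_def y toep_symbol_def)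
    moreover have "(\<Sum>\<^sub>\<infinity>j\<in>{1..}. lam' j * (if k \<ge> j then ?\<phi> (k - j, m) else 0)) = infsum ?g ?B"
    proof -
      have "(\<Sum>\<^sub>\<infinity>j\<in>{1..}. lam' j * (if k \<ge> j then ?\<phi> (k - j, m) else 0)) = (\<Sum>\<^sub>\<infinity>j\<in>{1..k}. lam' j * ?\<phi> (k - j, m))"
        by (rule infsum_cong_neutral) auto
      also have "\<dots> = infsum ?g ?B"
        by (subst infsum_reindex) (auto simp: inj_on_def o_def toep_def y toep_symbol_def of_nat_diff intro!: sum.cong)
      finally show ?thesis .
    qed
    moreover have "infsum ?g UNIV = infsum ?g (?A \<union> ?B)"
    proof (rule infsum_cong_neutral)
      show "?g w = 0" if w: "w \<in> UNIV - (?A \<union> ?B)" for w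
      proof -
        have "snd w \<noteq> m"
        proof
          assume m: "snd w = m"
          show False
          proof (cases "fst w \<ge> k")
            case True
            then have "w = (k + (fst w - k), m)" using m by (simp add: prod_eq_iff)
            then show False using w by blast
          next
            case False
            then have "w = (k - (k - fst w), m)" "k - fst w \<in> {1..k}" using m by (auto simp: prod_eq_iff)
            then show False using w by blast
          qed
        qed
        then show ?thesis by (auto simp: toep_def y)
      qed
    qed auto
    moreover have "infsum ?g (?A \<union> ?B) = infsum ?g ?A + infsum ?g ?B"
      by (rule infsum_Un_disjoint) (auto intro: summable_on_subset[OF st])
    ultimately show ?thesis by simp
  qed
  moreover have "cf (element_of f lam lam' \<xi>) (s, y) = (\<Sum>\<^sub>\<infinity>ij. cf (?T ij) (s, k, m))
      + (\<Sum>\<^sub>\<infinity>j. lam j * ?\<phi> (k + j, m)) + (\<Sum>\<^sub>\<infinity>j\<in>{1..}. lam' j * (if k \<ge> j then ?\<phi> (k - j, m) else 0))"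
    by (simp only: element_of_def cf_add cf_infsum[OF sT] s1(3) s2(3) y cf_alpha_pow cf_adj_alpha_pow)
  ultimately show "cf (element_of f lam lam' \<xi>) (s, y) = (\<Sum>\<^sub>\<infinity>w. ker ?c ?t s y w * ?\<phi> w)"
    unfolding ker_split distrib_right infsum_add[OF sc st] by (simp add: add.assoc)
qed

lemma has_expansion_kernel:
  assumes "has_expansion a f lam lam'"
  shows "has_kernel a (\<lambda>k l. fourier (f k l)) (toep_symbol lam lam')"
  using assms unfolding has_expansion_def rapid_decay_rd
  by (auto intro!: has_kernel_element_of rd3_fourier)

lemma kernel_has_expansion:
  assumes k: "has_kernel a c t"
  shows "has_expansion a (\<lambda>k l. trig (c k l)) (\<lambda>l. t (- int l)) (\<lambda>k. if k = 0 then 0 else t (int k))"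
    (is "has_expansion a ?f ?lam ?lam'")
proof -
  note r = has_kernel_rd[OF k]
  have ft: "(\<lambda>k l. fourier (?f k l)) = c" by (intro ext) (simp add: fourier_trig[OF rd3_section[OF r(1)]])
  have l: "rd ?lam" by (rule rd_le[OF r(2), of _ 1 0 "\<lambda>l. - int l"]) (auto simp: sz_int_def sz_nat_def)
  have l': "rd ?lam'" by (rule rd_le[OF r(2), of _ 1 0 int]) (auto simp: sz_int_def sz_nat_def)
  have t: "toep_symbol ?lam ?lam' = t" by (intro ext) (auto simp: toep_symbol_def)
  have e: "has_kernel (element_of ?f ?lam ?lam') c t"
    using has_kernel_element_of[of ?f ?lam ?lam'] r(1) l l' unfolding ft t by simp
  have "a = element_of ?f ?lam ?lam'"
  proof (intro ext cf_eqI)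
    fix \<xi> x show "cf (a \<xi>) x = cf (element_of ?f ?lam ?lam' \<xi>) x"
      by (cases x) (simp only: has_kernelD[OF k] has_kernelD[OF e])
  qed
  then show ?thesis
    unfolding has_expansion_def rapid_decay_rd
    using rapid_decay_smooth_trig[OF r(1)] l l' by simp
qed

lemma in_algebra_iff: "a \<in> \<A> \<longleftrightarrow> (\<exists>c t. has_kernel a c t)"
  unfolding \<A>_def using has_expansion_kernel kernel_has_expansion by blast

text \<open>The kernel is unique and smooth functions are recovered from their Fourier coefficients,
  so the definite description is meaningful; from here on the coefficients of an element are those
  of its kernel.\<close>

lemma expansion_eq:
  assumes k: "has_kernel a c t"
  shows "expansion a = (\<lambda>k l. trig (c k l), \<lambda>l. t (- int l), \<lambda>k. if k = 0 then 0 else t (int k))"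
  unfolding expansion_def
proof (rule the_equality)
  show "case (\<lambda>k l. trig (c k l), \<lambda>l. t (- int l), \<lambda>k. if k = 0 then 0 else t (int k)) of
      (f, lam, lam') \<Rightarrow> has_expansion a f lam lam'"
    using kernel_has_expansion[OF k] by simp
  fix x assume "case x of (f, lam, lam') \<Rightarrow> has_expansion a f lam lam'"
  then obtain f lam lam' where x: "x = (f, lam, lam')" and e: "has_expansion a f lam lam'" by (cases x) auto
  have u: "c = (\<lambda>k l. fourier (f k l))" "t = toep_symbol lam lam'"
    using has_kernel_unique[OF k has_expansion_kernel[OF e]] by auto
  have "f k l \<in> smooth_circle" for k l using e by (simp add: has_expansion_def rapid_decay_smooth_def)
  then have "f = (\<lambda>k l. trig (c k l))" unfolding u by (intro ext) (simp add: trig_fourier)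
  moreover have "lam = (\<lambda>l. t (- int l))" unfolding u by (auto simp: toep_symbol_def)
  moreover have "lam' = (\<lambda>k. if k = 0 then 0 else t (int k))"
    using e unfolding u by (auto simp: toep_symbol_def has_expansion_def)
  ultimately show "x = (\<lambda>k l. trig (c k l), \<lambda>l. t (- int l), \<lambda>k. if k = 0 then 0 else t (int k))"
    by (simp add: x)
qed

lemma f_coeff_eq: "has_kernel a c t \<Longrightarrow> f_coeff a k l = trig (c k l)"
  by (simp add: f_coeff_def expansion_eq)

lemma symbol_eq:
  assumes k: "has_kernel a c t" shows "\<sigma> a = trig (\<lambda>n. t (- n))"
proof
  fix x
  have r: "rd (\<lambda>n. t (- n))"
    by (rule rd_le[OF has_kernel_rd(2)[OF k], of _ 1 0 uminus]) (auto simp: sz_int_def)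
  let ?g = "\<lambda>n. t (- n) * cis (of_int n * x)"
  have g: "?g summable_on A" for A by (rule trig_summable[OF r])
  have 0: "(\<Sum>\<^sub>\<infinity>l. t (- int l) * cis (real l * x)) = (\<Sum>\<^sub>\<infinity>n\<in>{1..}. ?g (int n)) + ?g 0"
  proof -
    have "(\<lambda>l. ?g (int l)) summable_on {1..}" by (rule infsum_int_split(2)[OF g])
    then have "(\<Sum>\<^sub>\<infinity>l\<in>insert 0 {1..}. ?g (int l)) = ?g (int 0) + (\<Sum>\<^sub>\<infinity>n\<in>{1..}. ?g (int n))"
      by (rule infsum_insert) simp
    moreover have "insert 0 {1..} = (UNIV :: nat set)" by auto
    ultimately show ?thesis by simp
  qed
  have "\<sigma> a x = (\<Sum>\<^sub>\<infinity>l. t (- int l) * cis (real l * x)) + (\<Sum>\<^sub>\<infinity>k\<in>{1..}. t (int k) * cis (- (real k * x)))"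
    unfolding \<sigma>_def lam_coeff_def lam'_coeff_def expansion_eq[OF k]
    by (simp, rule infsum_cong) simp
  then show "\<sigma> a x = trig (\<lambda>n. t (- n)) x"
    unfolding trig_def infsum_int_split(1)[OF g] 0 by simp
qed

section \<open>Analytic continuation of Dirichlet series\<close>

lemma holomorphic_series:
  fixes f :: "nat \<Rightarrow> complex \<Rightarrow> complex"
  assumes S: "open S" and hol: "\<And>n. f n holomorphic_on S"
    and bound: "\<And>z. z \<in> S \<Longrightarrow> \<exists>d>0. cball z d \<subseteq> S \<and> (\<exists>M. summable M \<and> (\<forall>n. \<forall>w\<in>cball z d. cmod (f n w) \<le> M n))"
  shows "(\<lambda>z. \<Sum>n. f n z) holomorphic_on S" "z \<in> S \<Longrightarrow> summable (\<lambda>n. f n z)"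
proof -
  show "(\<lambda>z. \<Sum>n. f n z) holomorphic_on S"
  proof (rule holomorphic_uniform_sequence[OF S])
    show "(\<lambda>z. \<Sum>i<n. f i z) holomorphic_on S" for n by (intro holomorphic_intros hol)
    fix z assume "z \<in> S"
    from bound[OF this] obtain d M where d: "d > 0" "cball z d \<subseteq> S" "summable M"
      "\<And>n w. w \<in> cball z d \<Longrightarrow> cmod (f n w) \<le> M n" by blast
    then show "\<exists>d>0. cball z d \<subseteq> S \<and> uniform_limit (cball z d) (\<lambda>n z. \<Sum>i<n. f i z) (\<lambda>z. \<Sum>n. f n z) sequentially"
      using Weierstrass_m_test[of "cball z d" f M] by blast
  qed
  assume "z \<in> S"
  from bound[OF this] obtain d M where d: "d > 0" "summable M" "\<And>n w. w \<in> cball z d \<Longrightarrow> cmod (f n w) \<le> M n" by blast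
  show "summable (\<lambda>n. f n z)"
    by (rule summable_comparison_test'[OF d(2)]) (use d in auto)
qed

lemma summable_powr_Suc: "a > 1 \<Longrightarrow> summable (\<lambda>n. real (Suc n) powr - a)"
  using summable_Suc_iff[of "\<lambda>n. real n powr - a"] summable_real_powr_iff[of "- a"] by simp

text \<open>The \<open>j\<close>-th derivative of \<open>x \<mapsto> x powr (1 - w)\<close>.\<close>
definition powr_jet :: "complex \<Rightarrow> nat \<Rightarrow> complex \<Rightarrow> complex" where
  "powr_jet w j x = (\<Prod>i<j. 1 - w - of_nat i) * x powr (1 - w - of_nat j)"

lemma powr_jet_deriv:
  assumes "x \<notin> \<real>\<^sub>\<le>\<^sub>0"
  shows "(powr_jet w j has_field_derivative powr_jet w (Suc j) x) (at x within S)"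
proof -
  have "((\<lambda>x. (\<Prod>i<j. 1 - w - of_nat i) * x powr (1 - w - of_nat j)) has_field_derivative
      (\<Prod>i<j. 1 - w - of_nat i) * ((1 - w - of_nat j) * x powr (1 - w - of_nat j - 1))) (at x within S)"
    by (rule has_field_derivative_at_within, rule DERIV_cmult, rule has_field_derivative_powr[OF assms])
  then show ?thesis by (simp add: powr_jet_def[abs_def] algebra_simps)
qed

text \<open>The Euler-Maclaurin terms of order up to two for F x = x powr (1 - w), with 1/12 = B_2 /
  2!. By Taylor expansion the coefficients - 1/2 and 1/12 are exactly those for which the second and
  third derivatives of F cancel in a step from N to N + 1.\<close>

definition zeta_partial :: "complex \<Rightarrow> nat \<Rightarrow> complex" where
  "zeta_partial w n = powr_jet w 0 (of_nat (Suc n)) - powr_jet w 1 (of_nat (Suc n)) / 2 + powr_jet w 2 (of_nat (Suc n)) / 12"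

text \<open>By Euler-Maclaurin, the zeta series multiplied by \<open>w - 1\<close> telescopes up to these summands.\<close>
definition zeta_term :: "complex \<Rightarrow> nat \<Rightarrow> complex" where
  "zeta_term w n = (w - 1) * of_nat (Suc n) powr - w - zeta_partial w n + zeta_partial w (Suc n)"

text \<open>After that cancellation only fourth derivatives of size N powr (- 3 - Re w) are left,
  which is summable up to Re w = - 3/2. So much room is required since
  \<open>dirichlet_residue\<close> evaluates at z - 1 for Re z > - 1/2. The factor 2 dominates 1 +
  1/2 + 1/12.\<close>

lemma zeta_term_bound:
  assumes w: "Re w \<ge> - 3 / 2" and R: "cmod w \<le> R"
  shows "cmod (zeta_term w n) \<le> 2 * (R + 4) ^ 4 * real (Suc n) powr - (3 / 2)"
proof -
  let ?N = "of_nat (Suc n) :: complex" and ?N' = "of_nat (Suc (Suc n)) :: complex"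
  let ?S = "closed_segment ?N ?N'"
  let ?B = "(R + 4) ^ 4 * real (Suc n) powr - (3 / 2)"
  have R0: "R \<ge> 0" using R norm_ge_zero order_trans by blast
  have S: "\<exists>y. x = of_real y \<and> y \<ge> real (Suc n)" if "x \<in> ?S" for x
  proof -
    have "?S = of_real ` closed_segment (real (Suc n)) (real (Suc (Suc n)))"
      using closed_segment_of_real[of "real (Suc n)" "real (Suc (Suc n))", where ?'a = complex] by simp
    then show ?thesis using that by (auto simp: closed_segment_eq_real_ivl)
  qed
  have nn: "x \<notin> \<real>\<^sub>\<le>\<^sub>0" if "x \<in> ?S" for x
    using S[OF that] by (auto simp: complex_nonpos_Reals_iff)
  have d: "(powr_jet w i has_field_derivative powr_jet w (Suc i) x) (at x within ?S)" if "x \<in> ?S" for i x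
    by (rule powr_jet_deriv[OF nn[OF that]])
  have B: "cmod (powr_jet w 4 x) \<le> ?B" if "x \<in> ?S" for x
  proof -
    from S[OF that] obtain y where y: "x = of_real y" "y \<ge> real (Suc n)" by blast
    have y1: "y \<ge> 1" using y(2) by simp
    have "cmod (\<Prod>i<4. 1 - w - of_nat i) \<le> (\<Prod>i<4::nat. R + 4)"
      unfolding prod_norm[symmetric]
    proof (rule prod_mono, intro conjI)
      fix i :: nat assume i: "i \<in> {..<4}"
      have "cmod (1 - w - of_nat i) \<le> cmod (1 - of_nat i) + cmod w"
        using norm_triangle_ineq4[of "1 - of_nat i" w] by (simp add: algebra_simps)
      also have "cmod (1 - of_nat i :: complex) = \<bar>1 - real i\<bar>"
        by (metis norm_of_real of_real_1 of_real_diff of_real_of_nat_eq)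
      also have "\<bar>1 - real i\<bar> + cmod w \<le> R + 4" using i R by auto
      finally show "cmod (1 - w - of_nat i) \<le> R + 4" by simp
    qed simp
    moreover have "cmod (x powr (1 - w - of_nat 4)) \<le> real (Suc n) powr - (3 / 2)"
    proof -
      have "cmod (x powr (1 - w - of_nat 4)) = y powr (- 3 - Re w)"
        unfolding y using y1 by (subst norm_powr_real_powr) auto
      also have "\<dots> \<le> y powr - (3 / 2)" using w y1 by (intro powr_mono) auto
      also have "\<dots> \<le> real (Suc n) powr - (3 / 2)" using y(2) by (intro powr_mono2') auto
      finally show ?thesis .
    qed
    ultimately show ?thesis unfolding powr_jet_def norm_mult
      using R0 by (intro mult_mono) auto
  qed
  have B0: "?B \<ge> 0" using R0 by simp
  have taylor: "cmod (powr_jet w i ?N' - (\<Sum>j\<le>3 - i. powr_jet w (j + i) ?N / fact j)) \<le> ?B" if i: "i \<le> 3" for i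
  proof -
    have "cmod (powr_jet w (0 + i) ?N' - (\<Sum>j\<le>3 - i. powr_jet w (j + i) ?N * (?N' - ?N) ^ j / fact j))
        \<le> ?B * cmod (?N' - ?N) ^ Suc (3 - i) / fact (3 - i)"
    proof (rule complex_Taylor[where f = "\<lambda>j. powr_jet w (j + i)"])
      show "cmod (powr_jet w (Suc (3 - i) + i) x) \<le> ?B" if "x \<in> ?S" for x
        using B[OF that] i by simp
    qed (use d in auto)
    also have "\<dots> = ?B / fact (3 - i)" by simp
    also have "\<dots> \<le> ?B / 1" using B0 by (intro divide_left_mono) auto
    finally show ?thesis by simp
  qed
  define e0 where "e0 = powr_jet w 0 ?N' - (\<Sum>j\<le>3. powr_jet w j ?N / fact j)"
  define e1 where "e1 = powr_jet w 1 ?N' - (\<Sum>j\<le>2. powr_jet w (j + 1) ?N / fact j)"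
  define e2 where "e2 = powr_jet w 2 ?N' - (\<Sum>j\<le>1. powr_jet w (j + 2) ?N / fact j)"
  have "(w - 1) * ?N powr - w = - powr_jet w 1 ?N" by (simp add: powr_jet_def algebra_simps)
  then have zt: "zeta_term w n = - powr_jet w 1 ?N - zeta_partial w n + zeta_partial w (Suc n)"
    by (simp only: zeta_term_def)
  have "zeta_term w n = e0 - e1 / 2 + e2 / 12"
    unfolding zt zeta_partial_def e0_def e1_def e2_def
    by (simp add: numeral_eq_Suc field_simps)
  also have "cmod \<dots> \<le> cmod e0 + cmod e1 / 2 + cmod e2 / 12"
    by (rule order_trans[OF norm_triangle_ineq], rule add_mono, rule order_trans[OF norm_triangle_ineq4]) simp_all
  finally have 1: "cmod (zeta_term w n) \<le> cmod e0 + cmod e1 / 2 + cmod e2 / 12" .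
  have "cmod e0 \<le> ?B" "cmod e1 \<le> ?B" "cmod e2 \<le> ?B"
    using taylor[of 0] taylor[of 1] taylor[of 2] by (simp_all add: e0_def e1_def e2_def)
  with 1 B0 show ?thesis by linarith
qed

text \<open>This is (w - 1) zeta w.\<close>

definition zeta_aux :: "complex \<Rightarrow> complex" where
  "zeta_aux w = zeta_partial w 0 + (\<Sum>n. zeta_term w n)"

lemma zeta_term_locally_bounded:
  assumes z: "Re z > - 3 / 2"
  shows "\<exists>d>0. cball z d \<subseteq> {w. Re w > - 3 / 2} \<and>
    (\<exists>M. summable M \<and> (\<forall>n. \<forall>w\<in>cball z d. cmod (zeta_term w n) \<le> M n))"
proof -
  define d where "d = (Re z + 3 / 2) / 2"
  have d: "d > 0" using z by (simp add: d_def)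
  have Re: "Re w > - 3 / 2" if "w \<in> cball z d" for w
  proof -
    have "Re (z - w) \<le> d" using that complex_Re_le_cmod[of "z - w"] by (simp add: dist_norm)
    then show ?thesis using z by (simp add: d_def field_simps)
  qed
  have nw: "cmod w \<le> cmod z + d" if "w \<in> cball z d" for w
    using that norm_triangle_ineq4[of z "z - w"] by (simp add: dist_norm)
  have "cmod (zeta_term w n) \<le> 2 * (cmod z + d + 4) ^ 4 * real (Suc n) powr - (3 / 2)" if "w \<in> cball z d" for w n
    by (rule zeta_term_bound) (use Re[OF that] nw[OF that] in auto)
  moreover have "summable (\<lambda>n. 2 * (cmod z + d + 4) ^ 4 * real (Suc n) powr - (3 / 2))"
    by (intro summable_mult summable_powr_Suc) simp
  ultimately show ?thesis using d Re by blast
qed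

lemma zeta_term_holomorphic: "(\<lambda>w. zeta_term w n) holomorphic_on S"
  unfolding zeta_term_def zeta_partial_def powr_jet_def
  by (intro holomorphic_intros) (auto simp del: of_nat_Suc)

lemma
  shows zeta_aux_holomorphic: "zeta_aux holomorphic_on {w. Re w > - 3 / 2}"
    and zeta_term_summable: "Re w > - 3 / 2 \<Longrightarrow> summable (zeta_term w)"
proof -
  have o: "open {w. Re w > - 3 / 2}" by (rule open_halfspace_Re_gt)
  note h = holomorphic_series[of "{w. Re w > - 3 / 2}" "\<lambda>n w. zeta_term w n", OF o zeta_term_holomorphic]
  have "(\<lambda>w. zeta_partial w 0) holomorphic_on {w. Re w > - 3 / 2}"
    unfolding zeta_partial_def powr_jet_def by (intro holomorphic_intros) auto
  then show "zeta_aux holomorphic_on {w. Re w > - 3 / 2}"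
    unfolding zeta_aux_def by (intro holomorphic_intros h(1)) (use zeta_term_locally_bounded in auto)
  show "Re w > - 3 / 2 \<Longrightarrow> summable (zeta_term w)"
    by (rule h(2)) (use zeta_term_locally_bounded in auto)
qed

text \<open>At w = 1 the jet of order 0 is constantly 1 and the higher ones contain the factor 1 -
  w. The value is the residue of zeta at its pole.\<close>

lemma zeta_aux_1: "zeta_aux 1 = 1"
proof -
  have p: "zeta_partial 1 n = 1" for n
    by (simp add: zeta_partial_def powr_jet_def numeral_2_eq_2 del: of_nat_Suc)
  have "zeta_term 1 n = 0" for n by (simp add: zeta_term_def p)
  then show ?thesis by (simp add: zeta_aux_def p)
qed

lemma powr_neg_tendsto_0:
  assumes "Re a < 0" shows "(\<lambda>n. of_nat (Suc n) powr a :: complex) \<longlonglongrightarrow> 0"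
proof (rule tendsto_norm_zero_cancel)
  have "(\<lambda>n. real (Suc n) powr Re a) \<longlonglongrightarrow> 0"
    using assms by (intro tendsto_neg_powr filterlim_compose[OF filterlim_real_sequentially filterlim_Suc])
  then show "(\<lambda>n. cmod (of_nat (Suc n) powr a)) \<longlonglongrightarrow> 0"
    by (subst norm_powr_real_powr) auto
qed

lemma zeta_sums:
  assumes w: "Re w > 1"
  shows "(\<lambda>n. of_nat (Suc n) powr - w) sums (zeta_aux w / (w - 1))"
proof -
  have w1: "w \<noteq> 1" using w by auto
  have "(\<lambda>n. \<Sum>i<n. zeta_term w i) \<longlonglongrightarrow> (\<Sum>n. zeta_term w n)"
    using summable_LIMSEQ[OF zeta_term_summable, of w] w by simp
  then have "(\<lambda>n. ((\<Sum>i<n. zeta_term w i) + zeta_partial w 0 - zeta_partial w n) / (w - 1))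
      \<longlonglongrightarrow> ((\<Sum>n. zeta_term w n) + zeta_partial w 0 - 0) / (w - 1)"
  proof (intro tendsto_intros)
    have "(\<lambda>n. powr_jet w j (of_nat (Suc n))) \<longlonglongrightarrow> 0" for j
      unfolding powr_jet_def by (intro tendsto_mult_right_zero powr_neg_tendsto_0) (use w in simp)
    from tendsto_add[OF tendsto_diff[OF this[of 0] tendsto_divide[OF this[of 1] tendsto_const[of 2]]] tendsto_divide[OF this[of 2] tendsto_const[of 12]]]
    show "zeta_partial w \<longlonglongrightarrow> 0" unfolding zeta_partial_def[abs_def] by simp
  qed (use w1 in auto)
  moreover have "((\<Sum>i<n. zeta_term w i) + zeta_partial w 0 - zeta_partial w n) / (w - 1) = (\<Sum>i<n. of_nat (Suc i) powr - w)" for n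
  proof -
    have "(\<Sum>i<n. zeta_term w i) + zeta_partial w 0 - zeta_partial w n = (w - 1) * (\<Sum>i<n. of_nat (Suc i) powr - w)"
      by (induction n) (simp_all add: zeta_term_def algebra_simps del: of_nat_Suc)
    then show ?thesis using w1 by simp
  qed
  ultimately show ?thesis by (simp add: sums_def zeta_aux_def add.commute)
qed

lemma dirichlet_remainder_holomorphic:
  fixes a :: "nat \<Rightarrow> complex"
  assumes a: "\<And>n. cmod (a n) \<le> C / real (Suc n) ^ 2"
  shows "(\<lambda>z. \<Sum>n. a n * of_nat (Suc n) powr - z) holomorphic_on {z. Re z > - 1 / 2}"
    and "Re z > - 1 / 2 \<Longrightarrow> summable (\<lambda>n. a n * of_nat (Suc n) powr - z)"
proof -
  have C: "C \<ge> 0" using order_trans[OF norm_ge_zero a[of 0]] by simp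
  have b: "\<exists>d>0. cball z d \<subseteq> {w. Re w > - 1 / 2} \<and>
    (\<exists>M. summable M \<and> (\<forall>n. \<forall>w\<in>cball z d. cmod (a n * of_nat (Suc n) powr - w) \<le> M n))" if z: "z \<in> {w. Re w > - 1 / 2}" for z
  proof -
    define d where "d = (Re z + 1 / 2) / 2"
    have d: "d > 0" using z by (simp add: d_def)
    have Re: "Re w > - 1 / 2" if "w \<in> cball z d" for w
    proof -
      have "Re (z - w) \<le> d" using that complex_Re_le_cmod[of "z - w"] by (simp add: dist_norm)
      then show ?thesis using z by (simp add: d_def field_simps)
    qed
    have "cmod (a n * of_nat (Suc n) powr - w) \<le> C * real (Suc n) powr - (3 / 2)" if "w \<in> cball z d" for w n
    proof -
      have "cmod (of_nat (Suc n) powr - w) = real (Suc n) powr (- Re w)"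
        by (subst norm_powr_real_powr) auto
      also have "\<dots> \<le> real (Suc n) powr (1 / 2)" using Re[OF that] by (intro powr_mono) auto
      finally have "cmod (a n * of_nat (Suc n) powr - w) \<le> C / real (Suc n) ^ 2 * real (Suc n) powr (1 / 2)"
        unfolding norm_mult using C by (intro mult_mono a) auto
      also have "real (Suc n) ^ 2 = real (Suc n) powr 2" by (subst powr_numeral) auto
      also have "C / real (Suc n) powr 2 * real (Suc n) powr (1 / 2) = C * real (Suc n) powr - (3 / 2)"
        by (simp add: powr_minus field_simps powr_add[symmetric] del: of_nat_Suc)
      finally show ?thesis .
    qed
    moreover have "summable (\<lambda>n. C * real (Suc n) powr - (3 / 2))"
      by (intro summable_mult summable_powr_Suc) simp
    ultimately show ?thesis using d Re by blast
  qed
  have hol: "(\<lambda>w. a n * of_nat (Suc n) powr - w) holomorphic_on S" for n S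
    by (intro holomorphic_intros) (auto simp del: of_nat_Suc)
  note h = holomorphic_series[of "{w. Re w > - 1 / 2}" "\<lambda>n w. a n * of_nat (Suc n) powr - w", OF open_halfspace_Re_gt hol b]
  show "(\<lambda>z. \<Sum>n. a n * of_nat (Suc n) powr - z) holomorphic_on {z. Re z > - 1 / 2}"
    using h(1) by blast
  show "Re z > - 1 / 2 \<Longrightarrow> summable (\<lambda>n. a n * of_nat (Suc n) powr - z)"
    using h(2) by blast
qed

section \<open>Dirichlet series whose coefficients have an asymptotic expansion\<close>

definition has_asymptotics :: "(nat \<Rightarrow> complex) \<Rightarrow> complex \<Rightarrow> complex \<Rightarrow> complex \<Rightarrow> bool" where
  "has_asymptotics A c1 c0 c \<longleftrightarrow>
     (\<exists>C. \<forall>n\<ge>1. cmod (A n - (c1 * of_nat n + c0 + c / of_nat n)) \<le> C / real n ^ 2)"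

text \<open>The three terms of the expansion give zeta at z - 1, z and z + 1, with possible poles at
  z = 2, 1 and 0; only the last one is seen at 0. The O(n^-2) remainder is holomorphic around 0.
  Holomorphy off 0 is a conclusion because adding residues of \<open>g\<close> and another function
  requires it.\<close>

lemma dirichlet_residue:
  assumes A: "has_asymptotics A c1 c0 c"
  obtains g where "g meromorphic_on {z. Re z > - 1 / 2}" "residue g 0 = c"
    "\<And>z. Re z > 2 \<Longrightarrow> (\<lambda>n. A (Suc n) * of_nat (Suc n) powr - z) sums g z"
    "\<exists>U. open U \<and> 0 \<in> U \<and> g holomorphic_on (U - {0})"
proof -
  define a where "a = (\<lambda>n. A (Suc n) - (c1 * of_nat (Suc n) + c0 + c / of_nat (Suc n)))"
  obtain C where C: "\<And>n. n \<ge> 1 \<Longrightarrow> cmod (A n - (c1 * of_nat n + c0 + c / of_nat n)) \<le> C / real n ^ 2"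
    using A unfolding has_asymptotics_def by blast
  have a: "cmod (a n) \<le> C / real (Suc n) ^ 2" for n using C[of "Suc n"] unfolding a_def by simp
  note H = dirichlet_remainder_holomorphic[OF a]
  let ?H = "\<lambda>z. \<Sum>n. a n * of_nat (Suc n) powr - z"
  let ?S = "{z. Re z > - 1 / 2}"
  define h where "h = (\<lambda>z. c1 * (zeta_aux (z - 1) / (z - 2)) + c0 * (zeta_aux z / (z - 1)) + ?H z)"
  define g where "g = (\<lambda>z. h z + c * zeta_aux (z + 1) / z)"
  have z: "(\<lambda>z. zeta_aux (z - 1)) holomorphic_on ?S" "zeta_aux holomorphic_on ?S" "(\<lambda>z. zeta_aux (z + 1)) holomorphic_on ?S"
    by (auto intro!: holomorphic_on_compose_gen[OF _ zeta_aux_holomorphic, unfolded o_def]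
        holomorphic_on_subset[OF zeta_aux_holomorphic] holomorphic_intros)
  have oS: "open ?S" by (rule open_halfspace_Re_gt)
  have mer: "f meromorphic_on ?S" if "f holomorphic_on ?S" for f
    using that oS by (intro analytic_on_imp_meromorphic_on) (simp add: analytic_on_open)
  have g_mer: "g meromorphic_on ?S"
    unfolding g_def h_def by (intro meromorphic_intros mer z H(1))
  let ?U = "ball (0::complex) (1 / 2)"
  have US: "?U \<subseteq> ?S - {1, 2}"
  proof
    fix x :: complex assume "x \<in> ?U"
    then have "cmod x < 1 / 2" by (simp add: dist_norm)
    moreover have "\<bar>Re x\<bar> \<le> cmod x" by (rule abs_Re_le_cmod)
    ultimately show "x \<in> ?S - {1, 2}" by auto
  qed
  have hU: "h holomorphic_on ?U"
    unfolding h_def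
    by (intro holomorphic_intros holomorphic_on_subset[OF z(1)] holomorphic_on_subset[OF z(2)] holomorphic_on_subset[OF H(1)])
       (use US in auto)
  have zU: "(\<lambda>z. c * zeta_aux (z + 1)) holomorphic_on ?U"
    by (intro holomorphic_intros holomorphic_on_subset[OF z(3)]) (use US in auto)
  have qU: "(\<lambda>z. c * zeta_aux (z + 1) / z) holomorphic_on ?U - {0}"
    by (intro holomorphic_intros holomorphic_on_subset[OF zU]) auto
  have "residue g 0 = residue h 0 + residue (\<lambda>z. c * zeta_aux (z + 1) / z) 0"
    unfolding g_def by (rule residue_add[of ?U]) (use hU qU in \<open>auto intro: holomorphic_on_subset\<close>)
  also have "residue h 0 = 0" by (rule residue_holo[OF _ _ hU]) auto
  also have "residue (\<lambda>z. c * zeta_aux (z + 1) / z) 0 = c"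
    using residue_simple[of ?U 0 "\<lambda>z. c * zeta_aux (z + 1)"] zU by (simp add: zeta_aux_1)
  finally have res: "residue g 0 = c" by simp
  have sums: "(\<lambda>n. A (Suc n) * of_nat (Suc n) powr - z) sums g z" if z2: "Re z > 2" for z
  proof -
    have z0: "z \<noteq> 0" using z2 by auto
    have s1: "(\<lambda>n. c1 * of_nat (Suc n) powr - (z - 1)) sums (c1 * (zeta_aux (z - 1) / (z - 1 - 1)))"
      "(\<lambda>n. c0 * of_nat (Suc n) powr - z) sums (c0 * (zeta_aux z / (z - 1)))"
      "(\<lambda>n. c * of_nat (Suc n) powr - (z + 1)) sums (c * (zeta_aux (z + 1) / (z + 1 - 1)))"
      by (intro sums_mult zeta_sums, use z2 in simp)+
    have s2: "(\<lambda>n. a n * of_nat (Suc n) powr - z) sums ?H z"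
      using H(2)[of z] z2 by (simp add: summable_sums)
    have "A (Suc n) * of_nat (Suc n) powr - z = c1 * of_nat (Suc n) powr - (z - 1) + c0 * of_nat (Suc n) powr - z
      + a n * of_nat (Suc n) powr - z + c * of_nat (Suc n) powr - (z + 1)" for n
    proof -
      have e: "(of_nat (Suc n) :: complex) powr - (z - 1) = of_nat (Suc n) * of_nat (Suc n) powr - z"
        "(of_nat (Suc n) :: complex) powr - (z + 1) = of_nat (Suc n) powr - z / of_nat (Suc n)"
      proof -
        have "- (z - 1) = - z + 1" "- (z + 1) = - z - 1" by simp_all
        then show "(of_nat (Suc n) :: complex) powr - (z - 1) = of_nat (Suc n) * of_nat (Suc n) powr - z"
          "(of_nat (Suc n) :: complex) powr - (z + 1) = of_nat (Suc n) powr - z / of_nat (Suc n)"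
          by (simp_all only: powr_add powr_diff) (simp_all del: of_nat_Suc)
      qed
      show ?thesis unfolding e a_def by (simp add: algebra_simps del: of_nat_Suc)
    qed
    moreover have "g z = c1 * (zeta_aux (z - 1) / (z - 1 - 1)) + c0 * (zeta_aux z / (z - 1)) + ?H z + c * (zeta_aux (z + 1) / (z + 1 - 1))"
      by (simp add: g_def h_def)
    ultimately show ?thesis using sums_add[OF sums_add[OF sums_add[OF s1(1) s1(2)] s2] s1(3)] by (simp only:)
  qed
  have "g holomorphic_on (?U - {0})"
    unfolding g_def by (rule holomorphic_on_add[OF holomorphic_on_subset[OF hU] qU]) auto
  then have "\<exists>U. open U \<and> 0 \<in> U \<and> g holomorphic_on (U - {0})" by (intro exI[of _ ?U]) auto
  with g_mer res sums that show ?thesis by blast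
qed

section \<open>The residue of the trace\<close>

text \<open>On the common half plane, which is connected, the difference either vanishes off a
  sparse set or is nonzero off a sparse set. Agreement far to the right excludes the latter, so the
  functions agree near 0.\<close>

lemma meromorphic_residue_unique:
  assumes g: "g meromorphic_on {z. Re z > c}" and g': "g' meromorphic_on {z. Re z > c'}"
    and c: "c < 0" "c' < 0" and eq: "\<And>z. Re z > R \<Longrightarrow> g z = g' z"
  shows "residue g 0 = residue g' 0"
proof -
  let ?c = "max c c'"
  let ?A = "{z. Re z > ?c}"
  have "(\<lambda>z. g z - g' z) meromorphic_on ?A"
    by (intro meromorphic_intros meromorphic_on_subset[OF g] meromorphic_on_subset[OF g']) auto
  then have "eventually (\<lambda>z. g z - g' z = 0) (cosparse ?A) \<or> eventually (\<lambda>z. g z - g' z \<noteq> 0) (cosparse ?A)"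
    by (rule meromorphic_imp_constant_or_avoid)
       (rule open_halfspace_Re_gt, rule convex_connected[OF convex_halfspace_Re_gt])
  moreover have "\<not> eventually (\<lambda>z. g z - g' z \<noteq> 0) (cosparse ?A)"
  proof
    assume ev: "eventually (\<lambda>z. g z - g' z \<noteq> 0) (cosparse ?A)"
    let ?x = "of_real (max R 0 + 1) :: complex"
    have x: "?x \<in> ?A" using c by auto
    have "eventually (\<lambda>z. g z - g' z \<noteq> 0) (at ?x)"
      using eventually_cosparse_imp_eventually_at[OF ev x, of UNIV] by simp
    moreover have "eventually (\<lambda>z. Re z > R) (at ?x)"
      by (rule eventually_at_in_open'[of "{z. Re z > R}", simplified]) (auto intro: open_halfspace_Re_gt)
    ultimately have "eventually (\<lambda>z. False) (at ?x)" by eventually_elim (use eq in auto)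
    then show False by simp
  qed
  ultimately have ev: "eventually (\<lambda>z. g z - g' z = 0) (cosparse ?A)" by blast
  have "eventually (\<lambda>z. g z - g' z = 0) (at 0)"
    using eventually_cosparse_imp_eventually_at[OF ev, of 0 UNIV] c by simp
  then show ?thesis by (intro residue_cong) (auto elim: eventually_mono)
qed

lemma nc_integral_eqI:
  assumes "has_residue_trace \<epsilon> P r" shows "nc_integral \<epsilon> P = r"
  unfolding nc_integral_def
proof (rule the_equality[where P = "has_residue_trace \<epsilon> P", OF assms])
  fix r' assume "has_residue_trace \<epsilon> P r'"
  then obtain R' c' g' where 1: "c' < 0" "g' meromorphic_on {z. Re z > c'}"
    "\<forall>z. Re z > R' \<longrightarrow> g' z = operator_trace (P \<circ> absD_powr \<epsilon> (- z))" "residue g' 0 = r'"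
    unfolding has_residue_trace_def by blast
  obtain R c g where 2: "c < 0" "g meromorphic_on {z. Re z > c}"
    "\<forall>z. Re z > R \<longrightarrow> g z = operator_trace (P \<circ> absD_powr \<epsilon> (- z))" "residue g 0 = r"
    using assms unfolding has_residue_trace_def by blast
  have "residue g' 0 = residue g 0"
    by (rule meromorphic_residue_unique[OF 1(2) 2(2) 1(1) 2(1), of "max R R'"]) (use 1 2 in auto)
  then show "r' = r" using 1 2 by simp
qed

section \<open>The eigenvalues of \<open>D\<close> in coordinates, and the shells\<close>

lemma level_nonneg [simp]: "0 \<le> level x"
  by (simp add: level_def split: prod.split)

lemma level_eq_sz: "level x = sz x"
  by (cases x) (simp add: level_def sz_prod_def sz_nat_def sz_int_def)

definition sigmaD :: "site \<Rightarrow> real" where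
  "sigmaD x = (case x of (s, k, m) \<Rightarrow> if s = 0 \<and> m \<ge> 0 then level x else - level x)"

text \<open>n - i = s + max (- m) 0 vanishes exactly for s = 0 and m \<ge> 0.\<close>

lemma D_eigenvalue_st: "D_eigenvalue (st x) = sigmaD x"
proof -
  obtain s k m where x: "x = (s, k, m)" by (cases x)
  have "level (s, k, m) / 2 - (real k + max (real_of_int m) 0 - level (s, k, m) / 2) = real s + max (- real_of_int m) 0"
    by (simp add: level_def max_def)
  moreover have "real s + max (- real_of_int m) 0 = 0 \<longleftrightarrow> s = 0 \<and> m \<ge> 0" by (auto simp: max_def)
  ultimately show ?thesis
    unfolding x D_eigenvalue_def Rep_st sigmaD_def split \<delta>\<^sub>0_def by simp
qed

lemma abs_sigmaD: "\<bar>sigmaD x\<bar> = level x"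
  by (auto simp: sigmaD_def split: prod.split)

lemma D_zero_iff: "D_eigenvalue (st x) = 0 \<longleftrightarrow> level x = 0"
  unfolding D_eigenvalue_st by (metis abs_eq_0_iff abs_sigmaD)

lemma diagonal_operator_scaled_ket: "diagonal_operator d (c *\<^sub>C ket i) = (c * d i) *\<^sub>C ket i"
proof -
  have "(\<lambda>x. (cmod (d x * coord (c *\<^sub>C ket i) x))\<^sup>2) summable_on {i}" by simp
  then have s: "(\<lambda>x. (cmod (d x * coord (c *\<^sub>C ket i) x))\<^sup>2) summable_on UNIV"
    by (rule summable_on_cong_neutral[THEN iffD1, rotated -1]) (auto simp: coord_ket coord_scaleC)
  have "coord (diagonal_operator d (c *\<^sub>C ket i)) x = d x * coord (c *\<^sub>C ket i) x" for x
    unfolding diagonal_operator_def using s by (simp add: Abs_ell2_inverse)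
  then show ?thesis
    by (intro ell2_eqI) (auto simp: coord_scaleC coord_ket)
qed

definition absD :: "real \<Rightarrow> site \<Rightarrow> complex" where
  "absD \<epsilon> x = complex_of_real (if level x = 0 then \<epsilon> else level x)"

lemma absD_powr_scaled_ket:
  "absD_powr \<epsilon> w (c *\<^sub>C ket (st x)) = (c * absD \<epsilon> x powr w) *\<^sub>C ket (st x)"
  unfolding absD_powr_def diagonal_operator_scaled_ket D_zero_iff
  unfolding D_eigenvalue_st abs_sigmaD absD_def ..

lemma absD_powr_ket: "absD_powr \<epsilon> w (ket (st x)) = absD \<epsilon> x powr w *\<^sub>C ket (st x)"
proof -
  have "1 *\<^sub>C ket (st x) = ket (st x)" by (rule ell2_eqI) (simp add: coord_scaleC)
  then show ?thesis using absD_powr_scaled_ket[of \<epsilon> w 1 x] by simp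
qed

definition shell :: "nat \<Rightarrow> site set" where
  "shell N = {x. level x = real N}"

lemma finite_shell: "finite (shell N)"
proof (rule finite_subset)
  show "shell N \<subseteq> {..N} \<times> {..N} \<times> {- int N..int N}"
    by (auto simp: shell_def level_def)
qed auto

lemma infsum_shells:
  fixes f :: "site \<Rightarrow> complex"
  assumes "f summable_on UNIV" shows "(\<lambda>N. sum f (shell N)) sums infsum f UNIV"
proof -
  have l: "\<exists>N. level x = real N" for x
  proof -
    obtain s k m where x: "x = (s, k, m)" by (cases x)
    have "level x = real (k + s + nat \<bar>m\<bar>)" by (simp add: x level_def)
    then show ?thesis ..
  qed
  let ?S = "Sigma UNIV shell"
  have "((\<lambda>Nx. f (snd Nx)) has_sum infsum f UNIV) ?S = (f has_sum infsum f UNIV) UNIV"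
  proof (rule has_sum_reindex_bij_witness[of _ "\<lambda>x. (SOME N. level x = real N, x)" snd])
    fix Nx :: "nat \<times> site" assume "Nx \<in> ?S"
    then have "level (snd Nx) = real (fst Nx)" by (auto simp: shell_def)
    moreover then have "(SOME N. level (snd Nx) = real N) = fst Nx" by (intro some_equality) auto
    ultimately show "(SOME N. level (snd Nx) = real N, snd Nx) = Nx" by (simp add: prod_eq_iff)
  next
    fix x :: site show "(SOME N. level x = real N, x) \<in> ?S" using someI_ex[OF l[of x]] by (simp add: shell_def)
  qed auto
  then have "((\<lambda>Nx. f (snd Nx)) has_sum infsum f UNIV) ?S" using assms by simp
  then have "((\<lambda>N. sum f (shell N)) has_sum infsum f UNIV) UNIV"
    by (rule has_sum_Sigma') (auto intro: has_sum_finiteI finite_shell)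
  then show ?thesis by (rule has_sum_imp_sums)
qed

text \<open>\<open>Q\<close> may be unbounded, so it enters through its values on multiples of basis
  vectors. Their polynomial growth makes the norms summable for large Re z, which yields a nuclear
  representation along the basis and a trace that can be summed shell by shell.\<close>

lemma nc_integral_asymptotics:
  fixes Q :: opr and d :: "site \<Rightarrow> complex"
  assumes \<epsilon>: "\<epsilon> > 0"
    and hom: "\<And>c x. Q (c *\<^sub>C ket (st x)) = c *\<^sub>C Q (ket (st x))"
    and bound: "\<And>x. norm (Q (ket (st x))) \<le> C * (1 + level x) ^ q"
    and d: "\<And>x. coord (Q (ket (st x))) (st x) = d x"
    and asym: "has_asymptotics (\<lambda>N. sum d (shell N) / of_nat N ^ j) c1 c0 c"
  shows "nc_integral \<epsilon> (Q \<circ> absD_powr \<epsilon> (- of_nat j)) = c"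
proof (rule nc_integral_eqI)
  let ?P = "Q \<circ> absD_powr \<epsilon> (- of_nat j)"
  obtain g where g: "g meromorphic_on {z. Re z > - 1 / 2}" "residue g 0 = c"
    "\<And>z. Re z > 2 \<Longrightarrow> (\<lambda>n. sum d (shell (Suc n)) / of_nat (Suc n) ^ j * of_nat (Suc n) powr - z) sums g z"
    "\<exists>U. open U \<and> 0 \<in> U \<and> g holomorphic_on (U - {0})"
    using dirichlet_residue[OF asym] by blast
  obtain p :: nat where p: "(\<lambda>x::site. 1 / (1 + sz x) ^ p) summable_on UNIV" using summable_sz by blast
  \<comment> \<open>q powers compensate the growth of \<open>Q\<close>, p powers make the sum over
    all sites converge, and 2 puts z where \<open>g\<close> is given by its series.\<close>
  let ?R = "real (q + p) + 2"
  have C: "C \<ge> 0" using order_trans[OF norm_ge_zero bound[of "(0, 0, 0)"]] by (simp add: level_def)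
  have a0: "absD \<epsilon> x \<noteq> 0" for x using \<epsilon> by (simp add: absD_def)
  \<comment> \<open>The contribution of the shell of level 0, where \<epsilon> replaces |D|. It is
    entire in z and so has residue 0.\<close>
  define h where "h = (\<lambda>z. sum d (shell 0) * of_real \<epsilon> powr - of_nat j * of_real \<epsilon> powr - z)"
  have hol_h: "h holomorphic_on S" for S unfolding h_def using \<epsilon> by (intro holomorphic_intros) auto
  have Pket: "(?P \<circ> absD_powr \<epsilon> (- z)) (ket (st x)) = (absD \<epsilon> x powr - of_nat j * absD \<epsilon> x powr - z) *\<^sub>C Q (ket (st x))" for z x
    by (simp add: absD_powr_ket absD_powr_scaled_ket hom mult.commute)
  have nb: "norm ((?P \<circ> absD_powr \<epsilon> (- z)) (ket (st x))) \<le>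
      (2 powr Re z * C + C * \<epsilon> powr - real j * \<epsilon> powr - Re z) * (1 / (1 + sz x) ^ p)" if z: "Re z > ?R" for z x
  proof -
    have n: "norm ((?P \<circ> absD_powr \<epsilon> (- z)) (ket (st x))) = cmod (absD \<epsilon> x powr - of_nat j) * cmod (absD \<epsilon> x powr - z) * norm (Q (ket (st x)))"
      unfolding Pket norm_scaleC norm_mult ..
    show ?thesis
    proof (cases "level x = 0")
      case True
      then have "cmod (absD \<epsilon> x powr - of_nat j) * cmod (absD \<epsilon> x powr - z) = \<epsilon> powr - real j * \<epsilon> powr - Re z"
        unfolding absD_def using \<epsilon> by (simp add: norm_powr_real_powr)
      moreover have "norm (Q (ket (st x))) \<le> C" using bound[of x] True by simp
      ultimately have "norm ((?P \<circ> absD_powr \<epsilon> (- z)) (ket (st x))) \<le> \<epsilon> powr - real j * \<epsilon> powr - Re z * C"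
        unfolding n by (simp add: mult_left_mono)
      moreover have "0 \<le> 2 powr Re z * C" using C by simp
      moreover have "1 / (1 + sz x) ^ p = 1" using True by (simp add: level_eq_sz)
      ultimately show ?thesis by (simp add: mult_ac)
    next
      case False
      define L where "L = level x"
      have "\<exists>N. L = real N"
      proof -
        obtain s k m where x: "x = (s, k, m)" by (cases x)
        have "L = real (k + s + nat \<bar>m\<bar>)" by (simp add: L_def x level_def)
        then show ?thesis ..
      qed
      then have L1: "L \<ge> 1" using False unfolding L_def by (auto simp: not_le)
      have a: "absD \<epsilon> x = of_real L" using False by (simp add: absD_def L_def)
      have 1: "cmod (absD \<epsilon> x powr - of_nat j) \<le> 1"
        unfolding a using L1 powr_mono[of "- real j" 0 L] by (simp add: norm_powr_real_powr)
      have "cmod (absD \<epsilon> x powr - z) = L powr - Re z" unfolding a using L1 by (simp add: norm_powr_real_powr)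
      \<comment> \<open>L \<ge> (1 + L) / 2 because L \<ge> 1; this passes from powers of the level
        to powers of 1 + sz x at the price of 2 powr Re z.\<close>
      also have "\<dots> \<le> ((1 + L) / 2) powr - Re z" using L1 z by (intro powr_mono2') auto
      also have "\<dots> = 2 powr Re z * (1 + L) powr - Re z" using L1 by (simp add: powr_divide powr_minus field_simps)
      also have "\<dots> \<le> 2 powr Re z * (1 + L) powr - real (q + p)" using L1 z by (intro mult_left_mono powr_mono) auto
      also have "(1 + L) powr - real (q + p) = 1 / ((1 + L) ^ q * (1 + L) ^ p)"
        unfolding powr_minus_divide using L1 by (subst powr_realpow) (auto simp: power_add)
      finally have 2: "cmod (absD \<epsilon> x powr - z) \<le> 2 powr Re z * (1 / ((1 + L) ^ q * (1 + L) ^ p))" .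
      have "norm ((?P \<circ> absD_powr \<epsilon> (- z)) (ket (st x))) \<le> 1 * (2 powr Re z * (1 / ((1 + L) ^ q * (1 + L) ^ p))) * (C * (1 + L) ^ q)"
        unfolding n using 1 2 bound[of x] L1 by (intro mult_mono) (auto simp: L_def)
      also have "\<dots> = 2 powr Re z * C * (1 / (1 + sz x) ^ p)" using L1 by (simp add: L_def level_eq_sz)
      also have "\<dots> \<le> (2 powr Re z * C + C * \<epsilon> powr - real j * \<epsilon> powr - Re z) * (1 / (1 + sz x) ^ p)"
        using C by (intro mult_right_mono) auto
      finally show ?thesis .
    qed
  qed
  have sn: "(\<lambda>i. norm ((?P \<circ> absD_powr \<epsilon> (- z)) (ket i))) summable_on UNIV" if z: "Re z > ?R" for z
  proof -
    have "(\<lambda>x. norm ((?P \<circ> absD_powr \<epsilon> (- z)) (ket (st x)))) summable_on UNIV"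
      by (rule Infinite_Sum.abs_summable_on_comparison_test'[OF summable_on_cmult_right[OF p]]) (rule nb[OF z])
    then show ?thesis using summable_on_reindex_bij_betw[OF bij_st, of "\<lambda>i. norm ((?P \<circ> absD_powr \<epsilon> (- z)) (ket i))"] by simp
  qed
  have tc: "trace_class (?P \<circ> absD_powr \<epsilon> (- z))" if z: "Re z > ?R" for z
    unfolding trace_class_def
  proof (intro exI conjI allI)
    show "(\<lambda>i. norm ((?P \<circ> absD_powr \<epsilon> (- z)) (ket i)) * norm (ket i :: hilb)) summable_on UNIV"
      using sn[OF z] by (simp add: norm_ket)
    fix i
    have "(\<Sum>\<^sub>\<infinity>k. cinner (ket k) (ket i) *\<^sub>C (?P \<circ> absD_powr \<epsilon> (- z)) (ket k)) = (\<Sum>\<^sub>\<infinity>k\<in>{i}. (?P \<circ> absD_powr \<epsilon> (- z)) (ket k))"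
      by (rule infsum_cong_neutral) (auto intro!: ell2_eqI simp: cinner_ket_left coord_ket coord_scaleC coord_zero)
    then show "(?P \<circ> absD_powr \<epsilon> (- z)) (ket i) = (\<Sum>\<^sub>\<infinity>k. cinner (ket k) (ket i) *\<^sub>C (?P \<circ> absD_powr \<epsilon> (- z)) (ket k))"
      by simp
  qed
  have tr: "g z + h z = operator_trace (?P \<circ> absD_powr \<epsilon> (- z))" if z: "Re z > ?R" for z
  proof -
    let ?f = "\<lambda>x. absD \<epsilon> x powr - of_nat j * absD \<epsilon> x powr - z * d x"
    let ?T = "?P \<circ> absD_powr \<epsilon> (- z)"
    have f: "coord (?T (ket (st x))) (st x) = ?f x" for x unfolding Pket by (simp add: coord_scaleC d)
    have "(\<lambda>i. coord (?T (ket i)) i) summable_on UNIV"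
      by (rule abs_summable_summable, rule Infinite_Sum.abs_summable_on_comparison_test'[OF sn[OF z]]) (rule coord_le_norm)
    then have fs: "?f summable_on UNIV"
      unfolding f[symmetric] summable_on_reindex_bij_betw[OF bij_st, of "\<lambda>i. coord (?T (ket i)) i"] .
    have "operator_trace ?T = (\<Sum>\<^sub>\<infinity>x. coord (?T (ket (st x))) (st x))"
      unfolding operator_trace_def cinner_ket_left
      by (rule infsum_reindex_bij_betw[OF bij_st, symmetric])
    also have "\<dots> = infsum ?f UNIV" unfolding f ..
    finally have "(\<lambda>N. sum ?f (shell N)) sums operator_trace ?T" using infsum_shells[OF fs] by simp
    then have s1: "(\<lambda>N. sum ?f (shell (Suc N))) sums (operator_trace ?T - sum ?f (shell 0))"
      by (subst sums_Suc_iff) simp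
    have "sum ?f (shell (Suc n)) = sum d (shell (Suc n)) / of_nat (Suc n) ^ j * of_nat (Suc n) powr - z" for n
    proof -
      have "?f x = 1 / of_nat (Suc n) ^ j * of_nat (Suc n) powr - z * d x" if x: "x \<in> shell (Suc n)" for x
      proof -
        have "absD \<epsilon> x = of_nat (Suc n)" using x by (simp add: absD_def shell_def)
        moreover have "(of_nat (Suc n) :: complex) powr - of_nat j = 1 / of_nat (Suc n) ^ j"
          unfolding powr_minus by (subst powr_nat') (auto simp: field_simps simp del: of_nat_Suc)
        ultimately show ?thesis by (simp del: of_nat_Suc)
      qed
      then have e: "sum ?f (shell (Suc n)) = (\<Sum>x\<in>shell (Suc n). 1 / of_nat (Suc n) ^ j * of_nat (Suc n) powr - z * d x)"
        by (rule sum.cong[OF refl])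
      show ?thesis unfolding e sum_distrib_left[symmetric] by (simp del: of_nat_Suc)
    qed
    then have "(\<lambda>N. sum ?f (shell (Suc N))) sums g z" using g(3)[of z] z by (simp del: of_nat_Suc)
    with s1 have "operator_trace ?T - sum ?f (shell 0) = g z" by (rule sums_unique2)
    moreover have "sum ?f (shell 0) = h z"
    proof -
      have "sum ?f (shell 0) = (\<Sum>x\<in>shell 0. of_real \<epsilon> powr - of_nat j * of_real \<epsilon> powr - z * d x)"
        by (rule sum.cong) (auto simp: shell_def absD_def)
      then show ?thesis unfolding h_def sum_distrib_left[symmetric] by (simp add: mult_ac)
    qed
    ultimately show ?thesis by (simp add: algebra_simps)
  qed
  have "residue (\<lambda>z. g z + h z) 0 = c"
  proof -
    obtain U where U: "open U" "0 \<in> U" "g holomorphic_on (U - {0})" using g(4) by blast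
    have "residue (\<lambda>z. g z + h z) 0 = residue g 0 + residue h 0" by (rule residue_add[OF U hol_h])
    also have "residue h 0 = 0" by (rule residue_holo[OF _ _ hol_h[of UNIV]]) auto
    finally show ?thesis using g(2) by simp
  qed
  moreover have "(\<lambda>z. g z + h z) meromorphic_on {z. Re z > - 1 / 2}"
    by (intro meromorphic_intros g(1) analytic_on_imp_meromorphic_on)
       (simp add: analytic_on_open open_halfspace_Re_gt hol_h)
  ultimately show "has_residue_trace \<epsilon> ?P c"
    unfolding has_residue_trace_def using tc tr
    by (intro exI[of _ ?R] exI[of _ "- 1 / 2"] exI[of _ "\<lambda>z. g z + h z"]) auto
qed

section \<open>Operators on rapidly decaying vectors\<close>

lemma one_plus_ydist_neq_0 [simp]: "1 + ydist y z \<noteq> 0"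
  using ydist_nonneg[of y z] by linarith

text \<open>The common invariant domain: it lies in the domain of \<open>D\<close>, is mapped into
  itself by \<open>D\<close> and by the elements of the algebra, and contains the basis
  vectors.\<close>

definition rd_vec :: "hilb \<Rightarrow> bool" where
  "rd_vec \<xi> \<longleftrightarrow> rd (cf \<xi>)"

text \<open>The order of growth \<open>q\<close> is chosen before the decay exponent
  \<open>r\<close>. With this order of quantifiers products are again tempered and rapidly decaying
  vectors stay so.\<close>

definition tempered :: "mat \<Rightarrow> bool" where
  "tempered M \<longleftrightarrow> (\<exists>q. \<forall>r. \<exists>C. \<forall>s y z. cmod (M s y z) \<le> C * (1 + sz (s, z)) ^ q / (1 + ydist y z) ^ r)"

lemma tempered_bound:
  assumes "tempered M"
  shows "\<exists>q. \<forall>r. \<exists>C>0. \<forall>s y z. cmod (M s y z) \<le> C * (1 + sz (s, z)) ^ q / (1 + ydist y z) ^ r"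
proof -
  obtain q where q: "\<And>r. \<exists>C. \<forall>s y z. cmod (M s y z) \<le> C * (1 + sz (s, z)) ^ q / (1 + ydist y z) ^ r"
    using assms unfolding tempered_def by blast
  have "\<exists>C>0. \<forall>s y z. cmod (M s y z) \<le> C * (1 + sz (s, z)) ^ q / (1 + ydist y z) ^ r" for r
  proof -
    obtain C where C: "\<And>s y z. cmod (M s y z) \<le> C * (1 + sz (s, z)) ^ q / (1 + ydist y z) ^ r" using q[of r] by blast
    have "cmod (M s y z) \<le> max C 1 * (1 + sz (s, z)) ^ q / (1 + ydist y z) ^ r" for s y z
      by (rule order_trans[OF C]) (intro divide_right_mono mult_right_mono, simp_all)
    then show ?thesis by (intro exI[of _ "max C 1"]) auto
  qed
  then show ?thesis by blast
qed

lemma sz_site_le: "sz (s, y) \<le> sz (s, z) + ydist y z" for s :: nat and y z :: "nat \<times> int"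
  by (cases y; cases z) (simp add: sz_prod_def sz_nat_def sz_int_def ydist_def)

lemma power_sz_site_le: "(1 + sz (s, y)) ^ r \<le> (1 + sz (s, z)) ^ r * (1 + ydist y z) ^ r" for s :: nat and y z :: "nat \<times> int"
  unfolding power_mult_distrib[symmetric]
  by (intro power_mono one_plus_mult_le sz_site_le) (auto simp: add_nonneg_nonneg)

lemma tempered_apply_bound:
  fixes \<phi> :: "site \<Rightarrow> complex"
  assumes M: "tempered M" and \<phi>: "rd \<phi>"
  shows "\<exists>C>0. \<forall>s y z. cmod (M s y z * \<phi> (s, z)) \<le> C / (1 + sz (s, y)) ^ r / (1 + ydist y z) ^ p0"
proof -
  obtain q where q: "\<And>r. \<exists>C>0. \<forall>s y z. cmod (M s y z) \<le> C * (1 + sz (s, z)) ^ q / (1 + ydist y z) ^ r"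
    using tempered_bound[OF M] by blast
  obtain C where C: "C > 0" "\<And>s y z. cmod (M s y z) \<le> C * (1 + sz (s, z)) ^ q / (1 + ydist y z) ^ (r + p0)"
    using q[of "r + p0"] by blast
  obtain C' where C': "C' > 0" "\<And>x. cmod (\<phi> x) \<le> C' / (1 + sz x) ^ (q + r)" using \<phi> by (rule rdE) auto
  have "cmod (M s y z * \<phi> (s, z)) \<le> C * C' / (1 + sz (s, y)) ^ r / (1 + ydist y z) ^ p0" for s y z
  proof -
    have "cmod (M s y z * \<phi> (s, z)) \<le> C * (1 + sz (s, z)) ^ q / (1 + ydist y z) ^ (r + p0) * (C' / (1 + sz (s, z)) ^ (q + r))"
      unfolding norm_mult using C(1) by (intro mult_mono C C') auto
    also have "\<dots> = C * C' / ((1 + sz (s, z)) ^ r * (1 + ydist y z) ^ r) / (1 + ydist y z) ^ p0"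
      by (simp add: power_add)
    also have "\<dots> \<le> C * C' / (1 + sz (s, y)) ^ r / (1 + ydist y z) ^ p0"
      using C(1) C'(1) power_sz_site_le[of s y r z]
      by (intro divide_right_mono divide_left_mono mult_pos_pos) (auto intro: less_imp_le)
    finally show ?thesis .
  qed
  with C(1) C'(1) show ?thesis by (intro exI[of _ "C * C'"]) auto
qed

lemma tempered_apply:
  assumes M: "tempered M" and \<phi>: "rd \<phi>"
  shows "(\<lambda>z. cmod (M s y z * \<phi> (s, z))) summable_on UNIV" "(\<lambda>z. M s y z * \<phi> (s, z)) summable_on UNIV"
    and "rd (\<lambda>(s, y). \<Sum>\<^sub>\<infinity>z. M s y z * \<phi> (s, z))"
proof -
  obtain C where C: "C > 0" "\<And>s y z. cmod (M s y z * \<phi> (s, z)) \<le> C / (1 + sz (s, y)) ^ 0 / (1 + ydist y z) ^ p0"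
    using tempered_apply_bound[OF M \<phi>, of 0] by blast
  show "(\<lambda>z. cmod (M s y z * \<phi> (s, z))) summable_on UNIV" "(\<lambda>z. M s y z * \<phi> (s, z)) summable_on UNIV"
    by (rule ydist_estimate(1)[OF C(2)], use C(1) in simp, rule ydist_estimate(2)[OF C(2)], use C(1) in simp)
  show "rd (\<lambda>(s, y). \<Sum>\<^sub>\<infinity>z. M s y z * \<phi> (s, z))"
  proof (rule rdI)
    fix r
    obtain C where C: "C > 0" "\<And>s y z. cmod (M s y z * \<phi> (s, z)) \<le> C / (1 + sz (s, y)) ^ r / (1 + ydist y z) ^ p0"
      using tempered_apply_bound[OF M \<phi>, of r] by blast
    have "cmod (\<Sum>\<^sub>\<infinity>z. M s y z * \<phi> (s, z)) \<le> C / (1 + sz (s, y)) ^ r * S0" for s y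
      by (rule ydist_estimate(3)[OF C(2)]) (use C(1) in \<open>simp add: less_imp_le\<close>)
    then show "\<exists>C. \<forall>x. cmod (case x of (s, y) \<Rightarrow> \<Sum>\<^sub>\<infinity>z. M s y z * \<phi> (s, z)) \<le> C / (1 + sz x) ^ r"
      by (intro exI[of _ "C * S0"]) (auto simp: split_paired_all)
  qed
qed

definition has_matrix :: "opr \<Rightarrow> mat \<Rightarrow> bool" where
  "has_matrix T M \<longleftrightarrow> tempered M \<and>
     (\<forall>\<xi>. rd_vec \<xi> \<longrightarrow> (\<forall>s y. cf (T \<xi>) (s, y) = (\<Sum>\<^sub>\<infinity>z. M s y z * cf \<xi> (s, z))))"

lemma has_matrixD:
  "has_matrix T M \<Longrightarrow> rd_vec \<xi> \<Longrightarrow> cf (T \<xi>) (s, y) = (\<Sum>\<^sub>\<infinity>z. M s y z * cf \<xi> (s, z))"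
  by (simp add: has_matrix_def del: split_paired_All)

lemma has_matrixI:
  "tempered M \<Longrightarrow> (\<And>\<xi> s y. rd_vec \<xi> \<Longrightarrow> cf (T \<xi>) (s, y) = (\<Sum>\<^sub>\<infinity>z. M s y z * cf \<xi> (s, z))) \<Longrightarrow> has_matrix T M"
  by (simp add: has_matrix_def del: split_paired_All)

lemma has_matrix_tempered: "has_matrix T M \<Longrightarrow> tempered M"
  by (simp add: has_matrix_def)

lemma has_matrix_rd_vec:
  assumes "has_matrix T M" "rd_vec \<xi>" shows "rd_vec (T \<xi>)"
proof -
  have "cf (T \<xi>) = (\<lambda>(s, y). \<Sum>\<^sub>\<infinity>z. M s y z * cf \<xi> (s, z))"
    by (rule ext) (simp only: split_paired_all split has_matrixD[OF assms])
  then show ?thesis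
    using tempered_apply(3)[OF has_matrix_tempered[OF assms(1)], of "cf \<xi>"] assms(2) by (simp add: rd_vec_def)
qed

lemma has_matrix_kernel:
  assumes "has_kernel a c t" shows "has_matrix a (ker c t)"
proof (rule has_matrixI)
  show "tempered (ker c t)"
    unfolding tempered_def
  proof (rule exI[of _ 0], rule allI)
    fix r
    obtain C where "C > 0" "\<And>s y z. cmod (ker c t s y z) \<le> C / (1 + ydist y z) ^ r"
      by (rule toeplitz_mod_bound[OF toeplitz_mod_ker[OF has_kernel_rd[OF assms]], where r = r]) blast
    then show "\<exists>C. \<forall>s y z. cmod (ker c t s y z) \<le> C * (1 + sz (s, z)) ^ 0 / (1 + ydist y z) ^ r" by auto
  qed
qed (rule has_kernelD[OF assms])

lemma tempered_mult:
  assumes M: "tempered M" and M': "tempered M'" shows "tempered (mat_mult M M')"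
proof -
  obtain q where q: "\<And>r. \<exists>C>0. \<forall>s y z. cmod (M s y z) \<le> C * (1 + sz (s, z)) ^ q / (1 + ydist y z) ^ r"
    using tempered_bound[OF M] by blast
  obtain q' where q': "\<And>r. \<exists>C>0. \<forall>s y z. cmod (M' s y z) \<le> C * (1 + sz (s, z)) ^ q' / (1 + ydist y z) ^ r"
    using tempered_bound[OF M'] by blast
  have "\<exists>C. \<forall>s y z. cmod (mat_mult M M' s y z) \<le> C * (1 + sz (s, z)) ^ (q + q') / (1 + ydist y z) ^ r" for r
  proof -
    obtain C where C: "C > 0" "\<And>s y z. cmod (M s y z) \<le> C * (1 + sz (s, z)) ^ q / (1 + ydist y z) ^ (r + p0)"
      using q[of "r + p0"] by blast
    obtain C' where C': "C' > 0" "\<And>s y z. cmod (M' s y z) \<le> C' * (1 + sz (s, z)) ^ q' / (1 + ydist y z) ^ (q + r)"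
      using q'[of "q + r"] by blast
    have b: "cmod (M s y w * M' s w z) \<le> C * C' * (1 + sz (s, z)) ^ (q + q') / (1 + ydist y z) ^ r / (1 + ydist y w) ^ p0" for s y z w
    proof -
      have "cmod (M s y w * M' s w z) \<le> C * (1 + sz (s, w)) ^ q / (1 + ydist y w) ^ (r + p0) * (C' * (1 + sz (s, z)) ^ q' / (1 + ydist w z) ^ (q + r))"
        unfolding norm_mult using C(1) by (intro mult_mono C C') auto
      also have "\<dots> \<le> C * ((1 + sz (s, z)) ^ q * (1 + ydist w z) ^ q) / (1 + ydist y w) ^ (r + p0) * (C' * (1 + sz (s, z)) ^ q' / (1 + ydist w z) ^ (q + r))"
        using C(1) C'(1) by (intro mult_right_mono divide_right_mono mult_left_mono power_sz_site_le) auto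
      also have "\<dots> = C * C' * (1 + sz (s, z)) ^ (q + q') / ((1 + ydist y w) ^ r * (1 + ydist w z) ^ r) / (1 + ydist y w) ^ p0"
        using power_ydist_pos[of w z q] by (simp add: power_add mult_ac)
      also have "\<dots> \<le> C * C' * (1 + sz (s, z)) ^ (q + q') / (1 + ydist y z) ^ r / (1 + ydist y w) ^ p0"
      proof (intro divide_right_mono divide_left_mono mult_pos_pos)
        show "(1 + ydist y z) ^ r \<le> (1 + ydist y w) ^ r * (1 + ydist w z) ^ r"
          unfolding power_mult_distrib[symmetric]
          by (intro power_mono one_plus_mult_le ydist_triangle) (auto simp: add_nonneg_nonneg)
      qed (use C(1) C'(1) in \<open>auto intro: less_imp_le\<close>)
      finally show ?thesis .
    qed
    have "cmod (mat_mult M M' s y z) \<le> C * C' * (1 + sz (s, z)) ^ (q + q') / (1 + ydist y z) ^ r * S0" for s y z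
      unfolding mat_mult_def by (rule ydist_estimate(3)[OF b]) (use C(1) C'(1) in \<open>simp add: less_imp_le\<close>)
    then show ?thesis by (intro exI[of _ "C * C' * S0"]) (auto simp: mult_ac)
  qed
  then show ?thesis unfolding tempered_def by blast
qed

lemma tempered_abs: "tempered M \<Longrightarrow> tempered (\<lambda>s y z. of_real (cmod (M s y z)))"
  by (simp add: tempered_def)

text \<open>To exchange the sums, the bound for tempered matrices is applied to the absolute values
  of M' and of the coordinates of \<xi>: these give a rapidly decaying vector \<psi>, to which M is
  applied.\<close>

lemma has_matrix_comp:
  assumes T: "has_matrix T M" and T': "has_matrix T' M'"
  shows "has_matrix (T \<circ> T') (mat_mult M M')"
proof (rule has_matrixI)
  note M = has_matrix_tempered[OF T] and M' = has_matrix_tempered[OF T']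
  show "tempered (mat_mult M M')" by (rule tempered_mult[OF M M'])
  fix \<xi> s and y :: "nat \<times> int" assume \<xi>: "rd_vec \<xi>"
  then have \<phi>: "rd (cf \<xi>)" by (simp add: rd_vec_def)
  let ?\<phi> = "\<lambda>z. cf \<xi> (s, z)"
  let ?\<psi> = "\<lambda>(s, w). \<Sum>\<^sub>\<infinity>z. of_real (cmod (M' s w z)) * complex_of_real (cmod (cf \<xi> (s, z)))"
  have \<phi>': "rd (\<lambda>x. complex_of_real (cmod (cf \<xi> x)))" by (rule rd_mono[OF \<phi>]) simp
  have \<psi>: "rd ?\<psi>" by (rule tempered_apply(3)[OF tempered_abs[OF M'] \<phi>'])
  have s: "(\<lambda>(w, z). M s y w * (M' s w z * ?\<phi> z)) summable_on UNIV \<times> UNIV"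
  proof (rule abs_summable_pairI)
    show "(\<lambda>z. cmod (M s y w * (M' s w z * ?\<phi> z))) summable_on UNIV" for w
      using summable_on_cmult_right[OF tempered_apply(1)[OF M' \<phi>], of "cmod (M s y w)" s w] by (simp add: norm_mult)
    have "cmod (M s y w * ?\<psi> (s, w)) = (\<Sum>\<^sub>\<infinity>z. cmod (M s y w * (M' s w z * ?\<phi> z)))" for w
    proof -
      have hs: "((\<lambda>z. complex_of_real (cmod (M' s w z * ?\<phi> z))) has_sum of_real (\<Sum>\<^sub>\<infinity>z. cmod (M' s w z * ?\<phi> z))) UNIV"
        by (rule has_sum_bounded_linear[OF bounded_linear_of_real has_sum_infsum[OF tempered_apply(1)[OF M' \<phi>]]])
      have "?\<psi> (s, w) = of_real (\<Sum>\<^sub>\<infinity>z. cmod (M' s w z * ?\<phi> z))"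
        using infsumI[OF hs] by (simp add: norm_mult)
      moreover have "0 \<le> (\<Sum>\<^sub>\<infinity>z. cmod (M' s w z * ?\<phi> z))" by (rule infsum_nonneg) simp
      ultimately show ?thesis by (simp only: norm_mult norm_of_real abs_of_nonneg infsum_cmult_right')
    qed
    then show "(\<lambda>w. \<Sum>\<^sub>\<infinity>z. cmod (M s y w * (M' s w z * ?\<phi> z))) summable_on UNIV"
      using tempered_apply(1)[OF M \<psi>, of s y] by (simp only:)
  qed
  have "cf ((T \<circ> T') \<xi>) (s, y) = (\<Sum>\<^sub>\<infinity>w. M s y w * (\<Sum>\<^sub>\<infinity>z. M' s w z * ?\<phi> z))"
    by (simp add: has_matrixD[OF T has_matrix_rd_vec[OF T' \<xi>]] has_matrixD[OF T' \<xi>])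
  also have "\<dots> = (\<Sum>\<^sub>\<infinity>w. \<Sum>\<^sub>\<infinity>z. M s y w * (M' s w z * ?\<phi> z))"
    by (simp add: infsum_cmult_right')
  also have "\<dots> = (\<Sum>\<^sub>\<infinity>z. \<Sum>\<^sub>\<infinity>w. M s y w * (M' s w z * ?\<phi> z))"
    by (rule infsum_swap_banach[OF s])
  also have "\<dots> = (\<Sum>\<^sub>\<infinity>z. mat_mult M M' s y z * ?\<phi> z)"
    by (simp add: mat_mult_def infsum_cmult_left' flip: mult.assoc)
  finally show "cf ((T \<circ> T') \<xi>) (s, y) = (\<Sum>\<^sub>\<infinity>z. mat_mult M M' s y z * ?\<phi> z)" .
qed

text \<open>Moving the growth of the eigenvalue at (s, y) to (s, z) costs \<open>e\<close> powers of
  the distance, which is why the decay e + r is requested from M. It is stated for a general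
  diagonal action so that it serves \<open>D\<close> as well as \<open>D \<circ> D\<close>.\<close>

lemma has_matrix_commutator:
  fixes \<delta> :: "site \<Rightarrow> complex"
  assumes \<Delta>: "\<And>\<xi> x. rd_vec \<xi> \<Longrightarrow> cf (\<Delta> \<xi>) x = \<delta> x * cf \<xi> x"
    and \<delta>: "\<And>x. cmod (\<delta> x) \<le> (1 + sz x) ^ e"
    and T: "has_matrix T M"
  shows "has_matrix (commutator \<Delta> T) (\<lambda>s y z. (\<delta> (s, y) - \<delta> (s, z)) * M s y z)"
proof (rule has_matrixI)
  note M = has_matrix_tempered[OF T]
  obtain q where q: "\<And>r. \<exists>C>0. \<forall>s y z. cmod (M s y z) \<le> C * (1 + sz (s, z)) ^ q / (1 + ydist y z) ^ r"
    using tempered_bound[OF M] by blast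
  have "\<exists>C. \<forall>s y z. cmod ((\<delta> (s, y) - \<delta> (s, z)) * M s y z) \<le> C * (1 + sz (s, z)) ^ (e + q) / (1 + ydist y z) ^ r" for r
  proof -
    obtain C where C: "C > 0" "\<And>s y z. cmod (M s y z) \<le> C * (1 + sz (s, z)) ^ q / (1 + ydist y z) ^ (e + r)"
      using q[of "e + r"] by blast
    have "cmod ((\<delta> (s, y) - \<delta> (s, z)) * M s y z) \<le> 2 * C * (1 + sz (s, z)) ^ (e + q) / (1 + ydist y z) ^ r" for s y z
    proof -
      have "cmod (\<delta> (s, y) - \<delta> (s, z)) \<le> (1 + sz (s, y)) ^ e + (1 + sz (s, z)) ^ e"
        by (rule order_trans[OF norm_triangle_ineq4 add_mono[OF \<delta> \<delta>]])
      also have "\<dots> \<le> (1 + sz (s, z)) ^ e * (1 + ydist y z) ^ e + (1 + sz (s, z)) ^ e * (1 + ydist y z) ^ e"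
        using mult_left_mono[of 1 "(1 + ydist y z) ^ e" "(1 + sz (s, z)) ^ e"]
        by (intro add_mono power_sz_site_le) (simp add: one_le_power less_imp_le)
      finally have "cmod ((\<delta> (s, y) - \<delta> (s, z)) * M s y z) \<le>
          2 * ((1 + sz (s, z)) ^ e * (1 + ydist y z) ^ e) * (C * (1 + sz (s, z)) ^ q / (1 + ydist y z) ^ (e + r))"
        unfolding norm_mult by (intro mult_mono C) (simp_all add: algebra_simps)
      also have "\<dots> = 2 * C * (1 + sz (s, z)) ^ (e + q) / (1 + ydist y z) ^ r"
        using power_ydist_pos[of y z e] by (simp add: power_add)
      finally show ?thesis .
    qed
    then show ?thesis by blast
  qed
  then show "tempered (\<lambda>s y z. (\<delta> (s, y) - \<delta> (s, z)) * M s y z)" unfolding tempered_def by blast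
  fix \<xi> s and y :: "nat \<times> int" assume \<xi>: "rd_vec \<xi>"
  have \<Delta>\<xi>: "rd_vec (\<Delta> \<xi>)"
  proof -
    have "cf (\<Delta> \<xi>) = (\<lambda>x. \<delta> x * cf \<xi> x)" using \<Delta>[OF \<xi>] by blast
    then show ?thesis using rd_poly_mult[of "cf \<xi>" \<delta> 1 e] \<xi> \<delta> by (simp add: rd_vec_def)
  qed
  have "cf (commutator \<Delta> T \<xi>) (s, y) = \<delta> (s, y) * (\<Sum>\<^sub>\<infinity>z. M s y z * cf \<xi> (s, z)) - (\<Sum>\<^sub>\<infinity>z. M s y z * (\<delta> (s, z) * cf \<xi> (s, z)))"
    unfolding commutator_def cf_minus
    by (simp only: \<Delta>[OF has_matrix_rd_vec[OF T \<xi>]] has_matrixD[OF T \<xi>] has_matrixD[OF T \<Delta>\<xi>] \<Delta>[OF \<xi>])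
  also have "\<dots> = (\<Sum>\<^sub>\<infinity>z. \<delta> (s, y) * (M s y z * cf \<xi> (s, z)) - M s y z * (\<delta> (s, z) * cf \<xi> (s, z)))"
    using tempered_apply(2)[OF M, of "cf \<xi>" s y] tempered_apply(2)[OF M, of "cf (\<Delta> \<xi>)" s y] \<xi> \<Delta>\<xi>
    by (subst infsum_minus(1)) (auto simp: rd_vec_def \<Delta>[OF \<xi>] infsum_cmult_right' intro: summable_on_cmult_right)
  also have "\<dots> = (\<Sum>\<^sub>\<infinity>z. (\<delta> (s, y) - \<delta> (s, z)) * M s y z * cf \<xi> (s, z))"
    by (rule infsum_cong) (simp add: algebra_simps)
  finally show "cf (commutator \<Delta> T \<xi>) (s, y) = (\<Sum>\<^sub>\<infinity>z. (\<delta> (s, y) - \<delta> (s, z)) * M s y z * cf \<xi> (s, z))" .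
qed

section \<open>The action of \<open>D\<close> on rapidly decaying vectors, and residues of operators
  with a matrix\<close>

lemma rd_square_summable:
  assumes "rd f" shows "(\<lambda>x. (cmod (f x))\<^sup>2) summable_on UNIV"
proof -
  obtain C where C: "C > 0" "\<And>x. cmod (f x) \<le> C" using rd_bounded[OF assms] by blast
  show ?thesis
    by (rule summable_on_comparison_test[OF summable_on_cmult_right[OF rd_abs_summable[OF assms], of C]])
       (auto simp: power2_eq_square intro!: mult_right_mono C)
qed

text \<open>For a rapidly decaying vector the products with the eigenvalues are still square
  summable, so the first branch of \<open>diagonal_operator\<close> applies.\<close>

lemma cf_D:
  assumes \<xi>: "rd_vec \<xi>" shows "cf (D \<xi>) x = of_real (sigmaD x) * cf \<xi> x"
proof -
  have r: "rd (\<lambda>x. of_real (sigmaD x) * cf \<xi> x)"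
    using \<xi> by (intro rd_poly_mult[of "cf \<xi>" _ 1 1]) (auto simp: rd_vec_def abs_sigmaD level_eq_sz)
  let ?d = "\<lambda>i. complex_of_real (D_eigenvalue i)"
  have "(\<lambda>x. (cmod (?d (st x) * coord \<xi> (st x)))\<^sup>2) summable_on UNIV"
    using rd_square_summable[OF r] by (simp add: norm_mult cmod_cf D_eigenvalue_st)
  then have "(\<lambda>i. (cmod (?d i * coord \<xi> i))\<^sup>2) summable_on UNIV"
    using summable_on_reindex_bij_betw[OF bij_st, of "\<lambda>i. (cmod (?d i * coord \<xi> i))\<^sup>2"] by simp
  then have "coord (D \<xi>) i = ?d i * coord \<xi> i" for i
    unfolding D_def diagonal_operator_def by (simp add: Abs_ell2_inverse)
  then show ?thesis by (simp add: cf_def D_eigenvalue_st)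
qed

lemma rd_vec_D: "rd_vec \<xi> \<Longrightarrow> rd_vec (D \<xi>)"
proof -
  assume \<xi>: "rd_vec \<xi>"
  have "cf (D \<xi>) = (\<lambda>x. of_real (sigmaD x) * cf \<xi> x)" using cf_D[OF \<xi>] by blast
  moreover have "rd (\<lambda>x. of_real (sigmaD x) * cf \<xi> x)"
    using \<xi> by (intro rd_poly_mult[of "cf \<xi>" _ 1 1]) (auto simp: rd_vec_def abs_sigmaD level_eq_sz)
  ultimately show ?thesis by (simp add: rd_vec_def)
qed

lemma has_matrix_commutator_D:
  "has_matrix T M \<Longrightarrow> has_matrix (commutator D T) (\<lambda>s y z. of_real (sigmaD (s, y) - sigmaD (s, z)) * M s y z)"
  using has_matrix_commutator[of D "\<lambda>x. of_real (sigmaD x)" 1 T M]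
  by (simp add: cf_D abs_sigmaD level_eq_sz)

lemma has_matrix_nabla:
  assumes "has_matrix T M"
  shows "has_matrix (nabla T) (\<lambda>s y z. of_real ((level (s, y))\<^sup>2 - (level (s, z))\<^sup>2) * M s y z)"
proof -
  have sq: "sigmaD x * sigmaD x = (level x)\<^sup>2" for x using abs_sigmaD[of x] by (metis power2_abs power2_eq_square)
  have "has_matrix (commutator (D \<circ> D) T) (\<lambda>s y z. (of_real ((level (s, y))\<^sup>2) - of_real ((level (s, z))\<^sup>2)) * M s y z)"
  proof (rule has_matrix_commutator[OF _ _ assms, of "D \<circ> D" "\<lambda>x. of_real ((level x)\<^sup>2)" 2])
    show "cf ((D \<circ> D) \<xi>) x = of_real ((level x)\<^sup>2) * cf \<xi> x" if "rd_vec \<xi>" for \<xi> x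
      using that by (simp add: cf_D rd_vec_D sq[symmetric])
    show "cmod (of_real ((level x)\<^sup>2)) \<le> (1 + sz x)\<^sup>2" for x
      by (simp add: norm_power level_eq_sz power_mono)
  qed
  then show ?thesis by (simp add: nabla_def)
qed

lemma rd_vec_ket: "rd_vec (ket (st x))"
  unfolding rd_vec_def by (rule rd_finite_support) (simp add: cf_ket)

lemma rd_vec_scaled_ket: "rd_vec (c *\<^sub>C ket (st x))"
  using rd_cmult[OF rd_vec_ket[unfolded rd_vec_def], of c x] by (simp add: rd_vec_def cf_scaleC[abs_def])

lemma norm_le_sum_cf:
  assumes "(\<lambda>x. cmod (cf \<xi> x)) summable_on UNIV" shows "norm \<xi> \<le> (\<Sum>\<^sub>\<infinity>x. cmod (cf \<xi> x))"
proof (rule norm_infsum_le)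
  show "((\<lambda>x. coord \<xi> (st x) *\<^sub>C ket (st x)) has_sum \<xi>) UNIV"
    unfolding has_sum_reindex_bij_betw[OF bij_st, of "\<lambda>i. coord \<xi> i *\<^sub>C ket i"] by (rule has_sum_ket)
  show "((\<lambda>x. cmod (cf \<xi> x)) has_sum (\<Sum>\<^sub>\<infinity>x. cmod (cf \<xi> x))) UNIV" using assms by (rule has_sum_infsum)
qed (simp add: norm_scaleC norm_ket cmod_cf)

text \<open>The norm of \<open>Q\<close> on a basis vector is at most the absolute sum of a column
  of \<open>M\<close>, which has polynomial growth by translation uniform summability. On the
  diagonal the two parities cancel.\<close>

lemma nc_integral_matrix:
  assumes \<epsilon>: "\<epsilon> > 0" and Q: "has_matrix Q M"
    and asym: "has_asymptotics (\<lambda>N. (\<Sum>(s, y)\<in>shell N. M s y y) / of_nat N ^ j) c1 c0 c"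
  shows "nc_integral \<epsilon> (Q \<circ> absD_powr \<epsilon> (- of_nat j)) = c"
proof -
  have cfQ: "cf (Q (ket (st (s, z)))) (s', y) = (if s' = s then M s y z * parity (s, z) else 0)" for s s' y z
  proof -
    have "cf (Q (ket (st (s, z)))) (s', y) = (\<Sum>\<^sub>\<infinity>w. M s' y w * cf (ket (st (s, z))) (s', w))"
      by (rule has_matrixD[OF Q rd_vec_ket])
    also have "\<dots> = (\<Sum>\<^sub>\<infinity>w\<in>{z}. if s' = s then M s y w * parity (s, w) else 0)"
      by (rule infsum_cong_neutral) (auto simp: cf_ket)
    finally show ?thesis by simp
  qed
  obtain q where q: "\<And>r. \<exists>C>0. \<forall>s y z. cmod (M s y z) \<le> C * (1 + sz (s, z)) ^ q / (1 + ydist y z) ^ r"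
    using tempered_bound[OF has_matrix_tempered[OF Q]] by blast
  obtain C where C: "C > 0" "\<And>s y z. cmod (M s y z) \<le> C * (1 + sz (s, z)) ^ q / (1 + ydist y z) ^ p0"
    using q[of p0] by blast
  show ?thesis
  proof (rule nc_integral_asymptotics[OF \<epsilon>, where C = "C * S0" and q = q and d = "\<lambda>(s, y). M s y y"])
    show "Q (c *\<^sub>C ket (st x)) = c *\<^sub>C Q (ket (st x))" for c x
    proof (rule cf_eqI)
      fix w :: site
      show "cf (Q (c *\<^sub>C ket (st x))) w = cf (c *\<^sub>C Q (ket (st x))) w"
        by (cases w) (simp only: cf_scaleC has_matrixD[OF Q rd_vec_ket] has_matrixD[OF Q rd_vec_scaled_ket]
            infsum_cmult_right'[symmetric] mult.left_commute)
    qed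
    show "norm (Q (ket (st x))) \<le> C * S0 * (1 + level x) ^ q" for x
    proof -
      obtain s z where x: "x = (s, z)" by (cases x)
      let ?B = "C * (1 + sz (s, z)) ^ q"
      have b: "cmod (M s y z) \<le> ?B / (1 + ydist z y) ^ p0" for y using C(2)[of s y z] by (simp add: ydist_commute)
      have B: "?B \<ge> 0" using C(1) by simp
      have sm: "(\<lambda>y. cmod (M s y z)) summable_on UNIV" by (rule ydist_estimate(1)[OF b B])
      have r: "((\<lambda>w. cmod (cf (Q (ket (st x))) w)) has_sum (\<Sum>\<^sub>\<infinity>y. cmod (M s y z))) (range (Pair s))"
        using has_sum_reindex[of "Pair s" UNIV "\<lambda>w. cmod (cf (Q (ket (st x))) w)"] has_sum_infsum[OF sm]
        by (simp add: o_def x cfQ norm_mult inj_on_def)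
      then have r': "((\<lambda>w. cmod (cf (Q (ket (st x))) w)) has_sum (\<Sum>\<^sub>\<infinity>y. cmod (M s y z))) UNIV"
        by (rule has_sum_cong_neutral[THEN iffD1, rotated -1]) (auto simp: x cfQ)
      have "norm (Q (ket (st x))) \<le> (\<Sum>\<^sub>\<infinity>w. cmod (cf (Q (ket (st x))) w))"
        by (rule norm_le_sum_cf) (rule has_sum_imp_summable[OF r'])
      also have "\<dots> = (\<Sum>\<^sub>\<infinity>y. cmod (M s y z))" by (rule infsumI[OF r'])
      also have "\<dots> \<le> ?B * S0" by (rule ydist_estimate(4)[OF b B])
      finally show ?thesis by (simp add: x level_eq_sz mult_ac)
    qed
    show "coord (Q (ket (st x))) (st x) = (case x of (s, y) \<Rightarrow> M s y y)" for x
    proof -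
      obtain s z where x: "x = (s, z)" by (cases x)
      have "coord (Q (ket (st x))) (st x) = parity x * cf (Q (ket (st x))) x" by (simp add: cf_def)
      then show ?thesis using cfQ[of s z s z] by (simp add: x mult.commute)
    qed
  qed (rule asym)
qed

section \<open>Sums over the shells of constant level\<close>

text \<open>Polynomial bounds in \<open>x\<close>, uniform in N \<ge> 1. Applied to N^2 times a
  remainder, this is the form of O(N^-2) that survives summation against a rapidly decaying
  family.\<close>

definition upb :: "(nat \<Rightarrow> 'a::sized \<Rightarrow> real) \<Rightarrow> bool" where
  "upb F \<longleftrightarrow> (\<exists>K p. \<forall>N\<ge>1. \<forall>x. \<bar>F N x\<bar> \<le> K * (1 + sz x) ^ p)"

lemma upbI: "(\<And>N x. N \<ge> 1 \<Longrightarrow> \<bar>F N x\<bar> \<le> K * (1 + sz x) ^ p) \<Longrightarrow> upb F"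
  unfolding upb_def by blast

lemma upbE:
  assumes "upb F"
  shows "\<exists>K p. K \<ge> 0 \<and> (\<forall>N\<ge>1. \<forall>x. \<bar>F N x\<bar> \<le> K * (1 + sz x) ^ p)"
proof -
  obtain K p where K: "\<And>N x. N \<ge> 1 \<Longrightarrow> \<bar>F N x\<bar> \<le> K * (1 + sz x) ^ p" using assms unfolding upb_def by blast
  have "\<bar>F N x\<bar> \<le> max K 0 * (1 + sz x) ^ p" if "N \<ge> 1" for N x
    by (rule order_trans[OF K[OF that]]) (intro mult_right_mono, simp_all)
  then show ?thesis by (intro exI[of _ "max K 0"] exI[of _ p]) auto
qed

lemma upb_mono: "upb G \<Longrightarrow> (\<And>N x. N \<ge> 1 \<Longrightarrow> \<bar>F N x\<bar> \<le> \<bar>G N x\<bar>) \<Longrightarrow> upb F"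
  unfolding upb_def by (meson order_trans)

lemma upb_cong: "upb G \<Longrightarrow> (\<And>N x. N \<ge> 1 \<Longrightarrow> F N x = G N x) \<Longrightarrow> upb F"
  by (erule upb_mono) simp

lemma upb_const: "upb (\<lambda>N x. c)"
  by (rule upbI[of _ "\<bar>c\<bar>" 0]) simp

lemma upb_add:
  fixes F G :: "nat \<Rightarrow> 'a::sized \<Rightarrow> real"
  assumes "upb F" "upb G" shows "upb (\<lambda>N x. F N x + G N x)"
proof -
  obtain K p where K: "K \<ge> 0" "\<And>N x. N \<ge> 1 \<Longrightarrow> \<bar>F N x\<bar> \<le> K * (1 + sz x) ^ p" using upbE[OF assms(1)] by blast
  obtain K' p' where K': "K' \<ge> 0" "\<And>N x. N \<ge> 1 \<Longrightarrow> \<bar>G N x\<bar> \<le> K' * (1 + sz x) ^ p'" using upbE[OF assms(2)] by blast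
  show ?thesis
  proof (rule upbI)
    fix N :: nat and x :: 'a assume N: "N \<ge> 1"
    have "K * (1 + sz x) ^ p \<le> K * (1 + sz x) ^ (p + p')" "K' * (1 + sz x) ^ p' \<le> K' * (1 + sz x) ^ (p + p')"
      using K(1) K'(1) by (auto intro!: mult_left_mono power_increasing)
    then show "\<bar>F N x + G N x\<bar> \<le> (K + K') * (1 + sz x) ^ (p + p')"
      using K(2)[OF N, of x] K'(2)[OF N, of x] by (simp add: distrib_right)
  qed
qed

lemma upb_mult:
  fixes F G :: "nat \<Rightarrow> 'a::sized \<Rightarrow> real"
  assumes "upb F" "upb G" shows "upb (\<lambda>N x. F N x * G N x)"
proof -
  obtain K p where K: "K \<ge> 0" "\<And>N x. N \<ge> 1 \<Longrightarrow> \<bar>F N x\<bar> \<le> K * (1 + sz x) ^ p" using upbE[OF assms(1)] by blast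
  obtain K' p' where K': "K' \<ge> 0" "\<And>N x. N \<ge> 1 \<Longrightarrow> \<bar>G N x\<bar> \<le> K' * (1 + sz x) ^ p'" using upbE[OF assms(2)] by blast
  show ?thesis
  proof (rule upbI)
    fix N :: nat and x :: 'a assume N: "N \<ge> 1"
    have "\<bar>F N x\<bar> * \<bar>G N x\<bar> \<le> (K * (1 + sz x) ^ p) * (K' * (1 + sz x) ^ p')"
      using K(1) K(2)[OF N, of x] K'(2)[OF N, of x] by (intro mult_mono) auto
    then show "\<bar>F N x * G N x\<bar> \<le> (K * K') * (1 + sz x) ^ (p + p')"
      by (simp add: abs_mult power_add mult_ac)
  qed
qed

lemma upb_uminus: "upb F \<Longrightarrow> upb (\<lambda>N x. - F N x)"
  by (erule upb_mono) simp

lemma upb_diff: "upb F \<Longrightarrow> upb G \<Longrightarrow> upb (\<lambda>N x. F N x - G N x)"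
  using upb_add[OF _ upb_uminus] by fastforce

lemma upb_power: "upb F \<Longrightarrow> upb (\<lambda>N x. F N x ^ k)"
  by (induction k) (auto intro: upb_mult upb_const)

lemma upb_inverse: "upb (\<lambda>N x. 1 / real N)"
  by (rule upbI[of _ 1 0]) auto

lemma upb_divide: "upb F \<Longrightarrow> upb (\<lambda>N x. F N x / real N)"
  using upb_mult[OF _ upb_inverse] by fastforce

lemma upb_if: "upb F \<Longrightarrow> upb G \<Longrightarrow> upb (\<lambda>N x. if P N x then F N x else G N x)"
proof -
  assume "upb F" "upb G"
  then have "upb (\<lambda>N x. \<bar>F N x\<bar> + \<bar>G N x\<bar>)" by (intro upb_add) (auto elim: upb_mono)
  then show ?thesis by (rule upb_mono) auto
qed

lemma upb_sz: "upb (\<lambda>N x. 1 + sz x)"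
  by (rule upbI[of _ 1 1]) simp

lemma upb_le_sz: "(\<And>N x. \<bar>F N x\<bar> \<le> 1 + sz x) \<Longrightarrow> upb F"
  by (rule upbI[of _ 1 1]) simp

lemmas upb_intros = upb_const upb_add upb_mult upb_uminus upb_diff upb_power upb_inverse upb_divide

lemma upb_rd_mult:
  assumes f: "rd f" and V: "upb V" and N: "N \<ge> 1" shows "rd (\<lambda>x. f x * of_real (V N x))"
proof -
  obtain K p where K: "K \<ge> 0" "\<And>N x. N \<ge> 1 \<Longrightarrow> \<bar>V N x\<bar> \<le> K * (1 + sz x) ^ p" using upbE[OF V] by blast
  show ?thesis
    using rd_poly_mult[OF f, of "\<lambda>x. of_real (V N x)" K p] K N by (simp add: mult.commute)
qed

lemma has_asymptotics_infsum:
  fixes f :: "'a::sized \<Rightarrow> complex"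
  assumes f: "rd f"
    and e: "upb (\<lambda>_. e1)" "upb (\<lambda>_. e0)" "upb (\<lambda>_. e)"
    and V: "upb (\<lambda>N x. real N ^ 2 * (V N x - (e1 x * real N + e0 x + e x / real N)))"
  shows "has_asymptotics (\<lambda>N. \<Sum>\<^sub>\<infinity>x. f x * of_real (V N x))
    (\<Sum>\<^sub>\<infinity>x. f x * of_real (e1 x)) (\<Sum>\<^sub>\<infinity>x. f x * of_real (e0 x)) (\<Sum>\<^sub>\<infinity>x. f x * of_real (e x))"
proof -
  let ?R = "\<lambda>N x. real N ^ 2 * (V N x - (e1 x * real N + e0 x + e x / real N))"
  obtain K p where K: "K \<ge> 0" "\<And>N x. N \<ge> 1 \<Longrightarrow> \<bar>?R N x\<bar> \<le> K * (1 + sz x) ^ p" using upbE[OF V] by blast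
  have rp: "rd (\<lambda>x. f x * of_real (K * (1 + sz x) ^ p))"
    by (rule upb_rd_mult[OF f, of "\<lambda>N x. K * (1 + sz x) ^ p" 1]) (intro upb_intros upb_sz, simp)
  let ?C = "\<Sum>\<^sub>\<infinity>x. cmod (f x * of_real (K * (1 + sz x) ^ p))"
  have se: "(\<lambda>x. f x * of_real (d x)) summable_on UNIV" if "upb (\<lambda>_. d)" for d
    using upb_rd_mult[OF f that, of 1] by (intro rd_summable) simp
  have "cmod ((\<Sum>\<^sub>\<infinity>x. f x * of_real (V N x)) - ((\<Sum>\<^sub>\<infinity>x. f x * of_real (e1 x)) * of_nat N
      + (\<Sum>\<^sub>\<infinity>x. f x * of_real (e0 x)) + (\<Sum>\<^sub>\<infinity>x. f x * of_real (e x)) / of_nat N)) \<le> ?C / real N ^ 2" if N: "N \<ge> 1" for N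
  proof -
    have N0: "real N \<noteq> 0" using N by simp
    have Veq: "V N x = e1 x * real N + e0 x + e x / real N + ?R N x / real N ^ 2" for x
      using N0 by simp
    have rR: "rd (\<lambda>x. f x * of_real (?R N x))" by (rule upb_rd_mult[OF f V N])
    have sR: "(\<lambda>x. f x * of_real (?R N x)) summable_on UNIV" by (rule rd_summable[OF rR])
    have "(\<Sum>\<^sub>\<infinity>x. f x * of_real (V N x)) = (\<Sum>\<^sub>\<infinity>x. f x * of_real (e1 x) * of_nat N + f x * of_real (e0 x)
        + f x * of_real (e x) * (1 / of_nat N) + f x * of_real (?R N x) * (1 / of_nat N ^ 2))"
    proof (rule infsum_cong)
      fix x show "f x * of_real (V N x) = f x * of_real (e1 x) * of_nat N + f x * of_real (e0 x)
        + f x * of_real (e x) * (1 / of_nat N) + f x * of_real (?R N x) * (1 / of_nat N ^ 2)"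
        by (subst Veq) (simp add: ring_distribs)
    qed
    also have "\<dots> = (\<Sum>\<^sub>\<infinity>x. f x * of_real (e1 x)) * of_nat N + (\<Sum>\<^sub>\<infinity>x. f x * of_real (e0 x))
      + (\<Sum>\<^sub>\<infinity>x. f x * of_real (e x)) * (1 / of_nat N) + (\<Sum>\<^sub>\<infinity>x. f x * of_real (?R N x)) * (1 / of_nat N ^ 2)"
      by (simp only: infsum_add summable_on_add summable_on_cmult_left se e sR infsum_cmult_left')
    finally have "(\<Sum>\<^sub>\<infinity>x. f x * of_real (V N x)) - ((\<Sum>\<^sub>\<infinity>x. f x * of_real (e1 x)) * of_nat N
      + (\<Sum>\<^sub>\<infinity>x. f x * of_real (e0 x)) + (\<Sum>\<^sub>\<infinity>x. f x * of_real (e x)) / of_nat N)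
      = (\<Sum>\<^sub>\<infinity>x. f x * of_real (?R N x)) * (1 / of_nat N ^ 2)" by (simp add: algebra_simps)
    also have "cmod \<dots> = cmod (\<Sum>\<^sub>\<infinity>x. f x * of_real (?R N x)) / real N ^ 2" by (simp add: norm_mult norm_divide norm_power)
    also have "\<dots> \<le> ?C / real N ^ 2"
    proof (intro divide_right_mono norm_infsum_le[OF has_sum_infsum[OF sR] has_sum_infsum[OF rd_abs_summable[OF rp]]])
      fix x show "cmod (f x * of_real (?R N x)) \<le> cmod (f x * of_real (K * (1 + sz x) ^ p))"
        unfolding norm_mult norm_of_real using K(2)[OF N, of x] by (intro mult_left_mono) auto
    qed simp
    finally show ?thesis .
  qed
  then show ?thesis unfolding has_asymptotics_def by blast
qed

lemma has_asymptotics_add: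
  assumes "has_asymptotics A a1 a0 a" "has_asymptotics B b1 b0 b"
  shows "has_asymptotics (\<lambda>N. A N + B N) (a1 + b1) (a0 + b0) (a + b)"
proof -
  obtain C where C: "\<And>n. n \<ge> 1 \<Longrightarrow> cmod (A n - (a1 * of_nat n + a0 + a / of_nat n)) \<le> C / real n ^ 2"
    using assms(1) unfolding has_asymptotics_def by blast
  obtain C' where C': "\<And>n. n \<ge> 1 \<Longrightarrow> cmod (B n - (b1 * of_nat n + b0 + b / of_nat n)) \<le> C' / real n ^ 2"
    using assms(2) unfolding has_asymptotics_def by blast
  have "cmod (A n + B n - ((a1 + b1) * of_nat n + (a0 + b0) + (a + b) / of_nat n)) \<le> (C + C') / real n ^ 2" if n: "n \<ge> 1" for n
  proof -
    have e: "A n + B n - ((a1 + b1) * of_nat n + (a0 + b0) + (a + b) / of_nat n)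
      = (A n - (a1 * of_nat n + a0 + a / of_nat n)) + (B n - (b1 * of_nat n + b0 + b / of_nat n))"
      by (simp add: ring_distribs add_divide_distrib)
    show ?thesis unfolding e using norm_triangle_mono[OF C[OF n] C'[OF n]] by (simp only: add_divide_distrib)
  qed
  then show ?thesis unfolding has_asymptotics_def by blast
qed

lemma has_asymptotics_cong:
  "has_asymptotics A c1 c0 c \<Longrightarrow> (\<And>N. N \<ge> 1 \<Longrightarrow> A N = B N) \<Longrightarrow> has_asymptotics B c1 c0 c"
  unfolding has_asymptotics_def by auto

section \<open>Elementary sums over one shell\<close>

definition mid :: "nat \<Rightarrow> int set" where
  "mid M = {- int M..int M}"

lemma mid_Suc: "mid (Suc M) = insert (int M + 1) (insert (- int M - 1) (mid M))"
  by (auto simp: mid_def)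

lemma finite_mid [simp]: "finite (mid M)" by (simp add: mid_def)

lemma sum_mid_Suc: "sum f (mid (Suc M)) = sum f (mid M) + (f (int M + 1) + f (- int M - 1))"
proof -
  have "int M + 1 \<notin> insert (- int M - 1) (mid M)" "- int M - 1 \<notin> mid M" by (auto simp: mid_def)
  then show ?thesis unfolding mid_Suc by (simp add: add_ac)
qed

lemma mid_0: "mid 0 = {0}" by (auto simp: mid_def)

lemma card_mid: "card (mid M) = 2 * M + 1" by (simp add: mid_def)

text \<open>Once \<open>l\<close> is fixed, m runs over |m| \<le> N - l and the coordinate s = N - l
  - |m| is determined.\<close>

lemma sum_shell:
  "sum f (shell N) = (\<Sum>l\<le>N. \<Sum>m\<in>mid (N - l). f (nat (int (N - l) - \<bar>m\<bar>), l, m))"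
proof -
  have "sum f (shell N) = (\<Sum>(l, m)\<in>Sigma {..N} (\<lambda>l. mid (N - l)). f (nat (int (N - l) - \<bar>m\<bar>), l, m))"
  proof (rule sum.reindex_bij_witness[of _ "\<lambda>(l, m). (nat (int (N - l) - \<bar>m\<bar>), l, m)" "\<lambda>(s, l, m). (l, m)"])
    fix x :: site assume x: "x \<in> shell N"
    obtain s l m where xs: "x = (s, l, m)" by (cases x)
    have "real (s + l + nat \<bar>m\<bar>) = real N" using x by (simp add: xs shell_def level_def)
    then have e: "s + l + nat \<bar>m\<bar> = N" by (simp only: of_nat_eq_iff)
    then show "(case case x of (s, l, m) \<Rightarrow> (l, m) of (l, m) \<Rightarrow> (nat (int (N - l) - \<bar>m\<bar>), l, m)) = x"
      "(case x of (s, l, m) \<Rightarrow> (l, m)) \<in> Sigma {..N} (\<lambda>l. mid (N - l))"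
      "(case case x of (s, l, m) \<Rightarrow> (l, m) of (l, m) \<Rightarrow> f (nat (int (N - l) - \<bar>m\<bar>), l, m)) = f x"
      by (auto simp: xs mid_def)
  next
    fix y assume "y \<in> Sigma {..N} (\<lambda>l. mid (N - l))"
    then show "(case case y of (l, m) \<Rightarrow> (nat (int (N - l) - \<bar>m\<bar>), l, m) of (s, l, m) \<Rightarrow> (l, m)) = y"
      "(case y of (l, m) \<Rightarrow> (nat (int (N - l) - \<bar>m\<bar>), l, m)) \<in> shell N"
      by (auto simp: shell_def level_def mid_def)
  qed
  also have "\<dots> = (\<Sum>l\<le>N. \<Sum>m\<in>mid (N - l). f (nat (int (N - l) - \<bar>m\<bar>), l, m))"
    by (rule sum.Sigma[symmetric]) auto
  finally show ?thesis .
qed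

definition sgr :: "nat \<Rightarrow> int \<Rightarrow> real" where
  "sgr s m = (if s = 0 \<and> m \<ge> 0 then 1 else - 1)"

lemma sum_mid_sgr: "(\<Sum>m\<in>mid M. sgr (nat (int M - \<bar>m\<bar>)) m) = 1 - 2 * real M"
proof -
  \<comment> \<open>s = 0 holds only for m = M and m = - M, so m = M is the only site with positive
    sign.\<close>
  have "(\<Sum>m\<in>mid M. sgr (nat (int M - \<bar>m\<bar>)) m) = (\<Sum>m\<in>mid M. - 1 + (if m = int M then 2 else 0))"
    by (rule sum.cong) (auto simp: sgr_def mid_def)
  also have "\<dots> = - real (card (mid M)) + 2"
    by (subst sum.distrib) (simp add: mid_def)
  finally show ?thesis by (simp add: card_mid)
qed

text \<open>For j = N + 1 the sum is empty and 1 - (N - j)^2 = 0. So the formula extends one step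
  beyond the range of summation, as the guard of \<open>toep_weight\<close> uses.\<close>

lemma sum_sgr_from:
  assumes "j \<le> N + 1"
  shows "(\<Sum>l\<in>{j..N}. 1 - 2 * real (N - l)) = 1 - (real N - real j)\<^sup>2"
proof (cases "j = N + 1")
  case False
  then have "j \<le> N" using assms by simp
  then show ?thesis
  proof (induction rule: inc_induct)
    case (step n)
    have "{n..N} = insert n {Suc n..N}" using step.hyps by auto
    then show ?case using step by (simp add: of_nat_diff power2_eq_square algebra_simps)
  qed simp
qed simp

definition level_shift :: "real \<Rightarrow> int \<Rightarrow> int \<Rightarrow> real" where
  "level_shift a m n = a + \<bar>real_of_int (m + n)\<bar> - \<bar>real_of_int m\<bar>"

text \<open>|m + n| - |m| and its value at - m cancel as soon as |m| \<ge> |n|. The part depending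
  on n therefore stops growing and stays at n^2.\<close>

lemma sum_level_shift:
  "(\<Sum>m\<in>mid M. level_shift a m n) = a * (2 * real M + 1) +
    (if int M \<le> \<bar>n\<bar> then (2 * real M + 1) * \<bar>real_of_int n\<bar> - real M * (real M + 1) else (real_of_int n)\<^sup>2)"
proof (induction M)
  case 0 then show ?case by (simp add: mid_0 level_shift_def)
next
  case (Suc M)
  have p: "level_shift a (int M + 1) n + level_shift a (- int M - 1) n = 2 * a +
    (if int M + 1 \<le> \<bar>n\<bar> then 2 * \<bar>real_of_int n\<bar> - 2 * (real M + 1) else 0)"
    by (auto simp: level_shift_def)
  show ?case
  proof (cases "int (Suc M) \<le> \<bar>n\<bar>")
    case True
    then show ?thesis unfolding sum_mid_Suc p using Suc by (simp add: algebra_simps)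
  next
    case False
    show ?thesis
    proof (cases "int M = \<bar>n\<bar>")
      case True
      then have "real M = \<bar>real_of_int n\<bar>" by (metis of_int_abs of_int_of_nat_eq)
      then show ?thesis unfolding sum_mid_Suc p using Suc False by (auto simp: algebra_simps power2_eq_square)
    next
      case F: False
      then show ?thesis unfolding sum_mid_Suc p using Suc False by (auto simp: algebra_simps)
    qed
  qed
qed

lemma level_shift_bound: "\<bar>level_shift a m n\<bar> \<le> \<bar>a\<bar> + \<bar>real_of_int n\<bar>"
  unfolding level_shift_def by auto

text \<open>For |m| \<ge> |n| a pair m, - m contributes (a + n)^2 + (a - n)^2 = 2 (a^2 + n^2)
  exactly. At most |n| pairs deviate, each by at most 4 B^2, and m = 0 adds another B^2.\<close>

lemma sum_level_shift2:
  fixes a B :: real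
  assumes B: "\<bar>a\<bar> + \<bar>real_of_int n\<bar> \<le> B" "1 \<le> B"
  shows "\<bar>(\<Sum>m\<in>mid M. (level_shift a m n)\<^sup>2) - 2 * real M * (a\<^sup>2 + (real_of_int n)\<^sup>2)\<bar> \<le> 5 * B ^ 3"
proof -
  have B0: "B \<ge> 0" using B by simp
  have d2: "(level_shift a m n)\<^sup>2 \<le> B\<^sup>2" for m
    using level_shift_bound[of a m n] B by (intro abs_le_square_iff[THEN iffD1]) auto
  have an: "a\<^sup>2 + (real_of_int n)\<^sup>2 \<le> B\<^sup>2"
  proof -
    have "a\<^sup>2 + (real_of_int n)\<^sup>2 \<le> (\<bar>a\<bar> + \<bar>real_of_int n\<bar>)\<^sup>2" by (simp add: power2_sum)
    also have "\<dots> \<le> B\<^sup>2" using B by (intro power_mono) auto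
    finally show ?thesis .
  qed
  have "\<bar>(\<Sum>m\<in>mid M. (level_shift a m n)\<^sup>2) - 2 * real M * (a\<^sup>2 + (real_of_int n)\<^sup>2)\<bar> \<le> B\<^sup>2 + 4 * B\<^sup>2 * min (real M) \<bar>real_of_int n\<bar>"
  proof (induction M)
    case 0 then show ?case using d2[of 0] by (simp add: mid_0)
  next
    case (Suc M)
    let ?x = "(level_shift a (int M + 1) n)\<^sup>2 + (level_shift a (- int M - 1) n)\<^sup>2 - 2 * (a\<^sup>2 + (real_of_int n)\<^sup>2)"
    have e: "(\<Sum>m\<in>mid (Suc M). (level_shift a m n)\<^sup>2) - 2 * real (Suc M) * (a\<^sup>2 + (real_of_int n)\<^sup>2)
      = ((\<Sum>m\<in>mid M. (level_shift a m n)\<^sup>2) - 2 * real M * (a\<^sup>2 + (real_of_int n)\<^sup>2)) + ?x"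
      unfolding sum_mid_Suc by (simp add: algebra_simps)
    show ?case
    proof (cases "int M + 1 \<le> \<bar>n\<bar>")
      case True
      then have r: "real M + 1 \<le> \<bar>real_of_int n\<bar>" by linarith
      have "\<bar>?x\<bar> \<le> 4 * B\<^sup>2"
        using d2[of "int M + 1"] d2[of "- int M - 1"] an by (auto simp: abs_le_iff) (smt (verit) zero_le_power2)+
      then show ?thesis unfolding e using Suc r by (simp add: min_def algebra_simps)
    next
      case False
      then have d: "level_shift a (int M + 1) n = a + n" "level_shift a (- int M - 1) n = a - n" by (auto simp: level_shift_def)
      have "?x = 0" unfolding d by (simp add: power2_sum power2_diff)
      moreover have "4 * B\<^sup>2 * min (real M) \<bar>real_of_int n\<bar> \<le> 4 * B\<^sup>2 * min (real (Suc M)) \<bar>real_of_int n\<bar>"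
        by (intro mult_left_mono) auto
      ultimately show ?thesis unfolding e using Suc by simp
    qed
  qed
  also have "\<dots> \<le> B\<^sup>2 * B + 4 * B\<^sup>2 * B"
    using B by (intro add_mono mult_left_mono) (auto simp: mult_le_cancel_left1)
  finally show ?thesis by (simp add: power2_eq_square power3_eq_cube)
qed

section \<open>The change of the eigenvalue of \<open>D\<close> along a step, summed over a
  shell\<close>

definition eigenvalue_shift :: "nat \<Rightarrow> nat \<Rightarrow> nat \<Rightarrow> int \<Rightarrow> int \<Rightarrow> real" where
  "eigenvalue_shift M l k m n = sigmaD (nat (int M - \<bar>m\<bar>), k, m + n) - sigmaD (nat (int M - \<bar>m\<bar>), l, m)"

text \<open>For |m| < M the site has s > 0, so both eigenvalues are the negatives of the levels.
  Hence \<open>eigenvalue_shift\<close> plus \<open>level_shift\<close> is supported at the two ends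
  m = M and m = - M, and shell sums reduce to those of \<open>level_shift\<close> up to two
  terms.\<close>

lemma eigenvalue_shift_interior: "\<bar>m\<bar> < int M \<Longrightarrow> eigenvalue_shift M l k m n = - level_shift (real k - real l) m n"
  by (auto simp: eigenvalue_shift_def sigmaD_def level_def level_shift_def)

lemma eigenvalue_shift_bound: "m \<in> mid M \<Longrightarrow> \<bar>eigenvalue_shift M l k m n\<bar> \<le> 1 + sz (l, k, n)"
  by (auto simp: eigenvalue_shift_def sigmaD_def level_def sz_triple mid_def)

lemma level_shift_bound_sz: "\<bar>level_shift (real k - real l) m n\<bar> \<le> 1 + sz (l, k, n)"
  using level_shift_bound[of "real k - real l" m n] by (simp add: sz_triple)

lemma eigenvalue_shift_top: "\<bar>n\<bar> < int M \<Longrightarrow> eigenvalue_shift M l k (int M) n = real k - real l + real_of_int n"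
  by (auto simp: eigenvalue_shift_def sigmaD_def level_def)

lemma eigenvalue_shift_bottom: "\<bar>n\<bar> < int M \<Longrightarrow> eigenvalue_shift M l k (- int M) n = - level_shift (real k - real l) (- int M) n"
  by (auto simp: eigenvalue_shift_def sigmaD_def level_def level_shift_def)

lemma sum_ends:
  fixes f :: "int \<Rightarrow> real"
  assumes "\<And>m. \<bar>m\<bar> < int M \<Longrightarrow> f m = 0"
  shows "sum f (mid M) = sum f {int M, - int M}"
  by (rule sum.mono_neutral_right) (use assms in \<open>auto simp: mid_def abs_less_iff not_less\<close>)

lemma sum_ends_bound:
  fixes f :: "int \<Rightarrow> real"
  assumes "\<And>m. \<bar>m\<bar> < int M \<Longrightarrow> f m = 0" and c: "\<And>m. m \<in> mid M \<Longrightarrow> \<bar>f m\<bar> \<le> c"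
  shows "\<bar>sum f (mid M)\<bar> \<le> 2 * c"
proof -
  have c': "\<bar>f (int M)\<bar> \<le> c" "\<bar>f (- int M)\<bar> \<le> c" by (auto intro!: c simp: mid_def)
  show ?thesis
  proof (cases "M = 0")
    case True
    then show ?thesis using c' by (simp add: mid_0)
  next
    case False
    have "sum f (mid M) = sum f {int M, - int M}" by (rule sum_ends) (rule assms(1))
    also have "\<dots> = f (int M) + f (- int M)" using False by simp
    finally show ?thesis using c' by linarith
  qed
qed

lemma sum_mid_bound:
  fixes f :: "int \<Rightarrow> real"
  assumes "\<And>m. m \<in> mid M \<Longrightarrow> \<bar>f m\<bar> \<le> c" shows "\<bar>sum f (mid M)\<bar> \<le> (2 * real M + 1) * c"
  using order_trans[OF sum_abs sum_bounded_above[of "mid M" "\<lambda>m. \<bar>f m\<bar>" c]] assms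
  by (simp add: card_mid add.commute)

text \<open>The factor coming from \<open>[D, a]\<close> and \<open>r\<close> commutators with \<open>D\<^sup>2\<close> for the passage from the site of
  level \<open>N\<close> with coordinates \<open>(l, m)\<close> to the one with coordinates \<open>(k, m + n)\<close>.\<close>
definition weight :: "nat \<Rightarrow> nat \<Rightarrow> nat \<times> nat \<times> int \<Rightarrow> int \<Rightarrow> real" where
  "weight r N x m = (case x of (l, k, n) \<Rightarrow> eigenvalue_shift (N - l) l k m n *
     (level_shift (real k - real l) m n * (2 * real N + level_shift (real k - real l) m n)) ^ r)"

text \<open>The denominator is the factor |D|^(-1 - 2 r) on the shell. The guard is needed as
  truncated subtraction would otherwise leave \<open>mid 0\<close>, which is not empty.\<close>

definition shell_weight :: "nat \<Rightarrow> nat \<Rightarrow> nat \<times> nat \<times> int \<Rightarrow> real" where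
  "shell_weight r N x = (if fst x \<le> N then (\<Sum>m\<in>mid (N - fst x). weight r N x m) / real N ^ (1 + 2 * r) else 0)"

text \<open>For N > B = 1 + sz x the expansion is exact. With a = k - l and M = N - l the end m = M
  contributes 2 (a + n) beyond the sum of - \<open>level_shift\<close>, the end m = - M nothing, so
  the sum is 2 (a + n) - a (2 M + 1) - n^2. For N \<le> B all powers of N turn into powers of B; the
  constant 10 is 5 + 5 from the last estimate there.\<close>

lemma shell_weight_0:
  "upb (\<lambda>N x. real N ^ 2 * (shell_weight 0 N x - (0 * real N + (case x of (l, k, n) \<Rightarrow> - 2 * (real k - real l))
    + (case x of (l, k, n) \<Rightarrow> (real k - real l) * (2 * real l + 1) - (real_of_int n)\<^sup>2 + 2 * real_of_int n) / real N)))"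
proof (rule upbI[where K = 10 and p = 3])
  fix N :: nat and x :: "nat \<times> nat \<times> int" assume N: "N \<ge> 1"
  obtain l k n where x: "x = (l, k, n)" by (cases x)
  define B where "B = 1 + sz x"
  have Bx: "B = 1 + real l + real k + \<bar>real_of_int n\<bar>" by (simp add: B_def x sz_triple)
  have B1: "B \<ge> 1" by (simp add: Bx)
  define a where "a = real k - real l"
  define e where "e = a * (2 * real l + 1) - (real_of_int n)\<^sup>2 + 2 * real_of_int n"
  have N1: "real N \<ge> 1" using N by simp
  have "\<bar>real N ^ 2 * (shell_weight 0 N x - (- 2 * a + e / real N))\<bar> \<le> 10 * B ^ 3"
  proof (cases "real N \<le> B")
    case False
    then have NB: "int N > int l + \<bar>n\<bar>" "l \<le> N" unfolding Bx by linarith+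
    define M where "M = N - l"
    have M: "\<bar>n\<bar> < int M" "real M = real N - real l" using NB by (auto simp: M_def of_nat_diff)
    have "(\<Sum>m\<in>mid M. eigenvalue_shift M l k m n) = (\<Sum>m\<in>mid M. eigenvalue_shift M l k m n + level_shift a m n) - (\<Sum>m\<in>mid M. level_shift a m n)"
      by (simp add: sum.distrib)
    also have "(\<Sum>m\<in>mid M. eigenvalue_shift M l k m n + level_shift a m n) = (\<Sum>m\<in>{int M, - int M}. eigenvalue_shift M l k m n + level_shift a m n)"
      by (rule sum_ends) (simp add: eigenvalue_shift_interior a_def)
    also have "\<dots> = 2 * (a + real_of_int n)"
      using M(1) by (simp add: eigenvalue_shift_top eigenvalue_shift_bottom a_def) (simp add: level_shift_def)
    also have "(\<Sum>m\<in>mid M. level_shift a m n) = a * (2 * real M + 1) + (real_of_int n)\<^sup>2" using M(1) by (simp add: sum_level_shift)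
    finally have s: "(\<Sum>m\<in>mid M. eigenvalue_shift M l k m n) = - 2 * a * real N + e"
      unfolding M(2) e_def by (simp add: algebra_simps)
    have "shell_weight 0 N x = (- 2 * a * real N + e) / real N"
      using NB(2) s by (simp add: shell_weight_def weight_def x M_def)
    then have "shell_weight 0 N x - (- 2 * a + e / real N) = 0" using N1 by (simp add: field_simps)
    then show ?thesis using B1 by simp
  next
    case True
    have a: "\<bar>a\<bar> \<le> B" by (simp add: a_def Bx)
    have "\<bar>shell_weight 0 N x\<bar> \<le> 3 * B"
    proof (cases "l \<le> N")
      case True
      have "\<bar>\<Sum>m\<in>mid (N - l). weight 0 N x m\<bar> \<le> (2 * real (N - l) + 1) * B"
        by (rule sum_mid_bound) (use eigenvalue_shift_bound[of _ "N - l" l k n] in \<open>simp add: weight_def x B_def\<close>)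
      also have "\<dots> \<le> 3 * real N * B" using N1 B1 by (intro mult_right_mono) (auto simp: of_nat_diff[OF True])
      finally show ?thesis using N1 True by (simp add: shell_weight_def x pos_divide_le_eq mult_ac)
    qed (use B1 in \<open>simp add: shell_weight_def x\<close>)
    moreover have "\<bar>e\<bar> \<le> 5 * B\<^sup>2"
    proof -
      have "\<bar>a * (2 * real l + 1)\<bar> \<le> B * (2 * B)"
        unfolding abs_mult using a B1 by (intro mult_mono) (auto simp: Bx)
      moreover have "(real_of_int n)\<^sup>2 \<le> B\<^sup>2" using B1 by (intro abs_le_square_iff[THEN iffD1]) (simp add: Bx)
      moreover have "\<bar>2 * real_of_int n\<bar> \<le> 2 * B\<^sup>2"
      proof -
        have "\<bar>real_of_int n\<bar> \<le> B" by (simp add: Bx)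
        also have "B \<le> B\<^sup>2" using B1 by (simp add: power2_eq_square mult_le_cancel_left1)
        finally show ?thesis by simp
      qed
      moreover have "0 \<le> (real_of_int n)\<^sup>2" by simp
      ultimately have "\<bar>e\<bar> \<le> B * (2 * B) + B\<^sup>2 + 2 * B\<^sup>2" unfolding e_def by linarith
      then show ?thesis by (simp add: power2_eq_square)
    qed
    ultimately have "\<bar>shell_weight 0 N x - (- 2 * a + e / real N)\<bar> \<le> 3 * B + 2 * B + 5 * B\<^sup>2 / real N"
    proof -
      assume 1: "\<bar>shell_weight 0 N x\<bar> \<le> 3 * B" and 2: "\<bar>e\<bar> \<le> 5 * B\<^sup>2"
      have "\<bar>e / real N\<bar> \<le> 5 * B\<^sup>2 / real N" using 2 N1 by (simp add: divide_right_mono)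
      then show ?thesis using 1 a by linarith
    qed
    then have "real N ^ 2 * \<bar>shell_weight 0 N x - (- 2 * a + e / real N)\<bar> \<le> real N ^ 2 * (5 * B + 5 * B\<^sup>2 / real N)"
      by (intro mult_left_mono) auto
    also have "\<dots> = 5 * (real N)\<^sup>2 * B + 5 * real N * B\<^sup>2" using N1 by (simp add: power2_eq_square field_simps)
    also have "\<dots> \<le> 5 * B\<^sup>2 * B + 5 * B * B\<^sup>2"
      using True B1 by (intro add_mono mult_right_mono mult_left_mono power_mono) auto
    finally show ?thesis by (simp add: abs_mult power2_eq_square power3_eq_cube)
  qed
  then show "\<bar>real N ^ 2 * (shell_weight 0 N x - (0 * real N + (case x of (l, k, n) \<Rightarrow> - 2 * (real k - real l))
    + (case x of (l, k, n) \<Rightarrow> (real k - real l) * (2 * real l + 1) - (real_of_int n)\<^sup>2 + 2 * real_of_int n) / real N))\<bar>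
    \<le> 10 * (1 + sz x) ^ 3"
    by (simp add: x a_def e_def B_def[unfolded x])
qed

text \<open>To leading order the weight is - 2 N times the square of \<open>level_shift\<close>, and
  by \<open>sum_level_shift2\<close> these squares sum to about 2 N (a^2 + n^2). The constant 29
  adds up 12 for the ends, 2 * 5 for the squares, 4 for replacing N - l by N, and 3 for the
  cubes.\<close>

lemma shell_weight_1:
  "upb (\<lambda>N x. real N ^ 2 * (shell_weight 1 N x - (0 * real N + 0
    + (case x of (l, k, n) \<Rightarrow> - 4 * ((real k - real l)\<^sup>2 + (real_of_int n)\<^sup>2)) / real N)))"
proof (rule upbI[where K = 29 and p = 3])
  fix N :: nat and x :: "nat \<times> nat \<times> int" assume N: "N \<ge> 1"
  obtain l k n where x: "x = (l, k, n)" by (cases x)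
  define B where "B = 1 + sz x"
  have Bx: "B = 1 + real l + real k + \<bar>real_of_int n\<bar>" by (simp add: B_def x sz_triple)
  have B1: "B \<ge> 1" by (simp add: Bx)
  define a where "a = real k - real l"
  define c where "c = a\<^sup>2 + (real_of_int n)\<^sup>2"
  have N1: "real N \<ge> 1" using N by simp
  have aB: "\<bar>a\<bar> + \<bar>real_of_int n\<bar> \<le> B" by (simp add: a_def Bx)
  have c: "0 \<le> c" "c \<le> B\<^sup>2"
  proof -
    have "c \<le> (\<bar>a\<bar> + \<bar>real_of_int n\<bar>)\<^sup>2" by (simp add: c_def power2_sum)
    also have "\<dots> \<le> B\<^sup>2" using aB by (intro power_mono) auto
    finally show "c \<le> B\<^sup>2" .
  qed (simp add: c_def)
  have "\<bar>real N ^ 2 * (shell_weight 1 N x - (- 4 * c / real N))\<bar> \<le> 29 * B ^ 3"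
  proof (cases "l \<le> N")
    case False
    have "real N * c \<le> B * B\<^sup>2" using False c B1 by (intro mult_mono) (auto simp: Bx)
    moreover have "0 \<le> B * B\<^sup>2" using B1 by simp
    moreover have "real N ^ 2 * (shell_weight 1 N x - (- 4 * c / real N)) = 4 * (real N * c)"
      using False N1 by (simp add: shell_weight_def x power2_eq_square)
    moreover have "0 \<le> real N * c" using c by simp
    ultimately have "\<bar>real N ^ 2 * (shell_weight 1 N x - (- 4 * c / real N))\<bar> \<le> 29 * (B * B\<^sup>2)" by linarith
    then show ?thesis by (simp add: power2_eq_square power3_eq_cube)
  next
    case True
    define M where "M = N - l"
    have M: "real M = real N - real l" using True by (simp add: M_def of_nat_diff)
    let ?d = "\<lambda>m. level_shift a m n" and ?e = "\<lambda>m. eigenvalue_shift M l k m n"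
    have dB: "\<bar>?d m\<bar> \<le> B" for m using level_shift_bound_sz[of k l m n] by (simp add: a_def B_def x)
    define S2 where "S2 = (\<Sum>m\<in>mid M. (?d m)\<^sup>2)"
    define S3 where "S3 = (\<Sum>m\<in>mid M. (?d m) ^ 3)"
    define R where "R = (\<Sum>m\<in>mid M. (?e m + ?d m) * (?d m * (2 * real N + ?d m)))"
    have "(\<Sum>m\<in>mid M. weight 1 N x m) = (\<Sum>m\<in>mid M. (?e m + ?d m) * (?d m * (2 * real N + ?d m)) - 2 * real N * (?d m)\<^sup>2 - (?d m) ^ 3)"
      by (rule sum.cong) (simp_all add: weight_def x M_def a_def power2_eq_square power3_eq_cube algebra_simps)
    also have "\<dots> = R - 2 * real N * S2 - S3"
      by (simp add: sum_subtractf sum_distrib_left[symmetric] R_def S2_def S3_def)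
    finally have sw: "shell_weight 1 N x = (R - 2 * real N * S2 - S3) / real N ^ 3"
      using True by (simp add: shell_weight_def x M_def numeral_eq_Suc)
    have eq: "real N ^ 2 * (shell_weight 1 N x - (- 4 * c / real N)) = R / real N - 2 * (S2 - 2 * real M * c) + 4 * real l * c - S3 / real N"
      unfolding sw M using N1 by (simp add: power2_eq_square power3_eq_cube field_simps)
    have "\<bar>R / real N\<bar> \<le> 12 * B ^ 3"
    proof -
      have "\<bar>R\<bar> \<le> 2 * ((2 * B) * (B * (3 * real N * B)))"
        unfolding R_def
      proof (rule sum_ends_bound)
        show "(?e m + ?d m) * (?d m * (2 * real N + ?d m)) = 0" if "\<bar>m\<bar> < int M" for m
          using eigenvalue_shift_interior[OF that, of l k n] by (simp add: a_def)
        fix m assume m: "m \<in> mid M"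
        have "\<bar>?e m + ?d m\<bar> \<le> 2 * B" using eigenvalue_shift_bound[OF m, of l k n] dB[of m] by (simp add: B_def x)
        moreover have "\<bar>2 * real N + ?d m\<bar> \<le> 3 * real N * B"
        proof -
          have "2 * real N + B \<le> 2 * real N * B + real N * B"
            using N1 B1 by (intro add_mono) (auto simp: mult_le_cancel_left1 mult_le_cancel_right1)
          then show ?thesis using dB[of m] N1 by linarith
        qed
        ultimately show "\<bar>(?e m + ?d m) * (?d m * (2 * real N + ?d m))\<bar> \<le> (2 * B) * (B * (3 * real N * B))"
          unfolding abs_mult using dB[of m] B1 by (intro mult_mono) auto
      qed
      then show ?thesis using N1 by (simp add: pos_divide_le_eq power3_eq_cube mult_ac)
    qed
    moreover have "\<bar>S2 - 2 * real M * c\<bar> \<le> 5 * B ^ 3" unfolding S2_def c_def by (rule sum_level_shift2[OF aB B1])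
    moreover have "\<bar>S3 / real N\<bar> \<le> 3 * B ^ 3"
    proof -
      have "\<bar>S3\<bar> \<le> (2 * real M + 1) * B ^ 3"
        unfolding S3_def by (rule sum_mid_bound) (unfold power_abs, intro power_mono dB, simp)
      also have "\<dots> \<le> 3 * real N * B ^ 3" using N1 B1 unfolding M by (intro mult_right_mono) auto
      finally show ?thesis using N1 by (simp add: pos_divide_le_eq mult_ac)
    qed
    moreover have "0 \<le> 4 * real l * c" "4 * real l * c \<le> 4 * B ^ 3"
    proof -
      have "real l * c \<le> B * B\<^sup>2" using c B1 by (intro mult_mono) (auto simp: Bx)
      then show "4 * real l * c \<le> 4 * B ^ 3" by (simp add: power2_eq_square power3_eq_cube)
    qed (use c in simp)
    moreover have "\<bar>u - 2 * v + w - z\<bar> \<le> 29 * b"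
      if "\<bar>u\<bar> \<le> 12 * b" "\<bar>v\<bar> \<le> 5 * b" "\<bar>z\<bar> \<le> 3 * b" "0 \<le> w" "w \<le> 4 * b" for u v w z b :: real
      using that by linarith
    ultimately show ?thesis unfolding eq by blast
  qed
  then show "\<bar>real N ^ 2 * (shell_weight 1 N x - (0 * real N + 0
    + (case x of (l, k, n) \<Rightarrow> - 4 * ((real k - real l)\<^sup>2 + (real_of_int n)\<^sup>2)) / real N))\<bar> \<le> 29 * (1 + sz x) ^ 3"
    by (simp add: x a_def c_def B_def[unfolded x])
qed

text \<open>Counting suffices: at most 3 N sites with weights of order N^2, divided by N^5. The
  constant is 27 = 3 * 3^2.\<close>

lemma shell_weight_2:
  "upb (\<lambda>N x. real N ^ 2 * (shell_weight 2 N x - (0 * real N + 0 + 0 / real N)))"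
proof (rule upbI[where K = 27 and p = 5])
  fix N :: nat and x :: "nat \<times> nat \<times> int" assume N: "N \<ge> 1"
  obtain l k n where x: "x = (l, k, n)" by (cases x)
  define B where "B = 1 + sz x"
  have B1: "B \<ge> 1" by (simp add: B_def)
  have N1: "real N \<ge> 1" using N by simp
  have "real N ^ 2 * \<bar>shell_weight 2 N x\<bar> \<le> 27 * B ^ 5"
  proof (cases "l \<le> N")
    case False then show ?thesis using B1 by (simp add: shell_weight_def x)
  next
    case True
    define M where "M = N - l"
    have M: "real M = real N - real l" using True by (simp add: M_def of_nat_diff)
    have "\<bar>\<Sum>m\<in>mid M. weight 2 N x m\<bar> \<le> (2 * real M + 1) * (B * (B * (3 * real N * B)) ^ 2)"
    proof (rule sum_mid_bound)
      fix m assume m: "m \<in> mid M"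
      let ?d = "level_shift (real k - real l) m n"
      have dB: "\<bar>?d\<bar> \<le> B" using level_shift_bound_sz[of k l m n] by (simp add: B_def x)
      have "2 * real N + B \<le> 2 * real N * B + real N * B"
        using N1 B1 by (intro add_mono) (auto simp: mult_le_cancel_left1 mult_le_cancel_right1)
      then have "\<bar>2 * real N + ?d\<bar> \<le> 3 * real N * B" using dB N1 by linarith
      then show "\<bar>weight 2 N x m\<bar> \<le> B * (B * (3 * real N * B)) ^ 2"
        unfolding weight_def x split abs_mult power_abs
        using eigenvalue_shift_bound[OF m, of l k n] dB B1 by (intro mult_mono power_mono) (auto simp: M_def B_def x)
    qed
    also have "\<dots> \<le> 3 * real N * (B * (B * (3 * real N * B)) ^ 2)" using N1 B1 unfolding M by (intro mult_right_mono) auto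
    finally have s: "\<bar>\<Sum>m\<in>mid M. weight 2 N x m\<bar> \<le> 3 * real N * (B * (B * (3 * real N * B)) ^ 2)" .
    have "real N ^ 2 * \<bar>shell_weight 2 N x\<bar> = \<bar>\<Sum>m\<in>mid M. weight 2 N x m\<bar> / real N ^ 3"
      using True N1 by (simp add: shell_weight_def x M_def numeral_eq_Suc)
    also have "\<dots> \<le> 3 * real N * (B * (B * (3 * real N * B)) ^ 2) / real N ^ 3" using s by (intro divide_right_mono) auto
    also have "\<dots> = 27 * B ^ 5" using N1 by (simp add: numeral_eq_Suc field_simps)
    finally show ?thesis .
  qed
  then show "\<bar>real N ^ 2 * (shell_weight 2 N x - (0 * real N + 0 + 0 / real N))\<bar> \<le> 27 * (1 + sz x) ^ 5"
    by (simp add: abs_mult B_def)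
qed

section \<open>The Toeplitz contribution\<close>

text \<open>With d = k - l, the condition k \<ge> 0 reads l \<ge> dm d: the diagonal d of a matrix
  on the half-line starts there.\<close>

definition dm :: "int \<Rightarrow> real" where
  "dm d = max 0 (- real_of_int d)"

text \<open>The signs of \<open>D\<close> on the sites of level \<open>N\<close> with \<open>l \<ge> dm d\<close> add up to \<open>1 - (N - dm d)\<^sup>2\<close>.\<close>
definition toep_weight :: "nat \<Rightarrow> nat \<Rightarrow> int \<Rightarrow> real" where
  "toep_weight r N d = (if dm d \<le> real N + 1 then
     real_of_int d * (real_of_int d * (2 * real N + real_of_int d)) ^ r * (1 - (real N - dm d)\<^sup>2) / real N ^ (1 + 2 * r) else 0)"

lemma upb_int: "upb (\<lambda>N d. real_of_int d)" "upb (\<lambda>N. dm)" "upb (\<lambda>N d. min (real N) (dm d))"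
  by (rule upb_le_sz; auto simp: dm_def sz_int_def)+

text \<open>Outside the region where the expansion is exact up to the remainder \<open>G\<close>, the level \<open>N\<close> is
  bounded by \<open>dm d\<close>.\<close>
lemma toep_weight_upb:
  assumes e: "upb (\<lambda>_. e1)" "upb (\<lambda>_. e0)" "upb (\<lambda>_. e)" and G: "upb G"
    and eq: "\<And>N d. N \<ge> 1 \<Longrightarrow> dm d \<le> real N + 1 \<Longrightarrow>
      real N ^ 2 * (toep_weight r N d - (e1 d * real N + e0 d + e d / real N)) = G N d"
  shows "upb (\<lambda>N d. real N ^ 2 * (toep_weight r N d - (e1 d * real N + e0 d + e d / real N)))"
proof -
  let ?n = "\<lambda>N d. min (real N) (dm d)"
  have "upb (\<lambda>N d. if dm d \<le> real N + 1 then G N d else - (e1 d * ?n N d ^ 3 + e0 d * ?n N d ^ 2 + e d * ?n N d))"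
    by (intro upb_if upb_intros e G upb_int)
  then show ?thesis
  proof (rule upb_cong)
    fix N :: nat and d :: int assume N: "N \<ge> 1"
    show "real N ^ 2 * (toep_weight r N d - (e1 d * real N + e0 d + e d / real N)) =
      (if dm d \<le> real N + 1 then G N d else - (e1 d * ?n N d ^ 3 + e0 d * ?n N d ^ 2 + e d * ?n N d))"
    proof (cases "dm d \<le> real N + 1")
      case True then show ?thesis using eq[OF N True] by simp
    next
      case False
      then have "?n N d = real N" by simp
      then show ?thesis using False N by (simp add: toep_weight_def power2_eq_square power3_eq_cube field_simps)
    qed
  qed
qed

lemma toep_weight_0:
  "upb (\<lambda>N d. real N ^ 2 * (toep_weight 0 N d - (- real_of_int d * real N + 2 * real_of_int d * dm d
    + real_of_int d * (1 - (dm d)\<^sup>2) / real N)))"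
  by (rule toep_weight_upb[where G = "\<lambda>N d. 0"]; (intro upb_intros upb_int)?)
     (simp add: toep_weight_def power2_eq_square field_simps)

text \<open>Here and for r = 2 the function G is N^2 times the part of the expanded polynomial below
  the order 1/N; for r = 0 nothing is left over.\<close>

lemma toep_weight_1:
  "upb (\<lambda>N d. real N ^ 2 * (toep_weight 1 N d - (0 * real N + (- 2 * (real_of_int d)\<^sup>2)
    + ((real_of_int d)\<^sup>2 * (4 * dm d - real_of_int d)) / real N)))"
  by (rule toep_weight_upb[where G = "\<lambda>N d. (real_of_int d)\<^sup>2 * (2 - 2 * (dm d)\<^sup>2 + 2 * real_of_int d * dm d)
      + (real_of_int d) ^ 3 * (1 - (dm d)\<^sup>2) / real N"]; (intro upb_intros upb_int)?)
     (simp add: toep_weight_def numeral_eq_Suc field_simps)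

lemma toep_weight_2:
  "upb (\<lambda>N d. real N ^ 2 * (toep_weight 2 N d - (0 * real N + 0 + (- 4 * (real_of_int d) ^ 3) / real N)))"
  by (rule toep_weight_upb[where G = "\<lambda>N d. (real_of_int d) ^ 3 * ((8 * dm d - 4 * real_of_int d)
      + (4 * (1 - (dm d)\<^sup>2) + 8 * real_of_int d * dm d - (real_of_int d)\<^sup>2) / real N
      + (4 * real_of_int d * (1 - (dm d)\<^sup>2) + 2 * (real_of_int d)\<^sup>2 * dm d) / real N / real N
      + (real_of_int d)\<^sup>2 * (1 - (dm d)\<^sup>2) / real N / real N / real N)"]; (intro upb_intros upb_int)?)
     (simp add: toep_weight_def numeral_eq_Suc field_simps)

section \<open>The traces of the cocycle\<close>

lemma infsum_of_sum:
  fixes f :: "'i \<Rightarrow> 'a \<Rightarrow> complex"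
  assumes "finite F" "\<And>i. i \<in> F \<Longrightarrow> f i summable_on A"
  shows "(\<Sum>\<^sub>\<infinity>x\<in>A. \<Sum>i\<in>F. f i x) = (\<Sum>i\<in>F. infsum (f i) A)" and "(\<lambda>x. \<Sum>i\<in>F. f i x) summable_on A"
proof -
  have "(\<Sum>\<^sub>\<infinity>x\<in>A. \<Sum>i\<in>F. f i x) = (\<Sum>i\<in>F. infsum (f i) A) \<and> (\<lambda>x. \<Sum>i\<in>F. f i x) summable_on A"
    using assms by (induction F) (auto simp: infsum_add intro: summable_on_add)
  then show "(\<Sum>\<^sub>\<infinity>x\<in>A. \<Sum>i\<in>F. f i x) = (\<Sum>i\<in>F. infsum (f i) A)" "(\<lambda>x. \<Sum>i\<in>F. f i x) summable_on A" by auto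
qed

lemma sum_infsum_fst:
  fixes F :: "nat \<times> 'a \<Rightarrow> complex"
  assumes F: "F summable_on UNIV" and 0: "\<And>l y. l > N \<Longrightarrow> F (l, y) = 0"
  shows "(\<Sum>l\<le>N. \<Sum>\<^sub>\<infinity>y. F (l, y)) = infsum F UNIV"
proof -
  have "(\<Sum>l\<le>N. \<Sum>\<^sub>\<infinity>y. F (l, y)) = (\<Sum>\<^sub>\<infinity>l\<in>{..N}. \<Sum>\<^sub>\<infinity>y. F (l, y))" by simp
  also have "\<dots> = (\<Sum>\<^sub>\<infinity>l. \<Sum>\<^sub>\<infinity>y. F (l, y))" by (rule infsum_cong_neutral) (auto simp: 0)
  also have "\<dots> = infsum F (UNIV \<times> UNIV)" by (rule infsum_Sigma_banach) (use F in simp)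
  finally show ?thesis by simp
qed

context
  fixes c0 c1 :: "nat \<Rightarrow> nat \<Rightarrow> int \<Rightarrow> complex" and t0 t1 :: "int \<Rightarrow> complex"
  assumes c: "rd3 c0" "rd3 c1" and t: "rd t0" "rd t1"
begin

definition tau :: "int \<Rightarrow> complex" where
  "tau d = t0 (- d) * t1 d"

text \<open>A triple (l, k, n) is a closed path: the second kernel leads from (l, m) to (k, m + n)
  and the first one back. The product does not depend on m, which enters the trace through
  \<open>weight\<close> alone.\<close>

definition qfull :: "nat \<times> nat \<times> int \<Rightarrow> complex" where
  "qfull x = (case x of (l, k, n) \<Rightarrow> (c0 l k (- n) + (if n = 0 then t0 (int l - int k) else 0)) *
     (c1 k l n + (if n = 0 then t1 (int k - int l) else 0)))"

text \<open>The product of the two Toeplitz parts does not decay along the diagonals \<open>k - l = d\<close>, so it is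
  split off.\<close>
definition qtoep :: "nat \<times> nat \<times> int \<Rightarrow> complex" where
  "qtoep x = (case x of (l, k, n) \<Rightarrow> if n = 0 then tau (int k - int l) else 0)"

definition qrest :: "nat \<times> nat \<times> int \<Rightarrow> complex" where
  "qrest x = qfull x - qtoep x"

lemma rd_tau: "rd tau"
proof -
  obtain C where C: "C > 0" "\<And>x. cmod (t0 x) \<le> C" using rd_bounded[OF t(1)] by blast
  show ?thesis
    by (rule rd_mono[OF rd_cmult[OF t(2), of "of_real C"]])
       (use C in \<open>auto simp: tau_def norm_mult intro!: mult_right_mono\<close>)
qed

lemma qrest_eq: "qrest (l, k, n) = c0 l k (- n) * (c1 k l n + (if n = 0 then t1 (int k - int l) else 0))
    + (if n = 0 then t0 (int l - int k) else 0) * c1 k l n"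
  by (simp add: qrest_def qfull_def qtoep_def tau_def algebra_simps)

text \<open>Every term of \<open>qrest_eq\<close> contains c0 or c1 at the full triple, and the
  other factor is bounded.\<close>

lemma rd_qrest: "rd qrest"
proof -
  obtain B0 where B0: "B0 > 0" "\<And>x. cmod (t0 x) \<le> B0" using rd_bounded[OF t(1)] by blast
  obtain B1 where B1: "B1 > 0" "\<And>x. cmod (t1 x) \<le> B1" using rd_bounded[OF t(2)] by blast
  obtain C1 where C1: "C1 > 0" "\<And>x. cmod (case x of (k, l, n) \<Rightarrow> c1 k l n) \<le> C1"
    using rd_bounded[OF c(2)[unfolded rd3_def]] by blast
  have 0: "rd (\<lambda>(l, k, n). c0 l k (- n) * of_real (C1 + B1))"
    by (rule rd_le[OF c(1)[unfolded rd3_def], of _ "C1 + B1" 0 "\<lambda>(l, k, n). (l, k, - n)"])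
       (use C1(1) B1(1) in \<open>auto simp: norm_mult sz_triple mult.commute simp flip: of_real_add\<close>)
  have 1: "rd (\<lambda>(l, k, n). of_real B0 * c1 k l n)"
    by (rule rd_le[OF c(2)[unfolded rd3_def], of _ B0 0 "\<lambda>(l, k, n). (k, l, n)"])
       (use B0(1) in \<open>auto simp: norm_mult sz_triple\<close>)
  have "rd (\<lambda>(l, k, n). c0 l k (- n) * (c1 k l n + (if n = 0 then t1 (int k - int l) else 0)))"
  proof (rule rd_mono[OF 0])
    fix x :: "nat \<times> nat \<times> int"
    obtain l k n where x: "x = (l, k, n)" by (cases x)
    have "cmod (c1 k l n + (if n = 0 then t1 (int k - int l) else 0)) \<le> C1 + B1"
      using C1(2)[of "(k, l, n)"] B1 by (intro order_trans[OF norm_triangle_ineq] add_mono) (auto intro: less_imp_le)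
    then show "cmod (case x of (l, k, n) \<Rightarrow> c0 l k (- n) * (c1 k l n + (if n = 0 then t1 (int k - int l) else 0)))
      \<le> cmod (case x of (l, k, n) \<Rightarrow> c0 l k (- n) * of_real (C1 + B1))"
      using C1(1) B1(1) unfolding x split norm_mult norm_of_real by (intro mult_left_mono) auto
  qed
  moreover have "rd (\<lambda>(l, k, n). (if n = 0 then t0 (int l - int k) else 0) * c1 k l n)"
    by (rule rd_mono[OF 1]) (use B0 in \<open>auto simp: norm_mult intro!: mult_right_mono\<close>)
  ultimately have "rd (\<lambda>x. (case x of (l, k, n) \<Rightarrow> c0 l k (- n) * (c1 k l n + (if n = 0 then t1 (int k - int l) else 0)))
     + (case x of (l, k, n) \<Rightarrow> (if n = 0 then t0 (int l - int k) else 0) * c1 k l n))"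
    by (rule rd_add)
  then show ?thesis by (rule rd_mono) (auto simp: qrest_eq)
qed

text \<open>The matrix of the first operator composed with the r-fold \<open>nabla\<close> of the
  commutator of \<open>D\<close> with the second: each \<open>nabla\<close> multiplies an entry by a
  difference of squared levels. The terms of \<open>\<phi>\<^sub>1\<close> are r = 0, 1, 2.\<close>

definition wmat :: "nat \<Rightarrow> mat" where
  "wmat r = mat_mult (ker c0 t0) (\<lambda>s y z. of_real ((sigmaD (s, y) - sigmaD (s, z)) *
     ((level (s, y))\<^sup>2 - (level (s, z))\<^sup>2) ^ r) * ker c1 t1 s y z)"

lemma weight_eq:
  assumes "l \<le> N" "m \<in> mid (N - l)" and s: "s = nat (int (N - l) - \<bar>m\<bar>)"
  shows "(sigmaD (s, k, m + n) - sigmaD (s, l, m)) * ((level (s, k, m + n))\<^sup>2 - (level (s, l, m))\<^sup>2) ^ r = weight r N (l, k, n) m"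
proof -
  have L: "level (s, l, m) = real N" "level (s, k, m + n) = real N + level_shift (real k - real l) m n"
    using assms by (auto simp: level_def mid_def level_shift_def)
  have "(level (s, k, m + n))\<^sup>2 - (level (s, l, m))\<^sup>2 = level_shift (real k - real l) m n * (2 * real N + level_shift (real k - real l) m n)"
    unfolding L by (simp add: power2_eq_square algebra_simps)
  then show ?thesis by (simp add: weight_def eigenvalue_shift_def s)
qed

lemma wmat_diag:
  assumes "l \<le> N" "m \<in> mid (N - l)" and s: "s = nat (int (N - l) - \<bar>m\<bar>)"
  shows "wmat r s (l, m) (l, m) = (\<Sum>\<^sub>\<infinity>(k, n). qfull (l, k, n) * of_real (weight r N (l, k, n) m))"
  unfolding wmat_def mat_mult_def
proof (rule infsum_reindex_bij_witness[of _ "\<lambda>(k, n). (k, m + n)" "\<lambda>(k, m'). (k, m' - m)"])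
  fix w :: "nat \<times> int"
  obtain k n where w: "w = (k, m + n)" by (metis diff_add_cancel add.commute prod.collapse)
  show "(case case w of (k, m') \<Rightarrow> (k, m' - m) of (k, n) \<Rightarrow> qfull (l, k, n) * of_real (weight r N (l, k, n) m)) =
    ker c0 t0 s (l, m) w * (of_real ((sigmaD (s, w) - sigmaD (s, l, m)) * ((level (s, w))\<^sup>2 - (level (s, l, m))\<^sup>2) ^ r) * ker c1 t1 s w (l, m))"
    unfolding w weight_eq[OF assms] by (simp add: qfull_def ker_def toep_def weight_eq[OF assms])
qed auto

lemma weight_bound:
  assumes N: "N \<ge> 1" and m: "m \<in> mid (N - fst x)"
  shows "\<bar>weight r N x m\<bar> \<le> (3 * real N) ^ r * (1 + sz x) ^ (1 + 3 * r)"
proof -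
  obtain l k n where x: "x = (l, k, n)" by (cases x)
  define B where "B = 1 + sz x"
  have B1: "B \<ge> 1" by (simp add: B_def)
  have N1: "real N \<ge> 1" using N by simp
  let ?d = "level_shift (real k - real l) m n"
  have dB: "\<bar>?d\<bar> \<le> B" using level_shift_bound_sz[of k l m n] by (simp add: B_def x)
  have "2 * real N + B \<le> 2 * real N * B + real N * B"
    using N1 B1 by (intro add_mono) (auto simp: mult_le_cancel_left1 mult_le_cancel_right1)
  then have "\<bar>2 * real N + ?d\<bar> \<le> 3 * real N * B" using dB N1 by linarith
  then have "\<bar>weight r N x m\<bar> \<le> B * (B * (3 * real N * B)) ^ r"
    unfolding weight_def x split abs_mult power_abs
    using eigenvalue_shift_bound[of m "N - l" l k n] m dB B1 by (intro mult_mono power_mono) (auto simp: B_def x)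
  also have "\<dots> = (3 * real N) ^ r * B ^ (1 + 2 * r)"
    by (simp add: power_mult_distrib power_add power_mult power2_eq_square mult_ac)
  also have "\<dots> \<le> (3 * real N) ^ r * B ^ (1 + 3 * r)"
    using B1 by (intro mult_left_mono power_increasing) auto
  finally show ?thesis by (simp add: B_def)
qed

text \<open>For fixed N the weights grow polynomially in the triple, so everything converges
  absolutely and the finite sum over m can be taken inside, where it produces
  \<open>shell_weight\<close>.\<close>

lemma rest_sum:
  assumes N: "N \<ge> 1"
  shows "(\<Sum>l\<le>N. \<Sum>m\<in>mid (N - l). \<Sum>\<^sub>\<infinity>(k, n). qrest (l, k, n) * of_real (weight r N (l, k, n) m))
      = of_nat N ^ (1 + 2 * r) * (\<Sum>\<^sub>\<infinity>x. qrest x * of_real (shell_weight r N x))"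
    and "l \<le> N \<Longrightarrow> m \<in> mid (N - l) \<Longrightarrow> (\<lambda>(k, n). qrest (l, k, n) * of_real (weight r N (l, k, n) m)) summable_on UNIV"
proof -
  have sm: "(\<lambda>(k, n). qrest (l, k, n) * of_real (weight r N (l, k, n) m)) summable_on UNIV"
    if "l \<le> N" "m \<in> mid (N - l)" for l m
  proof -
    let ?w = "\<lambda>x. if m \<in> mid (N - fst x) then weight r N x m else 0"
    have "rd (\<lambda>x. of_real (?w x) * qrest x)"
      by (rule rd_poly_mult[OF rd_qrest, of _ "(3 * real N) ^ r" "1 + 3 * r"]) (use weight_bound[OF N] in auto)
    then have "rd (\<lambda>(l, y). of_real (?w (l, y)) * qrest (l, y))" by (rule rd_mono) (simp add: case_prod_unfold)
    from rd_summable[OF rd_section[OF this, of l], of UNIV] show ?thesis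
      using that by (simp add: case_prod_unfold mult.commute)
  qed
  then show "l \<le> N \<Longrightarrow> m \<in> mid (N - l) \<Longrightarrow> (\<lambda>(k, n). qrest (l, k, n) * of_real (weight r N (l, k, n) m)) summable_on UNIV"
    by blast
  let ?F = "\<lambda>x. of_nat N ^ (1 + 2 * r) * (qrest x * of_real (shell_weight r N x))"
  have in_l: "(\<Sum>m\<in>mid (N - l). \<Sum>\<^sub>\<infinity>(k, n). qrest (l, k, n) * of_real (weight r N (l, k, n) m)) = (\<Sum>\<^sub>\<infinity>y. ?F (l, y))"
    if l: "l \<le> N" for l
  proof -
    have "(\<Sum>m\<in>mid (N - l). \<Sum>\<^sub>\<infinity>(k, n). qrest (l, k, n) * of_real (weight r N (l, k, n) m))
      = (\<Sum>\<^sub>\<infinity>y. \<Sum>m\<in>mid (N - l). case y of (k, n) \<Rightarrow> qrest (l, k, n) * of_real (weight r N (l, k, n) m))"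
      by (rule infsum_of_sum(1)[symmetric]) (use sm[OF l] in auto)
    also have "\<dots> = (\<Sum>\<^sub>\<infinity>y. ?F (l, y))"
    proof (rule infsum_cong)
      fix y :: "nat \<times> int"
      obtain k n where y: "y = (k, n)" by (cases y)
      have "of_real (\<Sum>m\<in>mid (N - l). weight r N (l, k, n) m) = (of_nat N :: complex) ^ (1 + 2 * r) * of_real (shell_weight r N (l, k, n))"
        using l N by (simp add: shell_weight_def)
      then show "(\<Sum>m\<in>mid (N - l). case y of (k, n) \<Rightarrow> qrest (l, k, n) * of_real (weight r N (l, k, n) m)) = ?F (l, y)"
        unfolding y split sum_distrib_left[symmetric] of_real_sum[symmetric] by (simp add: mult.left_commute)
    qed
    finally show ?thesis .
  qed
  have sw: "\<bar>shell_weight r N x\<bar> \<le> (2 * real N + 1) * (3 * real N) ^ r * (1 + sz x) ^ (1 + 3 * r)" for x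
  proof (cases "fst x \<le> N")
    case True
    have N1: "1 \<le> real N ^ (1 + 2 * r)" using N by (intro one_le_power) simp
    have "\<bar>\<Sum>m\<in>mid (N - fst x). weight r N x m\<bar> \<le> (2 * real (N - fst x) + 1) * ((3 * real N) ^ r * (1 + sz x) ^ (1 + 3 * r))"
      by (rule sum_mid_bound) (rule weight_bound[OF N])
    also have "\<dots> \<le> (2 * real N + 1) * ((3 * real N) ^ r * (1 + sz x) ^ (1 + 3 * r))"
      by (intro mult_right_mono) (auto intro!: mult_nonneg_nonneg)
    finally have 1: "\<bar>\<Sum>m\<in>mid (N - fst x). weight r N x m\<bar> \<le> (2 * real N + 1) * ((3 * real N) ^ r * (1 + sz x) ^ (1 + 3 * r))" .
    have "\<bar>shell_weight r N x\<bar> = \<bar>\<Sum>m\<in>mid (N - fst x). weight r N x m\<bar> / real N ^ (1 + 2 * r)"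
      using True by (simp add: shell_weight_def)
    also have "\<dots> \<le> \<bar>\<Sum>m\<in>mid (N - fst x). weight r N x m\<bar> / 1"
      using N1 by (intro divide_left_mono) auto
    finally show ?thesis using 1 by (simp add: mult.assoc)
  qed (simp add: shell_weight_def)
  have "rd (\<lambda>x. of_real (shell_weight r N x) * qrest x)"
    by (rule rd_poly_mult[OF rd_qrest, of _ "(2 * real N + 1) * (3 * real N) ^ r" "1 + 3 * r"]) (use sw in auto)
  then have F: "?F summable_on UNIV"
    by (intro summable_on_cmult_right rd_summable) (simp add: mult.commute)
  have "(\<Sum>l\<le>N. \<Sum>m\<in>mid (N - l). \<Sum>\<^sub>\<infinity>(k, n). qrest (l, k, n) * of_real (weight r N (l, k, n) m)) = (\<Sum>l\<le>N. \<Sum>\<^sub>\<infinity>y. ?F (l, y))"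
    by (intro sum.cong refl in_l) simp
  also have "\<dots> = infsum ?F UNIV"
    by (rule sum_infsum_fst[OF F]) (simp add: shell_weight_def)
  also have "\<dots> = of_nat N ^ (1 + 2 * r) * (\<Sum>\<^sub>\<infinity>x. qrest x * of_real (shell_weight r N x))"
    by (rule infsum_cmult_right')
  finally show "(\<Sum>l\<le>N. \<Sum>m\<in>mid (N - l). \<Sum>\<^sub>\<infinity>(k, n). qrest (l, k, n) * of_real (weight r N (l, k, n) m))
      = of_nat N ^ (1 + 2 * r) * (\<Sum>\<^sub>\<infinity>x. qrest x * of_real (shell_weight r N x))" .
qed

lemma weight_toep:
  "weight r N (l, k, 0) m = sgr (nat (int (N - l) - \<bar>m\<bar>)) m * (real k - real l) * ((real k - real l) * (2 * real N + (real k - real l))) ^ r"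
  by (auto simp: weight_def eigenvalue_shift_def level_shift_def sgr_def sigmaD_def level_def)

text \<open>For n = 0 the weight is the sign of the eigenvalue, which depends on l and m only, times
  a polynomial in d = k - l. For fixed d the signs add up over m to 1 - 2 (N - l) and then over l
  \<ge> dm d to 1 - (N - dm d)^2; the series over d converges by the decay of
  \<open>tau\<close>.\<close>

lemma toep_sum:
  assumes N: "N \<ge> 1"
  shows "(\<Sum>l\<le>N. \<Sum>m\<in>mid (N - l). \<Sum>\<^sub>\<infinity>(k, n). qtoep (l, k, n) * of_real (weight r N (l, k, n) m))
      = of_nat N ^ (1 + 2 * r) * (\<Sum>\<^sub>\<infinity>d. tau d * of_real (toep_weight r N d))"
    and "(\<lambda>(k, n). qtoep (l, k, n) * of_real (weight r N (l, k, n) m)) summable_on UNIV"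
proof -
  define g where "g = (\<lambda>d. real_of_int d * (real_of_int d * (2 * real N + real_of_int d)) ^ r)"
  let ?h = "\<lambda>d. tau d * of_real (g d)"
  have gb: "upb (\<lambda>_. g)"
    unfolding g_def by (intro upb_intros upb_int(1))
  have h: "rd ?h" using upb_rd_mult[OF rd_tau gb N] .
  have hs: "?h summable_on A" for A by (rule rd_summable[OF h])
  let ?s = "\<lambda>l m. sgr (nat (int (N - l) - \<bar>m\<bar>)) m"
  have wk: "qtoep (l, k, 0) * of_real (weight r N (l, k, 0) m) = of_real (?s l m) * ?h (int k - int l)" for l k m
    by (simp add: weight_toep g_def qtoep_def)
  have inj: "inj (\<lambda>k. (k, 0::int))" by (simp add: inj_on_def)
  have kd: "(\<Sum>\<^sub>\<infinity>k. ?h (int k - int l)) = infsum ?h {- int l..}" for l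
    by (rule infsum_reindex_bij_witness[of _ "\<lambda>d. nat (d + int l)" "\<lambda>k. int k - int l"]) auto
  have kds: "(\<lambda>k. ?h (int k - int l)) summable_on UNIV" for l
  proof -
    have "((\<lambda>k. ?h (int k - int l)) summable_on UNIV) = (?h summable_on {- int l..})"
      by (rule summable_on_reindex_bij_witness[of _ "\<lambda>d. nat (d + int l)" "\<lambda>k. int k - int l"]) auto
    then show ?thesis using hs by simp
  qed
  let ?G = "\<lambda>l m y. case y of (k, n) \<Rightarrow> qtoep (l, k, n) * of_real (weight r N (l, k, n) m)"
  have Gs: "?G l m summable_on UNIV" for l m
  proof -
    have "?G l m summable_on range (\<lambda>k. (k, 0::int))"
      unfolding summable_on_reindex[OF inj] o_def split wk by (intro summable_on_cmult_right kds)
    then show ?thesis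
      by (rule summable_on_cong_neutral[THEN iffD1, rotated -1]) (auto simp: qtoep_def)
  qed
  then show "(\<lambda>(k, n). qtoep (l, k, n) * of_real (weight r N (l, k, n) m)) summable_on UNIV" .
  have Gi: "infsum (?G l m) UNIV = of_real (?s l m) * infsum ?h {- int l..}" for l m
  proof -
    have "infsum (?G l m) UNIV = infsum (?G l m) (range (\<lambda>k. (k, 0::int)))"
      by (rule infsum_cong_neutral) (auto simp: qtoep_def)
    also have "\<dots> = (\<Sum>\<^sub>\<infinity>k. of_real (?s l m) * ?h (int k - int l))"
      unfolding infsum_reindex[OF inj] o_def split wk ..
    finally show ?thesis by (simp only: infsum_cmult_right' kd)
  qed
  have "(\<Sum>l\<le>N. \<Sum>m\<in>mid (N - l). infsum (?G l m) UNIV) = (\<Sum>l\<le>N. of_real (1 - 2 * real (N - l)) * infsum ?h {- int l..})"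
    unfolding Gi sum_distrib_right[symmetric] of_real_sum[symmetric] sum_mid_sgr ..
  also have "\<dots> = (\<Sum>l\<le>N. \<Sum>\<^sub>\<infinity>d. of_real (1 - 2 * real (N - l)) * (if - int l \<le> d then ?h d else 0))"
  proof (rule sum.cong[OF refl])
    fix l
    have "infsum ?h {- int l..} = (\<Sum>\<^sub>\<infinity>d. if - int l \<le> d then ?h d else 0)"
      by (rule infsum_cong_neutral) auto
    then show "of_real (1 - 2 * real (N - l)) * infsum ?h {- int l..} = (\<Sum>\<^sub>\<infinity>d. of_real (1 - 2 * real (N - l)) * (if - int l \<le> d then ?h d else 0))"
      by (simp only: infsum_cmult_right')
  qed
  also have "\<dots> = (\<Sum>\<^sub>\<infinity>d. \<Sum>l\<le>N. of_real (1 - 2 * real (N - l)) * (if - int l \<le> d then ?h d else 0))"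
  proof (rule infsum_of_sum(1)[symmetric])
    fix l
    have "rd (\<lambda>d. if - int l \<le> d then ?h d else 0)" by (rule rd_mono[OF h]) auto
    then show "(\<lambda>d. of_real (1 - 2 * real (N - l)) * (if - int l \<le> d then ?h d else 0)) summable_on UNIV"
      by (intro summable_on_cmult_right rd_summable)
  qed simp
  also have "\<dots> = (\<Sum>\<^sub>\<infinity>d. of_nat N ^ (1 + 2 * r) * (tau d * of_real (toep_weight r N d)))"
  proof (rule infsum_cong)
    fix d :: int
    define j where "j = nat (max 0 (- d))"
    have jd: "real j = dm d" by (simp add: j_def dm_def)
    have "(\<Sum>l\<le>N. of_real (1 - 2 * real (N - l)) * (if - int l \<le> d then ?h d else 0)) = (\<Sum>l\<in>{j..N}. of_real (1 - 2 * real (N - l)) * ?h d)"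
      by (rule sum.mono_neutral_cong_right) (auto simp: j_def)
    also have "\<dots> = of_real (\<Sum>l\<in>{j..N}. 1 - 2 * real (N - l)) * ?h d"
      by (simp only: sum_distrib_right of_real_sum)
    also have "(\<Sum>l\<in>{j..N}. 1 - 2 * real (N - l)) = (if dm d \<le> real N + 1 then 1 - (real N - dm d)\<^sup>2 else 0)"
    proof (cases "j \<le> N + 1")
      case True
      then have "dm d \<le> real N + 1" unfolding jd[symmetric] by simp
      then show ?thesis using sum_sgr_from[OF True] by (simp only: jd if_True)
    next
      case False
      then have "\<not> dm d \<le> real N + 1" unfolding jd[symmetric] by simp
      then show ?thesis using False by simp
    qed
    also have "of_real (if dm d \<le> real N + 1 then 1 - (real N - dm d)\<^sup>2 else 0) * ?h d = of_nat N ^ (1 + 2 * r) * (tau d * of_real (toep_weight r N d))"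
      using N by (simp add: toep_weight_def g_def)
    finally show "(\<Sum>l\<le>N. of_real (1 - 2 * real (N - l)) * (if - int l \<le> d then ?h d else 0)) = of_nat N ^ (1 + 2 * r) * (tau d * of_real (toep_weight r N d))" .
  qed
  also have "\<dots> = of_nat N ^ (1 + 2 * r) * (\<Sum>\<^sub>\<infinity>d. tau d * of_real (toep_weight r N d))"
    by (rule infsum_cmult_right')
  finally show "(\<Sum>l\<le>N. \<Sum>m\<in>mid (N - l). \<Sum>\<^sub>\<infinity>(k, n). qtoep (l, k, n) * of_real (weight r N (l, k, n) m))
      = of_nat N ^ (1 + 2 * r) * (\<Sum>\<^sub>\<infinity>d. tau d * of_real (toep_weight r N d))" .
qed

lemma wmat_shell:
  assumes N: "N \<ge> 1"
  shows "(\<Sum>(s, y)\<in>shell N. wmat r s y y) / of_nat N ^ (1 + 2 * r)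
    = (\<Sum>\<^sub>\<infinity>x. qrest x * of_real (shell_weight r N x)) + (\<Sum>\<^sub>\<infinity>d. tau d * of_real (toep_weight r N d))"
proof -
  have "(\<Sum>(s, y)\<in>shell N. wmat r s y y) = (\<Sum>l\<le>N. \<Sum>m\<in>mid (N - l).
      (\<Sum>\<^sub>\<infinity>(k, n). qrest (l, k, n) * of_real (weight r N (l, k, n) m))
    + (\<Sum>\<^sub>\<infinity>(k, n). qtoep (l, k, n) * of_real (weight r N (l, k, n) m)))"
    unfolding sum_shell split
  proof (intro sum.cong refl)
    fix l m assume l: "l \<in> {..N}" and m: "m \<in> mid (N - l)"
    have "wmat r (nat (int (N - l) - \<bar>m\<bar>)) (l, m) (l, m) = (\<Sum>\<^sub>\<infinity>(k, n). qfull (l, k, n) * of_real (weight r N (l, k, n) m))"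
      using l m by (intro wmat_diag) auto
    also have "\<dots> = (\<Sum>\<^sub>\<infinity>y. (case y of (k, n) \<Rightarrow> qrest (l, k, n) * of_real (weight r N (l, k, n) m))
      + (case y of (k, n) \<Rightarrow> qtoep (l, k, n) * of_real (weight r N (l, k, n) m)))"
      by (rule infsum_cong) (simp add: qrest_def algebra_simps split: prod.split)
    also have "\<dots> = (\<Sum>\<^sub>\<infinity>(k, n). qrest (l, k, n) * of_real (weight r N (l, k, n) m))
    + (\<Sum>\<^sub>\<infinity>(k, n). qtoep (l, k, n) * of_real (weight r N (l, k, n) m))"
      using l m by (intro infsum_add rest_sum(2)[OF N] toep_sum(2)[OF N]) auto
    finally show "wmat r (nat (int (N - l) - \<bar>m\<bar>)) (l, m) (l, m) = (\<Sum>\<^sub>\<infinity>(k, n). qrest (l, k, n) * of_real (weight r N (l, k, n) m))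
    + (\<Sum>\<^sub>\<infinity>(k, n). qtoep (l, k, n) * of_real (weight r N (l, k, n) m))" .
  qed
  then show ?thesis
    using N by (simp add: sum.distrib rest_sum(1)[OF N] toep_sum(1)[OF N] add_divide_distrib)
qed

lemma wmat_asymptotics:
  assumes "upb (\<lambda>N x. real N ^ 2 * (shell_weight r N x - (e1 x * real N + e0 x + e x / real N)))"
    and "upb (\<lambda>_. e1)" "upb (\<lambda>_. e0)" "upb (\<lambda>_. e)"
    and "upb (\<lambda>N x. real N ^ 2 * (toep_weight r N x - (e1' x * real N + e0' x + e' x / real N)))"
    and "upb (\<lambda>_. e1')" "upb (\<lambda>_. e0')" "upb (\<lambda>_. e')"
  shows "\<exists>a1 a0. has_asymptotics (\<lambda>N. (\<Sum>(s, y)\<in>shell N. wmat r s y y) / of_nat N ^ (1 + 2 * r)) a1 a0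
    ((\<Sum>\<^sub>\<infinity>x. qrest x * of_real (e x)) + (\<Sum>\<^sub>\<infinity>d. tau d * of_real (e' d)))"
  using has_asymptotics_cong[OF has_asymptotics_add[OF has_asymptotics_infsum[OF rd_qrest assms(2,3,4,1)]
    has_asymptotics_infsum[OF rd_tau assms(6,7,8,5)]] wmat_shell[of _ r, symmetric]]
  by blast

end

section \<open>The cochains \<open>\<phi>\<^sub>1\<close>, \<open>\<tau>\<^sub>1\<close> and
  \<open>\<phi>\<^sub>0\<close> in terms of kernels\<close>

lemma rd_reflect: "rd t \<Longrightarrow> rd (\<lambda>n :: int. t (- n))"
  by (rule rd_le[of t _ 1 0 uminus]) (auto simp: sz_int_def)

lemma upb_triple:
  "upb (\<lambda>N x :: nat \<times> nat \<times> int. real (fst x))" "upb (\<lambda>N x :: nat \<times> nat \<times> int. real (fst (snd x)))"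
  "upb (\<lambda>N x :: nat \<times> nat \<times> int. real_of_int (snd (snd x)))"
  by (rule upb_le_sz; auto simp: sz_prod_def sz_nat_def sz_int_def)+

lemma infsum_triple:
  fixes f :: "nat \<times> nat \<times> int \<Rightarrow> complex"
  assumes "rd f" shows "infsum f UNIV = (\<Sum>\<^sub>\<infinity>(l, k). \<Sum>\<^sub>\<infinity>n. f (l, k, n))"
proof -
  have s: "f summable_on UNIV" by (rule rd_summable[OF assms])
  have "(f summable_on UNIV) = ((\<lambda>(p, n). f (fst p, snd p, n)) summable_on UNIV \<times> UNIV)"
    by (rule summable_on_reindex_bij_witness[of _ "\<lambda>(p, n). (fst p, snd p, n)" "\<lambda>(i, j, n). ((i, j), n)"]) auto
  then have s': "(\<lambda>(p, n). f (fst p, snd p, n)) summable_on UNIV \<times> UNIV" using s by simp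
  have "infsum f UNIV = infsum (\<lambda>(p, n). f (fst p, snd p, n)) (UNIV \<times> UNIV)"
    by (rule infsum_reindex_bij_witness[of _ "\<lambda>(p, n). (fst p, snd p, n)" "\<lambda>(i, j, n). ((i, j), n)"]) auto
  also have "\<dots> = (\<Sum>\<^sub>\<infinity>p. \<Sum>\<^sub>\<infinity>n. f (fst p, snd p, n))"
    using infsum_Sigma_banach[OF s'] by simp
  finally show ?thesis by (simp add: case_prod_unfold)
qed

text \<open>Starting the closed path at its other end exchanges the operators, exchanges k and l,
  and reverses n.\<close>

lemma qrest_swap:
  assumes "rd3 c0" "rd3 c1" "rd t0" "rd t1"
  shows "qrest c1 c0 t1 t0 (k, l, - n) = qrest c0 c1 t0 t1 (l, k, n)"
  by (simp add: qrest_eq[OF assms] qrest_eq[OF assms(2,1,4,3)] algebra_simps)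

lemma tau_swap:
  assumes "rd3 c0" "rd3 c1" "rd t0" "rd t1"
  shows "tau t1 t0 d = tau t0 t1 (- d)"
  by (simp add: tau_def[OF assms] tau_def[OF assms(2,1,4,3)])

lemma upb_rho: "upb (\<lambda>_ x :: nat \<times> nat \<times> int. \<rho> (fst x))" "upb (\<lambda>_ x :: nat \<times> nat \<times> int. \<rho> (fst (snd x)))"
  unfolding \<rho>_def by (intro upb_intros upb_triple)+

text \<open>The constant 2/3 in \<rho> is what makes the quadratic term cancel against nothing but
  the linear and square parts and leaves the linear coefficient 1, matching the term d of
  \<open>phi1_eq\<close>.\<close>

lemma sum_rho: "(\<Sum>l<n. \<rho> l) = real n - real n ^ 3 / 3"
  by (induction n) (simp_all add: \<rho>_def power2_eq_square power3_eq_cube field_simps)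

context
  fixes a0 a1 :: opr and c0 c1 :: "nat \<Rightarrow> nat \<Rightarrow> int \<Rightarrow> complex" and t0 t1 :: "int \<Rightarrow> complex"
  assumes ker: "has_kernel a0 c0 t0" "has_kernel a1 c1 t1"
begin

lemma kernel_decay: "rd3 c0" "rd3 c1" "rd t0" "rd t1"
  using ker by (auto dest: has_kernel_rd)

lemma rd_qrest_upb: "upb (\<lambda>_. e) \<Longrightarrow> rd (\<lambda>x. qrest c0 c1 t0 t1 x * of_real (e x))"
  by (rule upb_rd_mult[OF rd_qrest[OF kernel_decay], of "\<lambda>_. e" 1]) simp_all

lemma rd_tau_upb: "upb (\<lambda>_. e) \<Longrightarrow> rd (\<lambda>x. tau t0 t1 x * of_real (e x))"
  by (rule upb_rd_mult[OF rd_tau[OF kernel_decay], of "\<lambda>_. e" 1]) simp_all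

lemma nc_integral_wmat:
  assumes "\<epsilon> > 0" "has_matrix T (\<lambda>s y z. of_real ((sigmaD (s, y) - sigmaD (s, z)) * ((level (s, y))\<^sup>2 - (level (s, z))\<^sup>2) ^ r) * ker c1 t1 s y z)"
    and "upb (\<lambda>N x. real N ^ 2 * (shell_weight r N x - (e1 x * real N + e0 x + e x / real N)))"
    and "upb (\<lambda>_. e1)" "upb (\<lambda>_. e0)" "upb (\<lambda>_. e)"
    and "upb (\<lambda>N x. real N ^ 2 * (toep_weight r N x - (e1' x * real N + e0' x + e' x / real N)))"
    and "upb (\<lambda>_. e1')" "upb (\<lambda>_. e0')" "upb (\<lambda>_. e')"
  shows "nc_integral \<epsilon> (a0 \<circ> T \<circ> absD_powr \<epsilon> (- of_nat (1 + 2 * r)))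
    = (\<Sum>\<^sub>\<infinity>x. qrest c0 c1 t0 t1 x * of_real (e x)) + (\<Sum>\<^sub>\<infinity>d. tau t0 t1 d * of_real (e' d))"
proof -
  have m: "has_matrix (a0 \<circ> T) (wmat c0 c1 t0 t1 r)"
    using has_matrix_comp[OF has_matrix_kernel[OF ker(1)] assms(2)]
    by (simp add: wmat_def[OF kernel_decay, abs_def])
  show ?thesis
    using wmat_asymptotics[OF kernel_decay assms(3-)] nc_integral_matrix[OF assms(1) m] by blast
qed

text \<open>With a = k - l, subtracting a quarter of - 4 (a^2 + n^2) removes - n^2 and turns a (2 l
  + 1) into a (1 + k + l). In the Toeplitz part the dependence on \<open>dm\<close> drops
  out.\<close>

lemma phi1_eq:
  assumes \<epsilon>: "\<epsilon> > 0"
  shows "\<phi>\<^sub>1 \<epsilon> [a0, a1] =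
    (\<Sum>\<^sub>\<infinity>x. qrest c0 c1 t0 t1 x * of_real (case x of (l, k, n) \<Rightarrow> (real k - real l) * (1 + real k + real l) + 2 * real_of_int n))
    + (\<Sum>\<^sub>\<infinity>d. tau t0 t1 d * of_real (real_of_int d - real_of_int d ^ 3 / 4))"
proof -
  let ?M = "\<lambda>r s y z. of_real ((sigmaD (s, y) - sigmaD (s, z)) * ((level (s, y))\<^sup>2 - (level (s, z))\<^sup>2) ^ r) * ker c1 t1 s y z"
  have M0: "has_matrix (commutator D a1) (?M 0)"
    using has_matrix_commutator_D[OF has_matrix_kernel[OF ker(2)]] by simp
  have M1: "has_matrix (nabla (commutator D a1)) (?M 1)"
    using has_matrix_nabla[OF M0] by (simp add: mult_ac)
  have M2: "has_matrix (nabla (nabla (commutator D a1))) (?M 2)"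
    using has_matrix_nabla[OF M1] by (simp add: mult_ac power2_eq_square)
  let ?q = "qrest c0 c1 t0 t1" and ?t = "tau t0 t1"
  let ?e0 = "\<lambda>x. case x of (l, k, n) \<Rightarrow> (real k - real l) * (2 * real l + 1) - (real_of_int n)\<^sup>2 + 2 * real_of_int n"
  let ?e1 = "\<lambda>x. case x of (l, k, n) \<Rightarrow> - 4 * ((real k - real l)\<^sup>2 + (real_of_int n)\<^sup>2)"
  let ?e0' = "\<lambda>d. real_of_int d * (1 - (dm d)\<^sup>2)" and ?e1' = "\<lambda>d. (real_of_int d)\<^sup>2 * (4 * dm d - real_of_int d)"
    and ?e2' = "\<lambda>d. - 4 * (real_of_int d) ^ 3"
  have u: "upb (\<lambda>_. ?e0)" "upb (\<lambda>_. ?e1)" "upb (\<lambda>_ x :: nat \<times> nat \<times> int. case x of (l, k, n) \<Rightarrow> - 2 * (real k - real l))"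
    unfolding case_prod_unfold by (intro upb_intros upb_triple)+
  have u': "upb (\<lambda>_. ?e0')" "upb (\<lambda>_. ?e1')" "upb (\<lambda>_. ?e2')" "upb (\<lambda>_ d. - real_of_int d)"
    "upb (\<lambda>_ d. 2 * real_of_int d * dm d)" "upb (\<lambda>_ d. - 2 * (real_of_int d)\<^sup>2)"
    by (intro upb_intros upb_int)+
  have I0: "nc_integral \<epsilon> (a0 \<circ> commutator D a1 \<circ> absD_powr \<epsilon> (-1))
      = (\<Sum>\<^sub>\<infinity>x. ?q x * of_real (?e0 x)) + (\<Sum>\<^sub>\<infinity>d. ?t d * of_real (?e0' d))"
    using nc_integral_wmat[OF \<epsilon> M0 shell_weight_0 upb_const u(3,1) toep_weight_0 u'(4,5,1)] by simp
  have I1: "nc_integral \<epsilon> (a0 \<circ> nabla (commutator D a1) \<circ> absD_powr \<epsilon> (-3))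
      = (\<Sum>\<^sub>\<infinity>x. ?q x * of_real (?e1 x)) + (\<Sum>\<^sub>\<infinity>d. ?t d * of_real (?e1' d))"
    using nc_integral_wmat[OF \<epsilon> M1 shell_weight_1 upb_const upb_const u(2) toep_weight_1 upb_const u'(6,2)] by simp
  have I2: "nc_integral \<epsilon> (a0 \<circ> nabla (nabla (commutator D a1)) \<circ> absD_powr \<epsilon> (-5))
      = (\<Sum>\<^sub>\<infinity>d. ?t d * of_real (?e2' d))"
    using nc_integral_wmat[OF \<epsilon> M2 shell_weight_2 upb_const upb_const upb_const toep_weight_2 upb_const upb_const u'(3)] by simp
  have s: "(\<lambda>x. ?q x * of_real (?e0 x)) summable_on UNIV" "(\<lambda>x. ?q x * of_real (?e1 x)) summable_on UNIV"
    "(\<lambda>x. ?t x * of_real (?e0' x)) summable_on UNIV" "(\<lambda>x. ?t x * of_real (?e1' x)) summable_on UNIV"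
    "(\<lambda>x. ?t x * of_real (?e2' x)) summable_on UNIV"
    by (intro rd_summable rd_qrest_upb rd_tau_upb u u')+
  have "(\<Sum>\<^sub>\<infinity>x. ?q x * of_real (case x of (l, k, n) \<Rightarrow> (real k - real l) * (1 + real k + real l) + 2 * real_of_int n))
    = (\<Sum>\<^sub>\<infinity>x. ?q x * of_real (?e0 x) - 1/4 * (?q x * of_real (?e1 x)))"
    by (rule infsum_cong) (auto simp: field_simps power2_eq_square)
  also have "\<dots> = (\<Sum>\<^sub>\<infinity>x. ?q x * of_real (?e0 x)) - 1/4 * (\<Sum>\<^sub>\<infinity>x. ?q x * of_real (?e1 x))"
    by (subst infsum_minus(1)[OF s(1) summable_on_cmult_right[OF s(2)]]) (simp only: infsum_cmult_right')
  finally have 1: "(\<Sum>\<^sub>\<infinity>x. ?q x * of_real (case x of (l, k, n) \<Rightarrow> (real k - real l) * (1 + real k + real l) + 2 * real_of_int n))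
    = (\<Sum>\<^sub>\<infinity>x. ?q x * of_real (?e0 x)) - 1/4 * (\<Sum>\<^sub>\<infinity>x. ?q x * of_real (?e1 x))" .
  have "(\<Sum>\<^sub>\<infinity>d. ?t d * of_real (real_of_int d - real_of_int d ^ 3 / 4))
    = (\<Sum>\<^sub>\<infinity>x. ?t x * of_real (?e0' x) - 1/4 * (?t x * of_real (?e1' x)) + 1/8 * (?t x * of_real (?e2' x)))"
  proof (rule infsum_cong)
    fix d
    \<comment> \<open>Either dm d = 0 or dm d = - d.\<close>
    have 0: "dm d * (dm d + real_of_int d) = 0" by (auto simp: dm_def max_def)
    have "?e0' d - 1/4 * ?e1' d + 1/8 * ?e2' d = real_of_int d - real_of_int d ^ 3 / 4 - real_of_int d * (dm d * (dm d + real_of_int d))"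
      by (simp add: power2_eq_square power3_eq_cube field_simps)
    then have "real_of_int d - real_of_int d ^ 3 / 4 = ?e0' d - 1/4 * ?e1' d + 1/8 * ?e2' d"
      unfolding 0 by simp
    then show "?t d * of_real (real_of_int d - real_of_int d ^ 3 / 4)
      = ?t d * of_real (?e0' d) - 1/4 * (?t d * of_real (?e1' d)) + 1/8 * (?t d * of_real (?e2' d))"
      by (simp only:) (simp add: algebra_simps)
  qed
  also have "\<dots> = (\<Sum>\<^sub>\<infinity>x. ?t x * of_real (?e0' x)) - 1/4 * (\<Sum>\<^sub>\<infinity>x. ?t x * of_real (?e1' x)) + 1/8 * (\<Sum>\<^sub>\<infinity>x. ?t x * of_real (?e2' x))"
    by (subst infsum_add[OF infsum_minus(2)[OF s(3) summable_on_cmult_right[OF s(4)]] summable_on_cmult_right[OF s(5)]],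
        subst infsum_minus(1)[OF s(3) summable_on_cmult_right[OF s(4)]]) (simp only: infsum_cmult_right')
  finally show ?thesis
    unfolding \<phi>\<^sub>1.simps I0 I1 I2 1 by (simp add: algebra_simps)
qed

text \<open>The zeroth coefficient of f g' is the sum of i n times the products of coefficients at -
  n and n. The factor n annihilates the terms of \<open>qrest\<close> that involve a Toeplitz part,
  as these have n = 0.\<close>

lemma tau1_eq: "\<tau>\<^sub>1 [a0, a1] = (\<Sum>\<^sub>\<infinity>x. qrest c0 c1 t0 t1 x * of_real (2 * real_of_int (snd (snd x))))"
proof -
  have r: "rd (\<lambda>x. qrest c0 c1 t0 t1 x * of_real (2 * real_of_int (snd (snd x))))"
    by (intro rd_qrest_upb upb_intros upb_triple)
  have "1 / (pi * \<i>) * circle_integral (\<lambda>t. f_coeff a0 k l t * ddt (f_coeff a1 l k) t)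
    = (\<Sum>\<^sub>\<infinity>n. qrest c0 c1 t0 t1 (k, l, n) * of_real (2 * real_of_int n))" for k l
  proof -
    note d = rd3_section[OF kernel_decay(1), of k l] rd3_section[OF kernel_decay(2), of l k]
    have "(\<lambda>t. f_coeff a0 k l t * ddt (f_coeff a1 l k) t) = trig (conv (c0 k l) (\<lambda>n. \<i> * of_int n * c1 l k n))"
      unfolding f_coeff_eq[OF ker(1)] f_coeff_eq[OF ker(2)] ddt_trig[OF d(2)]
      by (rule ext) (rule trig_mult[OF d(1) rd_deriv1[OF d(2)]])
    then have "1 / (pi * \<i>) * circle_integral (\<lambda>t. f_coeff a0 k l t * ddt (f_coeff a1 l k) t)
      = 1 / (pi * \<i>) * (of_real (2 * pi) * conv (c0 k l) (\<lambda>n. \<i> * of_int n * c1 l k n) 0)"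
      by (simp only: circle_integral_trig[OF rd_conv[OF d(1) rd_deriv1[OF d(2)]]])
    also have "\<dots> = (\<Sum>\<^sub>\<infinity>n. 2 / \<i> * (c0 k l (- n) * (\<i> * of_int n * c1 l k n)))"
      unfolding infsum_cmult_right' by (simp add: conv_def)
    also have "\<dots> = (\<Sum>\<^sub>\<infinity>n. qrest c0 c1 t0 t1 (k, l, n) * of_real (2 * real_of_int n))"
      by (rule infsum_cong) (auto simp: qrest_eq[OF kernel_decay] field_simps)
    finally show ?thesis .
  qed
  then show ?thesis unfolding \<tau>\<^sub>1.simps infsum_triple[OF r] by simp
qed


text \<open>On the half-line the product of the Toeplitz parts falls short of the convolution by the
  terms with d < - l, and this defect belongs to the decaying part of the product. Weighted with
  \<rho> and summed over l < - d, it gives dm d - (dm d)^3 / 3 by \<open>sum_rho\<close>.\<close>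

lemma phi0_comp:
  "\<phi>\<^sub>0 [a0 \<circ> a1] = (\<Sum>\<^sub>\<infinity>x. qrest c0 c1 t0 t1 x * of_real (\<rho> (fst x)))
    - (\<Sum>\<^sub>\<infinity>d. tau t0 t1 d * of_real (dm d - dm d ^ 3 / 3))"
proof -
  let ?q = "qrest c0 c1 t0 t1" and ?t = "tau t0 t1"
  obtain c'' where k'': "has_kernel (a0 \<circ> a1) c'' (conv t0 t1)"
    and m'': "\<And>s y z. mat_mult (ker c0 t0) (ker c1 t1) s y z = ker c'' (conv t0 t1) s y z"
    using has_kernel_comp[OF ker] by blast
  have rt: "rd ?t" by (rule rd_tau[OF kernel_decay])
  have ts: "?t summable_on A" for A by (rule rd_summable[OF rt])
  have qs: "(\<lambda>(k, n). ?q (l, k, n)) summable_on UNIV" for l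
    using rd_summable[OF rd_section[of "\<lambda>l y. ?q (l, y)" l], of UNIV] rd_qrest[OF kernel_decay]
    by (simp add: case_prod_unfold)
  have diag: "c'' l l 0 = (\<Sum>\<^sub>\<infinity>(k, n). ?q (l, k, n)) - infsum ?t {..<- int l}" for l
  proof -
    have inj: "inj (\<lambda>k. (k, 0::int))" by (simp add: inj_on_def)
    let ?T = "\<lambda>(k, n). qtoep t0 t1 (l, k, n)"
    have T0: "qtoep t0 t1 (l, k, n) = (if n = 0 then ?t (int k - int l) else 0)" for k n
      by (simp add: qtoep_def[OF kernel_decay])
    have "((\<lambda>k. ?t (int k - int l)) summable_on UNIV) = (?t summable_on {- int l..})"
      by (rule summable_on_reindex_bij_witness[of _ "\<lambda>d. nat (d + int l)" "\<lambda>k. int k - int l"]) auto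
    then have "?T summable_on range (\<lambda>k. (k, 0::int))"
      unfolding summable_on_reindex[OF inj] o_def split T0 using ts by simp
    then have Ts: "?T summable_on UNIV"
      by (rule summable_on_cong_neutral[THEN iffD1, rotated -1]) (auto simp: T0)
    have "infsum ?T UNIV = infsum ?T (range (\<lambda>k. (k, 0::int)))"
      by (rule infsum_cong_neutral) (auto simp: T0)
    also have "\<dots> = (\<Sum>\<^sub>\<infinity>k. ?t (int k - int l))"
      unfolding infsum_reindex[OF inj] o_def split T0 by simp
    also have "\<dots> = infsum ?t {- int l..}"
      by (rule infsum_reindex_bij_witness[of _ "\<lambda>d. nat (d + int l)" "\<lambda>k. int k - int l"]) auto
    finally have Ti: "infsum ?T UNIV = infsum ?t {- int l..}" .
    have "c'' l l 0 + conv t0 t1 0 = mat_mult (ker c0 t0) (ker c1 t1) 0 (l, 0) (l, 0)"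
      unfolding m'' by (simp add: ker_def toep_def)
    also have "\<dots> = (\<Sum>\<^sub>\<infinity>y. (case y of (k, n) \<Rightarrow> ?q (l, k, n)) + ?T y)"
      unfolding mat_mult_def
      by (rule infsum_cong) (auto simp: ker_def toep_def qrest_def[OF kernel_decay] qfull_def[OF kernel_decay])
    also have "\<dots> = (\<Sum>\<^sub>\<infinity>(k, n). ?q (l, k, n)) + infsum ?t {- int l..}"
      unfolding Ti[symmetric] by (rule infsum_add[OF qs Ts])
    finally have 1: "c'' l l 0 + conv t0 t1 0 = (\<Sum>\<^sub>\<infinity>(k, n). ?q (l, k, n)) + infsum ?t {- int l..}" .
    have "conv t0 t1 0 = infsum ?t UNIV"
      unfolding conv_def by (rule infsum_cong) (simp add: tau_def[OF kernel_decay])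
    also have "\<dots> = infsum ?t ({..<- int l} \<union> {- int l..})" by (rule arg_cong[of _ _ "infsum ?t"]) auto
    also have "\<dots> = infsum ?t {..<- int l} + infsum ?t {- int l..}"
      by (rule infsum_Un_disjoint) (auto intro: ts)
    finally show ?thesis using 1 by (simp add: eq_diff_eq)
  qed
  have rq: "rd (\<lambda>x. ?q x * of_real (\<rho> (fst x)))" by (intro rd_qrest_upb upb_rho)
  then have q2: "(\<lambda>(l, y). ?q (l, y) * of_real (\<rho> l)) summable_on UNIV \<times> UNIV"
    using rd_summable[OF rq, of UNIV] by (simp add: case_prod_unfold)
  have qsum: "(\<Sum>\<^sub>\<infinity>l. of_real (\<rho> l) * (\<Sum>\<^sub>\<infinity>(k, n). ?q (l, k, n))) = (\<Sum>\<^sub>\<infinity>x. ?q x * of_real (\<rho> (fst x)))"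
    and qsm: "(\<lambda>l. of_real (\<rho> l) * (\<Sum>\<^sub>\<infinity>(k, n). ?q (l, k, n))) summable_on UNIV"
    using infsum_Sigma_banach[OF q2] summable_on_Sigma_banach[OF q2]
    by (simp_all add: infsum_cmult_left' mult.commute[of "of_real (\<rho> _)"] case_prod_unfold)
  \<comment> \<open>For given l this is the defect of the convolution, for given d it involves the
    first dm d values of \<rho>.\<close>
  let ?G = "\<lambda>d l. if d < - int l then of_real (\<rho> l) * ?t d else 0"
  have Gf: "(\<Sum>\<^sub>\<infinity>l. g (?G d l)) = (\<Sum>l<nat (- d). g (of_real (\<rho> l) * ?t d))" if "g 0 = 0" for d and g :: "complex \<Rightarrow> 'z :: banach"
    unfolding infsum_finite[OF finite_lessThan, symmetric]
    by (rule infsum_cong_neutral) (auto simp: that)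
  have G: "(\<lambda>(d, l). ?G d l) summable_on UNIV \<times> UNIV"
  proof (rule abs_summable_pairI)
    show "(\<lambda>l. cmod (?G d l)) summable_on UNIV" for d
    proof -
      have "(\<lambda>l. cmod (?G d l)) summable_on {..<nat (- d)}" by simp
      then show ?thesis by (rule summable_on_cong_neutral[THEN iffD1, rotated -1]) auto
    qed
    \<comment> \<open>At most |d| values of a function of quadratic growth: a cubic bound, absorbed
      by the decay of \<open>tau\<close>.\<close>
    have b: "(\<Sum>l<nat (- d). \<bar>\<rho> l\<bar>) \<le> 1 * (1 + sz d) ^ 3" for d
    proof -
      have "(\<Sum>l<nat (- d). \<bar>\<rho> l\<bar>) \<le> (\<Sum>l<nat (- d). (1 + sz d)\<^sup>2)"
      proof (rule sum_mono)
        fix l assume "l \<in> {..<nat (- d)}"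
        then have l: "real l \<le> sz d" by (auto simp: sz_int_def)
        have "\<bar>\<rho> l\<bar> \<le> (1 + real l)\<^sup>2" unfolding \<rho>_def by (simp add: abs_le_iff power2_eq_square algebra_simps)
        also have "\<dots> \<le> (1 + sz d)\<^sup>2" using l by (intro power_mono) auto
        finally show "\<bar>\<rho> l\<bar> \<le> (1 + sz d)\<^sup>2" .
      qed
      also have "\<dots> = real (nat (- d)) * (1 + sz d)\<^sup>2" by simp
      also have "\<dots> \<le> (1 + sz d) * (1 + sz d)\<^sup>2" by (intro mult_right_mono) (auto simp: sz_int_def)
      finally show ?thesis by (simp add: power2_eq_square power3_eq_cube)
    qed
    have "rd (\<lambda>d. of_real (\<Sum>l<nat (- d). \<bar>\<rho> l\<bar>) * ?t d)"
      by (rule rd_poly_mult[OF rt, of _ 1 3]) (use b in \<open>simp_all add: norm_of_real sum_nonneg del: of_real_sum\<close>)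
    then have "(\<lambda>d. cmod (of_real (\<Sum>l<nat (- d). \<bar>\<rho> l\<bar>) * ?t d)) summable_on UNIV" by (rule rd_abs_summable)
    moreover have "cmod (of_real (\<Sum>l<nat (- d). \<bar>\<rho> l\<bar>) * ?t d) = (\<Sum>\<^sub>\<infinity>l. cmod (?G d l))" for d
      by (simp add: Gf[of cmod] norm_mult sum_distrib_right sum_nonneg del: of_real_sum)
    ultimately show "(\<lambda>d. \<Sum>\<^sub>\<infinity>l. cmod (?G d l)) summable_on UNIV" by simp
  qed
  have G': "(\<lambda>(l, d). ?G d l) summable_on UNIV \<times> UNIV"
    using summable_on_swap[THEN iffD1, OF G] by simp
  have tl: "of_real (\<rho> l) * infsum ?t {..<- int l} = (\<Sum>\<^sub>\<infinity>d. ?G d l)" for l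
    unfolding infsum_cmult_right'[symmetric] by (rule infsum_cong_neutral) auto
  have tsm: "(\<lambda>l. of_real (\<rho> l) * infsum ?t {..<- int l}) summable_on UNIV"
    unfolding tl by (rule summable_on_Sigma_banach[OF G'])
  have "(\<Sum>\<^sub>\<infinity>l. of_real (\<rho> l) * infsum ?t {..<- int l}) = (\<Sum>\<^sub>\<infinity>d. \<Sum>\<^sub>\<infinity>l. ?G d l)"
    unfolding tl by (rule infsum_swap_banach[OF G'])
  also have "\<dots> = (\<Sum>\<^sub>\<infinity>d. ?t d * of_real (dm d - dm d ^ 3 / 3))"
  proof (rule infsum_cong)
    fix d :: int
    have "dm d = real (nat (- d))" by (simp add: dm_def)
    then have "of_real (dm d - dm d ^ 3 / 3) = (\<Sum>l<nat (- d). complex_of_real (\<rho> l))"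
      unfolding of_real_sum[symmetric] sum_rho by simp
    moreover have "(\<Sum>\<^sub>\<infinity>l. ?G d l) = ?t d * (\<Sum>l<nat (- d). complex_of_real (\<rho> l))"
      using Gf[of "\<lambda>z. z" d] by (simp add: sum_distrib_left mult.commute)
    ultimately show "(\<Sum>\<^sub>\<infinity>l. ?G d l) = ?t d * of_real (dm d - dm d ^ 3 / 3)" by (simp only:)
  qed
  finally have tsum: "(\<Sum>\<^sub>\<infinity>l. of_real (\<rho> l) * infsum ?t {..<- int l}) = (\<Sum>\<^sub>\<infinity>d. ?t d * of_real (dm d - dm d ^ 3 / 3))" .
  have "\<phi>\<^sub>0 [a0 \<circ> a1] = (\<Sum>\<^sub>\<infinity>l. of_real (\<rho> l) * c'' l l 0)"
    unfolding \<phi>\<^sub>0.simps f_coeff_eq[OF k''] circle_integral_trig[OF rd3_section[OF has_kernel_rd(1)[OF k'']]] by simp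
  also have "\<dots> = (\<Sum>\<^sub>\<infinity>l. of_real (\<rho> l) * (\<Sum>\<^sub>\<infinity>(k, n). ?q (l, k, n)) - of_real (\<rho> l) * infsum ?t {..<- int l})"
    unfolding diag right_diff_distrib ..
  also have "\<dots> = (\<Sum>\<^sub>\<infinity>x. ?q x * of_real (\<rho> (fst x))) - (\<Sum>\<^sub>\<infinity>d. ?t d * of_real (dm d - dm d ^ 3 / 3))"
    unfolding infsum_minus(1)[OF qsm tsm] qsum tsum ..
  finally show ?thesis .
qed


end

context
  fixes a0 a1 :: opr and c0 c1 :: "nat \<Rightarrow> nat \<Rightarrow> int \<Rightarrow> complex" and t0 t1 :: "int \<Rightarrow> complex"
  assumes ker: "has_kernel a0 c0 t0" "has_kernel a1 c1 t1"
begin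

text \<open>The term for the reversed product is rewritten by \<open>qrest_swap\<close> and
  \<open>tau_swap\<close>. Of dm d and dm (- d) at most one is nonzero, so the two half-line cubics
  combine to the odd polynomial d - d^3 / 3 on all integers.\<close>

lemma b_phi0_eq:
  "hochschild_b \<phi>\<^sub>0 [a0, a1] = (\<Sum>\<^sub>\<infinity>x. qrest c0 c1 t0 t1 x * of_real (\<rho> (fst x) - \<rho> (fst (snd x))))
    + (\<Sum>\<^sub>\<infinity>d. tau t0 t1 d * of_real (real_of_int d - real_of_int d ^ 3 / 3))"
proof -
  let ?q = "qrest c0 c1 t0 t1" and ?t = "tau t0 t1"
  note kd = kernel_decay[OF ker]
  let ?R = "\<lambda>d. dm d - dm d ^ 3 / 3"
  have u: "upb (\<lambda>_. ?R)" "upb (\<lambda>_ d. ?R (- d))"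
  proof -
    have dm': "dm (- d) = dm d + real_of_int d" for d by (simp add: dm_def max_def)
    have "upb (\<lambda>_ :: nat. \<lambda>d. dm d * dm d * dm d * (1/3))" "upb (\<lambda>_ d. (dm d + real_of_int d) ^ 3 * (1/3))"
      by (intro upb_intros upb_int)+
    then show "upb (\<lambda>_. ?R)" "upb (\<lambda>_ d. ?R (- d))"
      unfolding dm' by (auto intro!: upb_diff upb_add upb_int simp: power3_eq_cube)
  qed
  have s: "(\<lambda>x. ?q x * of_real (\<rho> (fst x))) summable_on UNIV" "(\<lambda>x. ?q x * of_real (\<rho> (fst (snd x)))) summable_on UNIV"
    by (intro rd_summable rd_qrest_upb[OF ker] upb_rho)+
  have s': "(\<lambda>d. ?t d * of_real (?R d)) summable_on UNIV" "(\<lambda>d. ?t d * of_real (?R (- d))) summable_on UNIV"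
    by (intro rd_summable rd_tau_upb[OF ker] u)+
  have "(\<Sum>\<^sub>\<infinity>x. qrest c1 c0 t1 t0 x * of_real (\<rho> (fst x))) = (\<Sum>\<^sub>\<infinity>x. ?q x * of_real (\<rho> (fst (snd x))))"
    by (rule infsum_reindex_bij_witness[of _ "\<lambda>(l, k, n). (k, l, - n)" "\<lambda>(l, k, n). (k, l, - n)"])
       (auto simp: qrest_swap[OF kd, of _ _ "- _", simplified])
  moreover have "(\<Sum>\<^sub>\<infinity>d. tau t1 t0 d * of_real (?R d)) = (\<Sum>\<^sub>\<infinity>d. ?t d * of_real (?R (- d)))"
    by (rule infsum_reindex_bij_witness[of _ uminus uminus]) (auto simp: tau_swap[OF kd])
  ultimately have "hochschild_b \<phi>\<^sub>0 [a0, a1] =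
      ((\<Sum>\<^sub>\<infinity>x. ?q x * of_real (\<rho> (fst x))) - (\<Sum>\<^sub>\<infinity>x. ?q x * of_real (\<rho> (fst (snd x)))))
    + ((\<Sum>\<^sub>\<infinity>d. ?t d * of_real (?R (- d))) - (\<Sum>\<^sub>\<infinity>d. ?t d * of_real (?R d)))"
    by (simp add: hochschild_b_def phi0_comp[OF ker] phi0_comp[OF ker(2,1)] del: \<phi>\<^sub>0.simps)
  also have "\<dots> = (\<Sum>\<^sub>\<infinity>x. ?q x * of_real (\<rho> (fst x)) - ?q x * of_real (\<rho> (fst (snd x))))
    + (\<Sum>\<^sub>\<infinity>d. ?t d * of_real (?R (- d)) - ?t d * of_real (?R d))"
    unfolding infsum_minus(1)[OF s] infsum_minus(1)[OF s'(2,1)] ..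
  also have "(\<lambda>x. ?q x * of_real (\<rho> (fst x)) - ?q x * of_real (\<rho> (fst (snd x)))) = (\<lambda>x. ?q x * of_real (\<rho> (fst x) - \<rho> (fst (snd x))))"
    by (simp add: right_diff_distrib)
  also have "(\<lambda>d. ?t d * of_real (?R (- d)) - ?t d * of_real (?R d)) = (\<lambda>d. ?t d * of_real (real_of_int d - real_of_int d ^ 3 / 3))"
  proof
    fix d
    have "?R (- d) - ?R d = real_of_int d - real_of_int d ^ 3 / 3"
      by (simp add: dm_def max_def)
    then show "?t d * of_real (?R (- d)) - ?t d * of_real (?R d) = ?t d * of_real (real_of_int d - real_of_int d ^ 3 / 3)"
      unfolding right_diff_distrib[symmetric] of_real_diff[symmetric] by (simp only:)
  qed
  finally show ?thesis .
qed

section \<open>The coboundary \<open>connes_B\<close> of \<open>\<phi>\<^sub>2\<close>\<close>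

lemma symbol_id: "\<sigma> id = (\<lambda>_. 1)"
proof
  fix x show "\<sigma> id x = 1"
    unfolding symbol_eq[OF has_kernel_id] by (subst trig_finite[of "{0}"]) auto
qed

lemma ddt_const: "ddt (\<lambda>_. c) = (\<lambda>_. 0)"
  unfolding ddt_def by (intro ext vector_derivative_at) (rule has_vector_derivative_const)

lemma phi2_id_eq: "\<phi>\<^sub>2 [id, a0, a1] = 1/24 * (\<Sum>\<^sub>\<infinity>d. tau t0 t1 d * of_real (real_of_int d ^ 3))"
proof -
  note kd = kernel_decay[OF ker]
  let ?s = "\<lambda>n. t0 (- n)" and ?r = "\<lambda>n. t1 (- n)"
  note r = rd_reflect[OF kd(3)] rd_reflect[OF kd(4)]
  let ?s' = "\<lambda>n. \<i> * of_int n * ?s n" and ?r' = "\<lambda>n. \<i> * of_int n * (\<i> * of_int n * ?r n)"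
  have r': "rd ?s'" "rd ?r'" by (intro rd_deriv1 r)+
  have "(\<lambda>t. \<sigma> id t * ddt (\<sigma> a0) t * ddt (ddt (\<sigma> a1)) t) = trig (conv ?s' ?r')"
    unfolding symbol_id symbol_eq[OF ker(1)] symbol_eq[OF ker(2)] ddt_trig[OF r(1)] ddt_trig[OF r(2)] ddt_trig[OF rd_deriv1[OF r(2)]]
    by (simp add: trig_mult[OF r'])
  then have "\<phi>\<^sub>2 [id, a0, a1] = - 1/24 * (1 / (2 * pi * \<i>)) * (of_real (2 * pi) * conv ?s' ?r' 0)"
    by (simp only: \<phi>\<^sub>2.simps circle_integral_trig[OF rd_conv[OF r']])
  also have "conv ?s' ?r' 0 = (\<Sum>\<^sub>\<infinity>d. - \<i> * (tau t0 t1 d * of_real (real_of_int d ^ 3)))"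
    unfolding conv_def
    by (rule infsum_reindex_bij_witness[of _ uminus uminus]) (auto simp: tau_def[OF kd] power3_eq_cube mult_ac)
  also have "\<dots> = - \<i> * (\<Sum>\<^sub>\<infinity>d. tau t0 t1 d * of_real (real_of_int d ^ 3))"
    by (rule infsum_cmult_right')
  also have "- 1/24 * (1 / (2 * pi * \<i>)) * (of_real (2 * pi) * (- \<i> * S)) = 1/24 * S" for S
    by (simp add: field_simps)
  finally show ?thesis .
qed

lemma phi2_id_right: "\<phi>\<^sub>2 [a0, a1, id] = 0"
  by (simp add: symbol_id ddt_const circle_integral_def)

end

context
  fixes a0 a1 :: opr and c0 c1 :: "nat \<Rightarrow> nat \<Rightarrow> int \<Rightarrow> complex" and t0 t1 :: "int \<Rightarrow> complex"
  assumes ker: "has_kernel a0 c0 t0" "has_kernel a1 c1 t1"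
begin

text \<open>Terms with the unit in the last place vanish, since its symbol is constant. The cyclic
  antisymmetrisation doubles the rest because d^3 is odd while \<open>tau\<close> is reflected, so
  1/24 becomes 1/12.\<close>

lemma B_phi2_eq: "connes_B \<phi>\<^sub>2 [a0, a1] = 1/12 * (\<Sum>\<^sub>\<infinity>d. tau t0 t1 d * of_real (real_of_int d ^ 3))"
proof -
  note kd = kernel_decay[OF ker]
  have "(\<Sum>\<^sub>\<infinity>d. tau t1 t0 d * of_real (real_of_int d ^ 3)) = (\<Sum>\<^sub>\<infinity>d. - 1 * (tau t0 t1 d * of_real (real_of_int d ^ 3)))"
    by (rule infsum_reindex_bij_witness[of _ uminus uminus]) (auto simp: tau_swap[OF kd])
  also have "\<dots> = - 1 * (\<Sum>\<^sub>\<infinity>d. tau t0 t1 d * of_real (real_of_int d ^ 3))" by (rule infsum_cmult_right')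
  finally have sw: "(\<Sum>\<^sub>\<infinity>d. tau t1 t0 d * of_real (real_of_int d ^ 3)) = - (\<Sum>\<^sub>\<infinity>d. tau t0 t1 d * of_real (real_of_int d ^ 3))" by simp
  have "connes_B \<phi>\<^sub>2 [a0, a1] = (\<phi>\<^sub>2 [id, a0, a1] - \<phi>\<^sub>2 [a0, a1, id]) - (\<phi>\<^sub>2 [id, a1, a0] - \<phi>\<^sub>2 [a1, a0, id])"
    by (simp add: connes_B_def A_cyc_def B\<^sub>0_def numeral_2_eq_2 del: \<phi>\<^sub>2.simps)
  then show ?thesis
    unfolding phi2_id_eq[OF ker] phi2_id_eq[OF ker(2,1)] phi2_id_right[OF ker] phi2_id_right[OF ker(2,1)] sw
    by simp
qed

lemma phi1_cohomologous:
  assumes "\<epsilon> > 0"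
  shows "\<phi>\<^sub>1 \<epsilon> [a0, a1] = \<tau>\<^sub>1 [a0, a1] + hochschild_b \<phi>\<^sub>0 [a0, a1] + connes_B \<phi>\<^sub>2 [a0, a1]"
proof -
  let ?q = "qrest c0 c1 t0 t1" and ?t = "tau t0 t1"
  let ?b = "\<lambda>x :: nat \<times> nat \<times> int. \<rho> (fst x) - \<rho> (fst (snd x))" and ?n = "\<lambda>x :: nat \<times> nat \<times> int. 2 * real_of_int (snd (snd x))"
  let ?d = "\<lambda>d. real_of_int d - real_of_int d ^ 3 * (1 / 3)" and ?c = "\<lambda>d. real_of_int d ^ 3"
  have s: "(\<lambda>x. ?q x * of_real (?n x)) summable_on UNIV" "(\<lambda>x. ?q x * of_real (?b x)) summable_on UNIV"
    "(\<lambda>d. ?t d * of_real (?d d)) summable_on UNIV" "(\<lambda>d. ?t d * of_real (?c d)) summable_on UNIV"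
    by (intro rd_summable rd_qrest_upb[OF ker] rd_tau_upb[OF ker] upb_rho upb_intros upb_int upb_triple)+
  have q: "(\<Sum>\<^sub>\<infinity>x. ?q x * of_real (case x of (l, k, n) \<Rightarrow> (real k - real l) * (1 + real k + real l) + 2 * real_of_int n))
    = (\<Sum>\<^sub>\<infinity>x. ?q x * of_real (?n x)) + (\<Sum>\<^sub>\<infinity>x. ?q x * of_real (?b x))"
    unfolding infsum_add[OF s(1,2), symmetric]
    by (rule infsum_cong) (auto simp: \<rho>_def power2_eq_square algebra_simps)
  have t: "(\<Sum>\<^sub>\<infinity>d. ?t d * of_real (real_of_int d - real_of_int d ^ 3 / 4))
    = (\<Sum>\<^sub>\<infinity>d. ?t d * of_real (?d d)) + 1/12 * (\<Sum>\<^sub>\<infinity>d. ?t d * of_real (?c d))"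
    unfolding infsum_cmult_right'[symmetric] infsum_add[OF s(3) summable_on_cmult_right[OF s(4)], symmetric]
    by (rule infsum_cong) (simp add: algebra_simps)
  show ?thesis
    unfolding phi1_eq[OF ker assms] tau1_eq[OF ker] b_phi0_eq[OF ker] B_phi2_eq q t by simp
qed

end

section \<open>The cubic term\<close>

text \<open>If the signs of the eigenvalues differ, then s = 0 and the second coordinates lie on
  different sides of 0, so their absolute values add up to their distance. The change of the
  eigenvalue is thus controlled by \<open>esz\<close>, although the levels are not.\<close>

lemma sigmaD_diff: "\<bar>sigmaD (s, y) - sigmaD (s, z)\<bar> \<le> esz y z"
proof -
  obtain k m l m' where "y = (k, m)" "z = (l, m')" by (cases y, cases z) auto
  then show ?thesis by (auto simp: sigmaD_def level_def esz_def)
qed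

lemma sigmaD_diff_sg:
  "complex_of_real (sigmaD (s, k, m) - sigmaD (s, l, m)) = sg s m * of_int (int k - int l)"
  by (auto simp: sigmaD_def level_def sg_def)

lemma sg_cube: "sg s m ^ 3 = of_real (sgr s m)"
  by (simp add: sg_def sgr_def)

lemma rd_times_int: "rd t \<Longrightarrow> rd (\<lambda>d. of_int d * t d)"
  by (rule rd_poly_mult[of t _ 1 1]) (auto simp: sz_int_def)

text \<open>On the diagonal m = m' the difference of eigenvalues is exactly the sign times k - l,
  which produces the new symbol. On the error it costs one power of \<open>esz\<close>, hence the
  exponent r + 1.\<close>

lemma toeplitz_mod_commutator:
  assumes c: "rd3 c" and t: "rd t"
  shows "toeplitz_mod 1 (\<lambda>d. of_int d * t d) (\<lambda>s y z. of_real (sigmaD (s, y) - sigmaD (s, z)) * ker c t s y z)"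
  unfolding toeplitz_mod_def
proof (intro conjI allI rd_times_int t)
  fix r
  obtain C where C: "C > 0" "\<And>s y z. cmod (ker c t s y z - toep 0 t s y z) \<le> C / (1 + esz y z) ^ (r + 1)"
    using toeplitz_modE[OF toeplitz_mod_ker[OF c t], of "r + 1"] by blast
  have "cmod (of_real (sigmaD (s, y) - sigmaD (s, z)) * ker c t s y z - toep 1 (\<lambda>d. of_int d * t d) s y z)
    \<le> C / (1 + esz y z) ^ r" for s y z
  proof -
    have "toep 1 (\<lambda>d. of_int d * t d) s y z = of_real (sigmaD (s, y) - sigmaD (s, z)) * toep 0 t s y z"
      by (cases y, cases z) (simp add: toep_def sigmaD_diff_sg del: of_real_diff of_int_diff)
    then have "cmod (of_real (sigmaD (s, y) - sigmaD (s, z)) * ker c t s y z - toep 1 (\<lambda>d. of_int d * t d) s y z)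
      = \<bar>sigmaD (s, y) - sigmaD (s, z)\<bar> * cmod (ker c t s y z - toep 0 t s y z)"
      by (simp only: right_diff_distrib[symmetric] norm_mult norm_of_real)
    also have "\<dots> \<le> (1 + esz y z) * (C / (1 + esz y z) ^ (r + 1))"
      using sigmaD_diff[of s y z] by (intro mult_mono C(2)) (auto simp: add_nonneg_nonneg)
    also have "\<dots> = C / (1 + esz y z) ^ r"
      using esz_nonneg[of y z] by (simp add: field_simps add_nonneg_eq_0_iff)
    finally show ?thesis .
  qed
  then show "\<exists>C. \<forall>s y z. cmod (of_real (sigmaD (s, y) - sigmaD (s, z)) * ker c t s y z - toep 1 (\<lambda>d. of_int d * t d) s y z)
    \<le> C / (1 + esz y z) ^ r" by blast
qed

text \<open>The cube of the sign is the sign, so the Toeplitz part contributes (1 - N^2) u 0. The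
  error on the diagonal decays in l uniformly in m; with at most 3 N values of m for each l it is
  O(N), and so O(N^-2) after division by N^3.\<close>

lemma toeplitz_mod_asymptotics:
  assumes M: "toeplitz_mod 3 u M"
  shows "has_asymptotics (\<lambda>N. (\<Sum>(s, y)\<in>shell N. M s y y) / of_nat N ^ 3) 0 0 (- u 0)"
proof -
  obtain p :: nat where p: "(\<lambda>x::nat. 1 / (1 + sz x) ^ p) summable_on UNIV" using summable_sz by blast
  obtain C where C: "C > 0" "\<And>s y z. cmod (M s y z - toep 3 u s y z) \<le> C / (1 + esz y z) ^ p"
    using toeplitz_modE[OF M] by blast
  define S where "S = (\<Sum>\<^sub>\<infinity>x::nat. 1 / (1 + sz x) ^ p)"
  have S0: "S \<ge> 0" unfolding S_def by (rule infsum_nonneg) simp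
  have "cmod ((\<Sum>(s, y)\<in>shell N. M s y y) / of_nat N ^ 3 - (0 * of_nat N + 0 + - u 0 / of_nat N)) \<le> (3 * C * S + cmod (u 0)) / real N ^ 2"
    if N: "N \<ge> 1" for N
  proof -
    have N1: "real N \<ge> 1" using N by simp
    have tp: "toep 3 u (nat (int (N - l) - \<bar>m\<bar>)) (l, m) (l, m) = of_real (sgr (nat (int (N - l) - \<bar>m\<bar>)) m) * u 0" for l m
      by (simp add: toep_def sg_cube)
    have "(\<Sum>(s, y)\<in>shell N. toep 3 u s y y) = (\<Sum>l\<le>N. \<Sum>m\<in>mid (N - l). of_real (sgr (nat (int (N - l) - \<bar>m\<bar>)) m) * u 0)"
      unfolding sum_shell split tp ..
    also have "\<dots> = of_real (\<Sum>l\<in>{0..N}. 1 - 2 * real (N - l)) * u 0"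
      unfolding sum_distrib_right[symmetric] of_real_sum[symmetric] sum_mid_sgr atLeast0AtMost ..
    also have "\<dots> = of_real (1 - (real N)\<^sup>2) * u 0" by (subst sum_sgr_from) simp_all
    finally have T: "(\<Sum>(s, y)\<in>shell N. toep 3 u s y y) = of_real (1 - (real N)\<^sup>2) * u 0" .
    have "cmod ((\<Sum>(s, y)\<in>shell N. M s y y) - (\<Sum>(s, y)\<in>shell N. toep 3 u s y y))
      = cmod (\<Sum>(s, y)\<in>shell N. M s y y - toep 3 u s y y)"
      by (simp add: sum_subtractf case_prod_unfold)
    also have "\<dots> \<le> (\<Sum>(s, y)\<in>shell N. cmod (M s y y - toep 3 u s y y))"
      using norm_sum[of "\<lambda>(s, y). M s y y - toep 3 u s y y" "shell N"] by (simp add: case_prod_unfold)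
    also have "\<dots> \<le> (\<Sum>l\<le>N. \<Sum>m\<in>mid (N - l). C * (1 / (1 + sz l) ^ p))"
      unfolding sum_shell split
    proof (intro sum_mono)
      fix l m
      have "C / (1 + esz (l, m) (l, m)) ^ p \<le> C / (1 + sz l) ^ p"
        using C(1) by (intro divide_left_mono power_mono mult_pos_pos) (auto simp: esz_def sz_nat_def intro!: zero_less_power)
      then show "cmod (M (nat (int (N - l) - \<bar>m\<bar>)) (l, m) (l, m) - toep 3 u (nat (int (N - l) - \<bar>m\<bar>)) (l, m) (l, m)) \<le> C * (1 / (1 + sz l) ^ p)"
        using C(2)[of "nat (int (N - l) - \<bar>m\<bar>)" "(l, m)" "(l, m)"] by simp
    qed
    also have "\<dots> \<le> (\<Sum>l\<le>N. 3 * real N * C * (1 / (1 + sz l) ^ p))"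
    proof (rule sum_mono)
      fix l assume "l \<in> {..N}"
      have "real (2 * (N - l) + 1) * (C * (1 / (1 + sz l) ^ p)) \<le> 3 * real N * (C * (1 / (1 + sz l) ^ p))"
        using N1 C(1) by (intro mult_right_mono) auto
      then show "(\<Sum>m\<in>mid (N - l). C * (1 / (1 + sz l) ^ p)) \<le> 3 * real N * C * (1 / (1 + sz l) ^ p)"
        by (simp add: card_mid mult.assoc)
    qed
    also have "\<dots> = 3 * real N * C * (\<Sum>l\<le>N. 1 / (1 + sz l) ^ p)" by (simp only: sum_distrib_left)
    also have "\<dots> \<le> 3 * real N * C * S"
      unfolding S_def using C(1) by (intro mult_left_mono finite_sum_le_infsum p) auto
    finally have E: "cmod ((\<Sum>(s, y)\<in>shell N. M s y y) - of_real (1 - (real N)\<^sup>2) * u 0) \<le> 3 * real N * C * S"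
      unfolding T .
    let ?A = "\<Sum>(s, y)\<in>shell N. M s y y"
    have N0: "(of_nat N :: complex) \<noteq> 0" using N by simp
    have "?A / of_nat N ^ 3 - (0 * of_nat N + 0 + - u 0 / of_nat N) = (?A - of_real (1 - (real N)\<^sup>2) * u 0) / of_nat N ^ 3 + u 0 / of_nat N ^ 3"
      using N0 by (simp add: field_simps power2_eq_square power3_eq_cube)
    also have "cmod \<dots> \<le> 3 * real N * C * S / real N ^ 3 + cmod (u 0) / real N ^ 3"
      using E by (intro order_trans[OF norm_triangle_ineq] add_mono) (simp_all add: norm_divide norm_power divide_right_mono)
    also have "\<dots> \<le> 3 * C * S / real N ^ 2 + cmod (u 0) / real N ^ 2"
    proof (rule add_mono)
      show "3 * real N * C * S / real N ^ 3 \<le> 3 * C * S / real N ^ 2" using N1 by (simp add: power2_eq_square power3_eq_cube)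
      show "cmod (u 0) / real N ^ 3 \<le> cmod (u 0) / real N ^ 2"
        using N1 by (intro divide_left_mono power_increasing) auto
    qed
    finally show ?thesis by (simp add: add_divide_distrib)
  qed
  then show ?thesis unfolding has_asymptotics_def by blast
qed

text \<open>Each commutator carries one sign and the symbol d t(d), so the composite has j = 3 and
  the convolution as its symbol; its diagonal sees the value at 0, and the minus sign comes from 1 -
  N^2.\<close>

lemma phi3_eq:
  assumes \<epsilon>: "\<epsilon> > 0" and k: "has_kernel a0 c0 t0" "has_kernel a1 c1 t1" "has_kernel a2 c2 t2" "has_kernel a3 c3 t3"
  shows "\<phi>\<^sub>3 \<epsilon> [a0, a1, a2, a3] = - 1/12 *
    conv (conv (conv t0 (\<lambda>d. of_int d * t1 d)) (\<lambda>d. of_int d * t2 d)) (\<lambda>d. of_int d * t3 d) 0"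
proof -
  define K where "K = (\<lambda>c t s y z. complex_of_real (sigmaD (s, y) - sigmaD (s, z)) * ker c t s y z)"
  have mK: "has_matrix (commutator D a) (K c t)" if "has_kernel a c t" for a c t
    unfolding K_def by (rule has_matrix_commutator_D[OF has_matrix_kernel[OF that]])
  have tK: "toeplitz_mod 1 (\<lambda>d. of_int d * t d) (K c t)" if "has_kernel a c t" for a c t
    unfolding K_def by (rule toeplitz_mod_commutator[OF has_kernel_rd[OF that]])
  have m: "has_matrix (a0 \<circ> commutator D a1 \<circ> commutator D a2 \<circ> commutator D a3)
      (mat_mult (mat_mult (mat_mult (ker c0 t0) (K c1 t1)) (K c2 t2)) (K c3 t3))"
    by (intro has_matrix_comp has_matrix_kernel mK k)
  have "toeplitz_mod (0 + 1 + 1 + 1) (conv (conv (conv t0 (\<lambda>d. of_int d * t1 d)) (\<lambda>d. of_int d * t2 d)) (\<lambda>d. of_int d * t3 d))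
      (mat_mult (mat_mult (mat_mult (ker c0 t0) (K c1 t1)) (K c2 t2)) (K c3 t3))"
    by (rule toeplitz_mod_mult(1) toeplitz_mod_ker tK k has_kernel_rd)+
  then have "toeplitz_mod 3 (conv (conv (conv t0 (\<lambda>d. of_int d * t1 d)) (\<lambda>d. of_int d * t2 d)) (\<lambda>d. of_int d * t3 d))
      (mat_mult (mat_mult (mat_mult (ker c0 t0) (K c1 t1)) (K c2 t2)) (K c3 t3))"
    by (simp add: numeral_3_eq_3)
  from nc_integral_matrix[OF \<epsilon> m toeplitz_mod_asymptotics[OF this]] show ?thesis by simp
qed

section \<open>Products of symbols and the Hochschild coboundary of
  \<open>\<phi>\<^sub>2\<close>\<close>

lemma conv_reflect: "conv (\<lambda>n. c (- n)) (\<lambda>n. d (- n)) n = conv c d (- n)"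
  unfolding conv_def by (rule infsum_reindex_bij_witness[of _ uminus uminus]) auto

lemma trig_reflect_mult:
  assumes "rd c" "rd d"
  shows "trig (\<lambda>n. c (- n)) x * trig (\<lambda>n. d (- n)) x = trig (\<lambda>n. conv c d (- n)) x"
  unfolding trig_mult[OF rd_reflect[OF assms(1)] rd_reflect[OF assms(2)]]
  by (rule arg_cong[of _ _ "\<lambda>c. trig c x"]) (rule ext, rule conv_reflect[of c d])

text \<open>The Toeplitz parts of kernels convolve under composition, and reflecting the index is
  compatible with convolution.\<close>

lemma symbol_mult:
  assumes "has_kernel a c t" "has_kernel a' c' t'" shows "\<sigma> (a \<circ> a') = (\<lambda>x. \<sigma> a x * \<sigma> a' x)"
proof -
  obtain c'' where k: "has_kernel (a \<circ> a') c'' (conv t t')" by (rule has_kernel_comp[OF assms])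
  from symbol_eq[OF k] show ?thesis
    unfolding symbol_eq[OF assms(1)] symbol_eq[OF assms(2)]
      trig_reflect_mult[OF has_kernel_rd(2)[OF assms(1)] has_kernel_rd(2)[OF assms(2)]] .
qed

lemma ddt_mult:
  assumes "f \<in> smooth_circle" "g \<in> smooth_circle"
  shows "ddt (\<lambda>t. f t * g t) = (\<lambda>t. f t * ddt g t + ddt f t * g t)"
  unfolding ddt_def[of "\<lambda>t. f t * g t"]
  by (intro ext vector_derivative_at has_vector_derivative_mult smooth_circleD(1) assms)

lemma ddt_ddt_mult:
  assumes f: "f \<in> smooth_circle" and g: "g \<in> smooth_circle"
  shows "ddt (ddt (\<lambda>t. f t * g t)) = (\<lambda>t. f t * ddt (ddt g) t + 2 * ddt f t * ddt g t + ddt (ddt f) t * g t)"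
proof
  fix t
  note d = smooth_circleD(2)
  have "((\<lambda>t. f t * ddt g t + ddt f t * g t) has_vector_derivative
      (f t * ddt (ddt g) t + ddt f t * ddt g t) + (ddt f t * ddt g t + ddt (ddt f) t * g t)) (at t)"
    by (intro has_vector_derivative_add has_vector_derivative_mult smooth_circleD(1) f g d)
  then show "ddt (ddt (\<lambda>t. f t * g t)) t = f t * ddt (ddt g) t + 2 * ddt f t * ddt g t + ddt (ddt f) t * g t"
    unfolding ddt_mult[OF f g] unfolding ddt_def[of "\<lambda>t. f t * ddt g t + ddt f t * g t"]
    by (subst vector_derivative_at) (auto simp: algebra_simps)
qed

lemma circle_integral_alternating:
  assumes "continuous_on UNIV f" "continuous_on UNIV g" "continuous_on UNIV h" "continuous_on UNIV k"
  shows "circle_integral f - circle_integral g + circle_integral h - circle_integral k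
    = circle_integral (\<lambda>t. f t - g t + h t - k t)"
  by (simp only: circle_integral_diff circle_integral_add continuous_on_diff continuous_on_add assms)

text \<open>By the Leibniz rule all terms with a second derivative cancel pointwise and 2 f0 f1' f2'
  f3' remains. The prefactor is - 1/24 * 1/(2 pi i) * 2 * i * 2 pi = - 1/12, with the factor i from
  the three derivatives.\<close>

lemma b_phi2_eq:
  assumes k: "has_kernel a0 c0 t0" "has_kernel a1 c1 t1" "has_kernel a2 c2 t2" "has_kernel a3 c3 t3"
  shows "hochschild_b \<phi>\<^sub>2 [a0, a1, a2, a3] = - 1/12 *
    conv (conv (conv t0 (\<lambda>d. of_int d * t1 d)) (\<lambda>d. of_int d * t2 d)) (\<lambda>d. of_int d * t3 d) 0"
proof -
  let ?f = "\<sigma> a0" and ?g = "\<sigma> a1" and ?h = "\<sigma> a2" and ?k = "\<sigma> a3"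
  have sm: "\<sigma> a \<in> smooth_circle" if "has_kernel a c t" for a c t
    unfolding symbol_eq[OF that] by (rule trig_smooth[OF rd_reflect[OF has_kernel_rd(2)[OF that]]])
  note s = sm[OF k(1)] sm[OF k(2)] sm[OF k(3)] sm[OF k(4)]
  note s' = smooth_circleD(2)
  note C = smooth_circleD(4)[OF s(1)] smooth_circleD(4)[OF s(2)] smooth_circleD(4)[OF s(3)] smooth_circleD(4)[OF s(4)]
    smooth_circleD(4)[OF s'[OF s(2)]] smooth_circleD(4)[OF s'[OF s(3)]] smooth_circleD(4)[OF s'[OF s(4)]]
    smooth_circleD(4)[OF s'[OF s'[OF s(3)]]] smooth_circleD(4)[OF s'[OF s'[OF s(4)]]]
  let ?t' = "\<lambda>t d. of_int d * t (d :: int) :: complex"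
  have rt: "rd t0" "rd (?t' t1)" "rd (?t' t2)" "rd (?t' t3)"
    by (intro rd_times_int has_kernel_rd(2)[OF k(1)] has_kernel_rd(2)[OF k(2)] has_kernel_rd(2)[OF k(3)] has_kernel_rd(2)[OF k(4)])+
  let ?I = "circle_integral"
  have "?I (\<lambda>t. \<sigma> (a0 \<circ> a1) t * ddt ?h t * ddt (ddt ?k) t) - ?I (\<lambda>t. ?f t * ddt (\<sigma> (a1 \<circ> a2)) t * ddt (ddt ?k) t)
    + ?I (\<lambda>t. ?f t * ddt ?g t * ddt (ddt (\<sigma> (a2 \<circ> a3))) t) - ?I (\<lambda>t. \<sigma> (a3 \<circ> a0) t * ddt ?g t * ddt (ddt ?h) t)
    = ?I (\<lambda>t. \<sigma> (a0 \<circ> a1) t * ddt ?h t * ddt (ddt ?k) t - ?f t * ddt (\<sigma> (a1 \<circ> a2)) t * ddt (ddt ?k) t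
    + ?f t * ddt ?g t * ddt (ddt (\<sigma> (a2 \<circ> a3))) t - \<sigma> (a3 \<circ> a0) t * ddt ?g t * ddt (ddt ?h) t)"
    unfolding symbol_mult[OF k(1,2)] symbol_mult[OF k(2,3)] symbol_mult[OF k(3,4)] symbol_mult[OF k(4,1)]
      ddt_mult[OF s(2,3)] ddt_ddt_mult[OF s(3,4)]
    by (rule circle_integral_alternating; intro continuous_on_mult continuous_on_add continuous_on_const C)
  also have "\<dots> = ?I (\<lambda>t. 2 * (?f t * ddt ?g t * ddt ?h t * ddt ?k t))"
    unfolding symbol_mult[OF k(1,2)] symbol_mult[OF k(2,3)] symbol_mult[OF k(3,4)] symbol_mult[OF k(4,1)]
      ddt_mult[OF s(2,3)] ddt_ddt_mult[OF s(3,4)]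
    by (simp add: algebra_simps)
  also have "\<dots> = 2 * ?I (\<lambda>t. ?f t * ddt ?g t * ddt ?h t * ddt ?k t)"
    by (rule circle_integral_cmult)
  also have "(\<lambda>t. ?f t * ddt ?g t * ddt ?h t * ddt ?k t) = (\<lambda>t. \<i> * trig (\<lambda>n. conv (conv (conv t0 (\<lambda>d. of_int d * t1 d))
      (\<lambda>d. of_int d * t2 d)) (\<lambda>d. of_int d * t3 d) (- n)) t)"
  proof
    fix x
    have d: "ddt (\<sigma> a) x = - \<i> * trig (\<lambda>n. ?t' t (- n)) x" if "has_kernel a c t" for a c t
      unfolding symbol_eq[OF that] ddt_trig[OF rd_reflect[OF has_kernel_rd(2)[OF that]]] trig_cmult[symmetric]
      by (rule arg_cong[of _ _ "\<lambda>c. trig c x"]) auto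
    \<comment> \<open>Since the Fourier index is minus the Toeplitz index, each derivative gives - i
      d, and (- i)^3 = i.\<close>
    have e: "u * (- \<i> * v) * (- \<i> * w) * (- \<i> * z) = \<i> * (u * v * w * z)" for u v w z :: complex
      by (simp add: mult_ac)
    have "?f x * ddt ?g x * ddt ?h x * ddt ?k x = \<i> * (trig (\<lambda>n. t0 (- n)) x * trig (\<lambda>n. ?t' t1 (- n)) x
        * trig (\<lambda>n. ?t' t2 (- n)) x * trig (\<lambda>n. ?t' t3 (- n)) x)"
      unfolding d[OF k(2)] d[OF k(3)] d[OF k(4)] symbol_eq[OF k(1)] by (rule e)
    then show "?f x * ddt ?g x * ddt ?h x * ddt ?k x = \<i> * trig (\<lambda>n. conv (conv (conv t0 (?t' t1)) (?t' t2)) (?t' t3) (- n)) x"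
      unfolding trig_reflect_mult[OF rt(1,2)] trig_reflect_mult[OF rd_conv[OF rt(1,2)] rt(3)] trig_reflect_mult[OF rd_conv[OF rd_conv[OF rt(1,2)] rt(3)] rt(4)] .
  qed
  also have "?I \<dots> = \<i> * (of_real (2 * pi) * conv (conv (conv t0 (\<lambda>d. of_int d * t1 d)) (\<lambda>d. of_int d * t2 d)) (\<lambda>d. of_int d * t3 d) 0)"
    unfolding circle_integral_cmult
      circle_integral_trig[OF rd_reflect[OF rd_conv[OF rd_conv[OF rd_conv[OF rt(1,2)] rt(3)] rt(4)]]] by simp
  finally have I: "?I (\<lambda>t. \<sigma> (a0 \<circ> a1) t * ddt ?h t * ddt (ddt ?k) t) - ?I (\<lambda>t. ?f t * ddt (\<sigma> (a1 \<circ> a2)) t * ddt (ddt ?k) t)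
    + ?I (\<lambda>t. ?f t * ddt ?g t * ddt (ddt (\<sigma> (a2 \<circ> a3))) t) - ?I (\<lambda>t. \<sigma> (a3 \<circ> a0) t * ddt ?g t * ddt (ddt ?h) t)
    = 2 * (\<i> * (of_real (2 * pi) * conv (conv (conv t0 (\<lambda>d. of_int d * t1 d)) (\<lambda>d. of_int d * t2 d)) (\<lambda>d. of_int d * t3 d) 0))" .
  have "hochschild_b \<phi>\<^sub>2 [a0, a1, a2, a3] = \<phi>\<^sub>2 [a0 \<circ> a1, a2, a3] - \<phi>\<^sub>2 [a0, a1 \<circ> a2, a3] + \<phi>\<^sub>2 [a0, a1, a2 \<circ> a3] - \<phi>\<^sub>2 [a3 \<circ> a0, a1, a2]"
    by (simp add: hochschild_b_def numeral_2_eq_2 del: \<phi>\<^sub>2.simps)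
  also have "\<dots> = - 1/24 * (1 / (2 * pi * \<i>)) * (2 * (\<i> * (of_real (2 * pi) * conv (conv (conv t0 (\<lambda>d. of_int d * t1 d)) (\<lambda>d. of_int d * t2 d)) (\<lambda>d. of_int d * t3 d) 0)))"
    unfolding \<phi>\<^sub>2.simps I[symmetric] by (simp only: right_diff_distrib distrib_left)
  finally show ?thesis by simp
qed

theorem theorem3:
  fixes \<epsilon> :: real
  assumes "\<epsilon> > 0"
  shows "(\<forall>a0\<in>\<A>. \<forall>a1\<in>\<A>.
            \<phi>\<^sub>1 \<epsilon> [a0, a1] = \<tau>\<^sub>1 [a0, a1] + hochschild_b \<phi>\<^sub>0 [a0, a1] + connes_B \<phi>\<^sub>2 [a0, a1])
       \<and> (\<forall>a0\<in>\<A>. \<forall>a1\<in>\<A>. \<forall>a2\<in>\<A>. \<forall>a3\<in>\<A>.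
            \<phi>\<^sub>3 \<epsilon> [a0, a1, a2, a3] = hochschild_b \<phi>\<^sub>2 [a0, a1, a2, a3])"
proof (intro conjI ballI)
  fix a0 a1 assume "a0 \<in> \<A>" "a1 \<in> \<A>"
  then obtain c0 t0 c1 t1 where "has_kernel a0 c0 t0" "has_kernel a1 c1 t1"
    unfolding in_algebra_iff by blast
  then show "\<phi>\<^sub>1 \<epsilon> [a0, a1] = \<tau>\<^sub>1 [a0, a1] + hochschild_b \<phi>\<^sub>0 [a0, a1] + connes_B \<phi>\<^sub>2 [a0, a1]"
    by (rule phi1_cohomologous) (rule assms)
next
  fix a0 a1 a2 a3 assume "a0 \<in> \<A>" "a1 \<in> \<A>" "a2 \<in> \<A>" "a3 \<in> \<A>"
  then obtain c0 t0 c1 t1 c2 t2 c3 t3 where k: "has_kernel a0 c0 t0" "has_kernel a1 c1 t1" "has_kernel a2 c2 t2" "has_kernel a3 c3 t3"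
    unfolding in_algebra_iff by blast
  show "\<phi>\<^sub>3 \<epsilon> [a0, a1, a2, a3] = hochschild_b \<phi>\<^sub>2 [a0, a1, a2, a3]"
    unfolding phi3_eq[OF assms k] b_phi2_eq[OF k] ..
qed

end
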